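(* Let $\pi:(M,g,J)\to(N,g_N)$ be a (proper) bi-slant submersion from a Kähler manifold onto a Riemannian manifold. Then the following three facts are equivalent to each other: (i) $M$ is locally a product $M_{\ker\pi_*}\times M_{(\ker\pi_* )^\perp}$; (ii) $\pi$ is a totally geodesic map; (iii) both of the following conditions hold: $$\omega\big(\mathcal T_W PZ+\mathcal A_{FZ}W\big)+F\big(\hat\nabla_W PZ+\mathcal T_W FZ\big)=0$$ for $W,Z\in\ker\pi_*$, and $$\phi\big(\mathcal A_\xi\phi\eta+\mathcal H\nabla_\xi\omega\eta\big)+P\big(\mathcal A_\xi\omega\eta+\mathcal V\nabla_\xi\phi\eta\big)=0$$ for any $\xi,\eta\in(\ker\pi_* )^\perp$. Here $M_{\ker\pi_*}$ and $M_{(\ker\pi_* )^\perp}$ are integral manifolds of the distributions $\ker\pi_*$ and $(\ker\pi_* )^\perp$, respectively.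
   Context: A Riemannian submersion $\pi:(M,g)\to(N,g_N)$, $\dim M>\dim N$, is a surjective map of maximal rank such that $\pi_*$ restricted to $(\ker\pi_* )^\perp$ is a linear isometry. Vector fields in $\ker\pi_*$ are vertical, those in $(\ker\pi_* )^\perp$ horizontal; $\mathcal V,\mathcal H$ are the projections onto $\ker\pi_*$ and $(\ker\pi_* )^\perp$. A vector field on $M$ is basic if it is horizontal and $\pi$-related to a vector field on $N$. Standing convention: all horizontal vector fields are assumed to be basic. $\nabla$ is the Levi-Civita connection of $g$. O'Neill's tensors are $\mathcal T_E G=\mathcal V\nabla_{\mathcal V E}\mathcal H G+\mathcal H\nabla_{\mathcal V E}\mathcal V G$ and $\mathcal A_E G=\mathcal V\nabla_{\mathcal H E}\mathcal H G+\mathcal H\nabla_{\mathcal H E}\mathcal V G$. For vertical $V,W$, $\hat\nabla_V W=\mathcal V\nabla_V W$. Kähler means $J^2=-I$, $g(JX,JY)=g(X,Y)$, $\nabla J=0$. For $V\in\ker\pi_*$ write $JV=PV+FV$ with $PV$ vertical and $FV$ horizontal; for $\xi\in(\ker\pi_* )^\perp$ write $J\xi=\phi\xi+\omega\xi$ with $\phi\xi$ vertical and $\omega\xi$ horizontal. A distribution $\mathcal D$ is slant with slant angle $\theta$ if for every point $p$ and every nonzero $X\in\mathcal D_p$ the angle between $JX$ and $\mathcal D_p$ equals the constant $\theta$. A Riemannian submersion $\pi$ from a Kähler manifold is a bi-slant submersion if there are two slant distributions $\mathcal D^{\theta_1},\mathcal D^{\theta_2}\subset\ker\pi_*$, with slant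 angles $\theta_1$ and $\theta_2$ respectively, such that $\ker\pi_*=\mathcal D^{\theta_1}\oplus\mathcal D^{\theta_2}$. It is proper if each slant angle is different from $0$ and $\pi/2$. $\pi$ is a totally geodesic map if its second fundamental form $(\nabla\pi_* )(X,Y)=\nabla^{\pi}_X\pi_*Y-\pi_*(\nabla_XY)$ vanishes identically, where $\nabla^\pi$ is the pullback of the Levi-Civita connection of $N$.
   Formalization: In the first equation of (iii), A_{FZ}W is read as H∇_W(FZ), its value when FZ is basic; with O'Neill's tensor taken literally the term W(f)FPZ (from Z replaced by fZ) makes (iii) fail for flat projections along proper slant planes, where (i) and (ii) hold. *)

theory Defs
  imports "HOL-Analysis.Analysis"
begin

section \<open>Smooth manifolds\<close>

text \<open>
  A manifold is a whole (Hausdorff, second countable) type \<open>'m\<close> with a smooth atlas of charts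
  \<open>(U, c)\<close>, \<open>c : U \<rightarrow> 'e\<close>, where \<open>'e\<close> is a Euclidean space of the dimension of the manifold.
  Only the values of \<open>c\<close> on \<open>U\<close> matter.
\<close>

type_synonym ('m, 'e) chart = "'m set \<times> ('m \<Rightarrow> 'e)"

primrec Ck_on :: "nat \<Rightarrow> 'a::real_normed_vector set \<Rightarrow> ('a \<Rightarrow> 'b::real_normed_vector) \<Rightarrow> bool" where
  "Ck_on 0 S f \<longleftrightarrow> continuous_on S f"
| "Ck_on (Suc k) S f \<longleftrightarrow>
     f differentiable_on S \<and> (\<forall>v. Ck_on k S (\<lambda>x. frechet_derivative f (at x) v))"

text \<open>Only used for open sets.\<close>

definition smooth_on :: "'a::real_normed_vector set \<Rightarrow> ('a \<Rightarrow> 'b::real_normed_vector) \<Rightarrow> bool" where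
  "smooth_on S f \<longleftrightarrow> (\<forall>k. Ck_on k S f)"

definition smooth_atlas ::
  "('m::{t2_space, second_countable_topology}, 'e::euclidean_space) chart set \<Rightarrow> bool" where
  "smooth_atlas A \<longleftrightarrow>
     (\<forall>(U, c) \<in> A. open U \<and> open (c ` U) \<and> homeomorphism U (c ` U) c (inv_into U c)) \<and>
     (\<Union>(U, c) \<in> A. U) = UNIV \<and>
     (\<forall>(U, c) \<in> A. \<forall>(V, d) \<in> A. smooth_on (c ` (U \<inter> V)) (d \<circ> inv_into U c))"

definition chart_at :: "('m, 'e) chart set \<Rightarrow> 'm \<Rightarrow> ('m, 'e) chart" where
  "chart_at A p = (SOME C. C \<in> A \<and> p \<in> fst C)"

text \<open>
  The tangent space at \<open>p\<close> is \<open>'e\<close>, a tangent vector being identified with its components in the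
  chosen chart \<open>chart_at A p\<close>. Since this choice varies with \<open>p\<close> in an arbitrary way, smoothness of
  a field is always expressed through its components in a fixed chart, obtained by applying the
  differential \<open>dfun\<close> of the chart.
\<close>

definition dfun ::
  "('m, 'e::real_normed_vector) chart set \<Rightarrow> ('m \<Rightarrow> 'k::real_normed_vector) \<Rightarrow> 'm \<Rightarrow> 'e \<Rightarrow> 'k" where
  "dfun A f p =
     (case chart_at A p of (U, c) \<Rightarrow> frechet_derivative (f \<circ> inv_into U c) (at (c p)))"

definition dmap ::
  "('m, 'e::real_normed_vector) chart set \<Rightarrow> ('n, 'f::real_normed_vector) chart set
    \<Rightarrow> ('m \<Rightarrow> 'n) \<Rightarrow> 'm \<Rightarrow> 'e \<Rightarrow> 'f" where
  "dmap A B \<pi> p = dfun A (snd (chart_at B (\<pi> p)) \<circ> \<pi>) p"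

definition smooth_fun ::
  "('m, 'e::real_normed_vector) chart set \<Rightarrow> 'm set \<Rightarrow> ('m \<Rightarrow> 'k::real_normed_vector) \<Rightarrow> bool" where
  "smooth_fun A U f \<longleftrightarrow> (\<forall>(V, c) \<in> A. smooth_on (c ` (U \<inter> V)) (f \<circ> inv_into V c))"

definition smooth_map ::
  "('m::topological_space, 'e::real_normed_vector) chart set
    \<Rightarrow> ('n::topological_space, 'f::real_normed_vector) chart set
    \<Rightarrow> 'm set \<Rightarrow> ('m \<Rightarrow> 'n) \<Rightarrow> bool" where
  "smooth_map A B U \<pi> \<longleftrightarrow>
     continuous_on U \<pi> \<and> (\<forall>(V, d) \<in> B. smooth_fun A (U \<inter> \<pi> -` V) (d \<circ> \<pi>))"

definition smooth_vf ::
  "('m, 'e::real_normed_vector) chart set \<Rightarrow> 'm set \<Rightarrow> ('m \<Rightarrow> 'e) \<Rightarrow> bool" where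
  "smooth_vf A U X \<longleftrightarrow> (\<forall>(V, c) \<in> A. smooth_fun A (U \<inter> V) (\<lambda>p. dfun A c p (X p)))"

text \<open>Sections of the pullback along \<open>\<pi>\<close> of the tangent bundle of the target.\<close>

definition smooth_section_along ::
  "('m, 'e::real_normed_vector) chart set \<Rightarrow> ('n, 'f::real_normed_vector) chart set
    \<Rightarrow> ('m \<Rightarrow> 'n) \<Rightarrow> 'm set \<Rightarrow> ('m \<Rightarrow> 'f) \<Rightarrow> bool" where
  "smooth_section_along A B \<pi> U s \<longleftrightarrow>
     (\<forall>(V, d) \<in> B. smooth_fun A (U \<inter> \<pi> -` V) (\<lambda>p. dfun B d (\<pi> p) (s p)))"

section \<open>Riemannian manifolds and connections\<close>

definition riemannian_manifold ::
  "('m::{t2_space, second_countable_topology}, 'e::euclidean_space) chart set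
    \<Rightarrow> ('m \<Rightarrow> 'e \<Rightarrow> 'e \<Rightarrow> real) \<Rightarrow> bool" where
  "riemannian_manifold A g \<longleftrightarrow>
     smooth_atlas A \<and>
     (\<forall>p. bilinear (g p) \<and> (\<forall>u v. g p u v = g p v u) \<and> (\<forall>v. v \<noteq> 0 \<longrightarrow> g p v v > 0)) \<and>
     (\<forall>U X Y. open U \<and> smooth_vf A U X \<and> smooth_vf A U Y \<longrightarrow>
        smooth_fun A U (\<lambda>p. g p (X p) (Y p)))"

text \<open>
  Connections act on vector fields over arbitrary open sets \<open>U\<close> (values outside \<open>U\<close> are
  irrelevant), so that no bump functions are needed to speak about local fields.
\<close>

definition affine_connection ::
  "('m::topological_space, 'e::real_normed_vector) chart set
    \<Rightarrow> (('m \<Rightarrow> 'e) \<Rightarrow> ('m \<Rightarrow> 'e) \<Rightarrow> 'm \<Rightarrow> 'e) \<Rightarrow> bool" where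
  "affine_connection A nabla \<longleftrightarrow>
     (\<forall>U X Y. open U \<and> smooth_vf A U X \<and> smooth_vf A U Y \<longrightarrow> smooth_vf A U (nabla X Y)) \<and>
     (\<forall>U X X' Y Y' f. open U \<and> smooth_vf A U X \<and> smooth_vf A U X' \<and>
        smooth_vf A U Y \<and> smooth_vf A U Y' \<and> smooth_fun A U (f :: 'm \<Rightarrow> real) \<longrightarrow>
        (\<forall>p \<in> U.
           nabla (\<lambda>q. X q + X' q) Y p = nabla X Y p + nabla X' Y p \<and>
           nabla (\<lambda>q. f q *\<^sub>R X q) Y p = f p *\<^sub>R nabla X Y p \<and>
           nabla X (\<lambda>q. Y q + Y' q) p = nabla X Y p + nabla X Y' p \<and>
           nabla X (\<lambda>q. f q *\<^sub>R Y q) p = dfun A f p (X p) *\<^sub>R Y p + f p *\<^sub>R nabla X Y p))"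

text \<open>Torsion-freeness \<open>\<nabla>\<^sub>X Y - \<nabla>\<^sub>Y X = [X, Y]\<close> is tested on functions, by the definition of the bracket.\<close>

definition levi_civita ::
  "('m::topological_space, 'e::real_normed_vector) chart set \<Rightarrow> ('m \<Rightarrow> 'e \<Rightarrow> 'e \<Rightarrow> real)
    \<Rightarrow> (('m \<Rightarrow> 'e) \<Rightarrow> ('m \<Rightarrow> 'e) \<Rightarrow> 'm \<Rightarrow> 'e) \<Rightarrow> bool" where
  "levi_civita A g nabla \<longleftrightarrow>
     affine_connection A nabla \<and>
     (\<forall>U X Y f. open U \<and> smooth_vf A U X \<and> smooth_vf A U Y \<and>
        smooth_fun A U (f :: 'm \<Rightarrow> real) \<longrightarrow>
        (\<forall>p \<in> U. dfun A f p (nabla X Y p) - dfun A f p (nabla Y X p) =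
           dfun A (\<lambda>q. dfun A f q (Y q)) p (X p) - dfun A (\<lambda>q. dfun A f q (X q)) p (Y p))) \<and>
     (\<forall>U X Y Z. open U \<and> smooth_vf A U X \<and> smooth_vf A U Y \<and> smooth_vf A U Z \<longrightarrow>
        (\<forall>p \<in> U. dfun A (\<lambda>q. g q (Y q) (Z q)) p (X p) =
           g p (nabla X Y p) (Z p) + g p (Y p) (nabla X Z p)))"

text \<open>
  The pullback of a connection of the target along \<open>\<pi>\<close> is characterised by the Leibniz rule and by
  \<open>\<nabla>\<^sup>\<pi>\<^sub>X (Z \<circ> \<pi>) = \<nabla>\<^sub>V Z\<close> at \<open>\<pi> p\<close>, for every field \<open>V\<close> extending the vector \<open>\<pi>\<^sub>* (X p)\<close>.
\<close>

definition pullback_connection ::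
  "('m::topological_space, 'e::real_normed_vector) chart set
    \<Rightarrow> ('n::topological_space, 'f::real_normed_vector) chart set \<Rightarrow> ('m \<Rightarrow> 'n)
    \<Rightarrow> (('n \<Rightarrow> 'f) \<Rightarrow> ('n \<Rightarrow> 'f) \<Rightarrow> 'n \<Rightarrow> 'f)
    \<Rightarrow> (('m \<Rightarrow> 'e) \<Rightarrow> ('m \<Rightarrow> 'f) \<Rightarrow> 'm \<Rightarrow> 'f) \<Rightarrow> bool" where
  "pullback_connection A B \<pi> nablaN nablaP \<longleftrightarrow>
     (\<forall>U X s. open U \<and> smooth_vf A U X \<and> smooth_section_along A B \<pi> U s \<longrightarrow>
        smooth_section_along A B \<pi> U (nablaP X s)) \<and>
     (\<forall>U X X' s s' f. open U \<and> smooth_vf A U X \<and> smooth_vf A U X' \<and>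
        smooth_section_along A B \<pi> U s \<and> smooth_section_along A B \<pi> U s' \<and>
        smooth_fun A U (f :: 'm \<Rightarrow> real) \<longrightarrow>
        (\<forall>p \<in> U.
           nablaP (\<lambda>q. X q + X' q) s p = nablaP X s p + nablaP X' s p \<and>
           nablaP (\<lambda>q. f q *\<^sub>R X q) s p = f p *\<^sub>R nablaP X s p \<and>
           nablaP X (\<lambda>q. s q + s' q) p = nablaP X s p + nablaP X s' p \<and>
           nablaP X (\<lambda>q. f q *\<^sub>R s q) p = dfun A f p (X p) *\<^sub>R s p + f p *\<^sub>R nablaP X s p)) \<and>
     (\<forall>U X O' V Z p. open U \<and> smooth_vf A U X \<and> p \<in> U \<and>
        open O' \<and> smooth_vf B O' V \<and> smooth_vf B O' Z \<and> \<pi> p \<in> O' \<and> V (\<pi> p) = dmap A B \<pi> p (X p) \<longrightarrow>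
        nablaP X (Z \<circ> \<pi>) p = nablaN V Z (\<pi> p))"

text \<open>The Levi-Civita connection \<open>nabla\<close> is carried along as a parameter.\<close>

definition kaehler_manifold ::
  "('m::{t2_space, second_countable_topology}, 'e::euclidean_space) chart set
    \<Rightarrow> ('m \<Rightarrow> 'e \<Rightarrow> 'e \<Rightarrow> real) \<Rightarrow> ('m \<Rightarrow> 'e \<Rightarrow> 'e)
    \<Rightarrow> (('m \<Rightarrow> 'e) \<Rightarrow> ('m \<Rightarrow> 'e) \<Rightarrow> 'm \<Rightarrow> 'e) \<Rightarrow> bool" where
  "kaehler_manifold A g J nabla \<longleftrightarrow>
     riemannian_manifold A g \<and> levi_civita A g nabla \<and>
     (\<forall>p. linear (J p)) \<and>
     (\<forall>U X. open U \<and> smooth_vf A U X \<longrightarrow> smooth_vf A U (\<lambda>p. J p (X p))) \<and>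
     (\<forall>p v. J p (J p v) = - v) \<and>
     (\<forall>p u v. g p (J p u) (J p v) = g p u v) \<and>
     (\<forall>U X Y. open U \<and> smooth_vf A U X \<and> smooth_vf A U Y \<longrightarrow>
        (\<forall>p \<in> U. nabla X (\<lambda>q. J q (Y q)) p = J p (nabla X Y p)))"

section \<open>Distributions, slant angles and integral manifolds\<close>

definition oproj :: "('e::real_vector \<Rightarrow> 'e \<Rightarrow> real) \<Rightarrow> 'e set \<Rightarrow> 'e \<Rightarrow> 'e" where
  "oproj b D u = (THE w. w \<in> D \<and> (\<forall>z \<in> D. b (u - w) z = 0))"

definition ocomp :: "('e::real_vector \<Rightarrow> 'e \<Rightarrow> real) \<Rightarrow> 'e set \<Rightarrow> 'e set" where
  "ocomp b D = {u. \<forall>z \<in> D. b u z = 0}"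

text \<open>Angle between a nonzero vector and a subspace, i.e. between the vector and its projection.\<close>

definition angle_to :: "('e::real_vector \<Rightarrow> 'e \<Rightarrow> real) \<Rightarrow> 'e set \<Rightarrow> 'e \<Rightarrow> real" where
  "angle_to b D u = arccos (sqrt (b (oproj b D u) (oproj b D u)) / sqrt (b u u))"

definition distribution ::
  "('m::topological_space, 'e::real_normed_vector) chart set \<Rightarrow> ('m \<Rightarrow> 'e set) \<Rightarrow> bool" where
  "distribution A D \<longleftrightarrow>
     (\<forall>p. \<exists>U (k::nat) X. open U \<and> p \<in> U \<and> (\<forall>i<k. smooth_vf A U (X i)) \<and>
        (\<forall>q \<in> U. inj_on (\<lambda>i. X i q) {..<k} \<and> independent ((\<lambda>i. X i q) ` {..<k}) \<and>
           D q = span ((\<lambda>i. X i q) ` {..<k})))"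

definition slant_distribution ::
  "('m::topological_space, 'e::real_normed_vector) chart set \<Rightarrow> ('m \<Rightarrow> 'e \<Rightarrow> 'e \<Rightarrow> real)
    \<Rightarrow> ('m \<Rightarrow> 'e \<Rightarrow> 'e) \<Rightarrow> ('m \<Rightarrow> 'e set) \<Rightarrow> real \<Rightarrow> bool" where
  "slant_distribution A g J D \<theta> \<longleftrightarrow>
     distribution A D \<and> (\<forall>p. \<forall>X \<in> D p. X \<noteq> 0 \<longrightarrow> angle_to (g p) (D p) (J p X) = \<theta>)"

text \<open>Embedded submanifolds (given by slice charts) whose tangent spaces are those of \<open>D\<close>.\<close>

definition integral_manifold ::
  "('m::{t2_space, second_countable_topology}, 'e::euclidean_space) chart set
    \<Rightarrow> ('m \<Rightarrow> 'e set) \<Rightarrow> 'm set \<Rightarrow> bool" where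
  "integral_manifold A D S \<longleftrightarrow>
     (\<forall>p \<in> S. \<exists>V c K. smooth_atlas (insert (V, c) A) \<and> p \<in> V \<and> subspace K \<and>
        S \<inter> V = {q \<in> V. c q - c p \<in> K} \<and> (\<forall>q \<in> S \<inter> V. D q = {v. dfun A c q v \<in> K}))"

text \<open>
  Every point has a neighbourhood \<open>U\<close> that is isometric, via \<open>(\<rho>1, \<rho>2)\<close>, to the Riemannian product
  of an integral manifold \<open>S1\<close> of \<open>D1\<close> and an integral manifold \<open>S2\<close> of \<open>D2\<close>, such that the two
  foliations of the product correspond to \<open>D1\<close> and \<open>D2\<close>. The metric condition makes
  \<open>(\<rho>1, \<rho>2)\<close> an immersion, hence a diffeomorphism.
\<close>

definition locally_product ::
  "('m::{t2_space, second_countable_topology}, 'e::euclidean_space) chart set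
    \<Rightarrow> ('m \<Rightarrow> 'e \<Rightarrow> 'e \<Rightarrow> real) \<Rightarrow> ('m \<Rightarrow> 'e set) \<Rightarrow> ('m \<Rightarrow> 'e set) \<Rightarrow> bool" where
  "locally_product A g D1 D2 \<longleftrightarrow>
     (\<forall>p. \<exists>U S1 S2 \<rho>1 \<rho>2.
        open U \<and> p \<in> U \<and> p \<in> S1 \<and> p \<in> S2 \<and>
        integral_manifold A D1 S1 \<and> integral_manifold A D2 S2 \<and>
        smooth_map A A U \<rho>1 \<and> smooth_map A A U \<rho>2 \<and>
        bij_betw (\<lambda>q. (\<rho>1 q, \<rho>2 q)) U (S1 \<times> S2) \<and>
        (\<forall>q \<in> U.
           (\<forall>v \<in> D2 q. dmap A A \<rho>1 q v = 0) \<and>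
           (\<forall>v \<in> D1 q. dmap A A \<rho>2 q v = 0) \<and>
           (\<forall>u v. g q u v =
              g (\<rho>1 q) (dmap A A \<rho>1 q u) (dmap A A \<rho>1 q v) +
              g (\<rho>2 q) (dmap A A \<rho>2 q u) (dmap A A \<rho>2 q v))))"

section \<open>Riemannian submersions\<close>

definition vert ::
  "('m, 'e::real_normed_vector) chart set \<Rightarrow> ('n, 'f::real_normed_vector) chart set
    \<Rightarrow> ('m \<Rightarrow> 'n) \<Rightarrow> 'm \<Rightarrow> 'e set" where
  "vert A B \<pi> p = {v. dmap A B \<pi> p v = 0}"

definition horiz ::
  "('m, 'e::real_normed_vector) chart set \<Rightarrow> ('m \<Rightarrow> 'e \<Rightarrow> 'e \<Rightarrow> real)
    \<Rightarrow> ('n, 'f::real_normed_vector) chart set \<Rightarrow> ('m \<Rightarrow> 'n) \<Rightarrow> 'm \<Rightarrow> 'e set" where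
  "horiz A g B \<pi> p = ocomp (g p) (vert A B \<pi> p)"

definition riemannian_submersion ::
  "('m::topological_space, 'e::euclidean_space) chart set \<Rightarrow> ('m \<Rightarrow> 'e \<Rightarrow> 'e \<Rightarrow> real)
    \<Rightarrow> ('n::topological_space, 'f::euclidean_space) chart set \<Rightarrow> ('n \<Rightarrow> 'f \<Rightarrow> 'f \<Rightarrow> real)
    \<Rightarrow> ('m \<Rightarrow> 'n) \<Rightarrow> bool" where
  "riemannian_submersion A g B h \<pi> \<longleftrightarrow>
     DIM('e) > DIM('f) \<and> smooth_map A B UNIV \<pi> \<and> surj \<pi> \<and>
     (\<forall>p. surj (dmap A B \<pi> p)) \<and>
     (\<forall>p. \<forall>u \<in> horiz A g B \<pi> p. \<forall>v \<in> horiz A g B \<pi> p.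
        h (\<pi> p) (dmap A B \<pi> p u) (dmap A B \<pi> p v) = g p u v)"

definition vproj ::
  "('m, 'e::real_normed_vector) chart set \<Rightarrow> ('m \<Rightarrow> 'e \<Rightarrow> 'e \<Rightarrow> real)
    \<Rightarrow> ('n, 'f::real_normed_vector) chart set \<Rightarrow> ('m \<Rightarrow> 'n) \<Rightarrow> 'm \<Rightarrow> 'e \<Rightarrow> 'e" where
  "vproj A g B \<pi> p = oproj (g p) (vert A B \<pi> p)"

definition hproj ::
  "('m, 'e::real_normed_vector) chart set \<Rightarrow> ('m \<Rightarrow> 'e \<Rightarrow> 'e \<Rightarrow> real)
    \<Rightarrow> ('n, 'f::real_normed_vector) chart set \<Rightarrow> ('m \<Rightarrow> 'n) \<Rightarrow> 'm \<Rightarrow> 'e \<Rightarrow> 'e" where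
  "hproj A g B \<pi> p = oproj (g p) (horiz A g B \<pi> p)"

definition vertical_on ::
  "('m, 'e::real_normed_vector) chart set \<Rightarrow> ('n, 'f::real_normed_vector) chart set
    \<Rightarrow> ('m \<Rightarrow> 'n) \<Rightarrow> 'm set \<Rightarrow> ('m \<Rightarrow> 'e) \<Rightarrow> bool" where
  "vertical_on A B \<pi> U X \<longleftrightarrow> smooth_vf A U X \<and> (\<forall>p \<in> U. X p \<in> vert A B \<pi> p)"

definition basic_on ::
  "('m, 'e::real_normed_vector) chart set \<Rightarrow> ('m \<Rightarrow> 'e \<Rightarrow> 'e \<Rightarrow> real)
    \<Rightarrow> ('n::topological_space, 'f::real_normed_vector) chart set \<Rightarrow> ('m \<Rightarrow> 'n) \<Rightarrow> 'm set \<Rightarrow> ('m \<Rightarrow> 'e) \<Rightarrow> bool" where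
  "basic_on A g B \<pi> U X \<longleftrightarrow>
     smooth_vf A U X \<and> (\<forall>p \<in> U. X p \<in> horiz A g B \<pi> p) \<and>
     (\<exists>O' Y. open O' \<and> \<pi> ` U \<subseteq> O' \<and> smooth_vf B O' Y \<and> (\<forall>p \<in> U. dmap A B \<pi> p (X p) = Y (\<pi> p)))"

definition bi_slant_submersion ::
  "('m::topological_space, 'e::euclidean_space) chart set \<Rightarrow> ('m \<Rightarrow> 'e \<Rightarrow> 'e \<Rightarrow> real)
    \<Rightarrow> ('m \<Rightarrow> 'e \<Rightarrow> 'e)
    \<Rightarrow> ('n::topological_space, 'f::euclidean_space) chart set \<Rightarrow> ('n \<Rightarrow> 'f \<Rightarrow> 'f \<Rightarrow> real)
    \<Rightarrow> ('m \<Rightarrow> 'n) \<Rightarrow> real \<Rightarrow> real \<Rightarrow> bool" where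
  "bi_slant_submersion A g J B h \<pi> \<theta>1 \<theta>2 \<longleftrightarrow>
     riemannian_submersion A g B h \<pi> \<and>
     (\<exists>D1 D2. slant_distribution A g J D1 \<theta>1 \<and> slant_distribution A g J D2 \<theta>2 \<and>
        (\<forall>p. vert A B \<pi> p = {u + v |u v. u \<in> D1 p \<and> v \<in> D2 p} \<and> D1 p \<inter> D2 p = {0}))"

definition totally_geodesic_map ::
  "('m::topological_space, 'e::real_normed_vector) chart set
    \<Rightarrow> ('n, 'f::real_normed_vector) chart set \<Rightarrow> ('m \<Rightarrow> 'n)
    \<Rightarrow> (('m \<Rightarrow> 'e) \<Rightarrow> ('m \<Rightarrow> 'e) \<Rightarrow> 'm \<Rightarrow> 'e)
    \<Rightarrow> (('m \<Rightarrow> 'e) \<Rightarrow> ('m \<Rightarrow> 'f) \<Rightarrow> 'm \<Rightarrow> 'f) \<Rightarrow> bool" where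
  "totally_geodesic_map A B \<pi> nabla nablaP \<longleftrightarrow>
     (\<forall>U X Y. open U \<and> smooth_vf A U X \<and> smooth_vf A U Y \<longrightarrow>
        (\<forall>p \<in> U. nablaP X (\<lambda>q. dmap A B \<pi> q (Y q)) p - dmap A B \<pi> p (nabla X Y p) = 0))"

section \<open>O'Neill's tensors\<close>

definition app_field :: "('m \<Rightarrow> 'e \<Rightarrow> 'k) \<Rightarrow> ('m \<Rightarrow> 'e) \<Rightarrow> 'm \<Rightarrow> 'k" (infixr "\<odot>" 90) where
  "S \<odot> X = (\<lambda>p. S p (X p))"

definition oneill_T ::
  "(('m \<Rightarrow> 'e) \<Rightarrow> ('m \<Rightarrow> 'e) \<Rightarrow> 'm \<Rightarrow> 'e) \<Rightarrow> ('m \<Rightarrow> 'e \<Rightarrow> 'e) \<Rightarrow> ('m \<Rightarrow> 'e::real_vector \<Rightarrow> 'e)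
    \<Rightarrow> ('m \<Rightarrow> 'e) \<Rightarrow> ('m \<Rightarrow> 'e) \<Rightarrow> 'm \<Rightarrow> 'e" where
  "oneill_T nabla V H E G =
     (\<lambda>p. (V \<odot> nabla (V \<odot> E) (H \<odot> G)) p + (H \<odot> nabla (V \<odot> E) (V \<odot> G)) p)"

definition oneill_A ::
  "(('m \<Rightarrow> 'e) \<Rightarrow> ('m \<Rightarrow> 'e) \<Rightarrow> 'm \<Rightarrow> 'e) \<Rightarrow> ('m \<Rightarrow> 'e \<Rightarrow> 'e) \<Rightarrow> ('m \<Rightarrow> 'e::real_vector \<Rightarrow> 'e)
    \<Rightarrow> ('m \<Rightarrow> 'e) \<Rightarrow> ('m \<Rightarrow> 'e) \<Rightarrow> 'm \<Rightarrow> 'e" where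
  "oneill_A nabla V H E G =
     (\<lambda>p. (V \<odot> nabla (H \<odot> E) (H \<odot> G)) p + (H \<odot> nabla (H \<odot> E) (V \<odot> G)) p)"

text \<open>
  The meaning of \<open>\<A>\<^sub>X W\<close> for horizontal \<open>X\<close> and vertical \<open>W\<close> under the convention that horizontal
  fields are treated as basic: for basic \<open>X\<close> the bracket \<open>[W, X]\<close> is vertical, so that
  \<open>\<A>\<^sub>X W = \<H> \<nabla>\<^sub>W X\<close>. The field \<open>F Z\<close> (\<open>Z\<close> vertical) is not basic in general, and
  \<open>\<A>\<^bsub>F Z\<^esub> W\<close> is an abbreviation of \<open>\<H> \<nabla>\<^sub>W (F Z)\<close>. With the value of the tensor instead,
  the expression \<open>\<omega> (\<T>\<^sub>W P Z + \<A>\<^bsub>F Z\<^esub> W) + F (\<nabla>\<^sub>W P Z + \<T>\<^sub>W F Z)\<close> would not be tensorial in \<open>Z\<close>: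
  replacing \<open>Z\<close> by \<open>f Z\<close> would add the term \<open>W(f) F P Z\<close>. For basic \<open>X\<close> the two agree, see
  \<open>oneill_A_eq_oneill_A_basic\<close> below.
\<close>

definition oneill_A_basic ::
  "(('m \<Rightarrow> 'e) \<Rightarrow> ('m \<Rightarrow> 'e) \<Rightarrow> 'm \<Rightarrow> 'e) \<Rightarrow> ('m \<Rightarrow> 'e \<Rightarrow> 'e)
    \<Rightarrow> ('m \<Rightarrow> 'e) \<Rightarrow> ('m \<Rightarrow> 'e) \<Rightarrow> 'm \<Rightarrow> 'e" where
  "oneill_A_basic nabla H X W = H \<odot> nabla W X"

section \<open>Consistency of the convention on basic fields\<close>

lemma Ck_on_cong:
  assumes "open S" "Ck_on k S f" "\<And>x. x \<in> S \<Longrightarrow> f x = g x"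
  shows "Ck_on k S g"
  using assms(2,3)
proof (induction k arbitrary: f g)
  case 0
  then show ?case using continuous_on_cong[of S S f g] by simp
next
  case (Suc k)
  have df: "f differentiable (at x)" if "x \<in> S" for x
    using Suc.prems(1) that assms(1) by (simp add: differentiable_on_eq_differentiable_at)
  have fr: "(g has_derivative frechet_derivative f (at x)) (at x)" if "x \<in> S" for x
    using df[OF that] that Suc.prems(2) assms(1)
    by (intro has_derivative_transform_within_open[of f _ x UNIV S g])
       (auto simp: frechet_derivative_works)
  have eq: "frechet_derivative f (at x) = frechet_derivative g (at x)" if "x \<in> S" for x
    using frechet_derivative_at[OF fr[OF that]] .
  have "g differentiable_on S"
    using fr assms(1) by (auto simp: differentiable_on_eq_differentiable_at differentiable_def)
  moreover have "Ck_on k S (\<lambda>x. frechet_derivative g (at x) v)" for v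
    using Suc.IH[of "\<lambda>x. frechet_derivative f (at x) v" "\<lambda>x. frechet_derivative g (at x) v"]
      Suc.prems(1) eq by simp
  ultimately show ?case by simp
qed

lemma Ck_on_const: "Ck_on k S (\<lambda>x. c)"
  by (induction k arbitrary: c) (auto simp: frechet_derivative_const)

lemma Ck_on_inner:
  fixes f :: "'a::real_normed_vector \<Rightarrow> 'b::real_inner"
  assumes "open S" "Ck_on k S f"
  shows "Ck_on k S (\<lambda>x. f x \<bullet> b)"
  using assms(2)
proof (induction k arbitrary: f)
  case 0
  then show ?case by (simp add: continuous_on_inner)
next
  case (Suc k)
  have df: "(f has_derivative frechet_derivative f (at x)) (at x)" if "x \<in> S" for x
    using Suc.prems that assms(1)
    by (simp add: differentiable_on_eq_differentiable_at frechet_derivative_works[symmetric])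
  have fr: "((\<lambda>x. f x \<bullet> b) has_derivative (\<lambda>v. frechet_derivative f (at x) v \<bullet> b)) (at x)"
    if "x \<in> S" for x
    using df[OF that] by (rule has_derivative_inner_left)
  have eq: "frechet_derivative (\<lambda>x. f x \<bullet> b) (at x) = (\<lambda>v. frechet_derivative f (at x) v \<bullet> b)"
    if "x \<in> S" for x
    using frechet_derivative_at[OF fr[OF that]] by simp
  have "(\<lambda>x. f x \<bullet> b) differentiable_on S"
    using fr assms(1) by (auto simp: differentiable_on_eq_differentiable_at differentiable_def)
  moreover have "Ck_on k S (\<lambda>x. frechet_derivative (\<lambda>x. f x \<bullet> b) (at x) v)" for v
    by (rule Ck_on_cong[OF assms(1) Suc.IH[of "\<lambda>x. frechet_derivative f (at x) v"]])
       (use Suc.prems eq in auto)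
  ultimately show ?case by simp
qed

lemma smooth_on_differentiable:
  assumes "smooth_on S f" "open S" "x \<in> S"
  shows "f differentiable (at x)"
proof -
  have "Ck_on (Suc 0) S f" using assms(1) unfolding smooth_on_def by blast
  then show ?thesis using assms by (simp add: differentiable_on_eq_differentiable_at)
qed

lemma atlas_open_image:
  assumes "smooth_atlas A" "(V, c) \<in> A" "open U"
  shows "open (c ` (U \<inter> V))"
proof -
  have *: "open V" "open (c ` V)" "homeomorphism V (c ` V) c (inv_into V c)"
    using assms unfolding smooth_atlas_def by auto
  have "openin (top_of_set V) (U \<inter> V)"
    using assms(3) by (metis inf_commute openin_open_Int)
  then have "openin (top_of_set (c ` V)) (c ` (U \<inter> V))"
    using homeomorphism_imp_open_map[OF *(3)] by blast
  then show ?thesis using *(2) openin_open_trans by blast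
qed

lemma atlas_chart:
  assumes "smooth_atlas A" "(V, c) \<in> A"
  shows "open V" "inj_on c V"
proof -
  have "open V \<and> homeomorphism V (c ` V) c (inv_into V c)"
    using assms unfolding smooth_atlas_def by blast
  then show "open V" "inj_on c V"
    unfolding homeomorphism_def by (auto intro: inj_on_inverseI)
qed

lemma atlas_chart_at:
  assumes "smooth_atlas A"
  obtains V c where "chart_at A p = (V, c)" "(V, c) \<in> A" "p \<in> V" "open V" "inv_into V c (c p) = p"
    "inj_on c V"
proof -
  have "\<exists>C. C \<in> A \<and> p \<in> fst C" using assms unfolding smooth_atlas_def by force
  then have *: "chart_at A p \<in> A \<and> p \<in> fst (chart_at A p)"
    unfolding chart_at_def by (rule someI_ex)
  obtain V c where Vc: "chart_at A p = (V, c)" by (rule prod.exhaust)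
  with * have 1: "(V, c) \<in> A" "p \<in> V" by auto
  note 2 = atlas_chart[OF assms 1(1)]
  show ?thesis by (rule that[OF Vc 1 2(1) inv_into_f_f[OF 2(2) 1(2)] 2(2)])
qed

lemma smooth_fun_cong:
  assumes "smooth_atlas A" "open U" "smooth_fun A U f" "\<And>q. q \<in> U \<Longrightarrow> f q = f' q"
  shows "smooth_fun A U f'"
  unfolding smooth_fun_def
proof (clarify)
  fix V c assume Vc: "(V, c) \<in> A"
  then have "inj_on c V" by (rule atlas_chart(2)[OF assms(1)])
  then have "(f \<circ> inv_into V c) x = (f' \<circ> inv_into V c) x" if "x \<in> c ` (U \<inter> V)" for x
    using that assms(4) by auto
  then show "smooth_on (c ` (U \<inter> V)) (f' \<circ> inv_into V c)"
    using assms(3) Vc Ck_on_cong[OF atlas_open_image[OF assms(1) Vc assms(2)]]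
    unfolding smooth_fun_def smooth_on_def by blast
qed

lemma smooth_fun_const: "smooth_fun A U (\<lambda>q. c)"
  by (auto simp: smooth_fun_def smooth_on_def comp_def Ck_on_const)

lemma smooth_fun_inner:
  fixes f :: "'m::{t2_space, second_countable_topology} \<Rightarrow> 'b::real_inner"
  assumes "smooth_atlas A" "open U" "smooth_fun A U f"
  shows "smooth_fun A U (\<lambda>q. f q \<bullet> b)"
  unfolding smooth_fun_def smooth_on_def
proof (clarify)
  fix V c k assume Vc: "(V, c) \<in> A"
  then have "Ck_on k (c ` (U \<inter> V)) (f \<circ> inv_into V c)"
    using assms(3) unfolding smooth_fun_def smooth_on_def by blast
  from Ck_on_inner[OF atlas_open_image[OF assms(1) Vc assms(2)] this, of b]
  show "Ck_on k (c ` (U \<inter> V)) ((\<lambda>q. f q \<bullet> b) \<circ> inv_into V c)"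
    by (simp add: comp_def)
qed

lemma smooth_vf_cong:
  assumes "smooth_atlas A" "open U" "smooth_vf A U X" "\<And>q. q \<in> U \<Longrightarrow> X q = X' q"
  shows "smooth_vf A U X'"
  unfolding smooth_vf_def
proof (clarify)
  fix V c assume Vc: "(V, c) \<in> A"
  then have "open V" by (rule atlas_chart(1)[OF assms(1)])
  then show "smooth_fun A (U \<inter> V) (\<lambda>p. dfun A c p (X' p))"
    using smooth_fun_cong[OF assms(1), of "U \<inter> V" "\<lambda>p. dfun A c p (X p)"] assms Vc
    unfolding smooth_vf_def by fastforce
qed

lemma dfun_has_derivative:
  assumes "smooth_atlas A" "open U" "p \<in> U" "smooth_fun A U f" "chart_at A p = (V, c)"
  shows "((f \<circ> inv_into V c) has_derivative dfun A f p) (at (c p))"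
proof -
  obtain V' c' where *: "chart_at A p = (V', c')" "(V', c') \<in> A" "p \<in> V'"
    using atlas_chart_at[OF assms(1)] .
  with assms(5) have "(V, c) \<in> A" "p \<in> V" by auto
  then have "(f \<circ> inv_into V c) differentiable (at (c p))"
    using assms smooth_on_differentiable[OF _ atlas_open_image[OF assms(1) _ assms(2)]]
    unfolding smooth_fun_def by fast
  then show ?thesis unfolding dfun_def assms(5) by (simp add: frechet_derivative_works)
qed

lemma dfun_eqI:
  assumes "chart_at A p = (V, c)" "((f \<circ> inv_into V c) has_derivative D) (at (c p))"
  shows "dfun A f p = D"
  using frechet_derivative_at[OF assms(2)] unfolding dfun_def assms(1) by simp

lemma dfun_linear:
  assumes "smooth_atlas A" "open U" "p \<in> U" "smooth_fun A U f"
  shows "linear (dfun A f p)"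
proof -
  obtain V c where "chart_at A p = (V, c)" by fastforce
  from dfun_has_derivative[OF assms this] show ?thesis
    by (rule has_derivative_linear)
qed

lemma dfun_cong:
  assumes "smooth_atlas A" "open U" "p \<in> U" "\<And>q. q \<in> U \<Longrightarrow> f q = f' q"
  shows "dfun A f' p = dfun A f p"
proof -
  obtain V c where Vc: "chart_at A p = (V, c)" "(V, c) \<in> A" "p \<in> V" "inj_on c V"
    using atlas_chart_at[OF assms(1)] by metis
  have "((f' \<circ> inv_into V c) has_derivative D) (at (c p)) \<longleftrightarrow>
      ((f \<circ> inv_into V c) has_derivative D) (at (c p))" for D
    by (rule iffI; erule has_derivative_transform_within_open[OF _
          atlas_open_image[OF assms(1) Vc(2) assms(2)]])
       (use Vc assms in auto)
  then show ?thesis unfolding dfun_def Vc frechet_derivative_def by simp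
qed

lemma Ck_on_subset: "Ck_on k S f \<Longrightarrow> S' \<subseteq> S \<Longrightarrow> Ck_on k S' f"
  by (induction k arbitrary: f) (auto intro: continuous_on_subset differentiable_on_subset)

lemma smooth_fun_subset: "smooth_fun A U f \<Longrightarrow> U' \<subseteq> U \<Longrightarrow> smooth_fun A U' f"
  unfolding smooth_fun_def smooth_on_def by (fast intro: Ck_on_subset)

lemma smooth_vf_subset: "smooth_vf A U X \<Longrightarrow> U' \<subseteq> U \<Longrightarrow> smooth_vf A U' X"
  unfolding smooth_vf_def by (fast intro: smooth_fun_subset)

lemma dfun_inner:
  fixes f :: "'m::{t2_space, second_countable_topology} \<Rightarrow> 'b::real_inner"
  assumes "smooth_atlas A" "open U" "p \<in> U" "smooth_fun A U f"
  shows "dfun A (\<lambda>q. f q \<bullet> b) p v = dfun A f p v \<bullet> b"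
proof -
  obtain V c where Vc: "chart_at A p = (V, c)" by fastforce
  have "((\<lambda>x. (f \<circ> inv_into V c) x \<bullet> b) has_derivative (\<lambda>v. dfun A f p v \<bullet> b)) (at (c p))"
    by (rule has_derivative_inner_left[OF dfun_has_derivative[OF assms Vc]])
  then have "dfun A (\<lambda>q. f q \<bullet> b) p = (\<lambda>v. dfun A f p v \<bullet> b)"
    by (intro dfun_eqI[OF Vc]) (simp add: comp_def)
  then show ?thesis by simp
qed

lemma smooth_map_chart:
  assumes "smooth_atlas A" "smooth_atlas B" "smooth_map A B UNIV \<pi>" "(V, d) \<in> B"
  shows "open (\<pi> -` V)" "smooth_fun A (\<pi> -` V) (d \<circ> \<pi>)"
proof -
  have "open V" using atlas_chart(1)[OF assms(2,4)] .
  then show "open (\<pi> -` V)"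
    using assms(3) unfolding smooth_map_def by (simp add: continuous_on_open_vimage)
  show "smooth_fun A (\<pi> -` V) (d \<circ> \<pi>)"
    using assms(3,4) unfolding smooth_map_def by auto
qed

lemma dmap_linear:
  assumes "smooth_atlas A" "smooth_atlas B" "smooth_map A B UNIV \<pi>"
  shows "linear (dmap A B \<pi> p)"
proof -
  obtain V d where "chart_at B (\<pi> p) = (V, d)" "(V, d) \<in> B" "\<pi> p \<in> V"
    using atlas_chart_at[OF assms(2)] by metis
  then show ?thesis
    using dfun_linear[OF assms(1) smooth_map_chart(1)[OF assms] _ smooth_map_chart(2)[OF assms]]
    unfolding dmap_def by auto
qed

lemma dfun_comp:
  assumes "smooth_atlas A" "smooth_atlas B" "smooth_map A B UNIV \<pi>"
    and "open U" "\<pi> p \<in> U" "smooth_fun B U k"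
  shows "dfun A (k \<circ> \<pi>) p v = dfun B k (\<pi> p) (dmap A B \<pi> p v)"
proof -
  obtain V c where Vc: "chart_at A p = (V, c)" "(V, c) \<in> A" "p \<in> V" "inj_on c V"
      "inv_into V c (c p) = p"
    using atlas_chart_at[OF assms(1)] by metis
  obtain W d where Wd: "chart_at B (\<pi> p) = (W, d)" "(W, d) \<in> B" "\<pi> p \<in> W" "inj_on d W"
    using atlas_chart_at[OF assms(2)] by metis
  note m = smooth_map_chart[OF assms(1-3) Wd(2)]
  have "(d \<circ> \<pi> \<circ> inv_into V c has_derivative dmap A B \<pi> p) (at (c p))"
    unfolding dmap_def Wd(1) snd_conv
    by (rule dfun_has_derivative[OF assms(1) m(1) _ m(2) Vc(1)]) (use Wd in simp)
  moreover have "((k \<circ> inv_into W d) has_derivative dfun B k (\<pi> p))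
      (at ((d \<circ> \<pi> \<circ> inv_into V c) (c p)))"
    using dfun_has_derivative[OF assms(2) assms(4-6) Wd(1)] Vc(5) by simp
  ultimately have "((k \<circ> inv_into W d) \<circ> (d \<circ> \<pi> \<circ> inv_into V c) has_derivative
      dfun B k (\<pi> p) \<circ> dmap A B \<pi> p) (at (c p))"
    by (rule diff_chain_at)
  then have "(k \<circ> \<pi> \<circ> inv_into V c has_derivative dfun B k (\<pi> p) \<circ> dmap A B \<pi> p) (at (c p))"
    by (rule has_derivative_transform_within_open[OF _ atlas_open_image[OF assms(1) Vc(2) m(1)]])
       (use Vc Wd in auto)
  then show ?thesis using dfun_eqI[OF Vc(1)] by fastforce
qed

lemma smooth_vf_zero:
  assumes "smooth_atlas A" "open U"
  shows "smooth_vf A U (\<lambda>q. 0)"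
  unfolding smooth_vf_def
proof (clarify)
  fix V c assume Vc: "(V, c) \<in> A"
  then have V: "open V" by (rule atlas_chart(1)[OF assms(1)])
  have c: "smooth_fun A V c"
    using assms Vc unfolding smooth_fun_def smooth_atlas_def by (auto simp: Int_commute)
  have "dfun A c q 0 = 0" if "q \<in> V" for q
    by (rule linear_0[OF dfun_linear[OF assms(1) V that c]])
  then show "smooth_fun A (U \<inter> V) (\<lambda>p. dfun A c p 0)"
    by (intro smooth_fun_cong[OF assms(1) _ smooth_fun_const]) (use V assms(2) in auto)
qed

lemma affine_connectionD:
  fixes f :: "'m::topological_space \<Rightarrow> real"
  assumes "affine_connection A nabla" "open U" "p \<in> U" "smooth_vf A U X" "smooth_vf A U X'"
    "smooth_vf A U Y" "smooth_vf A U Y'" "smooth_fun A U f"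
  shows "nabla (\<lambda>q. X q + X' q) Y p = nabla X Y p + nabla X' Y p"
    and "nabla (\<lambda>q. f q *\<^sub>R X q) Y p = f p *\<^sub>R nabla X Y p"
    and "nabla X (\<lambda>q. Y q + Y' q) p = nabla X Y p + nabla X Y' p"
    and "nabla X (\<lambda>q. f q *\<^sub>R Y q) p = dfun A f p (X p) *\<^sub>R Y p + f p *\<^sub>R nabla X Y p"
proof -
  note * = assms(1)[unfolded affine_connection_def, THEN conjunct2, rule_format,
      of U X X' Y Y' f p, OF _ assms(3)]
  have **: "open U \<and> smooth_vf A U X \<and> smooth_vf A U X' \<and> smooth_vf A U Y \<and> smooth_vf A U Y' \<and>
      smooth_fun A U f"
    using assms by simp
  show "nabla (\<lambda>q. X q + X' q) Y p = nabla X Y p + nabla X' Y p"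
    and "nabla (\<lambda>q. f q *\<^sub>R X q) Y p = f p *\<^sub>R nabla X Y p"
    and "nabla X (\<lambda>q. Y q + Y' q) p = nabla X Y p + nabla X Y' p"
    and "nabla X (\<lambda>q. f q *\<^sub>R Y q) p = dfun A f p (X p) *\<^sub>R Y p + f p *\<^sub>R nabla X Y p"
    using *[OF **] by blast+
qed

lemma connection_local:
  assumes at: "smooth_atlas A" and con: "affine_connection A nabla" and U: "open U" "p \<in> U"
    and X: "smooth_vf A U X" "smooth_vf A U X'" and Y: "smooth_vf A U Y" "smooth_vf A U Y'"
    and eq: "\<And>q. q \<in> U \<Longrightarrow> X q = X' q" "\<And>q. q \<in> U \<Longrightarrow> Y q = Y' q"
  shows "nabla X Y p = nabla X' Y' p"
proof -
  define f :: "'a \<Rightarrow> real" where "f = (\<lambda>q. if q \<in> U then 0 else 1)"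
  have f: "smooth_fun A U f"
    using smooth_fun_cong[OF at U(1) smooth_fun_const[of A U 0], of f] by (simp add: f_def)
  have df: "dfun A f p v = 0" for v
  proof -
    have "dfun A f p = dfun A (\<lambda>q. 0 :: real) p"
      using dfun_cong[OF at U, of "\<lambda>_. 0" f] by (simp add: f_def)
    moreover obtain V c where "chart_at A p = (V, c)" by fastforce
    ultimately show ?thesis by (simp add: dfun_def comp_def frechet_derivative_const)
  qed
  have z: "smooth_vf A U (\<lambda>q. X q - X' q)" "smooth_vf A U (\<lambda>q. Y q - Y' q)"
    using smooth_vf_cong[OF at U(1) smooth_vf_zero[OF at U(1)]] eq by auto
  have e: "(\<lambda>q. f q *\<^sub>R (X q - X' q)) = (\<lambda>q. X q - X' q)"
    "(\<lambda>q. f q *\<^sub>R (Y q - Y' q)) = (\<lambda>q. Y q - Y' q)"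
    using eq by (auto simp: f_def fun_eq_iff)
  have "nabla (\<lambda>q. f q *\<^sub>R (X q - X' q)) Y p = f p *\<^sub>R nabla (\<lambda>q. X q - X' q) Y p"
    by (rule affine_connectionD(2)[OF con U z(1) z(1) Y f])
  then have zX: "nabla (\<lambda>q. X q - X' q) Y p = 0" using e U(2) by (simp add: f_def)
  have "nabla X' (\<lambda>q. f q *\<^sub>R (Y q - Y' q)) p =
      dfun A f p (X' p) *\<^sub>R (Y p - Y' p) + f p *\<^sub>R nabla X' (\<lambda>q. Y q - Y' q) p"
    by (rule affine_connectionD(4)[OF con U X(2) X(2) z(2) z(2) f])
  then have zY: "nabla X' (\<lambda>q. Y q - Y' q) p = 0" using e U(2) df by (simp add: f_def)
  have "nabla (\<lambda>q. X' q + (X q - X' q)) Y p = nabla X' Y p + nabla (\<lambda>q. X q - X' q) Y p"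
    by (rule affine_connectionD(1)[OF con U X(2) z(1) Y f])
  moreover have "nabla X' (\<lambda>q. Y' q + (Y q - Y' q)) p =
      nabla X' Y' p + nabla X' (\<lambda>q. Y q - Y' q) p"
    by (rule affine_connectionD(3)[OF con U X(2) X(2) Y(2) z(2) f])
  ultimately show ?thesis using zX zY by simp
qed

lemma connection_zero_right:
  assumes at: "smooth_atlas A" and con: "affine_connection A nabla" and U: "open U" "p \<in> U"
    and X: "smooth_vf A U X"
  shows "nabla X (\<lambda>q. 0) p = 0"
proof -
  have "nabla X (\<lambda>q. 0 + 0) p = nabla X (\<lambda>q. 0) p + nabla X (\<lambda>q. 0) p"
    by (rule affine_connectionD(3)[OF con U X X smooth_vf_zero[OF at U(1)] smooth_vf_zero[OF at U(1)]
          smooth_fun_const])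
  then show ?thesis by simp
qed

lemma oproj_id:
  assumes "bilinear b" "\<forall>v. v \<noteq> 0 \<longrightarrow> b v v > 0" "subspace D" "u \<in> D"
  shows "oproj b D u = u"
  unfolding oproj_def
proof (rule the_equality)
  show "u \<in> D \<and> (\<forall>z\<in>D. b (u - u) z = 0)" using assms by (simp add: bilinear_lzero)
  fix w assume w: "w \<in> D \<and> (\<forall>z\<in>D. b (u - w) z = 0)"
  then have "b (u - w) (u - w) = 0" using assms subspace_diff by blast
  then show "w = u" using assms(2) by (metis eq_iff_diff_eq_0 less_irrefl)
qed

lemma oproj_zero:
  assumes "bilinear b" "\<forall>v. v \<noteq> 0 \<longrightarrow> b v v > 0" "subspace D" "\<forall>z \<in> D. b u z = 0"
  shows "oproj b D u = 0"
  unfolding oproj_def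
proof (rule the_equality)
  show "0 \<in> D \<and> (\<forall>z\<in>D. b (u - 0) z = 0)" using assms by (simp add: subspace_0)
  fix w assume w: "w \<in> D \<and> (\<forall>z\<in>D. b (u - w) z = 0)"
  then have "b u w - b w w = 0" using bilinear_lsub[OF assms(1)] by metis
  then have "b w w = 0" using w assms(4) by simp
  then show "w = 0" using assms(2) by (metis less_irrefl)
qed

text \<open>\<open>oneill_A_basic\<close> agrees with the tensor on basic fields.\<close>

lemma oneill_A_eq_oneill_A_basic:
  assumes rm: "riemannian_manifold A g" and lc: "levi_civita A g nabla"
    and rmB: "riemannian_manifold B h" and sub: "riemannian_submersion A g B h \<pi>"
    and U: "open U" "p \<in> U" and bas: "basic_on A g B \<pi> U X" and ver: "vertical_on A B \<pi> U W"
  shows "oneill_A nabla (vproj A g B \<pi>) (hproj A g B \<pi>) X W p =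
    oneill_A_basic nabla (hproj A g B \<pi>) X W p"
proof -
  let ?V = "vproj A g B \<pi>" and ?H = "hproj A g B \<pi>"
  have at: "smooth_atlas A" "smooth_atlas B"
    and g: "\<And>p. bilinear (g p)" "\<And>p u v. g p u v = g p v u" "\<And>p. \<forall>v. v \<noteq> 0 \<longrightarrow> g p v v > 0"
    using rm rmB unfolding riemannian_manifold_def by auto
  have con: "affine_connection A nabla" using lc unfolding levi_civita_def by blast
  have sm: "smooth_map A B UNIV \<pi>" using sub unfolding riemannian_submersion_def by blast
  note lin = dmap_linear[OF at sm]
  have sv: "subspace (vert A B \<pi> q)" for q
    unfolding vert_def using lin by (rule linear_subspace_kernel)
  have sh: "subspace (horiz A g B \<pi> q)" for q
    unfolding horiz_def ocomp_def subspace_def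
    by (simp add: bilinear_lzero[OF g(1)] bilinear_ladd[OF g(1)] bilinear_lmul[OF g(1)])
  have gvh: "g q v u = 0" "g q u v = 0" if "v \<in> vert A B \<pi> q" "u \<in> horiz A g B \<pi> q" for q u v
    using that g(2) unfolding horiz_def ocomp_def by auto
  have Vv: "?V q v = v" "?H q v = 0" if "v \<in> vert A B \<pi> q" for q v
    unfolding vproj_def hproj_def
    using oproj_id[OF g(1,3) sv that] oproj_zero[OF g(1,3) sh] gvh(1)[OF that] by auto
  have Vh: "?H q v = v" "?V q v = 0" if "v \<in> horiz A g B \<pi> q" for q v
    unfolding vproj_def hproj_def
    using oproj_id[OF g(1,3) sh that] oproj_zero[OF g(1,3) sv] gvh(2)[OF _ that] by auto
  obtain N Y where N: "open N" "\<pi> ` U \<subseteq> N" and X: "smooth_vf A U X" "\<And>q. q \<in> U \<Longrightarrow> X q \<in> horiz A g B \<pi> q"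
    and Y: "smooth_vf B N Y" "\<And>q. q \<in> U \<Longrightarrow> dmap A B \<pi> q (X q) = Y (\<pi> q)"
    using bas unfolding basic_on_def by blast
  have W: "smooth_vf A U W" "\<And>q. q \<in> U \<Longrightarrow> W q \<in> vert A B \<pi> q"
    using ver unfolding vertical_on_def by auto
  have zero: "smooth_vf A U (\<lambda>q. 0)" by (rule smooth_vf_zero[OF at(1) U(1)])
  have "smooth_vf A U (?H \<odot> X)" "smooth_vf A U (?V \<odot> W)" "smooth_vf A U (?H \<odot> W)"
    using smooth_vf_cong[OF at(1) U(1)] X W zero Vv Vh unfolding app_field_def by fastforce+
  then have n: "nabla (?H \<odot> X) (?H \<odot> W) p = nabla X (\<lambda>q. 0) p"
    "nabla (?H \<odot> X) (?V \<odot> W) p = nabla X W p"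
    using X W zero Vv Vh
    by (auto intro!: connection_local[OF at(1) con U] simp: app_field_def)
  have V0: "?V p 0 = 0" using Vv(1) subspace_0[OF sv] by blast
  have A: "oneill_A nabla ?V ?H X W p = ?H p (nabla X W p)"
    using n V0 connection_zero_right[OF at(1) con U X(1)] unfolding oneill_A_def
    by (simp add: app_field_def)

  obtain O' d where d: "chart_at B (\<pi> p) = (O', d)" "(O', d) \<in> B" "\<pi> p \<in> O'" "open O'"
    using atlas_chart_at[OF at(2)] by metis
  note m = smooth_map_chart[OF at sm d(2)]
  have dd: "smooth_fun B O' d"
    using at(2) d(2) unfolding smooth_fun_def smooth_atlas_def by (auto simp: Int_commute)
  define U' where "U' = U \<inter> \<pi> -` O'"
  have U': "open U'" "p \<in> U'" "U' \<subseteq> U" "U' \<subseteq> \<pi> -` O'"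
    using U m(1) d(3) by (auto simp: U'_def)
  have NO: "open (N \<inter> O')" "\<pi> q \<in> N \<inter> O'" if "q \<in> U'" for q
    using N d U' that by auto
  have kY: "smooth_fun B (N \<inter> O') (\<lambda>y. dfun B d y (Y y) \<bullet> b)" for b
  proof (rule smooth_fun_inner[OF at(2) NO(1)[OF U'(2)]])
    show "smooth_fun B (N \<inter> O') (\<lambda>y. dfun B d y (Y y))"
      using Y(1) d(2) unfolding smooth_vf_def by blast
  qed
  have "dmap A B \<pi> p (nabla X W p) \<bullet> b = dmap A B \<pi> p (nabla W X p) \<bullet> b" for b
  proof -
    define f where "f = (\<lambda>q. (d \<circ> \<pi>) q \<bullet> b)"
    have f: "smooth_fun A (\<pi> -` O') f"
      unfolding f_def by (rule smooth_fun_inner[OF at(1) m])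
    have fp: "dfun A f p v = dmap A B \<pi> p v \<bullet> b" for v
      using dfun_inner[OF at(1) m(1) _ m(2)] d by (simp add: f_def dmap_def)
    have fq: "dfun A f q v = dfun B d (\<pi> q) (dmap A B \<pi> q v) \<bullet> b" if "q \<in> U'" for q v
      using dfun_inner[OF at(1) m(1) _ m(2), of q] dfun_comp[OF at sm d(4) _ dd, of q] that U'(4)
      by (auto simp: f_def)
    have fW: "dfun A f q (W q) = 0" if "q \<in> U'" for q
      using fq[OF that] W(2) linear_0[OF dfun_linear[OF at(2) d(4) _ dd]] that U'(3,4)
      by (force simp: vert_def)
    define k where "k = (\<lambda>y. dfun B d y (Y y) \<bullet> b)"
    have fX: "dfun A f q (X q) = (k \<circ> \<pi>) q" if "q \<in> U'" for q
      using fq[OF that] Y(2) that U'(3) by (auto simp: k_def)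
    have tf: "\<And>U X Y f p. open U \<Longrightarrow> smooth_vf A U X \<Longrightarrow> smooth_vf A U Y \<Longrightarrow>
        smooth_fun A U (f :: 'a \<Rightarrow> real) \<Longrightarrow> p \<in> U \<Longrightarrow>
        dfun A f p (nabla X Y p) - dfun A f p (nabla Y X p) =
          dfun A (\<lambda>q. dfun A f q (Y q)) p (X p) - dfun A (\<lambda>q. dfun A f q (X q)) p (Y p)"
      using lc unfolding levi_civita_def by blast
    have "dfun A f p (nabla X W p) - dfun A f p (nabla W X p) =
        dfun A (\<lambda>q. dfun A f q (W q)) p (X p) - dfun A (\<lambda>q. dfun A f q (X q)) p (W p)"
      by (rule tf[OF U'(1) _ _ _ U'(2)])
        (use U' smooth_vf_subset[OF X(1)] smooth_vf_subset[OF W(1)] smooth_fun_subset[OF f] in auto)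
    moreover have "dfun A (\<lambda>q. dfun A f q (W q)) p (X p) = 0"
    proof -
      have "dfun A (\<lambda>q. dfun A f q (W q)) p = dfun A (\<lambda>q. 0 :: real) p"
        by (rule dfun_cong[OF at(1) U'(1,2)]) (simp add: fW)
      then show ?thesis
        using dfun_inner[OF at(1) U smooth_fun_const[of A U "0::real"], of 0] by simp
    qed
    moreover have "dfun A (\<lambda>q. dfun A f q (X q)) p (W p) = 0"
    proof -
      have "dfun A (\<lambda>q. dfun A f q (X q)) p = dfun A (k \<circ> \<pi>) p"
        by (rule dfun_cong[OF at(1) U'(1,2)]) (simp add: fX)
      moreover have "dfun A (k \<circ> \<pi>) p (W p) = dfun B k (\<pi> p) (dmap A B \<pi> p (W p))"
        using dfun_comp[OF at sm NO(1)[OF U'(2)] NO(2)[OF U'(2)]] kY unfolding k_def by blast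
      moreover have "dmap A B \<pi> p (W p) = 0" using W(2)[OF U(2)] by (simp add: vert_def)
      moreover have "dfun B k (\<pi> p) 0 = 0"
        unfolding k_def
        by (rule linear_0[OF dfun_linear[OF at(2) NO(1)[OF U'(2)] NO(2)[OF U'(2)] kY]])
      ultimately show ?thesis by simp
    qed
    ultimately show ?thesis by (simp add: fp)
  qed
  then have "dmap A B \<pi> p (nabla X W p) = dmap A B \<pi> p (nabla W X p)"
    by (metis vector_eq_rdot)
  then have "nabla X W p - nabla W X p \<in> vert A B \<pi> p"
    unfolding vert_def using linear_diff[OF lin] by simp
  then have "g p (nabla X W p - nabla W X p) z = 0" if "z \<in> horiz A g B \<pi> p" for z
    using gvh(1) that by blast
  then have "g p (nabla X W p - w) z = g p (nabla W X p - w) z" if "z \<in> horiz A g B \<pi> p" for z w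
    using that by (simp add: bilinear_lsub[OF g(1)])
  then have "?H p (nabla X W p) = ?H p (nabla W X p)"
    unfolding hproj_def oproj_def by (metis (no_types, lifting))
  then show ?thesis using A unfolding oneill_A_basic_def app_field_def by simp
qed

end

theory Submission
  imports Defs
begin

text \<open>
  Both (ii) and (iii) say that \<open>\<H>(\<nabla>\<^sub>W Z) = 0\<close> for vertical \<open>W\<close>, \<open>Z\<close> and
  \<open>\<V>(\<nabla>\<^sub>\<xi> \<eta>) = 0\<close> for basic \<open>\<xi>\<close>, \<open>\<eta>\<close>, that is, that both distributions are parallel.
  For (iii), \<open>\<nabla>J = 0\<close> gives \<open>\<nabla>\<^sub>W Z = - J(\<nabla>\<^sub>W (J Z))\<close>, and the two expressions are
  \<open>- \<H>(\<nabla>\<^sub>W Z)\<close> and \<open>- \<V>(\<nabla>\<^sub>\<xi> \<eta>)\<close>. For (ii), the second fundamental form vanishes on pairs of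
  horizontal vectors by Koszul's formula, it is \<open>- \<pi>\<^sub>*(\<nabla>\<^sub>W Z)\<close> on vertical pairs and
  \<open>- \<pi>\<^sub>*(\<nabla>\<^sub>\<xi> W)\<close> on mixed ones, and \<open>g(\<nabla>\<^sub>\<xi> W, \<eta>) = - g(W, \<nabla>\<^sub>\<xi> \<eta>)\<close>.

  If the metric is locally a product, then Koszul's formula for fields tangent to the factors shows
  that the factors are parallel. Conversely, if both distributions are parallel, then the horizontal
  lifts of the coordinate fields of the base commute. Their time-one flow, smooth by the dependence
  of solutions of differential equations on parameters, straightens the fibres and the horizontal
  leaves simultaneously. In the resulting chart the metric of the fibres is constant along the
  leaves, and the metric of the leaves is that of the base.
\<close>

section \<open>Calculus of \<open>C\<^sup>k\<close> maps\<close>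

text \<open>The analytic cost lies in passing from parallel distributions to a product. The lifted
  coordinate fields are not flowed along one after another: a single equation moves a point x by the
  combination \<open>X (y x0 - y x)\<close>, whose coefficient depends on x only as a parameter. The
  coefficient vanishes at x0, so nearby solutions are slow and exist on a fixed time interval. Its
  half-length 2 puts time one in the interior, and with the Lipschitz constant 1/8 the product is
  1/4. Under such smallness Gronwall's inequality is just the absorption of half of a maximum,
  without exponentials. Smoothness in the parameter is an induction in which nothing deteriorates:
  the derivative of a solution solves an equation of the same kind with the same constant, on a
  slightly shorter interval. Horizontal lifts, and lifts from the factors of a product, are metric
  duals of pulled-back forms, so their smoothness rests on one fact, the smooth inversion of a
  family of linear maps.\<close>

lemma Ck_on_SucI:
  assumes "open S" "\<And>x. x \<in> S \<Longrightarrow> (f has_derivative f' x) (at x)"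
    and "\<And>v. Ck_on k S (\<lambda>x. f' x v)"
  shows "Ck_on (Suc k) S f"
proof -
  have eq: "frechet_derivative f (at x) = f' x" if "x \<in> S" for x
    using frechet_derivative_at[OF assms(2)[OF that]] by simp
  have "f differentiable_on S"
    using assms(1,2) by (auto simp: differentiable_on_eq_differentiable_at differentiable_def)
  moreover have "Ck_on k S (\<lambda>x. frechet_derivative f (at x) v)" for v
    by (rule Ck_on_cong[OF assms(1) assms(3)[of v]]) (simp add: eq)
  ultimately show ?thesis by simp
qed

lemma Ck_on_SucD:
  assumes "Ck_on (Suc k) S f" "open S"
  shows "\<And>x. x \<in> S \<Longrightarrow> (f has_derivative frechet_derivative f (at x)) (at x)"
    and "Ck_on k S (\<lambda>x. frechet_derivative f (at x) v)"
  using assms by (auto simp: differentiable_on_eq_differentiable_at frechet_derivative_works[symmetric])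

lemma Ck_on_Suc_imp: "Ck_on (Suc k) S f \<Longrightarrow> Ck_on k S f"
  by (induction k arbitrary: f) (auto intro: differentiable_imp_continuous_on)

lemma smooth_on_SucD:
  assumes "smooth_on S f" "open S"
  shows "\<And>x. x \<in> S \<Longrightarrow> (f has_derivative frechet_derivative f (at x)) (at x)"
    and "smooth_on S (\<lambda>x. frechet_derivative f (at x) v)"
proof -
  have "Ck_on (Suc k) S f" for k using assms unfolding smooth_on_def by blast
  then show "\<And>x. x \<in> S \<Longrightarrow> (f has_derivative frechet_derivative f (at x)) (at x)"
    and "smooth_on S (\<lambda>x. frechet_derivative f (at x) v)"
    using Ck_on_SucD[OF _ assms(2)] unfolding smooth_on_def by blast+
qed

lemma smooth_on_continuous_on: "smooth_on S f \<Longrightarrow> continuous_on S f"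
  unfolding smooth_on_def by (metis Ck_on.simps(1))

lemma smooth_on_cong:
  "open S \<Longrightarrow> smooth_on S f \<Longrightarrow> (\<And>x. x \<in> S \<Longrightarrow> f x = g x) \<Longrightarrow> smooth_on S g"
  unfolding smooth_on_def using Ck_on_cong by blast

lemma smooth_on_subset: "smooth_on S f \<Longrightarrow> T \<subseteq> S \<Longrightarrow> smooth_on T f"
  unfolding smooth_on_def using Ck_on_subset by blast

lemma Ck_on_local:
  assumes "open S" "\<And>x. x \<in> S \<Longrightarrow> \<exists>T. open T \<and> x \<in> T \<and> Ck_on k T f"
  shows "Ck_on k S f"
  using assms(2)
proof (induction k arbitrary: f)
  case 0
  then show ?case
    by (metis Ck_on.simps(1) continuous_at_imp_continuous_on continuous_on_eq_continuous_at)
next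
  case (Suc k)
  have "(f has_derivative frechet_derivative f (at x)) (at x)" if "x \<in> S" for x
    using Suc.prems[OF that] Ck_on_SucD(1)[where f = f and k = k] by blast
  moreover have "Ck_on k S (\<lambda>x. frechet_derivative f (at x) v)" for v
  proof (rule Suc.IH)
    fix x assume "x \<in> S"
    then obtain T where "open T" "x \<in> T" "Ck_on (Suc k) T f" using Suc.prems by blast
    then show "\<exists>T. open T \<and> x \<in> T \<and> Ck_on k T (\<lambda>x. frechet_derivative f (at x) v)"
      using Ck_on_SucD(2) by blast
  qed
  ultimately show ?case by (rule Ck_on_SucI[OF assms(1)])
qed

lemma smooth_on_local:
  assumes "open S" "\<And>x. x \<in> S \<Longrightarrow> \<exists>T. open T \<and> x \<in> T \<and> smooth_on T f"
  shows "smooth_on S f"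
  using assms Ck_on_local[OF assms(1)] unfolding smooth_on_def by meson

lemma Ck_on_bounded_linear:
  assumes "bounded_linear L" "open S" "Ck_on k S f"
  shows "Ck_on k S (\<lambda>x. L (f x))"
  using assms(3)
proof (induction k arbitrary: f)
  case 0
  then show ?case using bounded_linear.continuous_on[OF assms(1)] by simp
next
  case (Suc k)
  note d = Ck_on_SucD[OF Suc.prems assms(2)]
  show ?case
    by (rule Ck_on_SucI[OF assms(2) bounded_linear.has_derivative[OF assms(1) d(1)] Suc.IH[OF d(2)]])
qed

lemma Ck_on_add:
  assumes "open S" "Ck_on k S f" "Ck_on k S g"
  shows "Ck_on k S (\<lambda>x. f x + g x)"
  using assms(2,3)
proof (induction k arbitrary: f g)
  case 0
  then show ?case by (simp add: continuous_on_add)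
next
  case (Suc k)
  note f = Ck_on_SucD[OF Suc.prems(1) assms(1)] and g = Ck_on_SucD[OF Suc.prems(2) assms(1)]
  show ?case
    by (rule Ck_on_SucI[OF assms(1) has_derivative_add[OF f(1) g(1)] Suc.IH[OF f(2) g(2)]])
qed

lemma Ck_on_bounded_bilinear:
  assumes "bounded_bilinear pr" "open S" "Ck_on k S f" "Ck_on k S g"
  shows "Ck_on k S (\<lambda>x. pr (f x) (g x))"
  using assms(3,4)
proof (induction k arbitrary: f g)
  case 0
  then show ?case using bounded_bilinear.continuous_on[OF assms(1)] by simp
next
  case (Suc k)
  note f = Ck_on_SucD[OF Suc.prems(1) assms(2)] and g = Ck_on_SucD[OF Suc.prems(2) assms(2)]
  show ?case
    by (rule Ck_on_SucI[OF assms(2) bounded_bilinear.FDERIV[OF assms(1) f(1) g(1)]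
          Ck_on_add[OF assms(2) Suc.IH[OF Ck_on_Suc_imp[OF Suc.prems(1)] g(2)]
            Suc.IH[OF f(2) Ck_on_Suc_imp[OF Suc.prems(2)]]]])
qed

lemma Ck_on_sum:
  assumes "open S" "\<And>i. i \<in> I \<Longrightarrow> Ck_on k S (f i)"
  shows "Ck_on k S (\<lambda>x. \<Sum>i\<in>I. f i x)"
  using assms(2) by (induction I rule: infinite_finite_induct)
    (auto intro: Ck_on_add[OF assms(1)] simp: Ck_on_const)

lemma Ck_on_linear:
  fixes L :: "'a::euclidean_space \<Rightarrow> 'b::real_normed_vector"
  assumes "linear L" "open S"
  shows "Ck_on k S L"
proof (cases k)
  case 0
  then show ?thesis using assms linear_continuous_on linear_conv_bounded_linear by fastforce
next
  case (Suc j)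
  have "(L has_derivative L) (at x)" for x
    using assms(1) by (simp add: linear_conv_bounded_linear bounded_linear_imp_has_derivative)
  then show ?thesis unfolding Suc by (intro Ck_on_SucI[OF assms(2) _ Ck_on_const])
qed

lemma Ck_on_Pair:
  assumes "open S" "Ck_on k S f" "Ck_on k S g"
  shows "Ck_on k S (\<lambda>x. (f x, g x))"
proof -
  have "Ck_on k S (\<lambda>x. (f x, 0) + (0, g x))"
    using Ck_on_bounded_linear[OF bounded_linear_Pair[OF bounded_linear_ident bounded_linear_zero]
        assms(1,2)]
      Ck_on_bounded_linear[OF bounded_linear_Pair[OF bounded_linear_zero bounded_linear_ident]
        assms(1,3)] assms(1)
    by (intro Ck_on_add) auto
  then show ?thesis by simp
qed

lemma linear_euclidean_expand:
  fixes L :: "'a::euclidean_space \<Rightarrow> 'b::real_vector"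
  assumes "linear L"
  shows "L v = (\<Sum>b\<in>Basis. (v \<bullet> b) *\<^sub>R L b)"
  using assms by (metis (mono_tags, lifting) euclidean_representation linear_scale linear_sum sum.cong)

text \<open>\<open>Ck_on\<close> speaks of derivatives in a fixed direction, whereas the chain rule
  differentiates \<open>f\<close> in a direction that moves with x. Expanding this direction in
  \<open>Basis\<close> gives a finite sum of products, to which the induction hypothesis applies
  factor by factor.\<close>

lemma Ck_on_compose:
  fixes g :: "'a::real_normed_vector \<Rightarrow> 'b::euclidean_space"
    and f :: "'b \<Rightarrow> 'c::real_normed_vector"
  assumes "open S" "open T" "Ck_on k S g" "Ck_on k T f" "g ` S \<subseteq> T"
  shows "Ck_on k S (\<lambda>x. f (g x))"
  using assms(3,4)
proof (induction k arbitrary: f)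
  case 0
  then show ?case using continuous_on_compose2[OF _ _ assms(5)] by simp
next
  case (Suc k)
  note g = Ck_on_SucD[OF Suc.prems(1) assms(1)] and f = Ck_on_SucD[OF Suc.prems(2) assms(2)]
  let ?D = "\<lambda>x v. \<Sum>b\<in>Basis. (frechet_derivative g (at x) v \<bullet> b) *\<^sub>R frechet_derivative f (at (g x)) b"
  show ?case
  proof (rule Ck_on_SucI[OF assms(1), of _ ?D])
    fix x assume x: "x \<in> S"
    then have gx: "g x \<in> T" using assms(5) by blast
    have "((\<lambda>x. f (g x)) has_derivative
        (\<lambda>v. frechet_derivative f (at (g x)) (frechet_derivative g (at x) v))) (at x)"
      using diff_chain_at[OF g(1)[OF x] f(1)[OF gx]] by (simp add: comp_def)
    moreover have "(\<lambda>v. frechet_derivative f (at (g x)) (frechet_derivative g (at x) v)) = ?D x"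
      by (rule ext, rule linear_euclidean_expand[OF has_derivative_linear[OF f(1)[OF gx]]])
    ultimately show "((\<lambda>x. f (g x)) has_derivative ?D x) (at x)" by simp
  next
    fix v
    show "Ck_on k S (\<lambda>x. ?D x v)"
      by (intro Ck_on_sum[OF assms(1)] Ck_on_bounded_bilinear[OF bounded_bilinear_scaleR assms(1)]
          Ck_on_inner[OF assms(1) g(2)] Suc.IH Ck_on_Suc_imp[OF Suc.prems(1)] f(2))
  qed
qed

lemma smooth_on_const: "smooth_on S (\<lambda>x. c)"
  by (simp add: smooth_on_def Ck_on_const)

lemma smooth_on_linear: "linear L \<Longrightarrow> open S \<Longrightarrow> smooth_on S (L :: 'a::euclidean_space \<Rightarrow> _)"
  by (simp add: smooth_on_def Ck_on_linear)

lemma smooth_on_linear_comp: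
  "linear L \<Longrightarrow> open S \<Longrightarrow> smooth_on S f \<Longrightarrow> smooth_on S (\<lambda>x. L (f x))"
  for L :: "'a::euclidean_space \<Rightarrow> 'b::real_normed_vector"
  by (simp add: smooth_on_def Ck_on_bounded_linear linear_conv_bounded_linear)

lemma smooth_on_add:
  "open S \<Longrightarrow> smooth_on S f \<Longrightarrow> smooth_on S g \<Longrightarrow> smooth_on S (\<lambda>x. f x + g x)"
  by (simp add: smooth_on_def Ck_on_add)

lemma smooth_on_scaleR:
  "open S \<Longrightarrow> smooth_on S f \<Longrightarrow> smooth_on S g \<Longrightarrow> smooth_on S (\<lambda>x. f x *\<^sub>R g x)"
  by (simp add: smooth_on_def Ck_on_bounded_bilinear[OF bounded_bilinear_scaleR])

lemma smooth_on_inner: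
  "open S \<Longrightarrow> smooth_on S f \<Longrightarrow> smooth_on S (\<lambda>x. f x \<bullet> b)"
  by (simp add: smooth_on_def Ck_on_inner)

lemma smooth_on_diff:
  assumes "open S" "smooth_on S f" "smooth_on S g"
  shows "smooth_on S (\<lambda>x. f x - g x)"
  using smooth_on_add[OF assms(1,2) smooth_on_scaleR[OF assms(1) smooth_on_const[of S "-1"] assms(3)]]
  by simp

lemma smooth_on_sum:
  "open S \<Longrightarrow> (\<And>i. i \<in> I \<Longrightarrow> smooth_on S (f i)) \<Longrightarrow> smooth_on S (\<lambda>x. \<Sum>i\<in>I. f i x)"
  by (simp add: smooth_on_def Ck_on_sum)

lemma smooth_on_Pair:
  "open S \<Longrightarrow> smooth_on S f \<Longrightarrow> smooth_on S g \<Longrightarrow> smooth_on S (\<lambda>x. (f x, g x))"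
  by (simp add: smooth_on_def Ck_on_Pair)

lemma smooth_on_compose:
  fixes g :: "'a::real_normed_vector \<Rightarrow> 'b::euclidean_space"
  assumes "open S" "open T" "smooth_on S g" "smooth_on T f" "g ` S \<subseteq> T"
  shows "smooth_on S (\<lambda>x. f (g x))"
  using assms unfolding smooth_on_def by (blast intro: Ck_on_compose)

lemma smooth_on_derivative_apply:
  fixes f :: "'b::euclidean_space \<Rightarrow> 'c::real_normed_vector" and g h :: "'a::real_normed_vector \<Rightarrow> 'b"
  assumes "open S" "open T" "smooth_on S g" "smooth_on S h" "smooth_on T f" "g ` S \<subseteq> T"
  shows "smooth_on S (\<lambda>x. frechet_derivative f (at (g x)) (h x))"
proof (rule smooth_on_cong[OF assms(1)])
  show "smooth_on S (\<lambda>x. \<Sum>b\<in>Basis. (h x \<bullet> b) *\<^sub>R frechet_derivative f (at (g x)) b)"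
    by (intro smooth_on_sum smooth_on_scaleR smooth_on_inner assms
        smooth_on_compose[OF assms(1,2,3) smooth_on_SucD(2)[OF assms(5,2)] assms(6)])
  fix x assume "x \<in> S"
  then have "linear (frechet_derivative f (at (g x)))"
    using has_derivative_linear[OF smooth_on_SucD(1)[OF assms(5,2)]] assms(6) by blast
  then show "(\<Sum>b\<in>Basis. (h x \<bullet> b) *\<^sub>R frechet_derivative f (at (g x)) b) =
      frechet_derivative f (at (g x)) (h x)"
    by (rule linear_euclidean_expand[symmetric])
qed

subsection \<open>Inverses\<close>

text \<open>With z x = \<open>inv (L x) v\<close> and \<open>M\<close> the inverse at x0, z x - z x0
  is minus \<open>M\<close> applied to (L x - L x0) (z x), hence bounded by
  \<open>norm (z x)\<close> times \<open>K * s x\<close>. Once this factor is at most 1/2, z x is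
  bounded by twice z x0, and the difference tends to zero with \<open>s\<close>.\<close>

lemma continuous_on_inv_linear_family:
  fixes L :: "'a::euclidean_space \<Rightarrow> 'b::euclidean_space \<Rightarrow> 'b"
  assumes "open S" "\<And>x. x \<in> S \<Longrightarrow> linear (L x)" "\<And>x. x \<in> S \<Longrightarrow> bij (L x)"
    and "\<And>v. continuous_on S (\<lambda>x. L x v)"
  shows "continuous_on S (\<lambda>x. inv (L x) v)"
proof (rule continuous_at_imp_continuous_on, rule ballI)
  fix x0 assume x0: "x0 \<in> S"
  define M where "M = inv (L x0)"
  have "linear M" unfolding M_def using assms(2,3) x0 bij_is_inj linear_inj_imp_surj
    by (meson bij_is_surj inj_linear_imp_inv_linear)
  then obtain K where K: "K > 0" "\<And>w. norm (M w) \<le> norm w * K"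
    using bounded_linear.pos_bounded linear_conv_bounded_linear by metis
  define s where "s = (\<lambda>x. \<Sum>b\<in>Basis. norm (L x b - L x0 b))"
  have s: "norm (L x u - L x0 u) \<le> norm u * s x" if "x \<in> S" for x u
  proof -
    have "L x u - L x0 u = (\<Sum>b\<in>Basis. (u \<bullet> b) *\<^sub>R (L x b - L x0 b))"
      using linear_euclidean_expand[OF assms(2)[OF that], of u]
        linear_euclidean_expand[OF assms(2)[OF x0], of u]
      by (simp add: scaleR_diff_right sum_subtractf)
    also have "norm \<dots> \<le> (\<Sum>b\<in>Basis. norm u * norm (L x b - L x0 b))"
      by (intro sum_norm_le) (simp add: Basis_le_norm mult_right_mono)
    finally show ?thesis by (simp add: s_def sum_distrib_left)
  qed
  have "isCont s x0"
    unfolding s_def using assms(1,4) x0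
    by (intro continuous_intros) (auto simp: continuous_on_eq_continuous_at)
  then have s0: "(s \<longlongrightarrow> 0) (at x0)" by (simp add: isCont_def s_def)
  have s_nn: "s x \<ge> 0" for x unfolding s_def by (simp add: sum_nonneg)
  define z where "z = (\<lambda>x. inv (L x) v)"
  have bd: "norm (z x - z x0) \<le> K * s x * (2 * norm (z x0))" if "x \<in> S" "s x < 1 / (2 * K)" for x
  proof -
    have Lz: "L x (z x) = v" "L x0 (z x0) = v" unfolding z_def
      using assms(3) that x0 by (auto simp: bij_is_surj surj_f_inv_f)
    have "z x - z x0 = M (L x0 (z x - z x0))"
      unfolding M_def using assms(3)[OF x0] by (simp add: bij_is_inj)
    also have "L x0 (z x - z x0) = - (L x (z x) - L x0 (z x))"
      using Lz linear_diff[OF assms(2)[OF x0]] by simp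
    finally have "norm (z x - z x0) \<le> norm (z x) * s x * K"
      using K(2) s[OF that(1), of "z x"] K(1)
      by (metis (no_types, opaque_lifting) mult_right_mono norm_minus_cancel order_trans less_imp_le)
    moreover have "norm (z x) * s x * K \<le> norm (z x) * (1 / 2)"
    proof -
      have "s x * K \<le> 1 / 2" using that(2) K(1) by (simp add: field_simps)
      then show ?thesis by (metis mult.assoc mult_left_mono norm_ge_zero)
    qed
    ultimately have "norm (z x) \<le> 2 * norm (z x0)"
      using norm_triangle_ineq2[of "z x" "z x0"] by linarith
    then have "norm (z x) * (s x * K) \<le> (2 * norm (z x0)) * (s x * K)"
      using s_nn K(1) by (intro mult_right_mono) auto
    then show ?thesis using \<open>norm (z x - z x0) \<le> norm (z x) * s x * K\<close> by (simp add: mult_ac)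
  qed
  have "eventually (\<lambda>x. s x < 1 / (2 * K)) (at x0)"
    by (rule order_tendstoD(2)[OF s0]) (use K in simp)
  moreover have "eventually (\<lambda>x. x \<in> S) (at x0)"
    using assms(1) x0 by (metis eventually_at_topological)
  ultimately have ev: "eventually (\<lambda>x. norm (z x - z x0) \<le> K * s x * (2 * norm (z x0))) (at x0)"
    by eventually_elim (rule bd)
  have "((\<lambda>x. K * s x * (2 * norm (z x0))) \<longlongrightarrow> K * 0 * (2 * norm (z x0))) (at x0)"
    by (intro tendsto_intros s0)
  then have "((\<lambda>x. z x - z x0) \<longlongrightarrow> 0) (at x0)"
    by (intro Lim_null_comparison[OF ev]) simp
  then show "isCont (\<lambda>x. inv (L x) v) x0"
    unfolding isCont_def z_def by (simp add: LIM_zero_iff)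
qed

text \<open>The map sending (x, z) to (x, \<open>L x z\<close>) has the inverse sending (x, v) to
  (x, \<open>inv (L x) v\<close>). The theorem on the derivative of an inverse, applied to this one
  map, handles the whole family; restriction to fixed \<open>v\<close> gives the formula.\<close>

lemma inv_linear_family_has_derivative:
  fixes L :: "'a::euclidean_space \<Rightarrow> 'b::euclidean_space \<Rightarrow> 'b"
  assumes "open S" "\<And>x. x \<in> S \<Longrightarrow> linear (L x)" "\<And>x. x \<in> S \<Longrightarrow> bij (L x)"
    and L': "\<And>x v. x \<in> S \<Longrightarrow> ((\<lambda>x. L x v) has_derivative L' x v) (at x)" and x: "x \<in> S"
  shows "((\<lambda>x. inv (L x) v) has_derivative
    (\<lambda>h. - inv (L x) (\<Sum>b\<in>Basis. (inv (L x) v \<bullet> b) *\<^sub>R L' x b h))) (at x)"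
proof -
  \<comment> \<open>Written through the columns \<open>L x b\<close>, since \<open>L\<close> is
    known to be differentiable in x only for a fixed argument. Over \<open>S\<close> the second
    component is \<open>L x z\<close>.\<close>
  define G where "G = (\<lambda>p. (fst p, \<Sum>b\<in>Basis. (snd p \<bullet> b) *\<^sub>R L (fst p) b))"
  define Gi where "Gi = (\<lambda>p. (fst p, inv (L (fst p)) (snd p)))"
  define z where "z = inv (L x) v"
  define G' where "G' = (\<lambda>q. (fst q, \<Sum>b\<in>Basis. (z \<bullet> b) *\<^sub>R L' x b (fst q) + (snd q \<bullet> b) *\<^sub>R L x b))"
  define Gi' where "Gi' = (\<lambda>q. (fst q, inv (L x) (snd q - (\<Sum>b\<in>Basis. (z \<bullet> b) *\<^sub>R L' x b (fst q)))))"
  have G_eq: "G p = (fst p, L (fst p) (snd p))" if "fst p \<in> S" for p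
    unfolding G_def using linear_euclidean_expand[OF assms(2)[OF that], of "snd p"] by simp
  have z: "L x z = v" unfolding z_def using assms(3)[OF x] by (simp add: bij_is_surj surj_f_inv_f)
  have inv: "inv (L y) (L y w) = w" if "y \<in> S" for y w
    using assms(3)[OF that] by (simp add: bij_is_inj)
  have dG: "(G has_derivative (\<lambda>q. (fst q, \<Sum>b\<in>Basis. (snd p \<bullet> b) *\<^sub>R L' (fst p) b (fst q) +
      (snd q \<bullet> b) *\<^sub>R L (fst p) b))) (at p)" if "fst p \<in> S" for p
  proof -
    have "((\<lambda>p. L (fst p) b) has_derivative (\<lambda>q. L' (fst p) b (fst q))) (at p)" for b
      using diff_chain_at[OF has_derivative_fst[OF has_derivative_ident] L'[OF that, of b]]
      by (simp add: comp_def)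
    then show ?thesis unfolding G_def
      by (intro has_derivative_Pair has_derivative_sum has_derivative_fst has_derivative_ident)
        (auto intro!: derivative_eq_intros)
  qed
  have "(Gi has_derivative Gi') (at (G (x, z)))"
  proof (rule has_derivative_inverse_strong[where f = G and S = "S \<times> UNIV" and f' = G'])
    show "open (S \<times> (UNIV :: 'b set))" using assms(1) by (simp add: open_Times)
    show "(x, z) \<in> S \<times> UNIV" using x by simp
    show "continuous_on (S \<times> UNIV) G"
      by (intro continuous_at_imp_continuous_on ballI has_derivative_continuous[OF dG]) auto
    show "Gi (G p) = p" if "p \<in> S \<times> UNIV" for p
      using that inv by (cases p) (auto simp: Gi_def G_eq)
    show "(G has_derivative G') (at (x, z))" using dG[of "(x, z)"] x by (simp add: G'_def)
    have "L x (inv (L x) w) = w" for w using assms(3)[OF x] by (simp add: bij_is_surj surj_f_inv_f)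
    then show "G' \<circ> Gi' = id"
      by (auto simp: G'_def Gi'_def sum.distrib fun_eq_iff
          linear_euclidean_expand[OF assms(2)[OF x], symmetric])
  qed
  moreover have "G (x, z) = (x, v)" using x z by (simp add: G_eq)
  ultimately have "((\<lambda>y. snd (Gi (y, v))) has_derivative (\<lambda>h. snd (Gi' (h, 0)))) (at x)"
    using has_derivative_snd[OF has_derivative_compose[of "\<lambda>y. (y, v)" "\<lambda>h. (h, 0)" x UNIV Gi Gi']]
    by (simp add: has_derivative_Pair has_derivative_ident)
  moreover have "linear (inv (L x))"
    using assms(2,3) x by (meson bij_is_inj bij_is_surj inj_linear_imp_inv_linear)
  ultimately show ?thesis by (simp add: Gi_def Gi'_def z_def linear_neg)
qed

text \<open>The derivative of the inverse family is made of the inverse family and of the derivative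
  of \<open>L\<close>. Expanded over \<open>Basis\<close> it is a sum of products, so class C^k of
  the inverses yields class C^(k+1).\<close>

lemma Ck_on_inv_linear_family:
  fixes L :: "'a::euclidean_space \<Rightarrow> 'b::euclidean_space \<Rightarrow> 'b"
  assumes S: "open S" and lin: "\<And>x. x \<in> S \<Longrightarrow> linear (L x)" and bij: "\<And>x. x \<in> S \<Longrightarrow> bij (L x)"
    and "\<And>v. Ck_on k S (\<lambda>x. L x v)"
  shows "Ck_on k S (\<lambda>x. inv (L x) v)"
  using assms(4)
proof (induction k arbitrary: v)
  case 0
  then show ?case using continuous_on_inv_linear_family[OF S lin bij] by simp
next
  case (Suc k)
  note L = Ck_on_SucD[OF Suc.prems S]
  let ?L' = "\<lambda>x v. frechet_derivative (\<lambda>x. L x v) (at x)"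
  let ?D = "\<lambda>x h. - (\<Sum>c\<in>Basis. ((\<Sum>b\<in>Basis. (inv (L x) v \<bullet> b) *\<^sub>R ?L' x b h) \<bullet> c) *\<^sub>R inv (L x) c)"
  show ?case
  proof (rule Ck_on_SucI[OF S, of _ ?D])
    fix x assume x: "x \<in> S"
    have "linear (inv (L x))"
      using lin bij x by (meson bij_is_inj bij_is_surj inj_linear_imp_inv_linear)
    then have "?D x = (\<lambda>h. - inv (L x) (\<Sum>b\<in>Basis. (inv (L x) v \<bullet> b) *\<^sub>R ?L' x b h))"
      by (intro ext) (simp only: linear_euclidean_expand[of "inv (L x)", symmetric])
    then show "((\<lambda>x. inv (L x) v) has_derivative ?D x) (at x)"
      using inv_linear_family_has_derivative[OF S lin bij L(1) x] by simp
  next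
    fix h
    have "Ck_on k S (\<lambda>x. inv (L x) w)" for w
      by (rule Suc.IH) (rule Ck_on_Suc_imp[OF Suc.prems])
    then show "Ck_on k S (\<lambda>x. ?D x h)"
      by (intro Ck_on_bounded_linear[OF bounded_linear_minus[OF bounded_linear_ident] S]
          Ck_on_sum[OF S] Ck_on_bounded_bilinear[OF bounded_bilinear_scaleR S] Ck_on_inner[OF S] L(2))
  qed
qed

lemma smooth_on_inv_linear_family:
  fixes L :: "'a::euclidean_space \<Rightarrow> 'b::euclidean_space \<Rightarrow> 'b"
  assumes "open S" "\<And>x. x \<in> S \<Longrightarrow> linear (L x)" "\<And>x. x \<in> S \<Longrightarrow> bij (L x)"
    and "\<And>v. smooth_on S (\<lambda>x. L x v)" "smooth_on S f"
  shows "smooth_on S (\<lambda>x. inv (L x) (f x))"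
proof (rule smooth_on_cong[OF assms(1)])
  show "smooth_on S (\<lambda>x. \<Sum>b\<in>Basis. (f x \<bullet> b) *\<^sub>R inv (L x) b)"
    using assms Ck_on_inv_linear_family[OF assms(1-3)]
    by (intro smooth_on_sum smooth_on_scaleR smooth_on_inner) (auto simp: smooth_on_def)
  fix x assume x: "x \<in> S"
  then have "linear (inv (L x))"
    using assms(2,3) by (meson bij_is_inj bij_is_surj inj_linear_imp_inv_linear)
  then show "(\<Sum>b\<in>Basis. (f x \<bullet> b) *\<^sub>R inv (L x) b) = inv (L x) (f x)"
    by (rule linear_euclidean_expand[symmetric])
qed

text \<open>Bootstrapping: the inverse function theorem provides a differentiable inverse with
  \<open>h' y = inv (D (h y))\<close>. If \<open>h\<close> is of class C^k, so is the right-hand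
  side, hence \<open>h\<close> is of class C^(k+1).\<close>

theorem smooth_inverse_function:
  fixes f :: "'a::euclidean_space \<Rightarrow> 'a"
  assumes S: "open S" "x0 \<in> S" and f: "smooth_on S f" and inj: "inj (frechet_derivative f (at x0))"
  obtains U V h where "open U" "x0 \<in> U" "U \<subseteq> S" "open V" "homeomorphism U V f h" "smooth_on V h"
proof -
  let ?D = "\<lambda>x. frechet_derivative f (at x)"
  define D where "D = (\<lambda>x. Blinfun (?D x))"
  have df: "(f has_derivative ?D x) (at x)" if "x \<in> S" for x
    using smooth_on_SucD(1)[OF f S(1) that] .
  have D: "blinfun_apply (D x) = ?D x" if "x \<in> S" for x
    unfolding D_def using has_derivative_bounded_linear[OF df[OF that]]
    by (rule bounded_linear_Blinfun_apply)
  have cD: "continuous_on S D"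
  proof (rule continuous_on_blinfun_componentwise)
    fix b :: 'a
    show "continuous_on S (\<lambda>x. blinfun_apply (D x) b)"
      using smooth_on_continuous_on[OF smooth_on_SucD(2)[OF f S(1), of b]]
      by (rule continuous_on_eq) (simp add: D)
  qed
  obtain i where i: "linear i" "i \<circ> ?D x0 = id"
    using linear_injective_left_inverse[OF has_derivative_linear[OF df[OF S(2)]] inj] by blast
  have "Blinfun i o\<^sub>L D x0 = id_blinfun"
    using i D[OF S(2)]
    by (intro blinfun_eqI)
      (simp add: bounded_linear_Blinfun_apply linear_conv_bounded_linear pointfree_idE)
  then obtain U V h h' where *: "open U" "U \<subseteq> S" "x0 \<in> U" "open V" "homeomorphism U V f h"
    "\<And>y. y \<in> V \<Longrightarrow> (h has_derivative (h' y)) (at y)"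
    "\<And>y. y \<in> V \<Longrightarrow> h' y = inv (blinfun_apply (D (h y)))"
    "\<And>y. y \<in> V \<Longrightarrow> bij (blinfun_apply (D (h y)))"
    using inverse_function_theorem[OF S(1) _ cD S(2)] df D by (metis (no_types, lifting))
  have hV: "h y \<in> U" if "y \<in> V" for y using *(5) that unfolding homeomorphism_def by blast
  have "Ck_on k V h" for k
  proof (induction k)
    case 0
    then show ?case using *(5) by (simp add: homeomorphism_cont2)
  next
    case (Suc k)
    show ?case
    proof (rule Ck_on_SucI[OF *(4,6)])
      fix v
      show "Ck_on k V (\<lambda>y. h' y v)"
      proof (rule Ck_on_cong[OF *(4)])
        have "Ck_on k V (\<lambda>y. ?D (h y) w)" for w
          by (rule Ck_on_compose[OF *(4) S(1) Suc])
            (use smooth_on_SucD(2)[OF f S(1)] hV *(2) in \<open>auto simp: smooth_on_def\<close>)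
        then show "Ck_on k V (\<lambda>y. inv (?D (h y)) v)"
          using hV *(2,8) D by (intro Ck_on_inv_linear_family[OF *(4)])
            (auto intro!: has_derivative_linear[OF df], metis subset_iff)
        show "inv (?D (h y)) v = h' y v" if "y \<in> V" for y
          using *(7)[OF that] D hV[OF that] *(2) by auto
      qed
    qed
  qed
  then have "smooth_on V h" by (simp add: smooth_on_def)
  then show ?thesis using that * by blast
qed

section \<open>Smooth dependence of solutions of differential equations on parameters\<close>

text \<open>The derivative as an element of a normed space of operators, so that its uniform
  continuity and boundedness on compact sets make sense.\<close>

definition fderiv :: "('a::real_normed_vector \<Rightarrow> 'b::real_normed_vector) \<Rightarrow> 'a \<Rightarrow> 'a \<Rightarrow>\<^sub>L 'b" where
  "fderiv f x = Blinfun (frechet_derivative f (at x))"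

lemma has_derivative_fderiv:
  assumes "Ck_on (Suc k) S f" "open S" "x \<in> S"
  shows "(f has_derivative fderiv f x) (at x)" "blinfun_apply (fderiv f x) = frechet_derivative f (at x)"
proof -
  have *: "(f has_derivative frechet_derivative f (at x)) (at x)" using Ck_on_SucD(1)[OF assms] .
  show **: "blinfun_apply (fderiv f x) = frechet_derivative f (at x)"
    unfolding fderiv_def by (rule bounded_linear_Blinfun_apply[OF has_derivative_bounded_linear[OF *]])
  show "(f has_derivative fderiv f x) (at x)" using * ** by simp
qed

lemma fderiv_eqI: "(f has_derivative D) (at x) \<Longrightarrow> blinfun_apply (fderiv f x) = D"
  unfolding fderiv_def using frechet_derivative_at[of f D x]
  by (simp add: bounded_linear_Blinfun_apply has_derivative_bounded_linear)

lemma Ck_on_fderiv: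
  assumes "Ck_on (Suc k) S f" "open S"
  shows "Ck_on k S (\<lambda>x. fderiv f x v)"
  by (rule Ck_on_cong[OF assms(2) Ck_on_SucD(2)[OF assms, of v]])
    (simp add: has_derivative_fderiv(2)[OF assms])

lemma continuous_on_fderiv:
  fixes f :: "'a::euclidean_space \<Rightarrow> 'b::real_normed_vector"
  assumes "Ck_on (Suc k) S f" "open S"
  shows "continuous_on S (fderiv f)"
proof (rule continuous_on_blinfun_componentwise)
  have "Ck_on (Suc 0) S f" using assms(1)
  proof (induction k)
    case (Suc k)
    then show ?case using Ck_on_Suc_imp by blast
  qed
  from Ck_on_fderiv[OF this assms(2)]
  show "continuous_on S (\<lambda>x. fderiv f x b)" for b by simp
qed

text \<open>The derivative is uniformly continuous on a compact neighbourhood of \<open>C\<close>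
  inside \<open>S\<close>. It therefore varies by less than \<eta> on every short segment, and the
  mean value inequality applies with one \<open>d\<close> for all \<open>p\<close>.\<close>

lemma uniform_linearization:
  fixes f :: "'a::euclidean_space \<Rightarrow> 'b::real_normed_vector"
  assumes f: "Ck_on (Suc 0) S f" and S: "open S" and C: "compact C" "C \<subseteq> S" and \<eta>: "\<eta> > 0"
  shows "\<exists>d>0. \<forall>p\<in>C. \<forall>q. norm (q - p) < d \<longrightarrow>
    q \<in> S \<and> norm (f q - f p - fderiv f p (q - p)) \<le> \<eta> * norm (q - p)"
proof (cases "C = {}")
  case True
  then show ?thesis by (intro exI[of _ 1]) auto
next
  case False
  then obtain r where r: "r > 0" "{x. infdist x C \<le> r} \<subseteq> S"
    using compact_in_open_separated C S by metis
  let ?N = "{x. infdist x C \<le> r}"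
  have "compact ?N" by (rule compact_infdist_le[OF False C(1) r(1)])
  then have "uniformly_continuous_on ?N (fderiv f)"
    using continuous_on_subset[OF continuous_on_fderiv[OF f S] r(2)]
    by (rule compact_uniformly_continuous[rotated])
  then obtain d where d: "d > 0"
    "\<And>x y. x \<in> ?N \<Longrightarrow> y \<in> ?N \<Longrightarrow> dist y x < d \<Longrightarrow> dist (fderiv f y) (fderiv f x) < \<eta>"
    unfolding uniformly_continuous_on_def using \<eta> by meson
  have N: "y \<in> ?N" if "p \<in> C" "dist y p \<le> r" for y p using infdist_le2[OF that] by simp
  show ?thesis
  proof (intro exI[of _ "min d r"] conjI ballI allI impI)
    show "min d r > 0" using d r by simp
    fix p q assume pq: "p \<in> C" "norm (q - p) < min d r"
    show "q \<in> S" using N[OF pq(1), of q] pq(2) r(2) by (auto simp: dist_norm)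
    have seg: "dist (p + t *\<^sub>R (q - p)) p < min d r" if "t \<in> {0..1}" for t
    proof -
      have "\<bar>t\<bar> * norm (q - p) \<le> 1 * norm (q - p)" using that by (intro mult_right_mono) auto
      then show ?thesis using pq(2) by (simp add: dist_norm)
    qed
    have "norm (f q - f p - blinfun_apply (fderiv f p) (q - p)) \<le> norm (q - p) * \<eta>"
    proof (rule differentiable_bound_linearization[where S = "ball p (min d r)"
          and f' = "\<lambda>x. blinfun_apply (fderiv f x)"])
      show "p + t *\<^sub>R (q - p) \<in> ball p (min d r)" if "t \<in> {0..1}" for t
        using seg[OF that] by (simp add: dist_commute)
      show "p \<in> ball p (min d r)" using d r by simp
      fix x assume x: "x \<in> ball p (min d r)"
      then have xN: "x \<in> ?N" using N[OF pq(1), of x] by (simp add: dist_commute)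
      show "(f has_derivative blinfun_apply (fderiv f x)) (at x within ball p (min d r))"
        using has_derivative_fderiv(1)[OF f S] xN r(2) by (blast intro: has_derivative_at_withinI)
      have "norm (fderiv f x - fderiv f p) < \<eta>"
        using d(2)[of p x] N[OF pq(1), of p] xN x r(1) by (simp add: dist_norm norm_minus_commute)
      then show "onorm (blinfun_apply (fderiv f x) - blinfun_apply (fderiv f p)) \<le> \<eta>"
        by (simp add: norm_blinfun.rep_eq fun_diff_def minus_blinfun.rep_eq)
    qed
    then show "norm (f q - f p - fderiv f p (q - p)) \<le> \<eta> * norm (q - p)"
      by (simp add: mult.commute)
  qed
qed

text \<open>Where \<open>norm (\<phi> t)\<close> is maximal, the mean value inequality bounds the
  maximum by \<open>norm (\<phi> 0) + e * a\<close> plus half of itself, because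
  \<open>K * e\<close> is at most 1/2. With \<open>a = 0\<close> and \<open>\<phi> 0 = 0\<close>
  this is a uniqueness principle for linear equations.\<close>

lemma short_gronwall:
  fixes \<phi> :: "real \<Rightarrow> 'b::real_normed_vector"
  assumes e: "0 \<le> e" "K * e \<le> 1/2" "0 \<le> K" "0 \<le> a"
    and d: "\<And>t. t \<in> {-e..e} \<Longrightarrow> (\<phi> has_vector_derivative \<phi>' t) (at t within {-e..e})"
    and b: "\<And>t. t \<in> {-e..e} \<Longrightarrow> norm (\<phi>' t) \<le> K * norm (\<phi> t) + a"
    and t: "t \<in> {-e..e}"
  shows "norm (\<phi> t) \<le> 2 * (norm (\<phi> 0) + e * a)"
proof -
  have "continuous_on {-e..e} (\<lambda>t. norm (\<phi> t))"
    by (intro continuous_on_norm continuous_on_vector_derivative[OF d])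
  then obtain t0 where t0: "t0 \<in> {-e..e}" "\<And>t. t \<in> {-e..e} \<Longrightarrow> norm (\<phi> t) \<le> norm (\<phi> t0)"
    using continuous_attains_sup[of "{-e..e}" "\<lambda>t. norm (\<phi> t)"] t by (metis compact_Icc empty_iff)
  have "norm (\<phi> t0 - \<phi> 0) \<le> (K * norm (\<phi> t0) + a) * norm (t0 - 0)"
  proof (rule differentiable_bound[of "{-e..e}" \<phi> "\<lambda>t h. h *\<^sub>R \<phi>' t"])
    fix s assume s: "s \<in> {-e..e}"
    show "(\<phi> has_derivative (\<lambda>h. h *\<^sub>R \<phi>' s)) (at s within {-e..e})"
      using d[OF s] by (simp add: has_vector_derivative_def)
    have "norm (\<phi>' s) \<le> K * norm (\<phi> t0) + a"
      using b[OF s] mult_left_mono[OF t0(2)[OF s] e(3)] by linarith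
    then show "onorm (\<lambda>h. h *\<^sub>R \<phi>' s) \<le> K * norm (\<phi> t0) + a"
      by (intro onorm_le) (simp add: mult.commute[of "\<bar>_\<bar>"] mult_right_mono)
  qed (use e t0 in auto)
  also have "\<dots> \<le> (K * norm (\<phi> t0) + a) * e"
    using t0(1) e by (intro mult_left_mono) auto
  also have "\<dots> = (K * e) * norm (\<phi> t0) + e * a" by (simp add: algebra_simps)
  also have "\<dots> \<le> 1/2 * norm (\<phi> t0) + e * a" using e by (intro add_right_mono mult_right_mono) auto
  finally have "norm (\<phi> t0) - norm (\<phi> 0) \<le> 1/2 * norm (\<phi> t0) + e * a"
    using norm_triangle_ineq2 order_trans by blast
  then show ?thesis using t0(2)[OF t] by simp
qed

subsection \<open>Existence\<close>

text \<open>The scaled integral is the integral of \<phi> from 0 to t for either sign of t. The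
  domain of integration does not depend on t, which makes continuity in t and in further parameters
  immediate.\<close>

lemma signed_integral_has_vector_derivative:
  fixes \<phi> :: "real \<Rightarrow> 'b::banach"
  assumes "0 \<le> e" "continuous_on {-e..e} \<phi>" "t \<in> {-e..e}"
  shows "((\<lambda>t. t *\<^sub>R integral {0..1} (\<lambda>s. \<phi> (s * t))) has_vector_derivative \<phi> t) (at t within {-e..e})"
proof -
  define \<Psi> where "\<Psi> = (\<lambda>t. integral {-e..t} \<phi>)"
  have d: "(\<Psi> has_vector_derivative \<phi> t) (at t within {-e..e})" if "t \<in> {-e..e}" for t
    unfolding \<Psi>_def by (rule integral_has_vector_derivative[OF assms(2) that])
  have sub: "(\<lambda>s. s * t) ` {0..1} \<subseteq> {-e..e}" if "t \<in> {-e..e}" for t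
  proof safe
    fix s :: real assume "s \<in> {0..1}"
    then have "\<bar>s * t\<bar> \<le> 1 * \<bar>t\<bar>" by (subst abs_mult) (intro mult_right_mono, auto)
    then show "s * t \<in> {-e..e}" using that by auto
  qed
  have eq: "t *\<^sub>R integral {0..1} (\<lambda>s. \<phi> (s * t)) = \<Psi> t - \<Psi> 0" if t: "t \<in> {-e..e}" for t
  proof -
    have "((\<lambda>s. t *\<^sub>R \<phi> (s * t)) has_integral (\<Psi> (1 * t) - \<Psi> (0 * t))) {0..1}"
    proof (rule fundamental_theorem_of_calculus)
      fix s :: real assume s: "s \<in> {0..1}"
      have "((\<lambda>s. s * t) has_vector_derivative t) (at s within {0..1})"
        by (auto intro!: derivative_eq_intros simp: has_real_derivative_iff_has_vector_derivative[symmetric])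
      moreover have "(\<Psi> has_vector_derivative \<phi> (s * t)) (at (s * t) within (\<lambda>s. s * t) ` {0..1})"
        using has_vector_derivative_within_subset[OF d sub[OF t]] sub[OF t] s by blast
      ultimately show "((\<lambda>s. \<Psi> (s * t)) has_vector_derivative t *\<^sub>R \<phi> (s * t)) (at s within {0..1})"
        using vector_diff_chain_within[of "\<lambda>s. s * t" t s "{0..1}" \<Psi> "\<phi> (s * t)"]
        by (simp add: comp_def)
    qed simp
    from integral_unique[OF this] show ?thesis by simp
  qed
  show ?thesis
    by (rule has_vector_derivative_transform[OF assms(3) eq])
      (auto intro!: derivative_eq_intros d[OF assms(3)])
qed

text \<open>Picard iteration for all parameters at once: the unknown is a function of time and
  parameter, so the fixed point is jointly continuous. The integral operator contracts by
  \<open>K * e\<close>. Compactness of \<open>C\<close> bounds the iterates, and convexity provides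
  the closest-point projection.\<close>

lemma ode_existence:
  fixes F :: "real \<times> 'p::euclidean_space \<times> 'e::euclidean_space \<Rightarrow> 'e"
  assumes e: "0 < e" "0 \<le> K" "K * e \<le> 1/2"
    and C: "compact C" "convex C" "C \<noteq> {}"
    and F: "continuous_on ({-e..e} \<times> C \<times> UNIV) F"
    and lip: "\<And>t x w w'. t \<in> {-e..e} \<Longrightarrow> x \<in> C \<Longrightarrow> norm (F (t, x, w) - F (t, x, w')) \<le> K * norm (w - w')"
    and u0: "continuous_on C u0"
  shows "\<exists>u. continuous_on ({-e..e} \<times> C) u \<and> (\<forall>x\<in>C. u (0, x) = u0 x \<and>
    (\<forall>t\<in>{-e..e}. ((\<lambda>t. u (t, x)) has_vector_derivative F (t, x, u (t, x))) (at t within {-e..e})))"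
proof -
  let ?D = "{-e..e} \<times> C"
  have D: "compact ?D" "convex ?D" "?D \<noteq> {}" "closed ?D"
    using C e by (auto intro: compact_Times convex_Times compact_imp_closed)
  \<comment> \<open>The complete space of bounded continuous functions consists of functions on the
    whole type. Composition with the retraction \<open>r\<close> produces such functions without
    changing their values on the domain.\<close>
  define r where "r = closest_point ?D"
  have r: "continuous_on UNIV r" "\<And>z. r z \<in> ?D" "\<And>z. z \<in> ?D \<Longrightarrow> r z = z"
    unfolding r_def using D
    by (auto intro!: continuous_on_closest_point closest_point_in_set closest_point_self)
  define G where "G = (\<lambda>v (t, x). u0 x + t *\<^sub>R integral {0..1} (\<lambda>s. F (s * t, x, v (s * t, x))))"
  have scale: "s * t \<in> {-e..e}" if "t \<in> {-e..e}" "s \<in> {0..1}" for s t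
  proof -
    have "\<bar>s * t\<bar> \<le> 1 * \<bar>t\<bar>" using that by (subst abs_mult) (intro mult_right_mono, auto)
    then show ?thesis using that by auto
  qed
  have cont_in: "continuous_on (?D \<times> {0..1}) (\<lambda>(z, s). F (s * fst z, snd z, v (s * fst z, snd z)))"
    if "continuous_on ?D v" for v
    unfolding case_prod_unfold
    by (intro continuous_on_compose2[OF F] continuous_on_compose2[OF that] continuous_intros)
      (use scale in auto)
  have contG: "continuous_on ?D (G v)" if "continuous_on ?D v" for v
  proof -
    have "continuous_on ?D (\<lambda>z. integral (cbox 0 1) (\<lambda>s. F (s * fst z, snd z, v (s * fst z, snd z))))"
      using cont_in[OF that] by (intro integral_continuous_on_param) simp
    then have "continuous_on ?D (\<lambda>z. u0 (snd z) +
        fst z *\<^sub>R integral {0..1} (\<lambda>s. F (s * fst z, snd z, v (s * fst z, snd z))))"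
      by (intro continuous_intros continuous_on_compose2[OF u0]) auto
    then show ?thesis by (simp add: G_def case_prod_unfold)
  qed
  define T where "T = (\<lambda>v. Bcontfun (G (apply_bcontfun v) \<circ> r))"
  have T: "apply_bcontfun (T v) = G (apply_bcontfun v) \<circ> r" for v
  proof -
    have "continuous_on UNIV (G (apply_bcontfun v) \<circ> r)"
      using continuous_on_compose[OF r(1) continuous_on_subset[OF contG]] r(2)
      by (metis continuous_on_apply_bcontfun image_subsetI)
    moreover have "bounded (G (apply_bcontfun v) ` ?D)"
      by (intro compact_imp_bounded compact_continuous_image contG D) simp
    then have "bounded (range (G (apply_bcontfun v) \<circ> r))"
      by (rule bounded_subset) (use r(2) in auto)
    ultimately show ?thesis unfolding T_def by (intro Bcontfun_inverse) (simp add: bcontfun_def)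
  qed
  have "dist (T v) (T v') \<le> 1/2 * dist v v'" for v v'
  proof (rule dist_bound)
    fix z
    obtain t x where tx: "r z = (t, x)" "t \<in> {-e..e}" "x \<in> C"
      using r(2)[of z] by (metis mem_Sigma_iff prod.collapse)
    let ?f = "\<lambda>v s. F (s * t, x, apply_bcontfun v (s * t, x))"
    have c: "continuous_on {0..1} (?f v)" for v
    proof -
      have "continuous_on {0..1} ((\<lambda>(z, s). F (s * fst z, snd z, apply_bcontfun v (s * fst z, snd z)))
          \<circ> (\<lambda>s. ((t, x), s)))"
        by (intro continuous_on_compose continuous_on_subset[OF cont_in] continuous_intros)
          (use tx in auto)
      then show ?thesis by (simp add: comp_def)
    qed
    have "norm (integral {0..1} (\<lambda>s. ?f v s - ?f v' s)) \<le> K * dist v v' * (1 - 0)"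
    proof (rule integral_bound)
      show "continuous_on {0..1} (\<lambda>s. ?f v s - ?f v' s)" by (intro continuous_intros c)
      fix s :: real assume "s \<in> {0..1}"
      then have "norm (?f v s - ?f v' s) \<le>
          K * norm (apply_bcontfun v (s * t, x) - apply_bcontfun v' (s * t, x))"
        by (intro lip scale tx)
      also have "\<dots> \<le> K * dist v v'"
        using dist_bounded[of v "(s * t, x)" v'] e(2) by (intro mult_left_mono) (simp_all add: dist_norm)
      finally show "norm (?f v s - ?f v' s) \<le> K * dist v v'" .
    qed simp
    then have "norm (integral {0..1} (?f v) - integral {0..1} (?f v')) \<le> K * dist v v'"
      by (simp add: integral_diff integrable_continuous_real c)
    then have "\<bar>t\<bar> * norm (integral {0..1} (?f v) - integral {0..1} (?f v')) \<le> e * (K * dist v v')"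
      using tx(2) e by (intro mult_mono) auto
    moreover have "e * (K * dist v v') \<le> 1/2 * dist v v'"
      using mult_right_mono[OF e(3), of "dist v v'"] by (simp add: mult_ac)
    ultimately show "dist (apply_bcontfun (T v) z) (apply_bcontfun (T v') z) \<le> 1/2 * dist v v'"
      by (simp add: T G_def tx dist_norm flip: scaleR_diff_right)
  qed
  then obtain v where v: "T v = v" using banach_fix_type[of "1/2" T] by auto
  define u where "u = apply_bcontfun v"
  have u: "u z = G u z" if "z \<in> ?D" for z
    using T[of v] v r(3)[OF that] unfolding u_def by (metis comp_apply)
  have cu: "continuous_on ?D u" unfolding u_def by simp
  have "u (0, x) = u0 x" if "x \<in> C" for x using u[of "(0, x)"] that e by (simp add: G_def)
  moreover have "((\<lambda>t. u (t, x)) has_vector_derivative F (t, x, u (t, x))) (at t within {-e..e})"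
    if x: "x \<in> C" and t: "t \<in> {-e..e}" for x t
  proof (rule has_vector_derivative_transform[OF t])
    show "u (s, x) = u0 x + s *\<^sub>R integral {0..1} (\<lambda>r. F (r * s, x, u (r * s, x)))"
      if "s \<in> {-e..e}" for s using u[of "(s, x)"] that x by (simp add: G_def)
    have "continuous_on {-e..e} (\<lambda>s. F (s, x, u (s, x)))"
      by (intro continuous_on_compose2[OF F] continuous_on_compose2[OF cu] continuous_intros)
        (use x in auto)
    then show "((\<lambda>s. u0 x + s *\<^sub>R integral {0..1} (\<lambda>r. F (r * s, x, u (r * s, x))))
        has_vector_derivative F (t, x, u (t, x))) (at t within {-e..e})"
      using has_vector_derivative_add[OF has_vector_derivative_const
          signed_integral_has_vector_derivative[OF less_imp_le[OF e(1)] _ t], of _ "u0 x"] by simp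
  qed
  ultimately show ?thesis using cu by blast
qed

subsection \<open>Dependence on parameters\<close>

lemma bounded_linear_solution_bound:
  fixes w :: "'p::real_normed_vector \<Rightarrow> 'e::real_normed_vector"
  assumes "\<And>a b. w (a + b) = w a + w b" "\<And>c a. w (c *\<^sub>R a) = c *\<^sub>R w a" "\<And>a. norm (w a) \<le> C * norm a"
  shows "bounded_linear w"
  using assms by (intro bounded_linear_intro[of w C]) (auto simp: mult.commute)

text \<open>The derivative of \<open>F\<close> in the state direction is bounded along the solution
  only. The product \<open>K * e\<close> is at most half of what \<open>short_gronwall\<close>
  allows, because linearising \<open>F\<close> along the solution adds an error \<eta> to
  \<open>K\<close>.\<close>

locale param_ode =
  fixes e K :: real and W :: "'p::euclidean_space set"
    and Q :: "(real \<times> 'p \<times> 'e::euclidean_space) set"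
    and F :: "real \<times> 'p \<times> 'e \<Rightarrow> 'e" and u0 :: "'p \<Rightarrow> 'e" and u :: "real \<times> 'p \<Rightarrow> 'e"
  assumes e: "0 < e" "0 \<le> K" "K * e \<le> 1/4"
    and open_sets: "open W" "open Q"
    and F: "Ck_on (Suc 0) Q F" and u0: "Ck_on (Suc 0) W u0"
    and cont: "continuous_on ({-e..e} \<times> W) u"
    and inQ: "\<And>t x. t \<in> {-e..e} \<Longrightarrow> x \<in> W \<Longrightarrow> (t, x, u (t, x)) \<in> Q"
    and ode: "\<And>t x. t \<in> {-e..e} \<Longrightarrow> x \<in> W \<Longrightarrow>
      ((\<lambda>t. u (t, x)) has_vector_derivative F (t, x, u (t, x))) (at t within {-e..e})"
    and init: "\<And>x. x \<in> W \<Longrightarrow> u (0, x) = u0 x"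
    and bound: "\<And>t x v. t \<in> {-e..e} \<Longrightarrow> x \<in> W \<Longrightarrow>
      norm (fderiv F (t, x, u (t, x)) (0, 0, v)) \<le> K * norm v"
begin

abbreviation F' :: "real \<Rightarrow> 'p \<Rightarrow> real \<times> 'p \<times> 'e \<Rightarrow> 'e" where
  "F' t x \<equiv> blinfun_apply (fderiv F (t, x, u (t, x)))"

lemma F'_add: "F' t x (0, h, w) = F' t x (0, h, 0) + F' t x (0, 0, w)"
  using blinfun.add_right[of "fderiv F (t, x, u (t, x))" "(0, h, 0)" "(0, 0, w)"] by simp

lemma continuous_on_F':
  assumes "I \<subseteq> {-e..e}" "W' \<subseteq> W"
  shows "continuous_on (I \<times> W') (\<lambda>z. fderiv F (fst z, snd z, u z))"
  by (intro continuous_on_compose2[OF continuous_on_fderiv[OF F open_sets(2)]]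
      continuous_on_Pair continuous_on_fst continuous_on_snd continuous_on_id
      continuous_on_subset[OF cont]) (use assms inQ in \<open>auto simp: subset_iff\<close>)

text \<open>The difference between the increment of \<open>u\<close> and the solution \<open>w\<close> of the variational
  equation solves the same linear equation up to an error \<open>o(h)\<close>.\<close>

lemma variational_derivative:
  assumes x0: "x0 \<in> W" and t: "t \<in> {-e..e}"
    and w0: "\<And>h. w h 0 = fderiv u0 x0 h"
    and w: "\<And>h t. t \<in> {-e..e} \<Longrightarrow>
      (w h has_vector_derivative F' t x0 (0, h, w h t)) (at t within {-e..e})"
  shows "((\<lambda>x. u (t, x)) has_derivative (\<lambda>h. w h t)) (at x0)"
proof -
  have K2: "K * e \<le> 1/2" using e(3) by simp
  have e0: "0 \<le> e" using e(1) by simp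
  \<comment> \<open>A homogeneous solution starting at zero vanishes. This yields linearity in
    \<open>h\<close>, since \<open>w\<close> is given only as one solution for each
    \<open>h\<close>.\<close>
  have unique: "\<phi> t = 0" if "\<phi> 0 = 0" "t \<in> {-e..e}"
    and "\<And>t. t \<in> {-e..e} \<Longrightarrow> (\<phi> has_vector_derivative F' t x0 (0, 0, \<phi> t)) (at t within {-e..e})"
    for \<phi> t
  proof -
    have "norm (\<phi> t) \<le> 2 * (norm (\<phi> 0) + e * 0)"
      by (rule short_gronwall[OF e0 K2 e(2) order_refl that(3) _ that(2)])
        (use bound[OF _ x0] in simp_all)
    then show ?thesis using that(1) by simp
  qed
  have add: "w (a + b) t = w a t + w b t" if "t \<in> {-e..e}" for a b t
  proof -
    have "w (a + b) t - (w a t + w b t) = 0"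
    proof (rule unique[OF _ that])
      show "w (a + b) 0 - (w a 0 + w b 0) = 0" by (simp add: w0 blinfun.add_right)
      fix t assume t: "t \<in> {-e..e}"
      have eq: "F' t x0 (0, a + b, w (a + b) t) - (F' t x0 (0, a, w a t) + F' t x0 (0, b, w b t)) =
          F' t x0 (0, 0, w (a + b) t - (w a t + w b t))"
        by (simp flip: blinfun.add_right blinfun.diff_right)
      show "((\<lambda>t. w (a + b) t - (w a t + w b t)) has_vector_derivative
          F' t x0 (0, 0, w (a + b) t - (w a t + w b t))) (at t within {-e..e})"
        unfolding eq[symmetric]
        by (intro has_vector_derivative_diff has_vector_derivative_add w t)
    qed
    then show ?thesis by simp
  qed
  have scale: "w (c *\<^sub>R a) t = c *\<^sub>R w a t" if "t \<in> {-e..e}" for a c t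
  proof -
    have "w (c *\<^sub>R a) t - c *\<^sub>R w a t = 0"
    proof (rule unique[OF _ that])
      show "w (c *\<^sub>R a) 0 - c *\<^sub>R w a 0 = 0" by (simp add: w0 blinfun.scaleR_right)
      fix t assume t: "t \<in> {-e..e}"
      have eq: "F' t x0 (0, c *\<^sub>R a, w (c *\<^sub>R a) t) - c *\<^sub>R F' t x0 (0, a, w a t) =
          F' t x0 (0, 0, w (c *\<^sub>R a) t - c *\<^sub>R w a t)"
        by (simp flip: blinfun.scaleR_right blinfun.diff_right)
      have "((\<lambda>t. c *\<^sub>R w a t) has_vector_derivative c *\<^sub>R F' t x0 (0, a, w a t))
          (at t within {-e..e})"
        using has_vector_derivative_scaleR[OF DERIV_const w[OF t]] by simp
      then show "((\<lambda>t. w (c *\<^sub>R a) t - c *\<^sub>R w a t) has_vector_derivative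
          F' t x0 (0, 0, w (c *\<^sub>R a) t - c *\<^sub>R w a t)) (at t within {-e..e})"
        unfolding eq[symmetric] by (intro has_vector_derivative_diff w t)
    qed
    then show ?thesis by simp
  qed
  define curve where "curve = (\<lambda>t. (t, x0, u (t, x0))) ` {-e..e}"
  have cu: "continuous_on {-e..e} (\<lambda>t. u (t, x0))"
    using x0 by (intro continuous_on_compose2[OF cont] continuous_intros) auto
  have curve: "compact curve" "curve \<subseteq> Q" unfolding curve_def
    using inQ[OF _ x0] cu by (auto intro!: compact_continuous_image continuous_on_Pair
        continuous_on_id continuous_on_const)
  have "bounded (fderiv F ` curve)"
    by (intro compact_imp_bounded compact_continuous_image
        continuous_on_subset[OF continuous_on_fderiv[OF F open_sets(2)]] curve)
  then obtain M where M: "M > 0" "\<And>t. t \<in> {-e..e} \<Longrightarrow> norm (fderiv F (t, x0, u (t, x0))) \<le> M"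
    unfolding bounded_pos curve_def by auto
  have Mh: "norm (F' t x0 (0, h, 0)) \<le> M * norm h" if "t \<in> {-e..e}" for t h
    using order_trans[OF norm_blinfun mult_right_mono[OF M(2)[OF that] norm_ge_zero], of "(0, h, 0)"]
    by (simp add: norm_Pair)
  \<comment> \<open>Gronwall's bound for \<open>w h\<close>, whose equation has the inhomogeneous
    term \<open>F' t x0 (0, h, 0)\<close> of size at most \<open>M * norm h\<close>.\<close>
  define C where "C = 2 * (norm (fderiv u0 x0) + e * M)"
  have C0: "C \<ge> 0" unfolding C_def using M e by simp
  have C: "norm (w h t) \<le> C * norm h" if "t \<in> {-e..e}" for t h
  proof -
    have "norm (w h t) \<le> 2 * (norm (w h 0) + e * (M * norm h))"
    proof (rule short_gronwall[OF e0 K2 e(2) _ w _ that])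
      show "0 \<le> M * norm h" using M by simp
      fix t assume t: "t \<in> {-e..e}"
      show "norm (F' t x0 (0, h, w h t)) \<le> K * norm (w h t) + M * norm h"
        using norm_triangle_ineq[of "F' t x0 (0, h, 0)" "F' t x0 (0, 0, w h t)"] Mh[OF t, of h]
          bound[OF t x0, of "w h t"] F'_add[of t x0 h "w h t"] by simp
    qed
    also have "\<dots> \<le> 2 * (norm (fderiv u0 x0) * norm h + e * (M * norm h))"
      by (simp add: w0 norm_blinfun)
    finally show ?thesis by (simp add: C_def algebra_simps)
  qed
  have "bounded_linear (\<lambda>h. w h t)"
    by (rule bounded_linear_solution_bound[OF add[OF t] scale[OF t] C[OF t]])
  moreover have "\<exists>\<delta>>0. \<forall>x. norm (x - x0) < \<delta> \<longrightarrow>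
      norm (u (t, x) - u (t, x0) - w (x - x0) t) \<le> \<epsilon> * norm (x - x0)" if \<epsilon>: "\<epsilon> > 0" for \<epsilon>
  proof -
    \<comment> \<open>The first bound keeps \<open>(K + \<eta>) * e\<close> at most 1/2; the second
      makes the constant of the final Gronwall estimate at most \<epsilon>.\<close>
    define \<eta> where "\<eta> = min (1 / (4 * e)) (\<epsilon> / (2 * (1 + e * (1 + C))))"
    have pos: "1 + e * (1 + C) > 0" using e C0 by (simp add: add_pos_nonneg)
    have \<eta>: "\<eta> > 0" "\<eta> * e \<le> 1/4" "2 * (\<eta> * (1 + e * (1 + C))) \<le> \<epsilon>"
    proof -
      show "\<eta> > 0" unfolding \<eta>_def using e \<epsilon> pos by simp
      have "\<eta> * e \<le> 1 / (4 * e) * e" unfolding \<eta>_def using e by (intro mult_right_mono) auto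
      then show "\<eta> * e \<le> 1/4" using e by simp
      have "\<eta> * (1 + e * (1 + C)) \<le> \<epsilon> / (2 * (1 + e * (1 + C))) * (1 + e * (1 + C))"
        unfolding \<eta>_def using pos by (intro mult_right_mono) auto
      also have "\<dots> = \<epsilon> / 2" using pos by (simp add: field_simps)
      finally show "2 * (\<eta> * (1 + e * (1 + C))) \<le> \<epsilon>" by simp
    qed
    obtain d where d: "d > 0" "\<And>p q. p \<in> curve \<Longrightarrow> norm (q - p) < d \<Longrightarrow>
        norm (F q - F p - fderiv F p (q - p)) \<le> \<eta> * norm (q - p)"
      using uniform_linearization[OF F open_sets(2) curve \<eta>(1)] by blast
    have sw: "continuous_on (W \<times> {-e..e}) (\<lambda>(x, t). u (t, x))"
      unfolding case_prod_unfold by (intro continuous_on_compose2[OF cont] continuous_intros) auto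
    \<comment> \<open>Compactness of the time interval makes \<open>u (t, x)\<close> close to
      \<open>u (t, x0)\<close> uniformly in t, so the linearisation of \<open>F\<close> is usable
      along the whole curve.\<close>
    obtain X where X: "x0 \<in> X" "open X"
      "\<And>x t. x \<in> X \<inter> W \<Longrightarrow> t \<in> {-e..e} \<Longrightarrow> dist (u (t, x)) (u (t, x0)) \<le> d / 2"
      by (rule continuous_on_prod_compactE[OF sw compact_Icc x0, of "d / 2"]) (use d in auto)
    have "open (X \<inter> W)" "x0 \<in> X \<inter> W" using X x0 open_sets by auto
    then obtain \<delta>1 where \<delta>1: "\<delta>1 > 0" "ball x0 \<delta>1 \<subseteq> X \<inter> W" by (meson open_contains_ball)
    obtain \<delta>2 where \<delta>2: "\<delta>2 > 0" "\<And>x. norm (x - x0) < \<delta>2 \<Longrightarrow>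
        norm (u0 x - u0 x0 - fderiv u0 x0 (x - x0)) \<le> \<eta> * norm (x - x0)"
      using has_derivative_fderiv(1)[OF u0 open_sets(1) x0] \<eta>(1) unfolding has_derivative_at_alt
      by blast
    show ?thesis
    proof (intro exI[of _ "min (min \<delta>1 \<delta>2) (d / 2)"] conjI allI impI)
      show "min (min \<delta>1 \<delta>2) (d / 2) > 0" using \<delta>1 \<delta>2 d by simp
      fix x assume x: "norm (x - x0) < min (min \<delta>1 \<delta>2) (d / 2)"
      then have xX: "x \<in> X \<inter> W" using \<delta>1(2) by (auto simp: dist_norm norm_minus_commute)
      let ?h = "x - x0"
      define R where "R = (\<lambda>t. u (t, x) - u (t, x0) - w ?h t)"
      have Ke: "(K + \<eta>) * e \<le> 1/2" "0 \<le> K + \<eta>" using e \<eta> by (simp_all add: algebra_simps)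
      have "norm (R t) \<le> 2 * (norm (R 0) + e * (\<eta> * ((1 + C) * norm ?h)))"
      proof (rule short_gronwall[OF e0 Ke _ _ _ t])
        show "0 \<le> \<eta> * ((1 + C) * norm ?h)" using \<eta> C0 by simp
        fix t assume t: "t \<in> {-e..e}"
        let ?p = "(t, x0, u (t, x0))" and ?q = "(t, x, u (t, x))"
        show "(R has_vector_derivative F ?q - F ?p - F' t x0 (0, ?h, w ?h t)) (at t within {-e..e})"
          unfolding R_def using xX
          by (intro has_vector_derivative_diff ode w t x0) auto
        let ?\<Delta> = "u (t, x) - u (t, x0)"
        have \<Delta>: "norm ?\<Delta> \<le> norm (R t) + C * norm ?h"
          using C[OF t, of ?h] norm_triangle_ineq[of "R t" "w ?h t"] by (simp add: R_def)
        have qp: "?q - ?p = (0, ?h, ?\<Delta>)" by simp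
        have nqp: "norm (?q - ?p) \<le> norm ?h + norm ?\<Delta>"
          unfolding qp using norm_Pair_le[of ?h ?\<Delta>] by (simp add: norm_Pair)
        have "norm (?q - ?p) < d" using nqp x X(3)[OF xX t] by (simp add: dist_norm)
        then have "norm (F ?q - F ?p - fderiv F ?p (?q - ?p)) \<le> \<eta> * norm (?q - ?p)"
          using t by (intro d(2)) (simp_all add: curve_def)
        also have "\<dots> \<le> \<eta> * (norm ?h + norm ?\<Delta>)" using nqp \<eta> by (intro mult_left_mono) auto
        also have "\<dots> \<le> \<eta> * (norm ?h + (norm (R t) + C * norm ?h))"
          using \<Delta> \<eta> by (intro mult_left_mono add_left_mono) auto
        finally have 1: "norm (F ?q - F ?p - F' t x0 (0, ?h, ?\<Delta>)) \<le>
            \<eta> * norm (R t) + \<eta> * ((1 + C) * norm ?h)"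
          unfolding qp by (simp add: algebra_simps)
        have 2: "F' t x0 (0, ?h, ?\<Delta>) - F' t x0 (0, ?h, w ?h t) = F' t x0 (0, 0, R t)"
          by (simp add: R_def flip: blinfun.diff_right)
        have "F ?q - F ?p - F' t x0 (0, ?h, w ?h t) =
            (F ?q - F ?p - F' t x0 (0, ?h, ?\<Delta>)) + F' t x0 (0, 0, R t)"
          unfolding 2[symmetric] by simp
        then have "norm (F ?q - F ?p - F' t x0 (0, ?h, w ?h t)) \<le>
            norm (F ?q - F ?p - F' t x0 (0, ?h, ?\<Delta>)) + norm (F' t x0 (0, 0, R t))"
          by (metis norm_triangle_ineq)
        then show "norm (F ?q - F ?p - F' t x0 (0, ?h, w ?h t)) \<le>
            (K + \<eta>) * norm (R t) + \<eta> * ((1 + C) * norm ?h)"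
          using 1 bound[OF t x0, of "R t"] by (simp add: algebra_simps)
      qed
      also have "norm (R 0) \<le> \<eta> * norm ?h"
        using \<delta>2(2)[of x] x xX x0 by (simp add: R_def init w0)
      finally have "norm (R t) \<le> 2 * (\<eta> * (1 + e * (1 + C))) * norm ?h"
        by (simp add: algebra_simps)
      also have "\<dots> \<le> \<epsilon> * norm ?h" using \<eta>(3) by (intro mult_right_mono) auto
      finally show "norm (u (t, x) - u (t, x0) - w (x - x0) t) \<le> \<epsilon> * norm (x - x0)"
        by (simp add: R_def)
    qed
  qed
  ultimately show ?thesis unfolding has_derivative_at_alt by blast
qed

text \<open>Defined as a derivative, hence on all of \<open>W\<close>, and afterwards identified
  with the solutions of the variational equation that are constructed near each parameter. No
  patching of local solutions is then required.\<close>

definition w :: "'p \<Rightarrow> real \<times> 'p \<Rightarrow> 'e" where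
  "w h z = frechet_derivative (\<lambda>x. u (fst z, x)) (at (snd z)) h"

text \<open>A closed ball, because \<open>ode_existence\<close> wants a compact convex parameter
  set. The variational equation is affine in the state with Lipschitz constant \<open>K\<close>. At
  each x of the ball its solution is the derivative of \<open>u\<close> by
  \<open>variational_derivative\<close>, hence equals \<open>w\<close>.\<close>

lemma local_variational_solution:
  assumes x0: "x0 \<in> W"
  obtains r where "r > 0" "cball x0 r \<subseteq> W"
    "\<And>t x. t \<in> {-e..e} \<Longrightarrow> x \<in> cball x0 r \<Longrightarrow> ((\<lambda>x. u (t, x)) has_derivative (\<lambda>h. w h (t, x))) (at x)"
    "\<And>h. continuous_on ({-e..e} \<times> cball x0 r) (w h)"
    "\<And>h t x. t \<in> {-e..e} \<Longrightarrow> x \<in> cball x0 r \<Longrightarrow>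
      ((\<lambda>t. w h (t, x)) has_vector_derivative F' t x (0, h, w h (t, x))) (at t within {-e..e})"
    "\<And>h x. x \<in> cball x0 r \<Longrightarrow> w h (0, x) = fderiv u0 x h"
proof -
  obtain r where r: "r > 0" "cball x0 r \<subseteq> W" using open_sets(1) x0 by (meson open_contains_cball)
  have "\<exists>v. continuous_on ({-e..e} \<times> cball x0 r) v \<and> (\<forall>x\<in>cball x0 r. v (0, x) = fderiv u0 x h \<and>
      (\<forall>t\<in>{-e..e}. ((\<lambda>t. v (t, x)) has_vector_derivative
        (\<lambda>(t, x, y). F' t x (0, h, y)) (t, x, v (t, x))) (at t within {-e..e})))" for h
  proof (rule ode_existence[where K = K])
    show "K * e \<le> 1/2" using e by simp
    have "continuous_on ({-e..e} \<times> cball x0 r \<times> (UNIV :: 'e set))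
        (\<lambda>z. (\<lambda>z. fderiv F (fst z, snd z, u z)) (fst z, fst (snd z)) (0, h, snd (snd z)))"
      by (intro blinfun.continuous_on continuous_on_compose2[OF continuous_on_F'[OF order_refl r(2)]]
          continuous_intros) auto
    then show "continuous_on ({-e..e} \<times> cball x0 r \<times> (UNIV :: 'e set)) (\<lambda>(t, x, y). F' t x (0, h, y))"
      by (simp add: case_prod_unfold)
    fix t x y y' assume tx: "t \<in> {-e..e}" "x \<in> cball x0 r"
    have "F' t x (0, h, y) - F' t x (0, h, y') = F' t x (0, 0, y - y')"
      by (simp flip: blinfun.diff_right)
    then show "norm ((\<lambda>(t, x, y). F' t x (0, h, y)) (t, x, y) - (\<lambda>(t, x, y). F' t x (0, h, y)) (t, x, y'))
        \<le> K * norm (y - y')"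
      using bound[of t x "y - y'"] tx r(2) by auto
  next
    show "continuous_on (cball x0 r) (\<lambda>x. fderiv u0 x h)"
      using continuous_on_subset[OF continuous_on_fderiv[OF u0 open_sets(1)] r(2)]
      by (intro continuous_intros)
  qed (use e r in auto)
  then obtain v where v: "\<And>h. continuous_on ({-e..e} \<times> cball x0 r) (v h)"
    "\<And>h x. x \<in> cball x0 r \<Longrightarrow> v h (0, x) = fderiv u0 x h"
    "\<And>h x t. x \<in> cball x0 r \<Longrightarrow> t \<in> {-e..e} \<Longrightarrow>
      ((\<lambda>t. v h (t, x)) has_vector_derivative F' t x (0, h, v h (t, x))) (at t within {-e..e})"
    by (simp only: prod.case) metis
  have der: "((\<lambda>x. u (t, x)) has_derivative (\<lambda>h. v h (t, x))) (at x)"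
    if "t \<in> {-e..e}" "x \<in> cball x0 r" for t x
    using variational_derivative[of x t "\<lambda>h t. v h (t, x)"] v(2,3) that r(2) by blast
  have vw: "w h (t, x) = v h (t, x)" if "t \<in> {-e..e}" "x \<in> cball x0 r" for h t x
    by (simp add: w_def flip: frechet_derivative_at[OF der[OF that]])
  show ?thesis
  proof (rule that[OF r])
    fix h
    show "continuous_on ({-e..e} \<times> cball x0 r) (w h)"
      using v(1)[of h] by (rule continuous_on_eq) (use vw in auto)
    fix x assume x: "x \<in> cball x0 r"
    show "w h (0, x) = fderiv u0 x h" using vw[of 0 x] v(2)[OF x] x e by simp
    fix t assume t: "t \<in> {-e..e}"
    show "((\<lambda>x. u (t, x)) has_derivative (\<lambda>h. w h (t, x))) (at x)" using der[OF t x] vw[OF t x] by simp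
    show "((\<lambda>t. w h (t, x)) has_vector_derivative F' t x (0, h, w h (t, x))) (at t within {-e..e})"
      by (rule has_vector_derivative_transform[OF t])
        (use vw x t v(3)[OF x t] in auto)
  qed
qed

lemma partial_derivative:
  "t \<in> {-e..e} \<Longrightarrow> x \<in> W \<Longrightarrow> ((\<lambda>x. u (t, x)) has_derivative (\<lambda>h. w h (t, x))) (at x)"
  by (rule local_variational_solution[of x]) (auto dest: less_imp_le)

lemma variational_equation:
  "t \<in> {-e..e} \<Longrightarrow> x \<in> W \<Longrightarrow>
    ((\<lambda>t. w h (t, x)) has_vector_derivative F' t x (0, h, w h (t, x))) (at t within {-e..e})"
  by (rule local_variational_solution[of x]) (auto dest: less_imp_le)

lemma variational_init: "x \<in> W \<Longrightarrow> w h (0, x) = fderiv u0 x h"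
  by (rule local_variational_solution[of x]) (auto dest: less_imp_le)

lemma continuous_on_w: "continuous_on ({-e..e} \<times> W) (w h)"
  unfolding continuous_on_def
proof
  fix z assume z: "z \<in> {-e..e} \<times> W"
  obtain r where r: "r > 0" "cball (snd z) r \<subseteq> W" "continuous_on ({-e..e} \<times> cball (snd z) r) (w h)"
    using local_variational_solution[of "snd z"] z by (metis mem_Times_iff)
  have "(w h \<longlongrightarrow> w h z) (at z within {-e..e} \<times> cball (snd z) r)"
    using r z unfolding continuous_on_def by (cases z) auto
  moreover have "at z within {-e..e} \<times> W = at z within {-e..e} \<times> cball (snd z) r"
  proof (rule at_within_nhd)
    show "z \<in> UNIV \<times> ball (snd z) r" using r by (simp add: mem_Times_iff)
    show "open (UNIV \<times> ball (snd z) r)" by (simp add: open_Times)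
    have "ball (snd z) r \<subseteq> W" "ball (snd z) r \<subseteq> cball (snd z) r" using r by auto
    then show "{-e..e} \<times> W \<inter> UNIV \<times> ball (snd z) r - {z} =
        {-e..e} \<times> cball (snd z) r \<inter> UNIV \<times> ball (snd z) r - {z}" by blast
  qed
  ultimately show "(w h \<longlongrightarrow> w h z) (at z within {-e..e} \<times> W)" by simp
qed

text \<open>A partial derivative in time at the point, together with parameter derivatives that are
  continuous in both variables, gives a total derivative. The open time interval makes it
  two-sided.\<close>

lemma joint_derivative:
  assumes t: "t \<in> {-e<..<e}" and x: "x \<in> W"
  shows "(u has_derivative (\<lambda>(\<tau>, h). \<tau> *\<^sub>R F (t, x, u (t, x)) + w h (t, x))) (at (t, x))"
proof -
  obtain r where r: "r > 0" "ball x r \<subseteq> W" using open_sets(1) x by (meson open_contains_ball)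
  let ?I = "{-e<..<e}" and ?B = "ball x r"
  have bl: "blinfun_apply (Blinfun (\<lambda>h. w h (s, y))) = (\<lambda>h. w h (s, y))" if "s \<in> ?I" "y \<in> ?B" for s y
    using that r(2)
    by (intro bounded_linear_Blinfun_apply has_derivative_bounded_linear[OF partial_derivative]) auto
  have "((\<lambda>(s, y). u (s, y)) has_derivative
      (\<lambda>(\<tau>, h). \<tau> *\<^sub>R F (t, x, u (t, x)) + blinfun_apply (Blinfun (\<lambda>h. w h (t, x))) h)) (at (t, x) within ?I \<times> ?B)"
  proof (rule has_derivative_partialsI[where fy = "\<lambda>s y. Blinfun (\<lambda>h. w h (s, y))"])
    show "((\<lambda>s. u (s, x)) has_derivative (\<lambda>\<tau>. \<tau> *\<^sub>R F (t, x, u (t, x)))) (at t within ?I)"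
      using has_vector_derivative_within_subset[OF ode[OF _ x]] t
      by (simp add: has_vector_derivative_def subset_iff)
    show "((\<lambda>y. u (s, y)) has_derivative blinfun_apply (Blinfun (\<lambda>h. w h (s, y)))) (at y within ?B)"
      if "s \<in> ?I" "y \<in> ?B" for s y
      by (subst bl[OF that], rule has_derivative_at_withinI, rule partial_derivative)
        (use that r(2) in auto)
    have "continuous_on (?I \<times> ?B) (\<lambda>z. Blinfun (\<lambda>h. w h (fst z, snd z)))"
    proof (rule continuous_on_blinfun_componentwise)
      fix b :: 'p
      have "continuous_on (?I \<times> ?B) (w b)"
        by (rule continuous_on_subset[OF continuous_on_w]) (use r(2) in auto)
      then show "continuous_on (?I \<times> ?B) (\<lambda>z. blinfun_apply (Blinfun (\<lambda>h. w h (fst z, snd z))) b)"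
        by (rule continuous_on_eq) (auto simp: bl)
    qed
    then show "continuous (at (t, x) within ?I \<times> ?B) (\<lambda>(s, y). Blinfun (\<lambda>h. w h (s, y)))"
      unfolding continuous_on_eq_continuous_within case_prod_unfold
      by (rule bspec) (use t r(1) in simp)
  qed (use r in auto)
  moreover have "at (t, x) within ?I \<times> ?B = at (t, x)"
    using t r(1) by (intro at_within_open) (auto intro: open_Times)
  ultimately show ?thesis using bl[of t x] t r(1) by simp
qed

lemma Ck_on_derivative_along_solution:
  assumes "Ck_on (Suc k) Q F" "Ck_on k ({-e<..<e} \<times> W) u"
  shows "Ck_on k ({-e<..<e} \<times> W) (\<lambda>z. fderiv F (fst z, snd z, u z) v)"
proof -
  have op: "open ({-e<..<e} \<times> W)" using open_sets by (simp add: open_Times)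
  have "Ck_on k ({-e<..<e} \<times> W) (\<lambda>z. (fst z, snd z, u z))"
    by (intro Ck_on_Pair[OF op] assms(2) Ck_on_linear[OF _ op] bounded_linear.linear
        bounded_linear_fst bounded_linear_snd)
  then show ?thesis
    by (rule Ck_on_compose[OF op open_sets(2) _ Ck_on_fderiv[OF assms(1) open_sets(2)]])
      (use inQ in auto)
qed

end

text \<open>For a map that is affine along one line. The right-hand side of the variational equation
  is affine in the state, so its state derivative is found without differentiating in time and
  parameter.\<close>

lemma fderiv_directional:
  assumes "(f has_derivative D) (at z)" "\<And>s::real. f (z + s *\<^sub>R v) = f z + s *\<^sub>R c"
  shows "D v = c"
proof -
  have "((\<lambda>s. z + s *\<^sub>R v) has_vector_derivative v) (at 0)"
    by (auto intro!: derivative_eq_intros)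
  then have "((\<lambda>s. f (z + s *\<^sub>R v)) has_vector_derivative D v) (at 0)"
    using vector_derivative_diff_chain_within[of "\<lambda>s. z + s *\<^sub>R v" v 0 UNIV f D] assms(1)
    by (simp add: comp_def has_derivative_at_withinI)
  moreover have "((\<lambda>s. f (z + s *\<^sub>R v)) has_vector_derivative c) (at 0)"
    unfolding assms(2) by (auto intro!: derivative_eq_intros)
  ultimately show ?thesis by (rule vector_derivative_unique_at)
qed

text \<open>If \<open>u\<close> is of class C^(k+1), so is the right-hand side of the variational
  equation, and its state derivative is again that of \<open>F\<close> along \<open>u\<close>. So
  \<open>w h\<close> satisfies \<open>param_ode\<close> with the same \<open>K\<close>, has class
  C^(k+1) by the induction hypothesis, and both partial derivatives of \<open>u\<close> have this
  class.\<close>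

theorem param_ode_Ck:
  fixes W :: "'p::euclidean_space set" and u0 :: "'p \<Rightarrow> 'e::euclidean_space"
  assumes "param_ode e K W Q F u0 u" "Ck_on (Suc k) Q F" "Ck_on (Suc k) W u0"
  shows "Ck_on (Suc k) ({-e<..<e} \<times> W) u"
  using assms
proof (induction k arbitrary: e Q F u0 u)
  case (0 e Q F u0 u)
  interpret param_ode e K W Q F u0 u by (rule 0(1))
  have op: "open ({-e<..<e} \<times> W)" using open_sets by (simp add: open_Times)
  show ?case
  proof (rule Ck_on_SucI[OF op])
    show "(u has_derivative (\<lambda>(\<tau>, h). \<tau> *\<^sub>R F (fst z, snd z, u z) + w h z)) (at z)"
      if "z \<in> {-e<..<e} \<times> W" for z using joint_derivative[of "fst z" "snd z"] that by auto
    fix v :: "real \<times> 'p"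
    have "continuous_on ({-e<..<e} \<times> W) (\<lambda>z. F (fst z, snd z, u z))"
    proof (rule continuous_on_compose2[of Q F])
      show "continuous_on Q F" using F by (simp add: differentiable_imp_continuous_on)
      show "continuous_on ({-e<..<e} \<times> W) (\<lambda>z. (fst z, snd z, u z))"
        by (intro continuous_on_Pair continuous_on_fst continuous_on_snd continuous_on_id
            continuous_on_subset[OF cont]) auto
    qed (use inQ in auto)
    moreover have "continuous_on ({-e<..<e} \<times> W) (w (snd v))"
      by (rule continuous_on_subset[OF continuous_on_w]) auto
    ultimately show "Ck_on 0 ({-e<..<e} \<times> W)
        (\<lambda>z. case v of (\<tau>, h) \<Rightarrow> \<tau> *\<^sub>R F (fst z, snd z, u z) + w h z)"
      unfolding case_prod_unfold Ck_on.simps by (intro continuous_on_add continuous_on_scaleR continuous_on_const)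
  qed
next
  case (Suc k e Q F u0 u)
  interpret param_ode e K W Q F u0 u by (rule Suc.prems(1))
  have op: "open ({-e<..<e} \<times> W)" using open_sets by (simp add: open_Times)
  have u: "Ck_on (Suc k) ({-e<..<e} \<times> W) u"
    by (rule Suc.IH[OF Suc.prems(1) Ck_on_Suc_imp[OF Suc.prems(2)] Ck_on_Suc_imp[OF Suc.prems(3)]])
  have fz: "Ck_on (Suc k) ({-e<..<e} \<times> W) (\<lambda>z. F (fst z, snd z, u z))"
  proof (rule Ck_on_compose[OF op open_sets(2) _ Ck_on_Suc_imp[OF Suc.prems(2)]])
    show "Ck_on (Suc k) ({-e<..<e} \<times> W) (\<lambda>z. (fst z, snd z, u z))"
      by (intro Ck_on_Pair[OF op] u Ck_on_linear[OF _ op] bounded_linear.linear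
          bounded_linear_fst bounded_linear_snd)
  qed (use inQ in auto)
  note F'k = Ck_on_derivative_along_solution[OF Suc.prems(2) u]
  have wh: "Ck_on (Suc k) ({-e<..<e} \<times> W) (w h)" for h
  proof (rule Ck_on_local[OF op])
    fix z assume z: "z \<in> {-e<..<e} \<times> W"
    \<comment> \<open>Halfway between the absolute time of \<open>z\<close> and \<open>e\<close>:
      regularity of \<open>u\<close> is known on the open time interval, while
      \<open>param_ode\<close> uses a closed one.\<close>
    define a where "a = (\<bar>fst z\<bar> + e) / 2"
    have a: "0 < a" "a < e" "\<bar>fst z\<bar> < a" using z e by (auto simp: a_def)
    have ae: "t \<in> {-e<..<e}" "t \<in> {-e..e}" if "t \<in> {-a..a}" for t using that a by auto
    let ?Q = "{-e<..<e} \<times> W \<times> (UNIV :: 'e set)"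
    let ?F = "\<lambda>z. fderiv F (fst z, fst (snd z), u (fst z, fst (snd z))) (0, h, snd (snd z))"
    have oQ: "open ?Q" using open_sets by (simp add: open_Times)
    have proj: "Ck_on (Suc k) ?Q (\<lambda>z. (fst z, fst (snd z)))"
      using bounded_linear_compose[OF bounded_linear_fst bounded_linear_snd]
      by (intro Ck_on_Pair[OF oQ] Ck_on_linear[OF _ oQ] bounded_linear.linear bounded_linear_fst)
    have F'c: "Ck_on (Suc k) ?Q
        (\<lambda>z. fderiv F (fst z, fst (snd z), u (fst z, fst (snd z))) v)" for v
    proof -
      have "(\<lambda>z. (fst z, fst (snd z))) ` ?Q \<subseteq> {-e<..<e} \<times> W" by auto
      from Ck_on_compose[OF oQ op proj F'k[of v] this] show ?thesis by (simp only: fst_conv snd_conv)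
    qed
    have "Ck_on (Suc k) ?Q (\<lambda>z. fderiv F (fst z, fst (snd z), u (fst z, fst (snd z))) (0, h, 0) +
        (\<Sum>b\<in>Basis. (snd (snd z) \<bullet> b) *\<^sub>R
          fderiv F (fst z, fst (snd z), u (fst z, fst (snd z))) (0, 0, b)))"
      using bounded_linear_compose[OF bounded_linear_snd bounded_linear_snd]
      by (intro Ck_on_add[OF oQ] Ck_on_sum[OF oQ] Ck_on_inner[OF oQ] F'c
          Ck_on_bounded_bilinear[OF bounded_bilinear_scaleR oQ] Ck_on_linear[OF _ oQ]
          bounded_linear.linear)
    moreover have "fderiv F (fst z, fst (snd z), u (fst z, fst (snd z))) (0, h, 0) +
        (\<Sum>b\<in>Basis. (snd (snd z) \<bullet> b) *\<^sub>R
          fderiv F (fst z, fst (snd z), u (fst z, fst (snd z))) (0, 0, b)) = ?F z" for z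
    proof -
      have "linear (\<lambda>y. F' (fst z) (fst (snd z)) (0, 0, y))"
        by (intro linearI) (simp_all flip: blinfun.add_right blinfun.scaleR_right)
      from linear_euclidean_expand[OF this, of "snd (snd z)"]
      show ?thesis using F'_add[of "fst z" "fst (snd z)" h "snd (snd z)"] by simp
    qed
    ultimately have Fh: "Ck_on (Suc k) ?Q ?F" by simp
    have Fh1: "Ck_on (Suc 0) ?Q ?F" using Fh
    proof (induction k)
      case (Suc k)
      then show ?case using Ck_on_Suc_imp by blast
    qed
    have u0h: "Ck_on (Suc k) W (\<lambda>x. fderiv u0 x h)"
      by (rule Ck_on_fderiv[OF Suc.prems(3) open_sets(1)])
    have u0h1: "Ck_on (Suc 0) W (\<lambda>x. fderiv u0 x h)" using u0h
    proof (induction k)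
      case (Suc k)
      then show ?case using Ck_on_Suc_imp by blast
    qed
    have "param_ode a K W ?Q ?F (\<lambda>x. fderiv u0 x h) (w h)"
    proof
      show "K * a \<le> 1/4" using e a by (meson mult_left_mono less_imp_le order_trans)
      show "continuous_on ({-a..a} \<times> W) (w h)"
        by (rule continuous_on_subset[OF continuous_on_w]) (use ae in auto)
      fix t x assume t: "t \<in> {-a..a}" and x: "x \<in> W"
      then show "(t, x, w h (t, x)) \<in> ?Q" using ae by auto
      show "((\<lambda>t. w h (t, x)) has_vector_derivative ?F (t, x, w h (t, x))) (at t within {-a..a})"
        using has_vector_derivative_within_subset[OF variational_equation[OF ae(2)[OF t] x]] ae
        by (simp add: subset_iff)
      fix v
      have "fderiv ?F (t, x, w h (t, x)) (0, 0, v) = F' t x (0, 0, v)"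
      proof (rule fderiv_directional[OF has_derivative_fderiv(1)[OF Fh1 oQ]])
        show "(t, x, w h (t, x)) \<in> ?Q" using t x ae by auto
        show "?F ((t, x, w h (t, x)) + s *\<^sub>R (0, 0, v)) = ?F (t, x, w h (t, x)) + s *\<^sub>R F' t x (0, 0, v)"
          for s by (simp flip: blinfun.add_right blinfun.scaleR_right)
      qed
      then show "norm (fderiv ?F (t, x, w h (t, x)) (0, 0, v)) \<le> K * norm v"
        using bound[OF ae(2)[OF t] x] by simp
    next
      show "w h (0, x) = fderiv u0 x h" if "x \<in> W" for x using variational_init[OF that] .
    qed (use e a oQ open_sets Fh1 u0h1 in auto)
    from Suc.IH[OF this Fh u0h] have "Ck_on (Suc k) ({-a<..<a} \<times> W) (w h)" .
    moreover have "open ({-a<..<a} \<times> W)" "z \<in> {-a<..<a} \<times> W"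
      using open_sets z a by (auto simp: open_Times)
    ultimately show "\<exists>T. open T \<and> z \<in> T \<and> Ck_on (Suc k) T (w h)" by blast
  qed
  show ?case
  proof (rule Ck_on_SucI[OF op])
    show "(u has_derivative (\<lambda>(\<tau>, h). \<tau> *\<^sub>R F (fst z, snd z, u z) + w h z)) (at z)"
      if "z \<in> {-e<..<e} \<times> W" for z using joint_derivative[of "fst z" "snd z"] that by auto
    fix v :: "real \<times> 'p"
    have "Ck_on (Suc k) ({-e<..<e} \<times> W) (\<lambda>z. fst v *\<^sub>R F (fst z, snd z, u z) + w (snd v) z)"
      by (intro Ck_on_add[OF op] wh Ck_on_bounded_linear[OF bounded_linear_scaleR_right op] fz)
    then show "Ck_on (Suc k) ({-e<..<e} \<times> W)
        (\<lambda>z. case v of (\<tau>, h) \<Rightarrow> \<tau> *\<^sub>R F (fst z, snd z, u z) + w h z)"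
      by (simp add: case_prod_unfold)
  qed
qed

text \<open>Since \<open>F\<close> vanishes at the parameter \<open>p0\<close>, solutions for parameters near \<open>p0\<close> are so slow that
  they stay near \<open>x0\<close> for the whole time interval.\<close>

lemma param_flow_exists:
  fixes F :: "'p::euclidean_space \<times> 'e::euclidean_space \<Rightarrow> 'e"
  assumes Q: "open Q" "(p0, u0 p0) \<in> Q" and F: "smooth_on Q F" and F0: "\<And>v. (p0, v) \<in> Q \<Longrightarrow> F (p0, v) = 0"
    and W0: "open W0" "p0 \<in> W0" and u0: "smooth_on W0 u0"
  obtains W u where "open W" "p0 \<in> W" "W \<subseteq> W0"
    "param_ode 2 (1/8) W (UNIV \<times> Q) (\<lambda>z. F (snd z)) u0 u" "smooth_on ({-2<..<2} \<times> W) u"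
proof -
  define x0 where "x0 = u0 p0"
  have F1: "Ck_on (Suc 0) Q F" using F unfolding smooth_on_def by blast
  \<comment> \<open>At the parameter \<open>p0\<close> the map \<open>F\<close> is zero for all
    states, so its state derivative vanishes there and is small nearby.\<close>
  have F0': "fderiv F (p0, x0) (0, v) = 0" for v
  proof -
    obtain d where d: "d > 0" "ball (p0, x0) d \<subseteq> Q" using Q by (metis open_contains_ball x0_def)
    have "((\<lambda>s. x0 + s *\<^sub>R v) has_vector_derivative v) (at 0)"
      by (auto intro!: derivative_eq_intros)
    then have "((\<lambda>s. (p0, x0 + s *\<^sub>R v)) has_vector_derivative (0, v)) (at 0)"
      by (intro has_vector_derivative_Pair) auto
    then have 1: "((\<lambda>s. F (p0, x0 + s *\<^sub>R v)) has_vector_derivative fderiv F (p0, x0) (0, v)) (at 0)"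
      using vector_derivative_diff_chain_within[of "\<lambda>s. (p0, x0 + s *\<^sub>R v)" "(0, v)" 0 UNIV F]
        has_derivative_fderiv(1)[OF F1 Q(1), of "(p0, x0)"] Q(2)
      by (simp add: comp_def has_derivative_at_withinI x0_def)
    have "((\<lambda>s. 0) has_vector_derivative fderiv F (p0, x0) (0, v)) (at 0)"
    proof (rule has_vector_derivative_transform_within_open[OF 1])
      show "open ((\<lambda>s. (p0, x0 + s *\<^sub>R v)) -` ball (p0, x0) d)"
        by (intro open_vimage continuous_intros) auto
      show "0 \<in> (\<lambda>s. (p0, x0 + s *\<^sub>R v)) -` ball (p0, x0) d" using d by simp
    qed (use F0 d(2) in auto)
    then show ?thesis by (rule vector_derivative_unique_at[OF _ has_vector_derivative_const])
  qed
  have "continuous_on Q (\<lambda>z. \<Sum>b\<in>Basis. norm (fderiv F z (0, b)))"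
    by (intro continuous_intros continuous_on_fderiv[OF F1 Q(1)])
  then have "isCont (\<lambda>z. \<Sum>b\<in>Basis. norm (fderiv F z (0, b))) (p0, x0)"
    using Q by (simp add: continuous_on_eq_continuous_at x0_def)
  \<comment> \<open>1/8 times the half-length 2 of the time interval is the 1/4 demanded by
    \<open>param_ode\<close>.\<close>
  then obtain d where d: "d > 0" "\<And>z. dist z (p0, x0) < d \<Longrightarrow>
      dist (\<Sum>b\<in>Basis. norm (fderiv F z (0, b))) (\<Sum>b\<in>Basis. norm (fderiv F (p0, x0) (0, b))) < 1/8"
    unfolding continuous_at_eps_delta by (metis zero_less_divide_1_iff zero_less_numeral)
  then have d8: "(\<Sum>b\<in>Basis. norm (fderiv F z (0, b))) < 1/8" if "dist z (p0, x0) < d" for z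
    using that by (fastforce simp: F0' dist_real_def)
  obtain d' where d': "d' > 0" "ball (p0, x0) d' \<subseteq> Q" using Q by (metis open_contains_ball x0_def)
  \<comment> \<open>A third, so that a parameter and a state that are each within \<open>r\<close>
    of their centres form a pair within \<open>min d d'\<close>.\<close>
  define r where "r = min d d' / 3"
  have r: "r > 0" using d d' by (simp add: r_def)
  have near: "dist (p, x) (p0, x0) < d" "(p, x) \<in> Q" if "p \<in> cball p0 r" "x \<in> cball x0 r" for p x
  proof -
    have "dist (p, x) (p0, x0) \<le> dist p p0 + dist x x0"
      unfolding dist_Pair_Pair by (rule sqrt_sum_squares_le_sum) auto
    also have "\<dots> \<le> 2 * r" using that by (simp add: dist_commute)
    also have "\<dots> < min d d'" using r unfolding r_def by linarith
    finally show "dist (p, x) (p0, x0) < d" "(p, x) \<in> Q" using d'(2) by (auto simp: dist_commute)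
  qed
  have bound: "norm (fderiv F (p, x) (0, v)) \<le> 1/8 * norm v" if "p \<in> cball p0 r" "x \<in> cball x0 r" for p x v
  proof -
    have "linear (\<lambda>v. fderiv F (p, x) (0, v))"
      by (intro linearI) (simp_all flip: blinfun.add_right blinfun.scaleR_right)
    from linear_euclidean_expand[OF this, of v]
    have "norm (fderiv F (p, x) (0, v)) \<le> (\<Sum>b\<in>Basis. norm v * norm (fderiv F (p, x) (0, b)))"
      by (simp only:) (intro sum_norm_le, simp add: Basis_le_norm mult_right_mono)
    also have "\<dots> = norm v * (\<Sum>b\<in>Basis. norm (fderiv F (p, x) (0, b)))" by (simp add: sum_distrib_left)
    also have "\<dots> \<le> norm v * (1/8)" using d8[OF near(1)[OF that]] by (intro mult_left_mono) auto
    finally show ?thesis by simp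
  qed
  have lip: "norm (F (p, x) - F (p, x')) \<le> 1/8 * norm (x - x')"
    if "p \<in> cball p0 r" "x \<in> cball x0 r" "x' \<in> cball x0 r" for p x x'
  proof (rule differentiable_bound[OF convex_cball _ _ that(2,3)])
    fix z assume z: "z \<in> cball x0 r"
    have "((\<lambda>z. (p, z)) has_derivative (\<lambda>v. (0, v))) (at z within cball x0 r)"
      by (auto intro!: derivative_eq_intros)
    from has_derivative_compose[OF this has_derivative_fderiv(1)[OF F1 Q(1) near(2)[OF that(1) z]]]
    show "((\<lambda>z. F (p, z)) has_derivative (\<lambda>v. fderiv F (p, z) (0, v))) (at z within cball x0 r)" .
    show "onorm (\<lambda>v. fderiv F (p, z) (0, v)) \<le> 1/8" by (rule onorm_le) (rule bound[OF that(1) z])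
  qed
  have cF: "continuous_on (cball p0 r \<times> cball x0 r) (\<lambda>(p, x). F (p, x))"
    using near(2) by (auto intro!: continuous_on_subset[OF smooth_on_continuous_on[OF F]])
  obtain X where X: "p0 \<in> X" "open X" "\<And>p x. p \<in> X \<inter> cball p0 r \<Longrightarrow> x \<in> cball x0 r \<Longrightarrow>
      dist (F (p, x)) (F (p0, x)) \<le> r / 8"
    by (rule continuous_on_prod_compactE[OF cF compact_cball, of p0 "r / 8"]) (use r in auto)
  have slow: "norm (F (p, x)) \<le> r / 8" if "p \<in> X \<inter> cball p0 r" "x \<in> cball x0 r" for p x
    using X(3)[OF that] F0 near(2)[of p0 x] that(2) r by simp
  have "isCont u0 p0"
    using W0 smooth_on_continuous_on[OF u0] by (simp add: continuous_on_eq_continuous_at)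
  then obtain d'' where d'': "d'' > 0" "\<And>p. dist p p0 < d'' \<Longrightarrow> dist (u0 p) x0 < r / 2"
    unfolding continuous_at_eps_delta x0_def using r half_gt_zero by blast
  have "open (X \<inter> ball p0 r \<inter> ball p0 d'' \<inter> W0)" "p0 \<in> X \<inter> ball p0 r \<inter> ball p0 d'' \<inter> W0"
    using X W0 r d'' by auto
  then obtain s where s: "s > 0" "cball p0 s \<subseteq> X \<inter> ball p0 r \<inter> ball p0 d'' \<inter> W0"
    by (meson open_contains_cball)
  define C where "C = cball p0 s"
  have C: "p \<in> X \<inter> cball p0 r" "dist (u0 p) x0 < r / 2" "p \<in> W0" if "p \<in> C" for p
    using that s(2) d''(2)[of p] unfolding C_def by (auto simp: dist_commute)
  \<comment> \<open>Projecting the state onto the ball makes the right-hand side Lipschitz for all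
    states. The modification is not felt: the speed is at most r/8, so within time 2 a solution
    moves by at most r/4 from a start within r/2 of \<open>x0\<close>.\<close>
  define c where "c = closest_point (cball x0 r)"
  have c: "c x \<in> cball x0 r" "dist (c x) (c x') \<le> dist x x'" "continuous_on UNIV c"
    "x \<in> cball x0 r \<Longrightarrow> c x = x" for x x'
    unfolding c_def using r
    by (auto intro!: closest_point_in_set closest_point_lipschitz continuous_on_closest_point
        closest_point_self simp del: mem_cball)
  have "\<exists>u. continuous_on ({-2..2} \<times> C) u \<and> (\<forall>x\<in>C. u (0, x) = u0 x \<and>
      (\<forall>t\<in>{-2..2}. ((\<lambda>t. u (t, x)) has_vector_derivative
        (\<lambda>(t, p, x). F (p, c x)) (t, x, u (t, x))) (at t within {-2..2})))"
  proof (rule ode_existence[where K = "1/8"])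
    show "continuous_on ({-2..2} \<times> C \<times> UNIV) (\<lambda>(t, p, x). F (p, c x))"
      unfolding case_prod_unfold
      by (intro continuous_on_compose2[OF smooth_on_continuous_on[OF F]]
          continuous_on_compose2[OF c(3)] continuous_intros)
        (use C near(2) c(1) in fastforce)+
    show "norm ((\<lambda>(t, p, x). F (p, c x)) (t, p, x) - (\<lambda>(t, p, x). F (p, c x)) (t, p, x')) \<le>
        1/8 * norm (x - x')" if "p \<in> C" for t p x x'
      using lip[OF _ c(1) c(1), of p x x'] c(2)[of x x'] C(1)[OF that] by (simp add: dist_norm)
    show "continuous_on C u0"
      by (rule continuous_on_subset[OF smooth_on_continuous_on[OF u0]]) (use C in auto)
  qed (use s in \<open>auto simp: C_def\<close>)
  then obtain u where u: "continuous_on ({-2..2} \<times> C) u" "\<And>p. p \<in> C \<Longrightarrow> u (0, p) = u0 p"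
    "\<And>p t. p \<in> C \<Longrightarrow> t \<in> {-2..2} \<Longrightarrow>
      ((\<lambda>t. u (t, p)) has_vector_derivative F (p, c (u (t, p)))) (at t within {-2..2})"
    by auto
  have stay: "u (t, p) \<in> cball x0 r" if "p \<in> C" "t \<in> {-2..2}" for t p
  proof -
    have "norm (u (t, p) - u (0, p)) \<le> r / 8 * norm (t - 0)"
    proof (rule differentiable_bound[of "{-2..2}" "\<lambda>t. u (t, p)" "\<lambda>t h. h *\<^sub>R F (p, c (u (t, p)))"])
      fix t :: real assume "t \<in> {-2..2}"
      then show "((\<lambda>t. u (t, p)) has_derivative (\<lambda>h. h *\<^sub>R F (p, c (u (t, p))))) (at t within {-2..2})"
        using u(3)[OF that(1)] by (simp add: has_vector_derivative_def)
      show "onorm (\<lambda>h. h *\<^sub>R F (p, c (u (t, p)))) \<le> r / 8"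
      proof (rule onorm_le)
        fix h
        show "norm (h *\<^sub>R F (p, c (u (t, p)))) \<le> r / 8 * norm h"
          using mult_right_mono[OF slow[OF C(1)[OF that(1)] c(1), of "u (t, p)"], of "\<bar>h\<bar>"]
          by (simp add: mult_ac)
      qed
    qed (use that in auto)
    also have "\<dots> \<le> r / 8 * 2" using that r by (intro mult_left_mono) auto
    finally have "dist (u (t, p)) (u0 p) \<le> r / 4" using u(2)[OF that(1)] by (simp add: dist_norm)
    then show ?thesis using dist_triangle[of "u (t, p)" x0 "u0 p"] C(2)[OF that(1)] r
      by (simp add: dist_commute)
  qed
  define W where "W = ball p0 s"
  have WC: "W \<subseteq> C" unfolding W_def C_def by auto
  have Fs: "Ck_on k ((UNIV :: real set) \<times> Q) (\<lambda>z. F (snd z))" for k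
  proof (rule Ck_on_compose[where g = snd and f = F, OF open_Times[OF open_UNIV Q(1)] Q(1)])
    show "Ck_on k ((UNIV :: real set) \<times> Q) (snd :: real \<times> 'p \<times> 'e \<Rightarrow> 'p \<times> 'e)"
      by (rule Ck_on_linear[OF bounded_linear.linear[OF bounded_linear_snd] open_Times[OF open_UNIV Q(1)]])
    show "Ck_on k Q F" using F unfolding smooth_on_def by blast
  qed auto
  have u0k: "Ck_on k W u0" for k
    by (rule Ck_on_subset[of k W0]) (use u0 C(3) WC in \<open>auto simp: smooth_on_def\<close>)
  have ode: "param_ode 2 (1/8) W (UNIV \<times> Q) (\<lambda>z. F (snd z)) u0 u"
  proof
    fix t :: real and p assume tp: "t \<in> {-2..2}" "p \<in> W"
    then have p: "p \<in> C" using WC by blast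
    show "((\<lambda>t. u (t, p)) has_vector_derivative F (snd (t, p, u (t, p)))) (at t within {-2..2})"
      using u(3)[OF p tp(1)] c(4)[OF stay[OF p tp(1)]] by simp
    show inQ: "(t, p, u (t, p)) \<in> UNIV \<times> Q" using near(2)[OF _ stay[OF p tp(1)]] C(1)[OF p] by simp
    fix v
    have "((\<lambda>z. F (snd z)) has_derivative (\<lambda>z. fderiv F (p, u (t, p)) (snd z))) (at (t, p, u (t, p)))"
      using has_derivative_compose[OF has_derivative_snd[OF has_derivative_ident]
          has_derivative_fderiv(1)[OF F1 Q(1)], of "(t, p, u (t, p))" UNIV] inQ by simp
    from fderiv_eqI[OF this]
    show "norm (fderiv (\<lambda>z. F (snd z)) (t, p, u (t, p)) (0, 0, v)) \<le> 1/8 * norm v"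
      using bound[OF _ stay[OF p tp(1)], of p v] C(1)[OF p] by simp
  next
    show "open W" unfolding W_def by simp
    show "continuous_on ({-2..2} \<times> W) u"
      by (rule continuous_on_subset[OF u(1)]) (use WC in auto)
    show "u (0, p) = u0 p" if "p \<in> W" for p using u(2) WC that by blast
  qed (use Fs u0k Q(1) in \<open>auto simp: open_Times simp del: Ck_on.simps\<close>)
  show ?thesis
  proof (rule that[OF _ _ _ ode])
    show "open W" "p0 \<in> W" using s by (auto simp: W_def)
    show "W \<subseteq> W0" using WC C(3) by blast
    have "Ck_on k ({-2<..<2} \<times> W) u" for k
      by (rule Ck_on_Suc_imp, rule param_ode_Ck[OF ode]) (rule Fs u0k)+
    then show "smooth_on ({-2<..<2} \<times> W) u" by (simp add: smooth_on_def)
  qed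
qed

section \<open>Straightening commuting lifts of constant fields\<close>

lemma frechet_derivative_linear_family:
  fixes X :: "'f::euclidean_space \<Rightarrow> 'e::euclidean_space \<Rightarrow> 'e"
  assumes \<Omega>: "open \<Omega>" "x \<in> \<Omega>" and X: "\<And>v. smooth_on \<Omega> (X v)"
    and lin: "\<And>x. x \<in> \<Omega> \<Longrightarrow> linear (\<lambda>v. X v x)"
  shows "frechet_derivative (X v) (at x) h = (\<Sum>b\<in>Basis. (v \<bullet> b) *\<^sub>R frechet_derivative (X b) (at x) h)"
proof -
  have "((\<lambda>x. \<Sum>b\<in>Basis. (v \<bullet> b) *\<^sub>R X b x) has_derivative
      (\<lambda>h. \<Sum>b\<in>Basis. (v \<bullet> b) *\<^sub>R frechet_derivative (X b) (at x) h)) (at x)"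
    by (intro has_derivative_sum has_derivative_scaleR_right smooth_on_SucD(1)[OF X \<Omega>])
  then have "(X v has_derivative
      (\<lambda>h. \<Sum>b\<in>Basis. (v \<bullet> b) *\<^sub>R frechet_derivative (X b) (at x) h)) (at x)"
    by (rule has_derivative_transform_within_open[OF _ \<Omega>])
      (rule linear_euclidean_expand[OF lin, symmetric])
  from frechet_derivative_at[OF this] show ?thesis by metis
qed

text \<open>The time-one map of \<open>u' = X (y x0 - y x) u\<close>, \<open>u 0 = x\<close>, slides \<open>x\<close> along the leaf of the
  \<open>X v\<close> to the level set of \<open>y\<close> through \<open>x0\<close>. Since the \<open>X v\<close> commute, the solution of the
  variational equation with initial value \<open>X v x\<close> is \<open>(1 - t) X v (u t)\<close>, which vanishes at \<open>t = 1\<close>.\<close>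

lemma commuting_lifts_first_integral:
  fixes X :: "'f::euclidean_space \<Rightarrow> 'e::euclidean_space \<Rightarrow> 'e" and y :: "'e \<Rightarrow> 'f"
  assumes \<Omega>: "open \<Omega>" "x0 \<in> \<Omega>" and y: "smooth_on \<Omega> y" and X: "\<And>v. smooth_on \<Omega> (X v)"
    and lin: "\<And>x. x \<in> \<Omega> \<Longrightarrow> linear (\<lambda>v. X v x)"
    and dy: "\<And>x v. x \<in> \<Omega> \<Longrightarrow> frechet_derivative y (at x) (X v x) = v"
    and comm: "\<And>x v w. x \<in> \<Omega> \<Longrightarrow>
      frechet_derivative (X v) (at x) (X w x) = frechet_derivative (X w) (at x) (X v x)"
  obtains W \<rho> where "open W" "x0 \<in> W" "W \<subseteq> \<Omega>" "smooth_on W \<rho>" "\<rho> x0 = x0"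
    "\<And>x v. x \<in> W \<Longrightarrow> frechet_derivative \<rho> (at x) (X v x) = 0"
    "\<And>h. frechet_derivative y (at x0) h = 0 \<Longrightarrow> frechet_derivative \<rho> (at x0) h = h"
proof -
  let ?Dy = "\<lambda>x. frechet_derivative y (at x)" and ?DX = "\<lambda>v x. frechet_derivative (X v) (at x)"
  \<comment> \<open>The first component of \<open>z\<close> is the starting point, which enters as a
    parameter; the second is the moving state. The coefficients vanish when the starting point is
    \<open>x0\<close>.\<close>
  define F where "F = (\<lambda>z. \<Sum>b\<in>Basis. ((y x0 - y (fst z)) \<bullet> b) *\<^sub>R X b (snd z))"
  have oQ: "open (\<Omega> \<times> \<Omega>)" using \<Omega> by (simp add: open_Times)
  have Fs: "smooth_on (\<Omega> \<times> \<Omega>) F"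
  proof -
    have y1: "smooth_on (\<Omega> \<times> \<Omega>) (\<lambda>z. y (fst z))"
      by (rule smooth_on_compose[OF oQ \<Omega>(1) smooth_on_linear[OF linear_fst oQ] y]) auto
    have X2: "smooth_on (\<Omega> \<times> \<Omega>) (\<lambda>z. X b (snd z))" for b
      by (rule smooth_on_compose[OF oQ \<Omega>(1) smooth_on_linear[OF linear_snd oQ] X]) auto
    show ?thesis unfolding F_def
      by (intro smooth_on_sum[OF oQ] smooth_on_scaleR[OF oQ] smooth_on_inner[OF oQ]
          smooth_on_diff[OF oQ] smooth_on_const y1 X2)
  qed
  have F_eq: "F (x, v) = X (y x0 - y x) v" if "v \<in> \<Omega>" for x v
    unfolding F_def using linear_euclidean_expand[OF lin[OF that], of "y x0 - y x"] by simp
  have lin0: "X 0 x = 0" if "x \<in> \<Omega>" for x using linear_0[OF lin[OF that]] .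
  obtain W u where W: "open W" "x0 \<in> W" "W \<subseteq> \<Omega>"
    and po: "param_ode 2 (1/8) W (UNIV \<times> \<Omega> \<times> \<Omega>) (\<lambda>z. F (snd z)) (\<lambda>x. x) u"
    and us: "smooth_on ({-2<..<2} \<times> W) u"
    by (rule param_flow_exists[where ?p0.0 = x0 and ?u0.0 = "\<lambda>x. x",
          OF oQ _ Fs _ \<Omega> smooth_on_linear[OF linear_ident \<Omega>(1)]])
      (use \<Omega> F_eq lin0 in auto)
  interpret param_ode 2 "1/8" W "UNIV \<times> \<Omega> \<times> \<Omega>" "\<lambda>z. F (snd z)" "\<lambda>x. x" u by (rule po)
  have in\<Omega>: "x \<in> \<Omega>" "u (t, x) \<in> \<Omega>" if "t \<in> {-2..2}" "x \<in> W" for t x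
    using inQ[OF that] by auto
  have F': "F' t x (0, h, k) = - X (?Dy x h) (u (t, x)) + ?DX (y x0 - y x) (u (t, x)) k"
    if "t \<in> {-2..2}" "x \<in> W" for t x h k
  proof -
    note in\<Omega> = in\<Omega>[OF that]
    have "((\<lambda>z. F (snd z)) has_derivative (\<lambda>z. \<Sum>b\<in>Basis.
        ((y x0 - y x) \<bullet> b) *\<^sub>R ?DX b (u (t, x)) (snd (snd z)) +
        (- ?Dy x (fst (snd z)) \<bullet> b) *\<^sub>R X b (u (t, x)))) (at (t, x, u (t, x)))"
    proof -
      have 1: "((\<lambda>z. y (fst (snd z))) has_derivative (\<lambda>z. ?Dy x (fst (snd z)))) (at (t, x, u (t, x)))"
        using smooth_on_SucD(1)[OF y \<Omega>(1) in\<Omega>(1)]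
        by (intro has_derivative_compose[of "\<lambda>z. fst (snd z)" "\<lambda>z. fst (snd z)" _ _ y])
          (auto intro!: derivative_eq_intros)
      have 2: "((\<lambda>z. X b (snd (snd z))) has_derivative (\<lambda>z. ?DX b (u (t, x)) (snd (snd z))))
          (at (t, x, u (t, x)))" for b
        using smooth_on_SucD(1)[OF X \<Omega>(1) in\<Omega>(2)]
        by (intro has_derivative_compose[of "\<lambda>z. snd (snd z)" "\<lambda>z. snd (snd z)" _ _ "X b"])
          (auto intro!: derivative_eq_intros)
      have "((\<lambda>z. ((y x0 - y (fst (snd z))) \<bullet> b) *\<^sub>R X b (snd (snd z))) has_derivative
          (\<lambda>z. ((y x0 - y x) \<bullet> b) *\<^sub>R ?DX b (u (t, x)) (snd (snd z)) +
            (- ?Dy x (fst (snd z)) \<bullet> b) *\<^sub>R X b (u (t, x)))) (at (t, x, u (t, x)))" for b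
        using has_derivative_scaleR[OF
            has_derivative_inner_left[OF has_derivative_diff[OF has_derivative_const 1], of "y x0" b] 2]
        by simp
      then show ?thesis unfolding F_def by (intro has_derivative_sum)
    qed
    from fderiv_eqI[OF this]
    show ?thesis
      using linear_euclidean_expand[OF lin[OF in\<Omega>(2)], of "?Dy x h"]
        frechet_derivative_linear_family[OF \<Omega>(1) in\<Omega>(2) X lin, of "y x0 - y x" k]
      by (simp add: sum_subtractf)
  qed
  have init': "w h (0, x) = h" if "x \<in> W" for h x
    using variational_init[OF that] fderiv_eqI[OF has_derivative_ident] by metis
  define \<rho> where "\<rho> = (\<lambda>x. u (1, x))"
  have D\<rho>: "frechet_derivative \<rho> (at x) h = w h (1, x)" for x h unfolding \<rho>_def w_def by simp
  have \<rho>s: "smooth_on W \<rho>" unfolding \<rho>_def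
    by (rule smooth_on_compose[OF W(1) _ _ us])
      (auto intro!: smooth_on_Pair[OF W(1)] smooth_on_const smooth_on_linear[OF linear_ident W(1)]
        open_Times W(1))
  have along: "w (X v x) (1, x) = 0" if x: "x \<in> W" for x v
  proof -
    \<comment> \<open>Both terms solve \<open>k' = ?DX ?q (u (t, x)) k - X v (u (t, x))\<close>: the
      first because \<open>dy\<close> sends the direction \<open>X v x\<close> to \<open>v\<close>,
      the second because \<open>X v\<close> and \<open>X ?q\<close> commute. Their difference solves
      the homogeneous equation and starts at zero.\<close>
    define z where "z = (\<lambda>t. w (X v x) (t, x) - (1 - t) *\<^sub>R X v (u (t, x)))"
    let ?q = "y x0 - y x"
    have "norm (z 1) \<le> 2 * (norm (z 0) + 2 * 0)"
    proof (rule short_gronwall[of 2 "1/8" 0 z "\<lambda>t. ?DX ?q (u (t, x)) (z t)"])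
      fix t :: real assume t: "t \<in> {-2..2}"
      note in\<Omega> = in\<Omega>[OF t x]
      have lD: "linear (?DX ?q (u (t, x)))"
        by (rule has_derivative_linear[OF smooth_on_SucD(1)[OF X \<Omega>(1) in\<Omega>(2)]])
      have "((\<lambda>t. u (t, x)) has_vector_derivative X ?q (u (t, x))) (at t within {-2..2})"
        using ode[OF t x] F_eq[OF in\<Omega>(2)] by simp
      then have "((\<lambda>t. X v (u (t, x))) has_vector_derivative ?DX v (u (t, x)) (X ?q (u (t, x))))
          (at t within {-2..2})"
        using vector_derivative_diff_chain_within[of "\<lambda>t. u (t, x)" _ t "{-2..2}" "X v"]
          smooth_on_SucD(1)[OF X \<Omega>(1) in\<Omega>(2)]
        by (simp add: comp_def has_derivative_at_withinI)
      then have "((\<lambda>t. (1 - t) *\<^sub>R X v (u (t, x))) has_vector_derivative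
          (1 - t) *\<^sub>R ?DX v (u (t, x)) (X ?q (u (t, x))) + (- 1) *\<^sub>R X v (u (t, x))) (at t within {-2..2})"
        by (intro has_vector_derivative_scaleR) (auto intro!: derivative_eq_intros)
      from has_vector_derivative_diff[OF variational_equation[OF t x, of "X v x"] this]
      show "(z has_vector_derivative ?DX ?q (u (t, x)) (z t)) (at t within {-2..2})"
        unfolding z_def F'[OF t x] dy[OF in\<Omega>(1)]
        by (simp add: comm[OF in\<Omega>(2), of v ?q] linear_diff[OF lD] linear_scale[OF lD])
      have "F' t x (0, 0, z t) = ?DX ?q (u (t, x)) (z t)"
        unfolding F'[OF t x] using lin0[OF in\<Omega>(2)]
          linear_0[OF has_derivative_linear[OF smooth_on_SucD(1)[OF y \<Omega>(1) in\<Omega>(1)]]] by simp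
      then show "norm (?DX ?q (u (t, x)) (z t)) \<le> 1/8 * norm (z t) + 0"
        using bound[OF t x, of "z t"] by simp
    qed auto
    then show ?thesis using init'[OF x] init[OF x] by (simp add: z_def)
  qed
  have "X 0 = (\<lambda>x. X 0 x)" by simp
  have DX0: "?DX 0 x k = 0" if "x \<in> \<Omega>" for x k
    using frechet_derivative_linear_family[OF \<Omega>(1) that X lin, of 0 k] by simp
  \<comment> \<open>The coefficient \<open>y x0 - y x0\<close> is zero, so the solution starting at
    \<open>x0\<close> stands still.\<close>
  have fixed: "u (1, x0) = x0"
  proof -
    have "norm (u (1, x0) - x0) \<le> 2 * (norm (u (0, x0) - x0) + 2 * 0)"
    proof (rule short_gronwall[of 2 "1/8" 0 "\<lambda>t. u (t, x0) - x0" "\<lambda>t. 0"])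
      fix t :: real assume t: "t \<in> {-2..2}"
      show "((\<lambda>t. u (t, x0) - x0) has_vector_derivative 0) (at t within {-2..2})"
        using has_vector_derivative_diff[OF ode[OF t W(2)] has_vector_derivative_const]
          F_eq[OF in\<Omega>(2)[OF t W(2)], of x0] lin0[OF in\<Omega>(2)[OF t W(2)]] by simp
    qed auto
    then show ?thesis using init[OF W(2)] by simp
  qed
  \<comment> \<open>At \<open>x0\<close> the coefficient is zero, and \<open>h\<close> lies in the
    kernel of the derivative of \<open>y\<close>, so both terms of the variational equation vanish
    and \<open>w h\<close> is constant in time.\<close>
  have vertical: "w h (1, x0) = h" if h: "?Dy x0 h = 0" for h
  proof -
    have "norm (w h (1, x0) - h) \<le> 2 * (norm (w h (0, x0) - h) + 2 * 0)"
    proof (rule short_gronwall[of 2 "1/8" 0 "\<lambda>t. w h (t, x0) - h" "\<lambda>t. 0"])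
      fix t :: real assume t: "t \<in> {-2..2}"
      show "((\<lambda>t. w h (t, x0) - h) has_vector_derivative 0) (at t within {-2..2})"
        using has_vector_derivative_diff[OF variational_equation[OF t W(2), of h] has_vector_derivative_const[of h]]
          F'[OF t W(2), of h] lin0[OF in\<Omega>(2)[OF t W(2)]] DX0[OF in\<Omega>(2)[OF t W(2)]] h by simp
    qed auto
    then show ?thesis using init'[OF W(2)] by simp
  qed
  show ?thesis
    by (rule that[OF W \<rho>s]) (use fixed along vertical D\<rho> in \<open>auto simp: \<rho>_def\<close>)
qed

text \<open>The chart is a sum of \<open>P (\<rho> x - x0)\<close>, whose derivative along every
  \<open>X v\<close> is zero, and \<open>X (y x - y x0) x0\<close>, which is constant on the level
  sets of \<open>y\<close>. As \<open>P\<close> projects onto the kernel of the derivative of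
  \<open>y\<close> at \<open>x0\<close> along the vectors \<open>X v x0\<close>, the derivative of
  the sum at \<open>x0\<close> is the identity. In the chart each \<open>X v\<close> becomes a
  constant field.\<close>

lemma product_chart:
  fixes X :: "'f::euclidean_space \<Rightarrow> 'e::euclidean_space \<Rightarrow> 'e" and y :: "'e \<Rightarrow> 'f"
  assumes \<Omega>: "open \<Omega>" "x0 \<in> \<Omega>" and y: "smooth_on \<Omega> y" and X: "\<And>v. smooth_on \<Omega> (X v)"
    and lin: "\<And>x. x \<in> \<Omega> \<Longrightarrow> linear (\<lambda>v. X v x)"
    and dy: "\<And>x v. x \<in> \<Omega> \<Longrightarrow> frechet_derivative y (at x) (X v x) = v"
    and comm: "\<And>x v w. x \<in> \<Omega> \<Longrightarrow>
      frechet_derivative (X v) (at x) (X w x) = frechet_derivative (X w) (at x) (X v x)"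
  obtains U \<psi> \<psi>i P where "open U" "x0 \<in> U" "U \<subseteq> \<Omega>" "smooth_on U \<psi>" "\<psi> x0 = 0"
    "open (\<psi> ` U)" "convex (\<psi> ` U)" "homeomorphism U (\<psi> ` U) \<psi> \<psi>i" "smooth_on (\<psi> ` U) \<psi>i"
    "linear P" "\<forall>a. P (P a) = P a" "\<forall>a\<in>\<psi> ` U. \<forall>b\<in>\<psi> ` U. P a + (b - P b) \<in> \<psi> ` U"
    "\<forall>x\<in>U. \<forall>v. frechet_derivative \<psi> (at x) (X v x) = X v x0"
    "\<forall>x\<in>U. \<forall>h. frechet_derivative \<psi> (at x) h - P (frechet_derivative \<psi> (at x) h) =
      X (frechet_derivative y (at x) h) x0"
    "\<forall>x\<in>U. \<psi> x - P (\<psi> x) = X (y x - y x0) x0"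
proof -
  let ?Dy = "\<lambda>x. frechet_derivative y (at x)"
  obtain W \<rho> where W: "open W" "x0 \<in> W" "W \<subseteq> \<Omega>" and \<rho>: "smooth_on W \<rho>" "\<rho> x0 = x0"
    "\<And>x v. x \<in> W \<Longrightarrow> frechet_derivative \<rho> (at x) (X v x) = 0"
    "\<And>h. ?Dy x0 h = 0 \<Longrightarrow> frechet_derivative \<rho> (at x0) h = h"
    using commuting_lifts_first_integral[OF assms] by blast
  let ?D\<rho> = "\<lambda>x. frechet_derivative \<rho> (at x)"
  have lDy: "linear (?Dy x)" if "x \<in> \<Omega>" for x
    using has_derivative_linear[OF smooth_on_SucD(1)[OF y \<Omega>(1) that]] .
  have lX: "linear (\<lambda>v. X v x0)" by (rule lin[OF \<Omega>(2)])
  have X0: "X 0 x0 = 0" using linear_0[OF lX] .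
  define P where "P = (\<lambda>h. h - X (?Dy x0 h) x0)"
  have P: "linear P" unfolding P_def
    using linear_compose_sub[OF linear_ident linear_compose[OF lDy[OF \<Omega>(2)] lX]]
    by (simp add: comp_def)
  have DyP: "?Dy x0 (P h) = 0" for h
    unfolding P_def using linear_diff[OF lDy[OF \<Omega>(2)]] dy[OF \<Omega>(2)] by simp
  have PP: "P (P h) = P h" for h
    using DyP[of h] X0 unfolding P_def[of] by (metis P_def diff_zero)
  have PX: "P (X v x0) = 0" for v unfolding P_def using dy[OF \<Omega>(2)] by simp
  define \<psi> where "\<psi> = (\<lambda>x. P (\<rho> x - x0) + X (y x - y x0) x0)"
  have \<psi>s: "smooth_on W \<psi>" unfolding \<psi>_def
    by (intro smooth_on_add[OF W(1)] smooth_on_linear_comp[OF P W(1)] smooth_on_linear_comp[OF lX W(1)]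
        smooth_on_diff[OF W(1)] smooth_on_const \<rho>(1) smooth_on_subset[OF y W(3)])
  have \<psi>0: "\<psi> x0 = 0" unfolding \<psi>_def using \<rho>(2) linear_0[OF P] X0 by simp
  have bl: "bounded_linear P" "bounded_linear (\<lambda>v. X v x0)"
    using P lX linear_conv_bounded_linear by auto
  have D\<psi>: "frechet_derivative \<psi> (at x) = (\<lambda>h. P (?D\<rho> x h) + X (?Dy x h) x0)" if "x \<in> W" for x
  proof (rule frechet_derivative_at[symmetric])
    have "((\<lambda>x. P (\<rho> x - x0)) has_derivative (\<lambda>h. P (?D\<rho> x h - 0))) (at x)"
      by (intro bounded_linear.has_derivative[OF bl(1)] has_derivative_diff has_derivative_const
          smooth_on_SucD(1)[OF \<rho>(1) W(1) that])
    moreover have "((\<lambda>x. X (y x - y x0) x0) has_derivative (\<lambda>h. X (?Dy x h - 0) x0)) (at x)"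
      by (intro bounded_linear.has_derivative[OF bl(2)] has_derivative_diff has_derivative_const
          smooth_on_SucD(1)[OF y \<Omega>(1)]) (use that W(3) in auto)
    ultimately show "(\<psi> has_derivative (\<lambda>h. P (?D\<rho> x h) + X (?Dy x h) x0)) (at x)"
      unfolding \<psi>_def using has_derivative_add by fastforce
  qed
  have "?D\<rho> x0 h = P h" for h
  proof -
    have l: "linear (?D\<rho> x0)" using has_derivative_linear[OF smooth_on_SucD(1)[OF \<rho>(1) W(1,2)]] .
    have "?D\<rho> x0 h = ?D\<rho> x0 (P h) + ?D\<rho> x0 (X (?Dy x0 h) x0)"
      using linear_add[OF l, of "P h" "X (?Dy x0 h) x0"] by (simp add: P_def)
    then show ?thesis using \<rho>(3)[OF W(2)] \<rho>(4)[OF DyP] by simp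
  qed
  then have "frechet_derivative \<psi> (at x0) = id"
    using D\<psi>[OF W(2)] PP by (simp add: fun_eq_iff) (simp add: P_def)
  then have "inj (frechet_derivative \<psi> (at x0))" by simp
  then obtain U1 V h where *: "open U1" "x0 \<in> U1" "U1 \<subseteq> W" "open V" "homeomorphism U1 V \<psi> h"
    "smooth_on V h"
    using smooth_inverse_function[OF W(1,2) \<psi>s] by blast
  have "0 \<in> V" using *(2,5) \<psi>0 unfolding homeomorphism_def by force
  then obtain r where r: "r > 0" "ball 0 (2 * r) \<subseteq> V"
    using *(4) by (metis open_contains_ball field_sum_of_halves half_gt_zero mult_2)
  \<comment> \<open>A product of a ball for \<open>P\<close> and a ball for the complementary
    projection: convex, and closed under joining the \<open>P\<close>-part of one point to the
    complementary part of another. The radius \<open>2 * r\<close> above covers the sum of both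
    parts.\<close>
  define B where "B = P -` ball 0 r \<inter> (\<lambda>z. z - P z) -` ball 0 r"
  have lP': "linear (\<lambda>z. z - P z)" by (rule linear_compose_sub[OF linear_ident P])
  have oB: "open B" unfolding B_def
    by (intro open_Int open_vimage open_ball linear_continuous_on)
      (use P lP' linear_conv_bounded_linear in auto)
  have cB: "convex B" unfolding B_def
    by (intro convex_Int convex_linear_vimage P lP' convex_ball)
  have BV: "B \<subseteq> V"
  proof
    fix z assume "z \<in> B"
    then have "norm (P z + (z - P z)) < 2 * r"
      using norm_triangle_ineq[of "P z" "z - P z"] by (simp add: B_def)
    then show "z \<in> V" using r(2) by auto
  qed
  have P'P: "P (z - P z) = 0" for z using linear_diff[OF P] PP by simp
  define U where "U = h ` B"
  have hV: "\<psi> (h z) = z" "h z \<in> U1" if "z \<in> V" for z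
    using *(5) that unfolding homeomorphism_def by auto
  have hom: "homeomorphism U B \<psi> h"
  proof (rule homeomorphism_of_subsets[OF *(5)])
    show "U \<subseteq> U1" "\<psi> ` U = B" unfolding U_def using BV hV by force+
  qed (fact BV)
  have \<psi>U: "\<psi> ` U = B" by (rule homeomorphism_image1[OF hom])
  have UU: "U \<subseteq> U1" unfolding U_def using hV(2) BV by blast
  have UW: "U \<subseteq> W" using UU *(3) by blast
  show ?thesis
  proof (rule that[of U \<psi> h P])
    have "U = U1 \<inter> \<psi> -` B"
    proof
      show "U \<subseteq> U1 \<inter> \<psi> -` B" using UU \<psi>U by blast
      show "U1 \<inter> \<psi> -` B \<subseteq> U"
        unfolding U_def using *(5) unfolding homeomorphism_def by (auto intro!: rev_image_eqI)
    qed
    then show "open U"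
      using continuous_open_preimage[OF _ *(1) oB] *(5) unfolding homeomorphism_def by metis
    have "0 \<in> B" using r linear_0[OF P] by (simp add: B_def)
    then show "x0 \<in> U" using *(2) \<psi>0 \<open>U = U1 \<inter> \<psi> -` B\<close> by simp
    show "U \<subseteq> \<Omega>" using UW W(3) by blast
    show "smooth_on U \<psi>" by (rule smooth_on_subset[OF \<psi>s UW])
    show "\<psi> x0 = 0" by (rule \<psi>0)
    show "open (\<psi> ` U)" "convex (\<psi> ` U)" using oB cB \<psi>U by auto
    show "homeomorphism U (\<psi> ` U) \<psi> h" using hom \<psi>U by simp
    show "smooth_on (\<psi> ` U) h" using smooth_on_subset[OF *(6) BV] \<psi>U by simp
    show "linear P" "\<forall>a. P (P a) = P a" using P PP by auto
    show "\<forall>a\<in>\<psi> ` U. \<forall>b\<in>\<psi> ` U. P a + (b - P b) \<in> \<psi> ` U"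
      using P'P PP linear_add[OF P] unfolding \<psi>U by (simp add: B_def)
    have xW: "x \<in> W" "x \<in> \<Omega>" if "x \<in> U" for x using that UW W(3) by auto
    show "\<forall>x\<in>U. \<forall>v. frechet_derivative \<psi> (at x) (X v x) = X v x0"
      using \<rho>(3)[OF xW(1)] dy[OF xW(2)] linear_0[OF P] by (simp add: D\<psi>[OF xW(1)])
    show "\<forall>x\<in>U. \<forall>h. frechet_derivative \<psi> (at x) h - P (frechet_derivative \<psi> (at x) h) =
        X (frechet_derivative y (at x) h) x0"
      using PX PP linear_add[OF P] by (simp add: D\<psi>[OF xW(1)])
    show "\<forall>x\<in>U. \<psi> x - P (\<psi> x) = X (y x - y x0) x0"
      using PX PP linear_add[OF P] by (simp add: \<psi>_def)
  qed
qed

section \<open>Calculus on manifolds\<close>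

text \<open>A chart \<open>(V, c)\<close> with \<open>smooth_atlas (insert (V, c) A)\<close> is compatible with \<open>A\<close> and need not
  belong to it; the derivative \<open>dfun A\<close> is always taken with respect to the chosen charts of \<open>A\<close>.\<close>

lemma compatible_chart:
  assumes "smooth_atlas (insert (V, c) A)"
  shows "open V" "inj_on c V" "open (c ` V)" "homeomorphism V (c ` V) c (inv_into V c)"
    and "open U \<Longrightarrow> open (c ` (U \<inter> V))"
    and "q \<in> V \<Longrightarrow> inv_into V c (c q) = q"
proof -
  have *: "open V" "inj_on c V" by (rule atlas_chart[OF assms insertI1])+
  then show "open V" "inj_on c V" "q \<in> V \<Longrightarrow> inv_into V c (c q) = q" by auto
  show "open (c ` V)" "homeomorphism V (c ` V) c (inv_into V c)"
    using assms unfolding smooth_atlas_def by auto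
  show "open U \<Longrightarrow> open (c ` (U \<inter> V))" by (rule atlas_open_image[OF assms insertI1])
qed

text \<open>Neither chart need belong to \<open>A\<close>; near each point the transition factors
  through a chart of \<open>A\<close> around it.\<close>

lemma chart_transition_smooth:
  assumes "smooth_atlas A" "smooth_atlas (insert (V, c) A)" "smooth_atlas (insert (W, d) A)"
  shows "smooth_on (c ` (V \<inter> W)) (d \<circ> inv_into V c)"
proof -
  note c = compatible_chart[OF assms(2)] and d = compatible_chart[OF assms(3)]
  have op: "open (c ` (V \<inter> W))" using c(5)[OF d(1)] by (simp add: Int_commute)
  show ?thesis
  proof (rule smooth_on_local[OF op])
    fix x assume "x \<in> c ` (V \<inter> W)"
    then obtain q where q: "q \<in> V" "q \<in> W" "x = c q" by blast
    obtain V0 c0 where c0: "(V0, c0) \<in> A" "q \<in> V0" using atlas_chart_at[OF assms(1)] by metis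
    then have A0: "insert (V0, c0) A = A" by auto
    note c0' = compatible_chart[of V0 c0 A, unfolded A0, OF assms(1)]
    let ?T = "c ` ((V0 \<inter> W) \<inter> V)"
    have T: "open ?T" "open (c0 ` ((V \<inter> W) \<inter> V0))" using c(1,5) c0'(1,5) d(1) by blast+
    have 1: "smooth_on (c ` (V \<inter> V0)) (c0 \<circ> inv_into V c)"
      using assms(2) c0(1) unfolding smooth_atlas_def by fast
    have 2: "smooth_on (c0 ` (V0 \<inter> W)) (d \<circ> inv_into V0 c0)"
      using assms(3) c0(1) unfolding smooth_atlas_def by fast
    have "smooth_on ?T (\<lambda>x. (d \<circ> inv_into V0 c0) ((c0 \<circ> inv_into V c) x))"
      by (rule smooth_on_compose[OF T smooth_on_subset[OF 1] smooth_on_subset[OF 2]])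
        (use c in auto)
    then have "smooth_on ?T (d \<circ> inv_into V c)"
      by (rule smooth_on_cong[OF T(1)]) (use c c0' in auto)
    then show "\<exists>T. open T \<and> x \<in> T \<and> smooth_on T (d \<circ> inv_into V c)"
      using T(1) q c0 by blast
  qed
qed

lemma smooth_fun_chart_rep:
  assumes at: "smooth_atlas A" and ch: "smooth_atlas (insert (V, c) A)"
    and U: "open U" and f: "smooth_fun A U f"
  shows "smooth_on (c ` (U \<inter> V)) (f \<circ> inv_into V c)"
proof -
  note c = compatible_chart[OF ch]
  show ?thesis
  proof (rule smooth_on_local[OF c(5)[OF U]])
    fix x assume "x \<in> c ` (U \<inter> V)"
    then obtain q where q: "q \<in> U" "q \<in> V" "x = c q" by blast
    obtain V0 c0 where c0: "(V0, c0) \<in> A" "q \<in> V0" using atlas_chart_at[OF at] by metis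
    then have A0: "insert (V0, c0) A = A" by auto
    note c0' = compatible_chart[of V0 c0 A, unfolded A0, OF at]
    let ?T = "c ` ((U \<inter> V0) \<inter> V)"
    have T: "open ?T" "open (c0 ` (U \<inter> V0))" using c(1,5) c0'(1,5) U by blast+
    have 1: "smooth_on (c ` (V \<inter> V0)) (c0 \<circ> inv_into V c)"
      using chart_transition_smooth[OF at ch, of V0 c0] A0 at by simp
    have 2: "smooth_on (c0 ` (U \<inter> V0)) (f \<circ> inv_into V0 c0)"
      using f c0(1) unfolding smooth_fun_def by fast
    have "smooth_on ?T (\<lambda>x. (f \<circ> inv_into V0 c0) ((c0 \<circ> inv_into V c) x))"
      by (rule smooth_on_compose[OF T smooth_on_subset[OF 1] 2]) (use c in auto)
    then have "smooth_on ?T (f \<circ> inv_into V c)"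
      by (rule smooth_on_cong[OF T(1)]) (use c c0' in auto)
    then show "\<exists>T. open T \<and> x \<in> T \<and> smooth_on T (f \<circ> inv_into V c)"
      using T(1) q c0 by blast
  qed
qed

lemma smooth_fun_chartI:
  assumes at: "smooth_atlas A" and ch: "smooth_atlas (insert (V, c) A)"
    and U: "open U" "U \<subseteq> V" and F: "smooth_on (c ` U) F" "\<And>q. q \<in> U \<Longrightarrow> f q = F (c q)"
  shows "smooth_fun A U f"
  unfolding smooth_fun_def
proof clarify
  fix V0 c0 assume c0: "(V0, c0) \<in> A"
  then have A0: "insert (V0, c0) A = A" by auto
  note c = compatible_chart[OF ch] and c0' = compatible_chart[of V0 c0 A, unfolded A0, OF at]
  have "smooth_on (c0 ` (V0 \<inter> V)) (c \<circ> inv_into V0 c0)"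
    using chart_transition_smooth[OF at, of V0 c0 V c] A0 at ch by simp
  then have 1: "smooth_on (c0 ` (U \<inter> V0)) (c \<circ> inv_into V0 c0)"
    by (rule smooth_on_subset) (use U(2) in auto)
  have 2: "open (c ` U)" using c(5)[OF U(1)] U(2) by (simp add: Int_absorb2)
  have "(c \<circ> inv_into V0 c0) ` (c0 ` (U \<inter> V0)) \<subseteq> c ` U" using c0'(6) by auto
  from smooth_on_compose[OF c0'(5)[OF U(1)] 2 1 F(1) this]
  show "smooth_on (c0 ` (U \<inter> V0)) (f \<circ> inv_into V0 c0)"
    by (rule smooth_on_cong[OF c0'(5)[OF U(1)]]) (use c0' F(2) in auto)
qed

lemma smooth_fun_local:
  assumes at: "smooth_atlas A" and U: "open U"
    and loc: "\<And>p. p \<in> U \<Longrightarrow> \<exists>U'. open U' \<and> p \<in> U' \<and> smooth_fun A U' f"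
  shows "smooth_fun A U f"
  unfolding smooth_fun_def
proof clarify
  fix V c assume Vc: "(V, c) \<in> A"
  show "smooth_on (c ` (U \<inter> V)) (f \<circ> inv_into V c)"
  proof (rule smooth_on_local[OF atlas_open_image[OF at Vc U]])
    fix x assume "x \<in> c ` (U \<inter> V)"
    then obtain q where q: "q \<in> U" "q \<in> V" "x = c q" by blast
    obtain U' where U': "open U'" "q \<in> U'" "smooth_fun A U' f" using loc[OF q(1)] by blast
    have "smooth_on (c ` (U' \<inter> V)) (f \<circ> inv_into V c)" using U'(3) Vc unfolding smooth_fun_def by fast
    then show "\<exists>T. open T \<and> x \<in> T \<and> smooth_on T (f \<circ> inv_into V c)"
      using atlas_open_image[OF at Vc U'(1)] U'(2) q by blast
  qed
qed

lemma smooth_vf_local: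
  assumes at: "smooth_atlas A" and U: "open U"
    and loc: "\<And>p. p \<in> U \<Longrightarrow> \<exists>U'. open U' \<and> p \<in> U' \<and> smooth_vf A U' X"
  shows "smooth_vf A U X"
  unfolding smooth_vf_def
proof clarify
  fix V c assume Vc: "(V, c) \<in> A"
  have V: "open V" by (rule atlas_chart(1)[OF at Vc])
  show "smooth_fun A (U \<inter> V) (\<lambda>p. dfun A c p (X p))"
  proof (rule smooth_fun_local[OF at])
    fix p assume p: "p \<in> U \<inter> V"
    then obtain U' where U': "open U'" "p \<in> U'" "smooth_vf A U' X" using loc by blast
    then show "\<exists>U'. open U' \<and> p \<in> U' \<and> smooth_fun A U' (\<lambda>p. dfun A c p (X p))"
      using p V Vc unfolding smooth_vf_def by (intro exI[of _ "U' \<inter> V"]) auto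
  qed (use U V in auto)
qed

lemma smooth_fun_chart:
  assumes "smooth_atlas A" "smooth_atlas (insert (V, c) A)"
  shows "smooth_fun A V c"
  using compatible_chart[OF assms(2)]
  by (intro smooth_fun_chartI[OF assms _ _ smooth_on_linear[OF linear_ident]]) auto

lemma smooth_fun_add:
  fixes f :: "'m::{t2_space, second_countable_topology} \<Rightarrow> 'b::real_normed_vector"
  assumes "smooth_atlas A" "open U" "smooth_fun A U f" "smooth_fun A U f'"
  shows "smooth_fun A U (\<lambda>q. f q + f' q)"
  using assms smooth_on_add[OF atlas_open_image[OF assms(1) _ assms(2)]]
  unfolding smooth_fun_def comp_def by fast

lemma smooth_fun_scaleR:
  fixes f :: "'m::{t2_space, second_countable_topology} \<Rightarrow> real"
    and f' :: "'m \<Rightarrow> 'b::real_normed_vector"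
  assumes "smooth_atlas A" "open U" "smooth_fun A U f" "smooth_fun A U f'"
  shows "smooth_fun A U (\<lambda>q. f q *\<^sub>R f' q)"
  using assms smooth_on_scaleR[OF atlas_open_image[OF assms(1) _ assms(2)]]
  unfolding smooth_fun_def comp_def by fast

lemma smooth_fun_sum:
  fixes f :: "'i \<Rightarrow> 'm::{t2_space, second_countable_topology} \<Rightarrow> 'b::real_normed_vector"
  assumes "smooth_atlas A" "open U" "\<And>i. i \<in> I \<Longrightarrow> smooth_fun A U (f i)"
  shows "smooth_fun A U (\<lambda>q. \<Sum>i\<in>I. f i q)"
  using assms(3)
  by (induction I rule: infinite_finite_induct)
    (auto intro: smooth_fun_add[OF assms(1,2)] simp: smooth_fun_const)

lemma has_derivative_chart_rep:
  assumes at: "smooth_atlas A" and ch: "smooth_atlas (insert (V, c) A)"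
    and U: "open U" "q \<in> U" "q \<in> V" and f: "smooth_fun A U f"
  shows "((f \<circ> inv_into V c) has_derivative frechet_derivative (f \<circ> inv_into V c) (at (c q))) (at (c q))"
  using smooth_on_SucD(1)[OF smooth_fun_chart_rep[OF at ch U(1) f] compatible_chart(5)[OF ch U(1)]] U
  by blast

text \<open>A tangent vector is given by its components in the chosen chart at its point, and
  \<open>dfun A c q\<close> converts them into components in \<open>c\<close>. Since
  \<open>c\<close> stays fixed while q varies, smoothness can be read off on the right.\<close>

lemma dfun_chart_rep:
  assumes at: "smooth_atlas A" and ch: "smooth_atlas (insert (V, c) A)"
    and U: "open U" "q \<in> U" "q \<in> V" and f: "smooth_fun A U f"
  shows "dfun A f q v = frechet_derivative (f \<circ> inv_into V c) (at (c q)) (dfun A c q v)"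
proof -
  note c = compatible_chart[OF ch]
  obtain V0 c0 where c0: "chart_at A q = (V0, c0)" "(V0, c0) \<in> A" "q \<in> V0" "inv_into V0 c0 (c0 q) = q"
    "inj_on c0 V0" using atlas_chart_at[OF at] by metis
  have "((c \<circ> inv_into V0 c0) has_derivative dfun A c q) (at (c0 q))"
    by (rule dfun_has_derivative[OF at c(1) U(3) smooth_fun_chart[OF at ch] c0(1)])
  moreover have "((f \<circ> inv_into V c) has_derivative frechet_derivative (f \<circ> inv_into V c) (at (c q)))
      (at ((c \<circ> inv_into V0 c0) (c0 q)))"
    using has_derivative_chart_rep[OF assms] c0(4) by simp
  ultimately have "((f \<circ> inv_into V c) \<circ> (c \<circ> inv_into V0 c0) has_derivative
      frechet_derivative (f \<circ> inv_into V c) (at (c q)) \<circ> dfun A c q) (at (c0 q))"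
    by (rule diff_chain_at)
  then have "(f \<circ> inv_into V0 c0 has_derivative
      frechet_derivative (f \<circ> inv_into V c) (at (c q)) \<circ> dfun A c q) (at (c0 q))"
    by (rule has_derivative_transform_within_open[OF _ atlas_open_image[OF at c0(2) c(1)]])
      (use c0 c U in auto)
  then show ?thesis using dfun_eqI[OF c0(1)] by fastforce
qed

lemma dfun_chosen_chart:
  assumes "smooth_atlas A" "chart_at A q = (V, c)"
  shows "dfun A c q v = v"
proof -
  obtain V0 c0 where c0: "chart_at A q = (V0, c0)" "(V0, c0) \<in> A" "q \<in> V0" "open V0" "inj_on c0 V0"
    using atlas_chart_at[OF assms(1)] by metis
  then have Vc: "(V, c) \<in> A" "q \<in> V" "open V" "inj_on c V" using assms(2) by auto
  have "(c \<circ> inv_into V c has_derivative (\<lambda>v. v)) (at (c q))"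
    by (rule has_derivative_transform_within_open[OF has_derivative_ident
          atlas_open_image[OF assms(1) Vc(1,3)]]) (use Vc in auto)
  from dfun_eqI[OF assms(2) this] show ?thesis by simp
qed

text \<open>The derivative of the transition from \<open>c\<close> to the chosen chart is a left
  inverse, because in the chosen chart a tangent vector is its own component vector. Equality of
  dimensions does the rest.\<close>

lemma dfun_chart_bij:
  assumes at: "smooth_atlas A" and ch: "smooth_atlas (insert (V, c) A)" and q: "q \<in> V"
  shows "linear (dfun A c q)" "bij (dfun A c q)"
proof -
  note c = compatible_chart[OF ch]
  show lin: "linear (dfun A c q)" by (rule dfun_linear[OF at c(1) q smooth_fun_chart[OF at ch]])
  obtain V0 c0 where c0: "chart_at A q = (V0, c0)" "(V0, c0) \<in> A" "q \<in> V0" "open V0"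
    using atlas_chart_at[OF at] by metis
  then have "insert (V0, c0) A = A" by auto
  then have "smooth_fun A V0 c0" using smooth_fun_chart[OF at, of V0 c0] at by simp
  then have "frechet_derivative (c0 \<circ> inv_into V c) (at (c q)) (dfun A c q v) = v" for v
    using dfun_chart_rep[OF at ch c0(4,3) q, of c0 v] dfun_chosen_chart[OF at c0(1)] by simp
  then have "inj (dfun A c q)" by (metis injI)
  then show "bij (dfun A c q)" using linear_injective_imp_surjective[OF lin] by (simp add: bij_def)
qed

text \<open>The coordinate vector field of the chart \<open>c\<close> with constant components
  \<open>w\<close>; for \<open>w\<close> in \<open>Basis\<close> these fields are the coordinate
  frame.\<close>

definition coord_field ::
  "('m, 'e::real_normed_vector) chart set \<Rightarrow> ('m \<Rightarrow> 'k::real_normed_vector) \<Rightarrow> 'k \<Rightarrow> 'm \<Rightarrow> 'e" where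
  "coord_field A c w q = inv (dfun A c q) w"

lemma dfun_coord_field:
  assumes "smooth_atlas A" "smooth_atlas (insert (V, c) A)" "q \<in> V"
  shows "dfun A c q (coord_field A c w q) = w" "coord_field A c (dfun A c q v) q = v"
  using dfun_chart_bij(2)[OF assms]
  by (simp_all add: coord_field_def bij_is_surj surj_f_inv_f bij_is_inj)

lemma coord_field_linear:
  assumes "smooth_atlas A" "smooth_atlas (insert (V, c) A)" "q \<in> V"
  shows "linear (\<lambda>w. coord_field A c w q)"
  unfolding coord_field_def using dfun_chart_bij[OF assms]
  by (meson bij_is_inj bij_is_surj inj_linear_imp_inv_linear)

lemma coord_field_expand:
  assumes "smooth_atlas A" "smooth_atlas (insert (V, c) A)" "q \<in> V"
  shows "v = (\<Sum>b\<in>Basis. (dfun A c q v \<bullet> b) *\<^sub>R coord_field A c b q)"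
  using linear_euclidean_expand[OF coord_field_linear[OF assms], of "dfun A c q v"]
    dfun_coord_field(2)[OF assms, of v] by simp

lemma smooth_fun_dfun_chart_change:
  assumes at: "smooth_atlas A" and c: "smooth_atlas (insert (V, c) A)" and d: "smooth_atlas (insert (W, d) A)"
    and U: "open U" "U \<subseteq> V" "U \<subseteq> W" and X: "smooth_fun A U (\<lambda>q. dfun A c q (X q))"
  shows "smooth_fun A U (\<lambda>q. dfun A d q (X q))"
proof (rule smooth_fun_chartI[OF at c U(1,2)])
  note c' = compatible_chart[OF c] and d' = compatible_chart[OF d]
  have UV: "U \<inter> V = U" using U by auto
  have op: "open (c ` U)" "open (c ` (W \<inter> V))" using c'(5)[OF U(1)] c'(5)[OF d'(1)] UV by simp_all
  show "smooth_on (c ` U) (\<lambda>x. frechet_derivative (d \<circ> inv_into V c) (at x)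
      (((\<lambda>q. dfun A c q (X q)) \<circ> inv_into V c) x))"
    using smooth_fun_chart_rep[OF at c U(1) X] U smooth_on_linear[OF linear_ident op(1)]
      smooth_fun_chart_rep[OF at c d'(1) smooth_fun_chart[OF at d]]
    by (intro smooth_on_derivative_apply[OF op]) (auto simp: UV comp_def)
  show "dfun A d q (X q) = frechet_derivative (d \<circ> inv_into V c) (at (c q))
      (((\<lambda>q. dfun A c q (X q)) \<circ> inv_into V c) (c q))" if "q \<in> U" for q
    using dfun_chart_rep[OF at c d'(1) _ _ smooth_fun_chart[OF at d], of q] that U c'(2) by (simp add: subset_iff)
qed

lemma smooth_vf_chart_iff:
  assumes at: "smooth_atlas A" and c: "smooth_atlas (insert (V, c) A)" and U: "open U" "U \<subseteq> V"
  shows "smooth_vf A U X \<longleftrightarrow> smooth_fun A U (\<lambda>q. dfun A c q (X q))"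
proof
  assume X: "smooth_vf A U X"
  show "smooth_fun A U (\<lambda>q. dfun A c q (X q))"
  proof (rule smooth_fun_local[OF at U(1)])
    fix p assume p: "p \<in> U"
    obtain W d where d: "(W, d) \<in> A" "p \<in> W" "open W" using atlas_chart_at[OF at] by metis
    then have "insert (W, d) A = A" by auto
    then have "smooth_fun A (U \<inter> W) (\<lambda>q. dfun A c q (X q))"
      using smooth_fun_dfun_chart_change[OF at, of W d V c "U \<inter> W"] at c U d X
      unfolding smooth_vf_def by fastforce
    then show "\<exists>U'. open U' \<and> p \<in> U' \<and> smooth_fun A U' (\<lambda>q. dfun A c q (X q))"
      using U d p by (intro exI[of _ "U \<inter> W"]) auto
  qed
next
  assume X: "smooth_fun A U (\<lambda>q. dfun A c q (X q))"
  show "smooth_vf A U X"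
    unfolding smooth_vf_def
  proof clarify
    fix W d assume d: "(W, d) \<in> A"
    then have "insert (W, d) A = A" by auto
    moreover have "open W" by (rule atlas_chart(1)[OF at d])
    ultimately show "smooth_fun A (U \<inter> W) (\<lambda>q. dfun A d q (X q))"
      using smooth_fun_dfun_chart_change[OF at c, of W d "U \<inter> W"] at U smooth_fun_subset[OF X]
      by (simp add: open_Int le_infI1)
  qed
qed

lemma smooth_vf_chartD:
  assumes "smooth_atlas A" "smooth_atlas (insert (V, c) A)" "open U" "smooth_vf A U X"
  shows "smooth_fun A (U \<inter> V) (\<lambda>q. dfun A c q (X q))"
  using smooth_vf_chart_iff[OF assms(1,2), of "U \<inter> V" X] smooth_vf_subset[OF assms(4)]
    compatible_chart(1)[OF assms(2)] assms(3) by auto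

lemma smooth_vf_coord_field:
  assumes "smooth_atlas A" "smooth_atlas (insert (V, c) A)"
  shows "smooth_vf A V (coord_field A c w)"
  unfolding smooth_vf_chart_iff[OF assms compatible_chart(1)[OF assms(2)] order_refl]
  by (rule smooth_fun_cong[OF assms(1) compatible_chart(1)[OF assms(2)] smooth_fun_const])
    (simp add: dfun_coord_field[OF assms])

lemma smooth_vf_add:
  fixes X :: "'m::{t2_space, second_countable_topology} \<Rightarrow> 'e::euclidean_space"
  assumes at: "smooth_atlas A" and U: "open U" and X: "smooth_vf A U X" "smooth_vf A U Y"
  shows "smooth_vf A U (\<lambda>q. X q + Y q)"
  unfolding smooth_vf_def
proof clarify
  fix V c assume Vc: "(V, c) \<in> A"
  then have A: "insert (V, c) A = A" by auto
  note c = compatible_chart(1)[of V c A, unfolded A, OF at] and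
    lin = dfun_chart_bij(1)[of A V c, unfolded A, OF at at]
  have UV: "open (U \<inter> V)" by (rule open_Int[OF U c])
  show "smooth_fun A (U \<inter> V) (\<lambda>q. dfun A c q (X q + Y q))"
  proof (rule smooth_fun_cong[OF at UV])
    show "smooth_fun A (U \<inter> V) (\<lambda>q. dfun A c q (X q) + dfun A c q (Y q))"
      using X Vc unfolding smooth_vf_def by (intro smooth_fun_add[OF at UV]) auto
  qed (simp add: linear_add[OF lin])
qed

lemma smooth_vf_scaleR:
  fixes X :: "'m::{t2_space, second_countable_topology} \<Rightarrow> 'e::euclidean_space"
  assumes at: "smooth_atlas A" and U: "open U" and f: "smooth_fun A U f" and X: "smooth_vf A U X"
  shows "smooth_vf A U (\<lambda>q. f q *\<^sub>R X q)"
  unfolding smooth_vf_def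
proof clarify
  fix V c assume Vc: "(V, c) \<in> A"
  then have A: "insert (V, c) A = A" by auto
  note c = compatible_chart(1)[of V c A, unfolded A, OF at] and
    lin = dfun_chart_bij(1)[of A V c, unfolded A, OF at at]
  have UV: "open (U \<inter> V)" by (rule open_Int[OF U c])
  show "smooth_fun A (U \<inter> V) (\<lambda>q. dfun A c q (f q *\<^sub>R X q))"
  proof (rule smooth_fun_cong[OF at UV])
    show "smooth_fun A (U \<inter> V) (\<lambda>q. f q *\<^sub>R dfun A c q (X q))"
      using X Vc smooth_fun_subset[OF f] unfolding smooth_vf_def
      by (intro smooth_fun_scaleR[OF at UV]) auto
  qed (simp add: linear_scale[OF lin])
qed

lemma smooth_vf_sum:
  fixes X :: "'i \<Rightarrow> 'm::{t2_space, second_countable_topology} \<Rightarrow> 'e::euclidean_space"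
  assumes "smooth_atlas A" "open U" "\<And>i. i \<in> I \<Longrightarrow> smooth_vf A U (X i)"
  shows "smooth_vf A U (\<lambda>q. \<Sum>i\<in>I. X i q)"
  using assms(3)
  by (induction I rule: infinite_finite_induct)
    (auto intro: smooth_vf_add[OF assms(1,2)] simp: smooth_vf_zero[OF assms(1,2)])

lemma smooth_vf_diff:
  fixes X :: "'m::{t2_space, second_countable_topology} \<Rightarrow> 'e::euclidean_space"
  assumes "smooth_atlas A" "open U" "smooth_vf A U X" "smooth_vf A U Y"
  shows "smooth_vf A U (\<lambda>q. X q - Y q)"
  using smooth_vf_add[OF assms(1-3) smooth_vf_scaleR[OF assms(1,2) smooth_fun_const[of A U "-1"] assms(4)]]
  by simp

lemma smooth_fun_dfun_apply:
  assumes at: "smooth_atlas A" and U: "open U" and f: "smooth_fun A U f" and X: "smooth_vf A U X"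
  shows "smooth_fun A U (\<lambda>q. dfun A f q (X q))"
proof (rule smooth_fun_local[OF at U])
  fix p assume p: "p \<in> U"
  obtain V c where Vc: "(V, c) \<in> A" "p \<in> V" "open V" using atlas_chart_at[OF at] by metis
  then have A: "insert (V, c) A = A" by auto
  have at': "smooth_atlas (insert (V, c) A)" using A at by simp
  note c = compatible_chart[OF at']
  have UV: "open (U \<inter> V)" "U \<inter> V \<inter> V = U \<inter> V" using U Vc by auto
  have "smooth_fun A (U \<inter> V) (\<lambda>q. dfun A f q (X q))"
  proof (rule smooth_fun_chartI[OF at at' UV(1)])
    have op: "open (c ` (U \<inter> V))" by (rule c(5)[OF U])
    show "smooth_on (c ` (U \<inter> V)) (\<lambda>x. frechet_derivative (f \<circ> inv_into V c) (at x)
        (((\<lambda>q. dfun A c q (X q)) \<circ> inv_into V c) x))"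
      using smooth_fun_chart_rep[OF at at' UV(1) smooth_vf_chartD[OF at at' U X]]
        smooth_on_linear[OF linear_ident op] smooth_fun_chart_rep[OF at at' U f]
      by (intro smooth_on_derivative_apply[OF op op]) (auto simp: UV comp_def)
    show "dfun A f q (X q) = frechet_derivative (f \<circ> inv_into V c) (at (c q))
        (((\<lambda>q. dfun A c q (X q)) \<circ> inv_into V c) (c q))" if "q \<in> U \<inter> V" for q
      using dfun_chart_rep[OF at at' U _ _ f, of q] that c by auto
  qed simp
  then show "\<exists>U'. open U' \<and> p \<in> U' \<and> smooth_fun A U' (\<lambda>q. dfun A f q (X q))"
    using UV p Vc by blast
qed

lemma smooth_fun_comp_map:
  assumes at: "smooth_atlas A" "smooth_atlas B" and \<rho>: "smooth_map A B U \<rho>" and U: "open U"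
    and k: "smooth_fun B N k" and N: "open N"
  shows "open (U \<inter> \<rho> -` N)" "smooth_fun A (U \<inter> \<rho> -` N) (k \<circ> \<rho>)"
proof -
  have cont: "continuous_on U \<rho>" using \<rho> unfolding smooth_map_def by blast
  have op: "open (U \<inter> \<rho> -` N)" if "open N" for N by (rule continuous_open_preimage[OF cont U that])
  show "open (U \<inter> \<rho> -` N)" by (rule op[OF N])
  show "smooth_fun A (U \<inter> \<rho> -` N) (k \<circ> \<rho>)"
  proof (rule smooth_fun_local[OF at(1) op[OF N]])
    fix p assume p: "p \<in> U \<inter> \<rho> -` N"
    obtain W d where d: "(W, d) \<in> B" "\<rho> p \<in> W" "open W" "inj_on d W"
      using atlas_chart_at[OF at(2)] by metis
    let ?U = "U \<inter> \<rho> -` (N \<inter> W)"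
    have oU: "open ?U" using N d by (intro op) auto
    have "smooth_fun A ?U (k \<circ> \<rho>)"
      unfolding smooth_fun_def
    proof clarify
      fix V c assume Vc: "(V, c) \<in> A"
      have c: "inj_on c V" by (rule atlas_chart(2)[OF at(1) Vc])
      have "smooth_fun A (U \<inter> \<rho> -` W) (d \<circ> \<rho>)" using \<rho> d unfolding smooth_map_def by fast
      then have "smooth_on (c ` (U \<inter> \<rho> -` W \<inter> V)) ((d \<circ> \<rho>) \<circ> inv_into V c)"
        using Vc unfolding smooth_fun_def by fast
      then have 1: "smooth_on (c ` (?U \<inter> V)) ((d \<circ> \<rho>) \<circ> inv_into V c)"
        by (rule smooth_on_subset) auto
      have 2: "smooth_on (d ` (N \<inter> W)) (k \<circ> inv_into W d)"
        using k d unfolding smooth_fun_def by fast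
      note oc = atlas_open_image[OF at(1) Vc oU]
      have "smooth_on (c ` (?U \<inter> V)) (\<lambda>x. (k \<circ> inv_into W d) (((d \<circ> \<rho>) \<circ> inv_into V c) x))"
        by (rule smooth_on_compose[OF oc atlas_open_image[OF at(2) d(1) N] 1 2]) (use c in auto)
      then show "smooth_on (c ` (?U \<inter> V)) ((k \<circ> \<rho>) \<circ> inv_into V c)"
        by (rule smooth_on_cong[OF oc]) (use c d in auto)
    qed
    then show "\<exists>U'. open U' \<and> p \<in> U' \<and> smooth_fun A U' (k \<circ> \<rho>)" using oU p d by blast
  qed
qed

text \<open>The chain rule for a map smooth on \<open>U\<close> only, as are the projections of a
  local product. It frees \<open>dmap\<close> from the chosen chart at the image point.\<close>

lemma dmap_chart:
  assumes at: "smooth_atlas A" "smooth_atlas B" and \<rho>: "smooth_map A B U \<rho>" and U: "open U" "p \<in> U"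
    and N: "open N" "\<rho> p \<in> N" and k: "smooth_fun B N k"
  shows "dfun A (k \<circ> \<rho>) p v = dfun B k (\<rho> p) (dmap A B \<rho> p v)"
proof -
  obtain V c where Vc: "chart_at A p = (V, c)" "(V, c) \<in> A" "p \<in> V" "inj_on c V"
      "inv_into V c (c p) = p"
    using atlas_chart_at[OF at(1)] by metis
  obtain W d where Wd: "chart_at B (\<rho> p) = (W, d)" "(W, d) \<in> B" "\<rho> p \<in> W" "open W" "inj_on d W"
    using atlas_chart_at[OF at(2)] by metis
  then have "insert (W, d) B = B" by auto
  then have dd: "smooth_fun B W d" using smooth_fun_chart[OF at(2), of W d] at(2) by simp
  note m = smooth_fun_comp_map[OF at \<rho> U(1) dd Wd(4)]
  have "(d \<circ> \<rho> \<circ> inv_into V c has_derivative dmap A B \<rho> p) (at (c p))"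
    unfolding dmap_def Wd(1) snd_conv
    by (rule dfun_has_derivative[OF at(1) m(1) _ m(2) Vc(1)]) (use Wd U in simp)
  moreover have "((k \<circ> inv_into W d) has_derivative dfun B k (\<rho> p))
      (at ((d \<circ> \<rho> \<circ> inv_into V c) (c p)))"
    using dfun_has_derivative[OF at(2) N k Wd(1)] Vc(5) by simp
  ultimately have "((k \<circ> inv_into W d) \<circ> (d \<circ> \<rho> \<circ> inv_into V c) has_derivative
      dfun B k (\<rho> p) \<circ> dmap A B \<rho> p) (at (c p))"
    by (rule diff_chain_at)
  then have "(k \<circ> \<rho> \<circ> inv_into V c has_derivative dfun B k (\<rho> p) \<circ> dmap A B \<rho> p) (at (c p))"
    by (rule has_derivative_transform_within_open[OF _ atlas_open_image[OF at(1) Vc(2) m(1)]])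
       (use Vc Wd U in auto)
  then show ?thesis using dfun_eqI[OF Vc(1)] by fastforce
qed

lemma dmap_linear_on:
  assumes at: "smooth_atlas A" "smooth_atlas B" and \<rho>: "smooth_map A B U \<rho>" and U: "open U" "p \<in> U"
  shows "linear (dmap A B \<rho> p)"
proof -
  obtain W d where Wd: "chart_at B (\<rho> p) = (W, d)" "(W, d) \<in> B" "\<rho> p \<in> W" "open W"
    using atlas_chart_at[OF at(2)] by metis
  then have "insert (W, d) B = B" by auto
  then have dd: "smooth_fun B W d" using smooth_fun_chart[OF at(2), of W d] at(2) by simp
  note m = smooth_fun_comp_map[OF at \<rho> U(1) dd Wd(4)]
  show ?thesis unfolding dmap_def Wd(1) snd_conv
    by (rule dfun_linear[OF at(1) m(1) _ m(2)]) (use U Wd in auto)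
qed

section \<open>Metric duals\<close>

lemma bilinear_expand_right:
  fixes b :: "'e::euclidean_space \<Rightarrow> 'e \<Rightarrow> real"
  assumes "bilinear b"
  shows "linear (b u)" "linear (\<lambda>u. b u v)"
  using assms unfolding bilinear_def by auto

text \<open>The Riesz representative of \<alpha> with respect to \<open>b\<close>. Written with an
  explicit inverse of the Gram map, so that smooth dependence on \<open>b\<close> and \<alpha>
  reduces to inverting a smooth family of linear maps.\<close>

definition sharp :: "('e::euclidean_space \<Rightarrow> 'e \<Rightarrow> real) \<Rightarrow> ('e \<Rightarrow> real) \<Rightarrow> 'e" where
  "sharp b \<alpha> = inv (\<lambda>z. \<Sum>i\<in>Basis. b z i *\<^sub>R i) (\<Sum>i\<in>Basis. \<alpha> i *\<^sub>R i)"

lemma bilinear_flat_bij: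
  fixes b :: "'e::euclidean_space \<Rightarrow> 'e \<Rightarrow> real"
  assumes b: "bilinear b" "\<And>v. v \<noteq> 0 \<Longrightarrow> b v v > 0" and L: "linear L" "bij L"
  shows "linear (\<lambda>z. \<Sum>i\<in>Basis. b (L z) (L i) *\<^sub>R i)" "bij (\<lambda>z. \<Sum>i\<in>Basis. b (L z) (L i) *\<^sub>R i)"
proof -
  let ?f = "\<lambda>z. \<Sum>i\<in>Basis. b (L z) (L i) *\<^sub>R i"
  show lin: "linear ?f"
    by (intro linearI)
      (simp_all add: linear_add[OF L(1)] linear_scale[OF L(1)] bilinear_ladd[OF b(1)]
        bilinear_lmul[OF b(1)] scaleR_add_left sum.distrib scaleR_sum_right)
  have "z = 0" if z: "?f z = 0" for z
  proof -
    have "b (L z) (L i) = 0" if "i \<in> Basis" for i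
    proof -
      have "?f z \<bullet> i = b (L z) (L i)"
        using that by (simp add: inner_sum_left inner_Basis if_distrib sum.delta cong: if_cong)
      then show ?thesis using z by simp
    qed
    then have "b (L z) (L z) = 0"
      using linear_euclidean_expand[OF linear_compose[OF L(1) bilinear_expand_right(1)[OF b(1), of "L z"]], of z]
      by (simp add: comp_def)
    then have "L z = 0" using b(2) by (metis less_irrefl)
    then show "z = 0" using L linear_0[OF L(1)] by (metis bij_pointE)
  qed
  then have "inj ?f" using linear_injective_0[OF lin] by blast
  then show "bij ?f" using linear_injective_imp_surjective[OF lin] by (simp add: bij_def)
qed

lemma sharp:
  fixes b :: "'e::euclidean_space \<Rightarrow> 'e \<Rightarrow> real"
  assumes b: "bilinear b" "\<And>v. v \<noteq> 0 \<Longrightarrow> b v v > 0" and \<alpha>: "linear \<alpha>"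
  shows "b (sharp b \<alpha>) v = \<alpha> v"
proof -
  let ?f = "\<lambda>z. \<Sum>i\<in>Basis. b z i *\<^sub>R i"
  have "bij ?f" using bilinear_flat_bij(2)[OF b linear_ident bij_id[unfolded id_def]] .
  then have f: "?f (sharp b \<alpha>) = (\<Sum>i\<in>Basis. \<alpha> i *\<^sub>R i)"
    unfolding sharp_def by (rule surj_f_inv_f[OF bij_is_surj])
  have "b (sharp b \<alpha>) i = \<alpha> i" if "i \<in> Basis" for i
    using that arg_cong[OF f, of "\<lambda>z. z \<bullet> i"]
    by (simp add: inner_sum_left inner_Basis if_distrib sum.delta cong: if_cong)
  then show ?thesis
    using linear_euclidean_expand[OF \<alpha>, of v]
      linear_euclidean_expand[OF bilinear_expand_right(1)[OF b(1)], of "sharp b \<alpha>" v] by simp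
qed

lemma bilinear_eqI:
  fixes b :: "'e::euclidean_space \<Rightarrow> 'e \<Rightarrow> real"
  assumes "bilinear b" "\<And>v. v \<noteq> 0 \<Longrightarrow> b v v > 0" "\<And>v. b u v = b w v"
  shows "u = w"
  using assms(2)[of "u - w"] assms(3)[of "u - w"] bilinear_lsub[OF assms(1), of u w "u - w"] by force

text \<open>Tested on local vector fields, in the same way as smoothness of a Riemannian
  metric.\<close>

definition smooth_form ::
  "('m::topological_space, 'e::real_normed_vector) chart set \<Rightarrow> 'm set \<Rightarrow> ('m \<Rightarrow> 'e \<Rightarrow> real) \<Rightarrow> bool" where
  "smooth_form A U \<alpha> \<longleftrightarrow> (\<forall>q\<in>U. linear (\<alpha> q)) \<and>
     (\<forall>U' Y. open U' \<and> U' \<subseteq> U \<and> smooth_vf A U' Y \<longrightarrow> smooth_fun A U' (\<lambda>q. \<alpha> q (Y q)))"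

lemma riemannian_manifoldD:
  assumes "riemannian_manifold A g"
  shows "smooth_atlas A" "bilinear (g p)" "g p u v = g p v u" "v \<noteq> 0 \<Longrightarrow> g p v v > 0"
    and "open U \<Longrightarrow> smooth_vf A U X \<Longrightarrow> smooth_vf A U Y \<Longrightarrow> smooth_fun A U (\<lambda>p. g p (X p) (Y p))"
  using assms unfolding riemannian_manifold_def by blast+

text \<open>In a fixed chart the components of the dual vector solve a linear system:
  \<open>L\<close> is the Gram matrix of the coordinate frame and \<open>a\<close> holds the values
  of the form on the frame. The solution is smooth by
  \<open>smooth_on_inv_linear_family\<close>.\<close>

lemma smooth_vf_sharp:
  assumes rm: "riemannian_manifold A g" and U: "open U" and \<alpha>: "smooth_form A U \<alpha>"
  shows "smooth_vf A U (\<lambda>q. sharp (g q) (\<alpha> q))"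
proof -
  note rmD = riemannian_manifoldD[OF rm]
  note at = rmD(1)
  show ?thesis
  proof (rule smooth_vf_local[OF at U])
    fix p assume p: "p \<in> U"
    obtain V c where Vc: "(V, c) \<in> A" "p \<in> V" "open V" using atlas_chart_at[OF at] by metis
    then have "insert (V, c) A = A" by auto
    then have ch: "smooth_atlas (insert (V, c) A)" using at by simp
    note c = compatible_chart[OF ch]
    let ?U = "U \<inter> V"
    have oU: "open ?U" "?U \<subseteq> V" using U Vc by auto
    have op: "open (c ` ?U)" by (rule c(5)[OF U])
    have UV: "?U \<inter> V = ?U" by blast
    let ?e = "coord_field A c"
    define L where "L = (\<lambda>x z. \<Sum>i\<in>Basis. g (inv_into V c x) (?e z (inv_into V c x)) (?e i (inv_into V c x)) *\<^sub>R i)"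
    define a where "a = (\<lambda>x. \<Sum>i\<in>Basis. \<alpha> (inv_into V c x) (?e i (inv_into V c x)) *\<^sub>R i)"
    have e: "smooth_vf A ?U (?e w)" for w
      by (rule smooth_vf_subset[OF smooth_vf_coord_field[OF at ch]]) simp
    have q: "inv_into V c x \<in> ?U" if "x \<in> c ` ?U" for x using that c(2) by auto
    have el: "linear (\<lambda>w. ?e w q)" "bij (\<lambda>w. ?e w q)" if "q \<in> V" for q
      using coord_field_linear[OF at ch that] bij_imp_bij_inv[OF dfun_chart_bij(2)[OF at ch that]]
      unfolding coord_field_def by auto
    have L: "linear (L x)" "bij (L x)" if "x \<in> c ` ?U" for x
      unfolding L_def
      using bilinear_flat_bij[OF rmD(2,4) el, of "inv_into V c x" "inv_into V c x"] q[OF that] by auto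
    have Ls: "smooth_on (c ` ?U) (\<lambda>x. L x z)" for z
    proof -
      have "smooth_fun A ?U (\<lambda>q. \<Sum>i\<in>Basis. g q (?e z q) (?e i q) *\<^sub>R i)"
        by (intro smooth_fun_sum[OF at oU(1)] smooth_fun_scaleR[OF at oU(1)] rmD(5)[OF oU(1)] e
            smooth_fun_const)
      from smooth_fun_chart_rep[OF at ch oU(1) this] show ?thesis
        unfolding UV L_def comp_def .
    qed
    have as: "smooth_on (c ` ?U) a"
    proof -
      have "smooth_fun A ?U (\<lambda>q. \<Sum>i\<in>Basis. \<alpha> q (?e i q) *\<^sub>R i)"
        using \<alpha> oU e unfolding smooth_form_def
        by (intro smooth_fun_sum[OF at oU(1)] smooth_fun_scaleR[OF at oU(1)] smooth_fun_const) auto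
      from smooth_fun_chart_rep[OF at ch oU(1) this] show ?thesis
        unfolding UV a_def comp_def .
    qed
    have "smooth_vf A ?U (\<lambda>q. sharp (g q) (\<alpha> q))"
      unfolding smooth_vf_chart_iff[OF at ch oU]
    proof (rule smooth_fun_chartI[OF at ch oU])
      show "smooth_on (c ` ?U) (\<lambda>x. inv (L x) (a x))"
        by (rule smooth_on_inv_linear_family[OF op L Ls as])
      fix q assume q: "q \<in> ?U"
      then have ci: "inv_into V c (c q) = q" "q \<in> V" "q \<in> U" using c(6) by auto
      let ?X = "sharp (g q) (\<alpha> q)"
      have "linear (\<alpha> q)" using \<alpha> ci unfolding smooth_form_def by blast
      note s = sharp[OF rmD(2,4) this]
      have "L (c q) (dfun A c q ?X) = a (c q)"
        by (simp add: L_def a_def ci dfun_coord_field(2)[OF at ch ci(2)] s)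
      moreover have "bij (L (c q))" using L(2) q by blast
      ultimately show "dfun A c q ?X = inv (L (c q)) (a (c q))"
        by (metis bij_inv_eq_iff)
    qed
    then show "\<exists>U'. open U' \<and> p \<in> U' \<and> smooth_vf A U' (\<lambda>q. sharp (g q) (\<alpha> q))"
      using oU p Vc by blast
  qed
qed

text \<open>The metric dual of this form is the lift of \<open>Y\<close> along \<rho>, both for a
  submersion and for a projection of a product. Smoothness comes from expanding the image of a field
  under the differential of \<rho> in the coordinate frame of a target chart.\<close>

lemma smooth_form_pullback:
  assumes at: "smooth_atlas A" and rm: "riemannian_manifold B h"
    and \<rho>: "smooth_map A B U \<rho>" and U: "open U" and N: "open N" "\<rho> ` U \<subseteq> N" and Y: "smooth_vf B N Y"
  shows "smooth_form A U (\<lambda>q u. h (\<rho> q) (Y (\<rho> q)) (dmap A B \<rho> q u))"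
proof -
  note rmD = riemannian_manifoldD[OF rm]
  note at' = rmD(1)
  show ?thesis
    unfolding smooth_form_def
  proof (intro conjI ballI allI impI, goal_cases)
    case (1 q)
    show ?case
      using linear_compose[OF dmap_linear_on[OF at at' \<rho> U 1] bilinear_expand_right(1)[OF rmD(2)]]
      by (simp add: comp_def)
  next
    case (2 U' X)
    then have U': "open U'" "U' \<subseteq> U" "smooth_vf A U' X" by auto
    show ?case
    proof (rule smooth_fun_local[OF at U'(1)])
      fix p assume p: "p \<in> U'"
      obtain W d where Wd: "(W, d) \<in> B" "\<rho> p \<in> W" "open W" using atlas_chart_at[OF at'] by metis
      then have "insert (W, d) B = B" by auto
      then have ch: "smooth_atlas (insert (W, d) B)" using at' by simp
      have oN: "open (N \<inter> W)" using N Wd by auto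
      let ?U = "U' \<inter> (U \<inter> \<rho> -` W)"
      have d: "smooth_fun B W d" by (rule smooth_fun_chart[OF at' ch])
      note m = smooth_fun_comp_map[OF at at' \<rho> U d Wd(3)]
      have oU: "open ?U" using U' m by auto
      let ?k = "\<lambda>b y. h y (Y y) (coord_field B d b y)"
      have k: "smooth_fun B (N \<inter> W) (?k b)" for b
        using smooth_vf_subset[OF Y] smooth_vf_subset[OF smooth_vf_coord_field[OF at' ch]]
        by (intro rmD(5)[OF oN]) auto
      have kr: "smooth_fun A ?U (?k b \<circ> \<rho>)" for b
        by (rule smooth_fun_subset[OF smooth_fun_comp_map(2)[OF at at' \<rho> U k oN]]) (use N U' in auto)
      have "smooth_fun A ?U (\<lambda>q. \<Sum>b\<in>Basis. (dfun A (d \<circ> \<rho>) q (X q) \<bullet> b) *\<^sub>R (?k b \<circ> \<rho>) q)"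
        using smooth_fun_subset[OF m(2), of ?U] smooth_vf_subset[OF U'(3), of ?U] kr
        by (intro smooth_fun_sum[OF at oU] smooth_fun_scaleR[OF at oU] smooth_fun_inner[OF at oU]
            smooth_fun_dfun_apply[OF at oU]) (auto simp: comp_def)
      then have "smooth_fun A ?U (\<lambda>q. h (\<rho> q) (Y (\<rho> q)) (dmap A B \<rho> q (X q)))"
      proof (rule smooth_fun_cong[OF at oU])
        fix q assume q: "q \<in> ?U"
        have "dmap A B \<rho> q (X q) = (\<Sum>b\<in>Basis. (dfun A (d \<circ> \<rho>) q (X q) \<bullet> b) *\<^sub>R coord_field B d b (\<rho> q))"
          using coord_field_expand[OF at' ch, of "\<rho> q" "dmap A B \<rho> q (X q)"] q
            dmap_chart[OF at at' \<rho> U _ Wd(3) _ d, of q] by simp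
        then show "(\<Sum>b\<in>Basis. (dfun A (d \<circ> \<rho>) q (X q) \<bullet> b) *\<^sub>R (?k b \<circ> \<rho>) q) =
            h (\<rho> q) (Y (\<rho> q)) (dmap A B \<rho> q (X q))"
          by (simp add: linear_sum[OF bilinear_expand_right(1)[OF rmD(2)]]
              linear_scale[OF bilinear_expand_right(1)[OF rmD(2)]])
      qed
      then show "\<exists>U'. open U' \<and> p \<in> U' \<and>
          smooth_fun A U' (\<lambda>q. h (\<rho> q) (Y (\<rho> q)) (dmap A B \<rho> q (X q)))"
        using oU p U' Wd by blast
    qed
  qed
qed

section \<open>The Levi-Civita connection\<close>

text \<open>The Lie bracket, for a torsion-free connection. Expressed through \<open>nabla\<close>
  it is a vector at once, and its action on functions is recovered in
  \<open>nabla_torsion\<close>.\<close>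

definition torsion_bracket ::
  "(('m \<Rightarrow> 'e) \<Rightarrow> ('m \<Rightarrow> 'e) \<Rightarrow> 'm \<Rightarrow> 'e::real_vector) \<Rightarrow> ('m \<Rightarrow> 'e) \<Rightarrow> ('m \<Rightarrow> 'e) \<Rightarrow> 'm \<Rightarrow> 'e" where
  "torsion_bracket nabla X Y p = nabla X Y p - nabla Y X p"

lemma dfun_const: "dfun A (\<lambda>q. k) p = (\<lambda>v. 0)"
  unfolding dfun_def by (simp add: comp_def frechet_derivative_const case_prod_unfold)

locale levi_civita_manifold =
  fixes A :: "('m::{t2_space, second_countable_topology}, 'e::euclidean_space) chart set"
    and g :: "'m \<Rightarrow> 'e \<Rightarrow> 'e \<Rightarrow> real" and nabla
  assumes rm: "riemannian_manifold A g" and lc: "levi_civita A g nabla"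
begin

abbreviation brk where "brk \<equiv> torsion_bracket nabla"

lemmas at = riemannian_manifoldD(1)[OF rm]
  and g_bilinear = riemannian_manifoldD(2)[OF rm]
  and g_sym = riemannian_manifoldD(3)[OF rm]
  and g_pos = riemannian_manifoldD(4)[OF rm]
  and g_smooth = riemannian_manifoldD(5)[OF rm]

lemmas g_add_left = bilinear_ladd[OF g_bilinear]
  and g_add_right = bilinear_radd[OF g_bilinear]
  and g_diff_left = bilinear_lsub[OF g_bilinear]
  and g_scale_left = bilinear_lmul[OF g_bilinear]
  and g_scale_right = bilinear_rmul[OF g_bilinear]
  and g_zero_left = bilinear_lzero[OF g_bilinear]
  and g_zero_right = bilinear_rzero[OF g_bilinear]

lemma g_nondegenerate: "(\<And>v. g p u v = g p w v) \<Longrightarrow> u = w"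
  using bilinear_eqI[OF g_bilinear g_pos] .

lemma con: "affine_connection A nabla"
  using lc unfolding levi_civita_def by blast

lemma nabla_metric:
  assumes "open U" "p \<in> U" "smooth_vf A U X" "smooth_vf A U Y" "smooth_vf A U Z"
  shows "dfun A (\<lambda>q. g q (Y q) (Z q)) p (X p) = g p (nabla X Y p) (Z p) + g p (Y p) (nabla X Z p)"
  using lc assms unfolding levi_civita_def by blast

lemma nabla_torsion:
  fixes f :: "'m \<Rightarrow> real"
  assumes "open U" "p \<in> U" "smooth_vf A U X" "smooth_vf A U Y" "smooth_fun A U f"
  shows "dfun A f p (brk X Y p) =
    dfun A (\<lambda>q. dfun A f q (Y q)) p (X p) - dfun A (\<lambda>q. dfun A f q (X q)) p (Y p)"
  using lc assms linear_diff[OF dfun_linear[OF at assms(1,2,5)]]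
  unfolding levi_civita_def torsion_bracket_def by simp

lemma nabla_add_left:
  assumes "open U" "p \<in> U" "smooth_vf A U X" "smooth_vf A U X'" "smooth_vf A U Y"
  shows "nabla (\<lambda>q. X q + X' q) Y p = nabla X Y p + nabla X' Y p"
  by (rule affine_connectionD(1)[OF con assms assms(5) smooth_fun_const])

lemma nabla_scale_left:
  assumes "open U" "p \<in> U" "smooth_fun A U f" "smooth_vf A U X" "smooth_vf A U Y"
  shows "nabla (\<lambda>q. f q *\<^sub>R X q) Y p = f p *\<^sub>R nabla X Y p"
  by (rule affine_connectionD(2)[OF con assms(1,2,4,4,5,5,3)])

lemma nabla_add_right:
  assumes "open U" "p \<in> U" "smooth_vf A U X" "smooth_vf A U Y" "smooth_vf A U Y'"
  shows "nabla X (\<lambda>q. Y q + Y' q) p = nabla X Y p + nabla X Y' p"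
  by (rule affine_connectionD(3)[OF con assms(1,2,3,3,4,5) smooth_fun_const])

lemma nabla_scale_right:
  assumes "open U" "p \<in> U" "smooth_fun A U f" "smooth_vf A U X" "smooth_vf A U Y"
  shows "nabla X (\<lambda>q. f q *\<^sub>R Y q) p = dfun A f p (X p) *\<^sub>R Y p + f p *\<^sub>R nabla X Y p"
  by (rule affine_connectionD(4)[OF con assms(1,2,4,4,5,5,3)])

lemmas nabla_local = connection_local[OF at con]
lemmas nabla_zero_right = connection_zero_right[OF at con]

lemma nabla_zero_left:
  assumes "open U" "p \<in> U" "smooth_vf A U Y"
  shows "nabla (\<lambda>q. 0) Y p = 0"
  using nabla_scale_left[OF assms(1,2) smooth_fun_const[of A U 0] smooth_vf_zero[OF at assms(1)] assms(3)]
  by simp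

lemma nabla_sum_left:
  assumes U: "open U" "p \<in> U" and I: "finite I"
    and "\<And>i. i \<in> I \<Longrightarrow> smooth_fun A U (f i)" "\<And>i. i \<in> I \<Longrightarrow> smooth_vf A U (X i)" "smooth_vf A U Y"
  shows "nabla (\<lambda>q. \<Sum>i\<in>I. f i q *\<^sub>R X i q) Y p = (\<Sum>i\<in>I. f i p *\<^sub>R nabla (X i) Y p)"
  using I assms(4,5)
proof (induction I)
  case empty
  then show ?case using nabla_zero_left[OF U assms(6)] by simp
next
  case (insert i I)
  have "smooth_vf A U (\<lambda>q. \<Sum>i\<in>I. f i q *\<^sub>R X i q)" "smooth_vf A U (\<lambda>q. f i q *\<^sub>R X i q)"
    using insert.prems by (auto intro!: smooth_vf_sum[OF at U(1)] smooth_vf_scaleR[OF at U(1)])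
  then show ?case
    using insert nabla_add_left[OF U, of "\<lambda>q. f i q *\<^sub>R X i q" "\<lambda>q. \<Sum>i\<in>I. f i q *\<^sub>R X i q" Y] assms(6)
      nabla_scale_left[OF U, of "f i" "X i" Y] by simp
qed

text \<open>Expanded in a coordinate frame, \<open>nabla X Y p\<close> is a combination of
  derivatives along frame fields whose coefficients are the components of
  \<open>X p\<close>.\<close>

lemma nabla_tensorial:
  assumes U: "open U" "p \<in> U" and X: "smooth_vf A U X" "smooth_vf A U X'" and Y: "smooth_vf A U Y"
    and eq: "X p = X' p"
  shows "nabla X Y p = nabla X' Y p"
proof -
  obtain V c where Vc: "(V, c) \<in> A" "p \<in> V" "open V" using atlas_chart_at[OF at] by metis
  then have "insert (V, c) A = A" by auto
  then have ch: "smooth_atlas (insert (V, c) A)" using at by simp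
  let ?U = "U \<inter> V"
  have oU: "open ?U" "p \<in> ?U" using U Vc by auto
  have ex: "nabla X Y p = (\<Sum>b\<in>Basis. (dfun A c p (X p) \<bullet> b) *\<^sub>R nabla (coord_field A c b) Y p)"
    if X: "smooth_vf A U X" for X
  proof -
    have s: "smooth_fun A ?U (\<lambda>q. dfun A c q (X q) \<bullet> b)" "smooth_vf A ?U (coord_field A c b)" for b
      using smooth_fun_inner[OF at oU(1) smooth_vf_chartD[OF at ch U(1) X]]
        smooth_vf_subset[OF smooth_vf_coord_field[OF at ch]] by auto
    have Y': "smooth_vf A ?U Y" "smooth_vf A ?U X" by (auto intro: smooth_vf_subset[OF X] smooth_vf_subset[OF Y])
    have "nabla X Y p = nabla (\<lambda>q. \<Sum>b\<in>Basis. (dfun A c q (X q) \<bullet> b) *\<^sub>R coord_field A c b q) Y p"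
      by (rule nabla_local[OF oU Y'(2) _ Y'(1,1)])
        (use s in \<open>auto intro!: smooth_vf_sum[OF at oU(1)] smooth_vf_scaleR[OF at oU(1)]
          coord_field_expand[OF at ch]\<close>)
    then show ?thesis using nabla_sum_left[OF oU finite_Basis s Y'(1)] by simp
  qed
  show ?thesis unfolding ex[OF X(1)] ex[OF X(2)] eq ..
qed

lemma g_dfun_cong:
  assumes "open U" "p \<in> U" "\<And>q. q \<in> U \<Longrightarrow> g q (X q) (Y q) = k q"
  shows "dfun A (\<lambda>q. g q (X q) (Y q)) p = dfun A k p"
  using dfun_cong[OF at assms(1,2), of k "\<lambda>q. g q (X q) (Y q)"] assms(3) by simp

lemma koszul:
  assumes U: "open U" "p \<in> U" and XYZ: "smooth_vf A U X" "smooth_vf A U Y" "smooth_vf A U Z"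
  shows "2 * g p (nabla X Y p) (Z p) =
    dfun A (\<lambda>q. g q (Y q) (Z q)) p (X p) + dfun A (\<lambda>q. g q (X q) (Z q)) p (Y p) -
    dfun A (\<lambda>q. g q (X q) (Y q)) p (Z p) +
    g p (brk X Y p) (Z p) - g p (brk X Z p) (Y p) - g p (brk Y Z p) (X p)"
  unfolding nabla_metric[OF U XYZ] nabla_metric[OF U XYZ(2,1,3)] nabla_metric[OF U XYZ(3,1,2)]
    torsion_bracket_def g_diff_left
  using g_sym by (smt (verit))

text \<open>The torsion identity concerns real functions; on the coordinate functions of
  \<open>c\<close> it becomes the classical coordinate formula for the bracket.\<close>

lemma dfun_chart_bracket:
  assumes ch: "smooth_atlas (insert (V, c) A)" and U: "open U" "p \<in> U" "p \<in> V"
    and X: "smooth_vf A U X" and Y: "smooth_vf A U Y"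
  shows "dfun A c p (brk X Y p) =
    dfun A (\<lambda>q. dfun A c q (Y q)) p (X p) - dfun A (\<lambda>q. dfun A c q (X q)) p (Y p)"
proof (rule euclidean_eqI)
  fix b :: 'e assume "b \<in> Basis"
  have V: "open V" by (rule compatible_chart(1)[OF ch])
  let ?U = "U \<inter> V"
  have oU: "open ?U" "p \<in> ?U" using U V by auto
  have c: "smooth_fun A ?U c" by (rule smooth_fun_subset[OF smooth_fun_chart[OF at ch]]) simp
  have X': "smooth_vf A ?U X" "smooth_vf A ?U Y" by (auto intro: smooth_vf_subset[OF X] smooth_vf_subset[OF Y])
  have in1: "dfun A (\<lambda>q. c q \<bullet> b) q v = dfun A c q v \<bullet> b" if "q \<in> ?U" for q v
    by (rule dfun_inner[OF at oU(1) that c])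
  have in2: "dfun A (\<lambda>q. dfun A (\<lambda>q. c q \<bullet> b) q (Z q)) p v = dfun A (\<lambda>q. dfun A c q (Z q)) p v \<bullet> b"
    if Z: "smooth_vf A ?U Z" for Z v
  proof -
    have "dfun A (\<lambda>q. dfun A (\<lambda>q. c q \<bullet> b) q (Z q)) p = dfun A (\<lambda>q. dfun A c q (Z q) \<bullet> b) p"
      by (rule dfun_cong[OF at oU]) (simp add: in1)
    then show ?thesis
      using dfun_inner[OF at oU smooth_fun_dfun_apply[OF at oU(1) c Z]] by simp
  qed
  show "dfun A c p (brk X Y p) \<bullet> b =
      (dfun A (\<lambda>q. dfun A c q (Y q)) p (X p) - dfun A (\<lambda>q. dfun A c q (X q)) p (Y p)) \<bullet> b"
    using nabla_torsion[OF oU X' smooth_fun_inner[OF at oU(1) c], of b]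
    by (simp add: in1[OF oU(2)] in2[OF X'(1)] in2[OF X'(2)] inner_diff_left)
qed

end

text \<open>Related fields act compatibly on functions pulled back from the target, hence so do
  their commutators, and the coordinate functions of one target chart determine a vector. Used for
  \<pi> and for both projections of a local product.\<close>

lemma bracket_related:
  assumes M: "levi_civita_manifold A g nabla" and N: "levi_civita_manifold B h nablaN"
    and \<rho>: "smooth_map A B U \<rho>" and U: "open U" "p \<in> U" and O': "open O'" "\<rho> ` U \<subseteq> O'"
    and X: "smooth_vf A U X" "smooth_vf A U X'" and Y: "smooth_vf B O' Y" "smooth_vf B O' Y'"
    and rel: "\<And>q. q \<in> U \<Longrightarrow> dmap A B \<rho> q (X q) = Y (\<rho> q)" "\<And>q. q \<in> U \<Longrightarrow> dmap A B \<rho> q (X' q) = Y' (\<rho> q)"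
  shows "dmap A B \<rho> p (torsion_bracket nabla X X' p) = torsion_bracket nablaN Y Y' (\<rho> p)"
proof -
  interpret M: levi_civita_manifold A g nabla by (rule M)
  interpret N: levi_civita_manifold B h nablaN by (rule N)
  obtain W d where Wd: "(W, d) \<in> B" "\<rho> p \<in> W" "open W" using atlas_chart_at[OF N.at] by metis
  then have "insert (W, d) B = B" by auto
  then have ch: "smooth_atlas (insert (W, d) B)" using N.at by simp
  have d: "smooth_fun B W d" by (rule smooth_fun_chart[OF N.at ch])
  let ?W = "O' \<inter> W" and ?U = "U \<inter> \<rho> -` (O' \<inter> W)"
  have oW: "open ?W" "\<rho> p \<in> ?W" using O' Wd U by auto
  have Y': "smooth_vf B ?W Y" "smooth_vf B ?W Y'" by (auto intro: smooth_vf_subset[OF Y(1)] smooth_vf_subset[OF Y(2)])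
  have "dfun B d (\<rho> p) (dmap A B \<rho> p (torsion_bracket nabla X X' p)) \<bullet> b =
      dfun B d (\<rho> p) (torsion_bracket nablaN Y Y' (\<rho> p)) \<bullet> b" for b
  proof -
    define k where "k = (\<lambda>y. d y \<bullet> b)"
    have k: "smooth_fun B ?W k" unfolding k_def
      by (intro smooth_fun_inner[OF N.at oW(1)] smooth_fun_subset[OF d]) simp
    note m = smooth_fun_comp_map[OF M.at N.at \<rho> U(1) k oW(1)]
    have oU: "open ?U" "p \<in> ?U" using m(1) U oW by auto
    have X'': "smooth_vf A ?U X" "smooth_vf A ?U X'" by (auto intro: smooth_vf_subset[OF X(1)] smooth_vf_subset[OF X(2)])
    have step: "dfun A (\<lambda>q. dfun A (k \<circ> \<rho>) q (Z q)) p (Z' p) =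
        dfun B (\<lambda>y. dfun B k y (E y)) (\<rho> p) (E' (\<rho> p))"
      if "smooth_vf B ?W E" "\<And>q. q \<in> U \<Longrightarrow> dmap A B \<rho> q (Z q) = E (\<rho> q)"
        "\<And>q. q \<in> U \<Longrightarrow> dmap A B \<rho> q (Z' q) = E' (\<rho> q)" for Z Z' E E'
    proof -
      have "dfun A (k \<circ> \<rho>) q (Z q) = ((\<lambda>y. dfun B k y (E y)) \<circ> \<rho>) q" if "q \<in> ?U" for q
        using dmap_chart[OF M.at N.at \<rho> U(1) _ oW(1) _ k, of q] that \<open>\<And>q. q \<in> U \<Longrightarrow> dmap A B \<rho> q (Z q) = E (\<rho> q)\<close>
        by simp
      then have "dfun A (\<lambda>q. dfun A (k \<circ> \<rho>) q (Z q)) p = dfun A ((\<lambda>y. dfun B k y (E y)) \<circ> \<rho>) p"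
        using dfun_cong[OF M.at oU, of "(\<lambda>y. dfun B k y (E y)) \<circ> \<rho>" "\<lambda>q. dfun A (k \<circ> \<rho>) q (Z q)"]
        by metis
      then have "dfun A (\<lambda>q. dfun A (k \<circ> \<rho>) q (Z q)) p (Z' p) =
          dfun A ((\<lambda>y. dfun B k y (E y)) \<circ> \<rho>) p (Z' p)" by simp
      also have "\<dots> =
          dfun B (\<lambda>y. dfun B k y (E y)) (\<rho> p) (dmap A B \<rho> p (Z' p))"
        by (rule dmap_chart[OF M.at N.at \<rho> U oW smooth_fun_dfun_apply[OF N.at oW(1) k that(1)]])
      finally show ?thesis using that(3)[OF U(2)] by simp
    qed
    have "dfun B k (\<rho> p) (dmap A B \<rho> p (torsion_bracket nabla X X' p)) =
        dfun A (k \<circ> \<rho>) p (torsion_bracket nabla X X' p)"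
      by (rule dmap_chart[OF M.at N.at \<rho> U oW k, symmetric])
    also have "\<dots> = dfun B k (\<rho> p) (torsion_bracket nablaN Y Y' (\<rho> p))"
      unfolding M.nabla_torsion[OF oU X'' m(2)] N.nabla_torsion[OF oW Y' k]
      by (subst (1 2) step) (use rel Y' in auto)
    finally show ?thesis
      unfolding k_def using dfun_inner[OF N.at Wd(3,2) d, of b] by simp
  qed
  then have "dfun B d (\<rho> p) (dmap A B \<rho> p (torsion_bracket nabla X X' p)) =
      dfun B d (\<rho> p) (torsion_bracket nablaN Y Y' (\<rho> p))"
    by (metis vector_eq_rdot)
  then show ?thesis using dfun_chart_bij(2)[OF N.at ch Wd(2)] by (meson bij_is_inj injD)
qed

section \<open>Riemannian submersions\<close>

lemma oproj_eqI:
  fixes b :: "'e::euclidean_space \<Rightarrow> 'e \<Rightarrow> real"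
  assumes "bilinear b" "\<And>v. v \<noteq> 0 \<Longrightarrow> b v v > 0" "subspace D" "w \<in> D" "\<And>z. z \<in> D \<Longrightarrow> b (u - w) z = 0"
  shows "oproj b D u = w"
  unfolding oproj_def
proof (rule the_equality)
  show "w \<in> D \<and> (\<forall>z\<in>D. b (u - w) z = 0)" using assms by blast
  fix w' assume w': "w' \<in> D \<and> (\<forall>z\<in>D. b (u - w') z = 0)"
  then have d: "w' - w \<in> D" using assms subspace_diff by blast
  have "b (w' - w) (w' - w) = b (u - w) (w' - w) - b (u - w') (w' - w)"
    by (simp flip: bilinear_lsub[OF assms(1)])
  then have "b (w' - w) (w' - w) = 0" using w' assms(5) d by simp
  then show "w' = w" using assms(2) by (metis eq_iff_diff_eq_0 less_irrefl)
qed

locale submersion =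
  M: levi_civita_manifold A g nabla + N: levi_civita_manifold B h nablaN
  for A :: "('m::{t2_space, second_countable_topology}, 'e::euclidean_space) chart set" and g nabla
    and B :: "('n::{t2_space, second_countable_topology}, 'f::euclidean_space) chart set" and h nablaN +
  fixes \<pi> :: "'m \<Rightarrow> 'n"
  assumes sub: "riemannian_submersion A g B h \<pi>"
begin

abbreviation d\<pi> where "d\<pi> \<equiv> dmap A B \<pi>"
abbreviation ver where "ver \<equiv> vert A B \<pi>"
abbreviation hor where "hor \<equiv> horiz A g B \<pi>"
abbreviation V where "V \<equiv> vproj A g B \<pi>"
abbreviation H where "H \<equiv> hproj A g B \<pi>"

lemma smooth_pi: "smooth_map A B UNIV \<pi>"
  using sub unfolding riemannian_submersion_def by blast

lemma open_vimage_pi: "open O' \<Longrightarrow> open (\<pi> -` O')"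
  using smooth_pi unfolding smooth_map_def by (simp add: continuous_on_open_vimage)

lemma linear_dpi: "linear (d\<pi> q)"
  by (rule dmap_linear[OF M.at N.at smooth_pi])

lemma surj_dpi: "surj (d\<pi> q)"
  using sub unfolding riemannian_submersion_def by blast

lemma isometry_hor: "u \<in> hor q \<Longrightarrow> v \<in> hor q \<Longrightarrow> h (\<pi> q) (d\<pi> q u) (d\<pi> q v) = g q u v"
  using sub unfolding riemannian_submersion_def by blast

lemma ver_iff: "v \<in> ver q \<longleftrightarrow> d\<pi> q v = 0"
  by (simp add: vert_def)

lemma hor_iff: "u \<in> hor q \<longleftrightarrow> (\<forall>v\<in>ver q. g q u v = 0)"
  by (simp add: horiz_def ocomp_def)

lemma subspace_ver: "subspace (ver q)"
  unfolding vert_def by (rule linear_subspace_kernel[OF linear_dpi])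

lemma subspace_hor: "subspace (hor q)"
  unfolding horiz_def ocomp_def subspace_def
  by (simp add: M.g_zero_left M.g_add_left M.g_scale_left)

lemma hor_ver: "u \<in> hor q \<Longrightarrow> v \<in> ver q \<Longrightarrow> g q u v = 0" "u \<in> hor q \<Longrightarrow> v \<in> ver q \<Longrightarrow> g q v u = 0"
  using M.g_sym by (auto simp: hor_iff)

lemma hor_ver_zero: "u \<in> hor q \<Longrightarrow> u \<in> ver q \<Longrightarrow> u = 0"
  using hor_ver M.g_pos by (metis less_irrefl)

text \<open>The adjoint of \<open>d\<pi>\<close> with respect to the two metrics. Taken as a metric
  dual it is smooth without further work; that it is the horizontal lift is \<open>hlift_hor\<close>
  and \<open>dpi_hlift\<close>.\<close>

definition hlift :: "'m \<Rightarrow> 'f \<Rightarrow> 'e" where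
  "hlift q w = sharp (g q) (\<lambda>u. h (\<pi> q) w (d\<pi> q u))"

lemma g_hlift: "g q (hlift q w) u = h (\<pi> q) w (d\<pi> q u)"
  unfolding hlift_def
  by (rule sharp[OF M.g_bilinear M.g_pos])
    (use linear_compose[OF linear_dpi bilinear_expand_right(1)[OF N.g_bilinear]] in \<open>simp_all add: comp_def\<close>)

lemma hlift_hor: "hlift q w \<in> hor q"
  by (simp add: hor_iff g_hlift ver_iff N.g_zero_right)

lemma linear_hlift: "linear (hlift q)"
proof (rule linearI)
  show "hlift q (w + w') = hlift q w + hlift q w'" for w w'
    by (rule M.g_nondegenerate[of q]) (simp add: g_hlift M.g_add_left N.g_add_left)
  show "hlift q (c *\<^sub>R w) = c *\<^sub>R hlift q w" for c w
    by (rule M.g_nondegenerate[of q]) (simp add: g_hlift M.g_scale_left N.g_scale_left)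
qed

text \<open>Positivity makes \<open>d\<pi> q \<circ> hlift q\<close> injective, hence surjective on
  the tangent space of the base. For lifted vectors the isometry and the adjoint property then give
  the same inner products for \<open>d\<pi> q (hlift q w)\<close> and \<open>w\<close> against every
  vector.\<close>

lemma dpi_hlift: "d\<pi> q (hlift q w) = w"
proof -
  have "w = 0" if "d\<pi> q (hlift q w) = 0" for w
  proof -
    have "hlift q w = 0" using hor_ver_zero[OF hlift_hor] that ver_iff by blast
    then have "h (\<pi> q) w (d\<pi> q u) = 0" for u using g_hlift[of q w u] by (simp add: M.g_zero_left)
    then have "h (\<pi> q) w w = 0" using surj_dpi by (metis surjD)
    then show "w = 0" using N.g_pos by (metis less_irrefl)
  qed
  then have "inj (d\<pi> q \<circ> hlift q)"
    using linear_injective_0[OF linear_compose[OF linear_hlift linear_dpi]] by (metis comp_apply)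
  then have surj: "surj (d\<pi> q \<circ> hlift q)"
    using linear_injective_imp_surjective[OF linear_compose[OF linear_hlift linear_dpi]] by simp
  show ?thesis
  proof (rule N.g_nondegenerate[of "\<pi> q"])
    fix v
    obtain w' where "v = d\<pi> q (hlift q w')" using surj by (metis comp_apply surjD)
    then show "h (\<pi> q) (d\<pi> q (hlift q w)) v = h (\<pi> q) w v"
      using isometry_hor[OF hlift_hor hlift_hor, of q w w'] g_hlift by simp
  qed
qed

lemma ver_part: "u - hlift q (d\<pi> q u) \<in> ver q"
  by (simp add: ver_iff linear_diff[OF linear_dpi] dpi_hlift)

lemma H_eq: "H q u = hlift q (d\<pi> q u)"
  unfolding hproj_def
  by (rule oproj_eqI[OF M.g_bilinear M.g_pos subspace_hor hlift_hor])
    (auto intro: hor_ver(2)[OF _ ver_part])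

lemma V_eq: "V q u = u - hlift q (d\<pi> q u)"
  unfolding vproj_def
  by (rule oproj_eqI[OF M.g_bilinear M.g_pos subspace_ver ver_part])
    (auto intro: hor_ver(1)[OF hlift_hor])

lemma V_plus_H: "V q u + H q u = u" "H q u + V q u = u" by (simp_all add: H_eq V_eq)

lemma V_ver: "V q u \<in> ver q" by (simp add: V_eq ver_part)

lemma H_hor: "H q u \<in> hor q" by (simp add: H_eq hlift_hor)

lemma dpi_H: "d\<pi> q (H q u) = d\<pi> q u" by (simp add: H_eq dpi_hlift)

lemma V_of_ver: "v \<in> ver q \<Longrightarrow> V q v = v" "v \<in> ver q \<Longrightarrow> H q v = 0"
  by (simp_all add: V_eq H_eq ver_iff linear_0[OF linear_hlift])

lemma V_of_hor: "u \<in> hor q \<Longrightarrow> V q u = 0" "u \<in> hor q \<Longrightarrow> H q u = u"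
proof -
  assume u: "u \<in> hor q"
  have "V q u \<in> hor q" unfolding V_eq by (rule subspace_diff[OF subspace_hor u hlift_hor])
  then show "V q u = 0" using hor_ver_zero V_ver by blast
  then show "H q u = u" using V_plus_H(1)[of q u] by simp
qed

lemma H_zero_iff: "H q u = 0 \<longleftrightarrow> d\<pi> q u = 0"
  by (metis H_eq dpi_hlift linear_0 linear_dpi linear_hlift)

lemma V_zero_iff: "V q u = 0 \<longleftrightarrow> (\<forall>v\<in>ver q. g q u v = 0)"
  using V_of_hor(1) hor_iff V_plus_H(1)[of q u] H_hor[of q u] by (metis add_0)

lemma linear_H: "linear (H q)"
  using linear_compose[OF linear_dpi linear_hlift, of q q] by (simp add: H_eq[abs_def] comp_def)

lemma linear_V: "linear (V q)"
  using linear_compose_sub[OF linear_ident linear_compose[OF linear_dpi linear_hlift], of q q]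
  by (simp add: V_eq[abs_def] comp_def)

lemma hlift_of_hor: "u \<in> hor q \<Longrightarrow> hlift q (d\<pi> q u) = u"
  using V_of_hor(2) H_eq by metis

lemma smooth_vf_hlift:
  assumes N: "open N" and Y: "smooth_vf B N Y"
  shows "smooth_vf A (\<pi> -` N) (\<lambda>q. hlift q (Y (\<pi> q)))"
proof -
  have op: "open (\<pi> -` N)" by (rule open_vimage_pi[OF N])
  have "smooth_map A B (\<pi> -` N) \<pi>"
    using smooth_pi unfolding smooth_map_def
    by (auto intro: continuous_on_subset smooth_fun_subset)
  from smooth_vf_sharp[OF M.rm op smooth_form_pullback[OF M.at N.rm this op N _ Y]]
  show ?thesis unfolding hlift_def by auto
qed

lemma basic_on_hlift:
  assumes "open N" "smooth_vf B N Y"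
  shows "basic_on A g B \<pi> (\<pi> -` N) (\<lambda>q. hlift q (Y (\<pi> q)))"
  unfolding basic_on_def using smooth_vf_hlift[OF assms] hlift_hor assms
  by (auto simp: dpi_hlift intro!: exI[of _ N] exI[of _ Y])

lemma smooth_fun_pi:
  assumes "open N" "smooth_fun B N k"
  shows "smooth_fun A (\<pi> -` N) (k \<circ> \<pi>)"
  using smooth_fun_comp_map(2)[OF M.at N.at smooth_pi open_UNIV assms(2,1)] by simp

lemma dfun_pi:
  assumes "open N" "\<pi> q \<in> N" "smooth_fun B N k"
  shows "dfun A (k \<circ> \<pi>) q v = dfun B k (\<pi> q) (d\<pi> q v)"
  using dmap_chart[OF M.at N.at smooth_pi open_UNIV UNIV_I assms] .

lemma base_chart:
  obtains W d where "open W" "\<pi> p \<in> W" "smooth_atlas (insert (W, d) B)" "(W, d) \<in> B"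
    "smooth_fun B W d" "open (\<pi> -` W)" "smooth_fun A (\<pi> -` W) (d \<circ> \<pi>)"
    "\<And>q v. q \<in> \<pi> -` W \<Longrightarrow> d\<pi> q v = (\<Sum>b\<in>Basis. (dfun A (d \<circ> \<pi>) q v \<bullet> b) *\<^sub>R coord_field B d b (\<pi> q))"
    "\<And>q v. q \<in> \<pi> -` W \<Longrightarrow> dfun A (d \<circ> \<pi>) q v = dfun B d (\<pi> q) (d\<pi> q v)"
    "\<And>w. smooth_vf A (\<pi> -` W) (\<lambda>q. hlift q (coord_field B d w (\<pi> q)))"
proof -
  obtain W d where Wd: "(W, d) \<in> B" "\<pi> p \<in> W" "open W" using atlas_chart_at[OF N.at] by metis
  then have "insert (W, d) B = B" by auto
  then have ch: "smooth_atlas (insert (W, d) B)" using N.at by simp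
  have d: "smooth_fun B W d" by (rule smooth_fun_chart[OF N.at ch])
  have eq: "dfun A (d \<circ> \<pi>) q v = dfun B d (\<pi> q) (d\<pi> q v)" if "q \<in> \<pi> -` W" for q v
    by (rule dfun_pi[OF Wd(3) _ d]) (use that in simp)
  show ?thesis
  proof (rule that[OF Wd(3,2) ch Wd(1) d open_vimage_pi[OF Wd(3)] smooth_fun_pi[OF Wd(3) d]])
    show "d\<pi> q v = (\<Sum>b\<in>Basis. (dfun A (d \<circ> \<pi>) q v \<bullet> b) *\<^sub>R coord_field B d b (\<pi> q))"
      if "q \<in> \<pi> -` W" for q v
      unfolding eq[OF that] using coord_field_expand[OF N.at ch] that by simp
    show "smooth_vf A (\<pi> -` W) (\<lambda>q. hlift q (coord_field B d w (\<pi> q)))" for w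
      by (rule smooth_vf_hlift[OF Wd(3) smooth_vf_coord_field[OF N.at ch]])
  qed (rule eq)
qed

text \<open>The horizontal part is the lift of the projected vector. In a coordinate frame of the
  base it is a combination, with smooth coefficients, of the smooth lifts of the frame
  fields.\<close>

lemma smooth_H:
  assumes U: "open U" and X: "smooth_vf A U X"
  shows "smooth_vf A U (\<lambda>q. H q (X q))"
proof (rule smooth_vf_local[OF M.at U])
  fix p assume p: "p \<in> U"
  show "\<exists>U'. open U' \<and> p \<in> U' \<and> smooth_vf A U' (\<lambda>q. H q (X q))"
  proof (rule base_chart[of p])
    fix W d
    assume W: "\<pi> p \<in> W" "open (\<pi> -` W)" "smooth_fun A (\<pi> -` W) (d \<circ> \<pi>)"
      and ex: "\<And>q v. q \<in> \<pi> -` W \<Longrightarrow> d\<pi> q v = (\<Sum>b\<in>Basis. (dfun A (d \<circ> \<pi>) q v \<bullet> b) *\<^sub>R coord_field B d b (\<pi> q))"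
      and sm: "\<And>w. smooth_vf A (\<pi> -` W) (\<lambda>q. hlift q (coord_field B d w (\<pi> q)))"
    let ?U = "U \<inter> \<pi> -` W"
    have oU: "open ?U" "p \<in> ?U" using U W p by auto
    have "smooth_vf A ?U (\<lambda>q. \<Sum>b\<in>Basis. (dfun A (d \<circ> \<pi>) q (X q) \<bullet> b) *\<^sub>R
        hlift q (coord_field B d b (\<pi> q)))"
      by (intro smooth_vf_sum[OF M.at oU(1)] smooth_vf_scaleR[OF M.at oU(1)]
          smooth_fun_inner[OF M.at oU(1)] smooth_fun_dfun_apply[OF M.at oU(1)]
          smooth_fun_subset[OF W(3)] smooth_vf_subset[OF X] smooth_vf_subset[OF sm]) auto
    then have "smooth_vf A ?U (\<lambda>q. H q (X q))"
      by (rule smooth_vf_cong[OF M.at oU(1)])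
        (simp add: H_eq ex linear_sum[OF linear_hlift] linear_scale[OF linear_hlift])
    then show ?thesis using oU by blast
  qed
qed

lemma smooth_V:
  assumes U: "open U" and X: "smooth_vf A U X"
  shows "smooth_vf A U (\<lambda>q. V q (X q))"
  using smooth_vf_diff[OF M.at U X smooth_H[OF assms]] by (simp add: V_eq H_eq)

lemma vertical_extension:
  assumes v: "v \<in> ver p"
  obtains U Z where "open U" "p \<in> U" "vertical_on A B \<pi> U Z" "Z p = v"
proof -
  obtain C c where Cc: "(C, c) \<in> A" "p \<in> C" "open C" using atlas_chart_at[OF M.at] by metis
  then have "insert (C, c) A = A" by auto
  then have ch: "smooth_atlas (insert (C, c) A)" using M.at by simp
  let ?Z = "\<lambda>q. V q (coord_field A c (dfun A c p v) q)"
  show ?thesis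
  proof (rule that[OF Cc(3,2)])
    show "vertical_on A B \<pi> C ?Z"
      unfolding vertical_on_def
      using smooth_V[OF Cc(3) smooth_vf_coord_field[OF M.at ch]] V_ver by blast
    show "?Z p = v" using dfun_coord_field(2)[OF M.at ch Cc(2)] V_of_ver(1)[OF v] by simp
  qed
qed

lemma basic_extension:
  assumes v: "v \<in> hor p"
  obtains N E where "open N" "\<pi> p \<in> N" "smooth_vf B N E" "E (\<pi> p) = d\<pi> p v"
    "basic_on A g B \<pi> (\<pi> -` N) (\<lambda>q. hlift q (E (\<pi> q)))" "hlift p (E (\<pi> p)) = v" "open (\<pi> -` N)"
proof -
  obtain W d where Wd: "(W, d) \<in> B" "\<pi> p \<in> W" "open W" using atlas_chart_at[OF N.at] by metis
  then have "insert (W, d) B = B" by auto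
  then have ch: "smooth_atlas (insert (W, d) B)" using N.at by simp
  let ?E = "coord_field B d (dfun B d (\<pi> p) (d\<pi> p v))"
  have E: "?E (\<pi> p) = d\<pi> p v" by (rule dfun_coord_field(2)[OF N.at ch Wd(2)])
  show ?thesis
    by (rule that[OF Wd(3,2) smooth_vf_coord_field[OF N.at ch] E basic_on_hlift[OF Wd(3)
            smooth_vf_coord_field[OF N.at ch]] _ open_vimage_pi[OF Wd(3)]])
      (simp add: E hlift_of_hor[OF v])
qed

text \<open>The fibres are totally geodesic.\<close>

definition vertical_parallel :: bool where
  "vertical_parallel \<longleftrightarrow> (\<forall>U W Z. open U \<and> vertical_on A B \<pi> U W \<and> vertical_on A B \<pi> U Z \<longrightarrow>
     (\<forall>p\<in>U. H p (nabla W Z p) = 0))"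

text \<open>The horizontal distribution is integrable with totally geodesic leaves. Basic fields
  suffice because every horizontal vector extends to one, see
  \<open>basic_extension\<close>.\<close>

definition horizontal_parallel :: bool where
  "horizontal_parallel \<longleftrightarrow> (\<forall>U \<xi> \<eta>. open U \<and> basic_on A g B \<pi> U \<xi> \<and> basic_on A g B \<pi> U \<eta> \<longrightarrow>
     (\<forall>p\<in>U. V p (nabla \<xi> \<eta> p) = 0))"

lemma nabla_sum_right:
  assumes U: "open U" "p \<in> U" and I: "finite I"
    and "\<And>i. i \<in> I \<Longrightarrow> smooth_fun A U (f i)" "\<And>i. i \<in> I \<Longrightarrow> smooth_vf A U (Y i)" "smooth_vf A U X"
  shows "nabla X (\<lambda>q. \<Sum>i\<in>I. f i q *\<^sub>R Y i q) p =
    (\<Sum>i\<in>I. dfun A (f i) p (X p) *\<^sub>R Y i p + f i p *\<^sub>R nabla X (Y i) p)"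
  using I assms(4,5)
proof (induction I)
  case empty
  then show ?case using M.nabla_zero_right[OF U assms(6)] by simp
next
  case (insert i I)
  have "smooth_vf A U (\<lambda>q. \<Sum>i\<in>I. f i q *\<^sub>R Y i q)" "smooth_vf A U (\<lambda>q. f i q *\<^sub>R Y i q)"
    using insert.prems by (auto intro!: smooth_vf_sum[OF M.at U(1)] smooth_vf_scaleR[OF M.at U(1)])
  then show ?case
    using insert M.nabla_add_right[OF U assms(6), of "\<lambda>q. f i q *\<^sub>R Y i q" "\<lambda>q. \<Sum>i\<in>I. f i q *\<^sub>R Y i q"]
      M.nabla_scale_right[OF U, of "f i" X "Y i"] assms(6) by simp
qed

lemma vertical_smooth: "vertical_on A B \<pi> U Z \<Longrightarrow> smooth_vf A U Z"
  and vertical_ver: "vertical_on A B \<pi> U Z \<Longrightarrow> q \<in> U \<Longrightarrow> Z q \<in> ver q"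
  and basic_smooth: "basic_on A g B \<pi> U \<xi> \<Longrightarrow> smooth_vf A U \<xi>"
  and basic_hor: "basic_on A g B \<pi> U \<xi> \<Longrightarrow> q \<in> U \<Longrightarrow> \<xi> q \<in> hor q"
  unfolding vertical_on_def basic_on_def by blast+

lemma vertical_subset: "vertical_on A B \<pi> U Z \<Longrightarrow> U' \<subseteq> U \<Longrightarrow> vertical_on A B \<pi> U' Z"
  unfolding vertical_on_def using smooth_vf_subset by blast

lemma basic_subset:
  assumes "basic_on A g B \<pi> U \<xi>" "U' \<subseteq> U"
  shows "basic_on A g B \<pi> U' \<xi>"
proof -
  obtain N Y where "open N" "\<pi> ` U \<subseteq> N" "smooth_vf B N Y" "\<forall>p\<in>U. d\<pi> p (\<xi> p) = Y (\<pi> p)"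
    using assms(1) unfolding basic_on_def by blast
  then have "open N \<and> \<pi> ` U' \<subseteq> N \<and> smooth_vf B N Y \<and> (\<forall>p\<in>U'. d\<pi> p (\<xi> p) = Y (\<pi> p))"
    using assms(2) by blast
  then show ?thesis using assms unfolding basic_on_def by (blast intro: smooth_vf_subset)
qed

text \<open>A vertical field is \<pi>-related to the zero field and a basic one to a field on the
  base, so their bracket is related to a bracket with zero.\<close>

lemma dpi_bracket_vertical_basic:
  assumes U: "open U" "p \<in> U" and W: "vertical_on A B \<pi> U W" and \<xi>: "basic_on A g B \<pi> U \<xi>"
  shows "d\<pi> p (nabla W \<xi> p) = d\<pi> p (nabla \<xi> W p)"
proof -
  obtain N Y where N: "open N" "\<pi> ` U \<subseteq> N" "smooth_vf B N Y" "\<And>q. q \<in> U \<Longrightarrow> d\<pi> q (\<xi> q) = Y (\<pi> q)"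
    using \<xi> unfolding basic_on_def by blast
  have pN: "\<pi> p \<in> N" using N U by auto
  have "smooth_map A B U \<pi>"
    using smooth_pi unfolding smooth_map_def
    by (auto intro: continuous_on_subset smooth_fun_subset)
  from bracket_related[OF M.levi_civita_manifold_axioms N.levi_civita_manifold_axioms this U N(1,2)
      vertical_smooth[OF W] basic_smooth[OF \<xi>] smooth_vf_zero[OF N.at N(1)] N(3) _ N(4)]
  have "d\<pi> p (M.brk W \<xi> p) = N.brk (\<lambda>y. 0) Y (\<pi> p)"
    using vertical_ver[OF W] ver_iff by blast
  also have "\<dots> = 0"
    using N.nabla_zero_left[OF N(1) pN N(3)] N.nabla_zero_right[OF N(1) pN N(3)]
    by (simp add: torsion_bracket_def)
  finally show ?thesis by (simp add: torsion_bracket_def linear_diff[OF linear_dpi])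
qed

end

section \<open>Covariant derivatives of vertical fields and of horizontal lifts\<close>

context submersion
begin

lemma smooth_pi_on: "smooth_map A B U \<pi>"
  using smooth_pi unfolding smooth_map_def by (auto intro: continuous_on_subset smooth_fun_subset)

text \<open>For vertical \<open>X\<close> this is \<open>vertical_parallel\<close>. For horizontal
  \<open>X\<close>, replaced by a basic field with the same value at \<open>p\<close>, orthogonality
  of \<open>Z\<close> and a basic \<eta> moves the derivative to \<eta>, where
  \<open>horizontal_parallel\<close> applies.\<close>

lemma nabla_vertical_ver:
  assumes vp: vertical_parallel and hp: horizontal_parallel and U: "open U" "p \<in> U"
    and X: "smooth_vf A U X" and Z: "vertical_on A B \<pi> U Z"
  shows "d\<pi> p (nabla X Z p) = 0"
proof -
  note Zs = vertical_smooth[OF Z]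
  let ?X1 = "\<lambda>q. V q (X q)" and ?X2 = "\<lambda>q. H q (X q)"
  have X12: "smooth_vf A U ?X1" "smooth_vf A U ?X2" using smooth_V smooth_H U X by auto
  have "vertical_on A B \<pi> U ?X1" using X12 V_ver unfolding vertical_on_def by blast
  then have 1: "d\<pi> p (nabla ?X1 Z p) = 0"
    using vp U Z H_zero_iff unfolding vertical_parallel_def by blast
  obtain N E where N: "open N" "\<pi> p \<in> N" "open (\<pi> -` N)"
    and \<xi>: "basic_on A g B \<pi> (\<pi> -` N) (\<lambda>q. hlift q (E (\<pi> q)))" "hlift p (E (\<pi> p)) = ?X2 p"
    by (rule basic_extension[OF H_hor])
  let ?\<xi> = "\<lambda>q. hlift q (E (\<pi> q))"
  \<comment> \<open>The vector to be shown zero is itself extended to a basic field, so that the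
    metric identity ends in \<open>g p ?u ?u = 0\<close>.\<close>
  let ?u = "H p (nabla ?\<xi> Z p)"
  obtain N' E' where N': "open N'" "\<pi> p \<in> N'" "open (\<pi> -` N')"
    and \<eta>: "basic_on A g B \<pi> (\<pi> -` N') (\<lambda>q. hlift q (E' (\<pi> q)))" "hlift p (E' (\<pi> p)) = ?u"
    by (rule basic_extension[OF H_hor])
  let ?\<eta> = "\<lambda>q. hlift q (E' (\<pi> q))"
  let ?U = "U \<inter> (\<pi> -` N \<inter> \<pi> -` N')"
  have oU: "open ?U" "p \<in> ?U" using U N N' by auto
  have s: "smooth_vf A ?U Z" "smooth_vf A ?U ?X2"
    by (auto intro: smooth_vf_subset[OF Zs] smooth_vf_subset[OF X12(2)])
  have b: "basic_on A g B \<pi> ?U ?\<xi>" "basic_on A g B \<pi> ?U ?\<eta>"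
    by (auto intro: basic_subset[OF \<xi>(1)] basic_subset[OF \<eta>(1)])
  have "dfun A (\<lambda>q. g q (Z q) (?\<eta> q)) p = dfun A (\<lambda>q. 0) p"
    by (rule M.g_dfun_cong[OF oU]) (use vertical_ver[OF Z] hor_ver(2) hlift_hor in auto)
  then have "g p (nabla ?\<xi> Z p) (?\<eta> p) + g p (Z p) (nabla ?\<xi> ?\<eta> p) = 0"
    using M.nabla_metric[OF oU basic_smooth[OF b(1)] s(1) basic_smooth[OF b(2)]] by (simp add: dfun_const)
  moreover have "V p (nabla ?\<xi> ?\<eta> p) = 0"
    using hp b oU unfolding horizontal_parallel_def by blast
  then have "g p (Z p) (nabla ?\<xi> ?\<eta> p) = 0"
    using V_zero_iff vertical_ver[OF Z U(2)] M.g_sym by metis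
  ultimately have "g p (nabla ?\<xi> Z p) ?u = 0" using \<eta>(2) by simp
  moreover have "g p (V p (nabla ?\<xi> Z p)) ?u = 0" using hor_ver(2)[OF H_hor V_ver] .
  ultimately have "g p ?u ?u = 0"
    using V_plus_H(1)[of p "nabla ?\<xi> Z p"] M.g_add_left[of p "V p (nabla ?\<xi> Z p)" ?u ?u] by simp
  then have "?u = 0" using M.g_pos by (metis less_irrefl)
  then have "d\<pi> p (nabla ?\<xi> Z p) = 0" using H_zero_iff by blast
  moreover have "nabla ?X2 Z p = nabla ?\<xi> Z p"
    by (rule M.nabla_tensorial[OF oU s(2) basic_smooth[OF b(1)] s(1)]) (simp add: \<xi>(2))
  moreover have "nabla X Z p = nabla ?X1 Z p + nabla ?X2 Z p"
    using M.nabla_add_left[OF U X12 Zs] by (simp add: V_plus_H)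
  ultimately show ?thesis using 1 by (simp add: linear_add[OF linear_dpi])
qed

text \<open>Koszul's formula on both sides: inner products of lifts are inner products on the base
  composed with \<pi>, and brackets of lifts are \<pi>-related to brackets on the base, so
  corresponding terms agree.\<close>

lemma dpi_nabla_hlift:
  assumes N: "open N" "\<pi> p \<in> N" and Y: "smooth_vf B N Y" and E: "smooth_vf B N E"
  shows "d\<pi> p (nabla (\<lambda>q. hlift q (Y (\<pi> q))) (\<lambda>q. hlift q (E (\<pi> q))) p) = nablaN Y E (\<pi> p)"
proof (rule N.g_nondegenerate[of "\<pi> p"])
  fix v
  obtain W d where Wd: "(W, d) \<in> B" "\<pi> p \<in> W" "open W" using atlas_chart_at[OF N.at] by metis
  then have "insert (W, d) B = B" by auto
  then have ch: "smooth_atlas (insert (W, d) B)" using N.at by simp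
  define Z where "Z = coord_field B d (dfun B d (\<pi> p) v)"
  have Zp: "Z (\<pi> p) = v" unfolding Z_def by (rule dfun_coord_field(2)[OF N.at ch Wd(2)])
  let ?N = "N \<inter> W"
  have oN: "open ?N" "\<pi> p \<in> ?N" using N Wd by auto
  have sN: "smooth_vf B ?N Y" "smooth_vf B ?N E" "smooth_vf B ?N Z" unfolding Z_def
    by (auto intro: smooth_vf_subset[OF Y] smooth_vf_subset[OF E]
        smooth_vf_subset[OF smooth_vf_coord_field[OF N.at ch]])
  let ?L = "\<lambda>Y q. hlift q (Y (\<pi> q))"
  have oU: "open (\<pi> -` ?N)" "p \<in> \<pi> -` ?N" using open_vimage_pi[OF oN(1)] oN by auto
  note sM = sN[THEN smooth_vf_hlift[OF oN(1)]]
  have der: "dfun A (\<lambda>q. g q (?L Y1 q) (?L Y2 q)) p (?L Y3 p) =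
      dfun B (\<lambda>y. h y (Y1 y) (Y2 y)) (\<pi> p) (Y3 (\<pi> p))"
    if "smooth_vf B ?N Y1" "smooth_vf B ?N Y2" for Y1 Y2 Y3
  proof -
    have "(\<lambda>q. g q (?L Y1 q) (?L Y2 q)) = (\<lambda>y. h y (Y1 y) (Y2 y)) \<circ> \<pi>"
      by (simp add: fun_eq_iff g_hlift dpi_hlift)
    then show ?thesis
      using dfun_pi[OF oN N.g_smooth[OF oN(1) that], of "?L Y3 p"] by (simp add: dpi_hlift)
  qed
  have br: "g p (M.brk (?L Y1) (?L Y2) p) (?L Y3 p) = h (\<pi> p) (N.brk Y1 Y2 (\<pi> p)) (Y3 (\<pi> p))"
    if "smooth_vf B ?N Y1" "smooth_vf B ?N Y2" for Y1 Y2 Y3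
  proof -
    have "d\<pi> p (M.brk (?L Y1) (?L Y2) p) = N.brk Y1 Y2 (\<pi> p)"
      by (rule bracket_related[OF M.levi_civita_manifold_axioms N.levi_civita_manifold_axioms
            smooth_pi_on oU oN(1) _ smooth_vf_hlift[OF oN(1) that(1)] smooth_vf_hlift[OF oN(1) that(2)] that])
        (auto simp: dpi_hlift)
    then show ?thesis
      unfolding M.g_sym[of p "M.brk (?L Y1) (?L Y2) p" "?L Y3 p"] g_hlift
        N.g_sym[of "\<pi> p" "Y3 (\<pi> p)"] by simp
  qed
  have "2 * g p (nabla (?L Y) (?L E) p) (?L Z p) = 2 * h (\<pi> p) (nablaN Y E (\<pi> p)) (Z (\<pi> p))"
    unfolding M.koszul[OF oU sM] N.koszul[OF oN sN]
    by (simp add: der br sN)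
  then have "g p (?L Z p) (nabla (?L Y) (?L E) p) = h (\<pi> p) (nablaN Y E (\<pi> p)) v"
    using M.g_sym[of p "?L Z p" "nabla (?L Y) (?L E) p"] Zp by simp
  then show "h (\<pi> p) (d\<pi> p (nabla (?L Y) (?L E) p)) v = h (\<pi> p) (nablaN Y E (\<pi> p)) v"
    unfolding g_hlift Zp N.g_sym[of "\<pi> p" v] .
qed

lemma smooth_section_dpi:
  assumes U: "open U" and X: "smooth_vf A U X"
  shows "smooth_section_along A B \<pi> U (\<lambda>q. d\<pi> q (X q))"
  unfolding smooth_section_along_def
proof clarify
  fix W d assume Wd: "(W, d) \<in> B"
  then have "insert (W, d) B = B" by auto
  then have ch: "smooth_atlas (insert (W, d) B)" using N.at by simp
  have oW: "open W" by (rule atlas_chart(1)[OF N.at Wd])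
  have d: "smooth_fun B W d" by (rule smooth_fun_chart[OF N.at ch])
  have oU: "open (U \<inter> \<pi> -` W)" using U open_vimage_pi[OF oW] by auto
  have "smooth_fun A (U \<inter> \<pi> -` W) (\<lambda>q. dfun A (d \<circ> \<pi>) q (X q))"
    by (intro smooth_fun_dfun_apply[OF M.at oU] smooth_fun_subset[OF smooth_fun_pi[OF oW d]]
        smooth_vf_subset[OF X]) auto
  then show "smooth_fun A (U \<inter> \<pi> -` W) (\<lambda>q. dfun B d (\<pi> q) (d\<pi> q (X q)))"
    by (rule smooth_fun_cong[OF M.at oU]) (use dfun_pi[OF oW _ d] in auto)
qed

lemma smooth_section_comp:
  assumes N: "open N" and Y: "smooth_vf B N Y" and U: "open U" "U \<subseteq> \<pi> -` N"
  shows "smooth_section_along A B \<pi> U (Y \<circ> \<pi>)"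
  unfolding smooth_section_along_def
proof clarify
  fix W d assume Wd: "(W, d) \<in> B"
  have oW: "open W" by (rule atlas_chart(1)[OF N.at Wd])
  have "smooth_fun B (N \<inter> W) (\<lambda>y. dfun B d y (Y y))" using Y Wd unfolding smooth_vf_def by blast
  then have "smooth_fun A (\<pi> -` (N \<inter> W)) ((\<lambda>y. dfun B d y (Y y)) \<circ> \<pi>)"
    by (rule smooth_fun_pi[OF open_Int[OF N oW]])
  then have "smooth_fun A (U \<inter> \<pi> -` W) ((\<lambda>y. dfun B d y (Y y)) \<circ> \<pi>)"
    by (rule smooth_fun_subset) (use U in auto)
  then show "smooth_fun A (U \<inter> \<pi> -` W) (\<lambda>q. dfun B d (\<pi> q) ((Y \<circ> \<pi>) q))" by (simp add: comp_def)
qed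

lemma smooth_section_combine:
  assumes U: "open U" and f: "smooth_fun A U f" and s: "smooth_section_along A B \<pi> U s"
    and s': "smooth_section_along A B \<pi> U s'"
  shows "smooth_section_along A B \<pi> U (\<lambda>q. f q *\<^sub>R s q + s' q)"
  unfolding smooth_section_along_def
proof clarify
  fix W d assume Wd: "(W, d) \<in> B"
  then have "insert (W, d) B = B" by auto
  then have ch: "smooth_atlas (insert (W, d) B)" using N.at by simp
  have oW: "open W" by (rule atlas_chart(1)[OF N.at Wd])
  have oU: "open (U \<inter> \<pi> -` W)" using U open_vimage_pi[OF oW] by auto
  have "smooth_fun A (U \<inter> \<pi> -` W) (\<lambda>q. f q *\<^sub>R dfun B d (\<pi> q) (s q) + dfun B d (\<pi> q) (s' q))"
    using s s' Wd unfolding smooth_section_along_def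
    by (intro smooth_fun_add[OF M.at oU] smooth_fun_scaleR[OF M.at oU] smooth_fun_subset[OF f]) auto
  then show "smooth_fun A (U \<inter> \<pi> -` W) (\<lambda>q. dfun B d (\<pi> q) (f q *\<^sub>R s q + s' q))"
    by (rule smooth_fun_cong[OF M.at oU])
      (use dfun_chart_bij(1)[OF N.at ch] in \<open>simp add: linear_add linear_scale\<close>)
qed

lemma smooth_section_cong:
  assumes U: "open U" and s: "smooth_section_along A B \<pi> U s" and eq: "\<And>q. q \<in> U \<Longrightarrow> s q = s' q"
  shows "smooth_section_along A B \<pi> U s'"
  unfolding smooth_section_along_def
proof clarify
  fix W d assume Wd: "(W, d) \<in> B"
  have oW: "open W" by (rule atlas_chart(1)[OF N.at Wd])
  have oU: "open (U \<inter> \<pi> -` W)" using U open_vimage_pi[OF oW] by auto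
  show "smooth_fun A (U \<inter> \<pi> -` W) (\<lambda>q. dfun B d (\<pi> q) (s' q))"
    by (rule smooth_fun_cong[OF M.at oU, of "\<lambda>q. dfun B d (\<pi> q) (s q)"])
      (use s Wd eq in \<open>auto simp: smooth_section_along_def\<close>)
qed

lemma smooth_section_zero:
  assumes "open U"
  shows "smooth_section_along A B \<pi> U (\<lambda>q. 0)"
  using smooth_section_cong[OF assms smooth_section_dpi[OF assms smooth_vf_zero[OF M.at assms]]]
  by (simp add: linear_0[OF linear_dpi])

end

section \<open>Totally geodesic maps and parallel distributions\<close>

locale pullback_submersion = submersion +
  fixes nablaP
  assumes pc: "pullback_connection A B \<pi> nablaN nablaP"
begin

lemma
  assumes "open U" "p \<in> U" "smooth_vf A U X" "smooth_section_along A B \<pi> U s"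
    "smooth_section_along A B \<pi> U s'" "smooth_fun A U (f :: 'a \<Rightarrow> real)"
  shows nablaP_add: "nablaP X (\<lambda>q. s q + s' q) p = nablaP X s p + nablaP X s' p"
    and nablaP_scale: "nablaP X (\<lambda>q. f q *\<^sub>R s q) p = dfun A f p (X p) *\<^sub>R s p + f p *\<^sub>R nablaP X s p"
  using pc[unfolded pullback_connection_def, THEN conjunct2, THEN conjunct1, rule_format,
      of U X X s s' f p] assms by blast+

lemma nablaP_comp:
  assumes "open U" "smooth_vf A U X" "p \<in> U" "open N" "smooth_vf B N Y" "smooth_vf B N Z" "\<pi> p \<in> N"
    "Y (\<pi> p) = d\<pi> p (X p)"
  shows "nablaP X (Z \<circ> \<pi>) p = nablaN Y Z (\<pi> p)"
  using pc[unfolded pullback_connection_def, THEN conjunct2, THEN conjunct2, rule_format,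
      of U X p N Y Z] assms by blast

lemma nablaP_zero:
  assumes U: "open U" "p \<in> U" and X: "smooth_vf A U X" and s: "\<And>q. q \<in> U \<Longrightarrow> s q = 0"
  shows "nablaP X s p = 0"
proof -
  \<comment> \<open>Zero on \<open>U\<close> and one elsewhere: \<open>f\<close> is smooth on
    \<open>U\<close>, and \<open>f q *\<^sub>R s q\<close> equals \<open>s q\<close> at every point,
    also where \<open>s\<close> is arbitrary. The Leibniz rule at \<open>p\<close> therefore gives
    zero.\<close>
  define f :: "'a \<Rightarrow> real" where "f = (\<lambda>q. if q \<in> U then 0 else 1)"
  have f: "smooth_fun A U f"
    using smooth_fun_cong[OF M.at U(1) smooth_fun_const[of A U 0], of f] by (simp add: f_def)
  have ss: "smooth_section_along A B \<pi> U s"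
    by (rule smooth_section_cong[OF U(1) smooth_section_zero[OF U(1)]]) (simp add: s)
  have "(\<lambda>q. f q *\<^sub>R s q) = s" by (auto simp: f_def s fun_eq_iff)
  moreover have "s p = 0" "f p = 0" using s U by (auto simp: f_def)
  ultimately show ?thesis using nablaP_scale[OF U X ss ss f] by simp
qed

lemma nablaP_local:
  assumes U: "open U" "p \<in> U" and X: "smooth_vf A U X" and s: "smooth_section_along A B \<pi> U s"
    and eq: "\<And>q. q \<in> U \<Longrightarrow> s q = s' q"
  shows "nablaP X s' p = nablaP X s p"
proof -
  have d: "smooth_section_along A B \<pi> U (\<lambda>q. s' q - s q)"
    by (rule smooth_section_cong[OF U(1) smooth_section_zero[OF U(1)]]) (simp add: eq)
  have "nablaP X (\<lambda>q. s q + (s' q - s q)) p = nablaP X s p + nablaP X (\<lambda>q. s' q - s q) p"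
    by (rule nablaP_add[OF U X s d smooth_fun_const])
  then show ?thesis using nablaP_zero[OF U X, of "\<lambda>q. s' q - s q"] eq by simp
qed

lemma nablaP_sum:
  assumes U: "open U" "p \<in> U" and I: "finite I" and X: "smooth_vf A U X"
    and "\<And>i. i \<in> I \<Longrightarrow> smooth_fun A U (f i)" "\<And>i. i \<in> I \<Longrightarrow> smooth_section_along A B \<pi> U (s i)"
  shows "smooth_section_along A B \<pi> U (\<lambda>q. \<Sum>i\<in>I. f i q *\<^sub>R s i q) \<and>
    nablaP X (\<lambda>q. \<Sum>i\<in>I. f i q *\<^sub>R s i q) p =
    (\<Sum>i\<in>I. dfun A (f i) p (X p) *\<^sub>R s i p + f i p *\<^sub>R nablaP X (s i) p)"
  using I assms(5,6)
proof (induction I)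
  case empty
  then show ?case using nablaP_zero[OF U X, of "\<lambda>q. 0"] smooth_section_zero[OF U(1)] by simp
next
  case (insert i I)
  then have IH: "smooth_section_along A B \<pi> U (\<lambda>q. \<Sum>i\<in>I. f i q *\<^sub>R s i q)"
    "nablaP X (\<lambda>q. \<Sum>i\<in>I. f i q *\<^sub>R s i q) p =
      (\<Sum>i\<in>I. dfun A (f i) p (X p) *\<^sub>R s i p + f i p *\<^sub>R nablaP X (s i) p)"
    and fi: "smooth_fun A U (f i)" and si: "smooth_section_along A B \<pi> U (s i)" by auto
  have 1: "smooth_section_along A B \<pi> U (\<lambda>q. f i q *\<^sub>R s i q)"
    using smooth_section_combine[OF U(1) fi si smooth_section_zero[OF U(1)]] by simp
  show ?case
    using insert(1,2) IH(2) smooth_section_combine[OF U(1) fi si IH(1)]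
      nablaP_add[OF U X 1 IH(1) fi] nablaP_scale[OF U X si si fi] by simp
qed

text \<open>For vertical \<open>Z\<close> the section \<open>d\<pi> q (Z q)\<close> vanishes, so the
  hypothesis becomes \<open>d\<pi> p (nabla X Z p) = 0\<close> for every \<open>X\<close>. Vertical
  \<open>X\<close> settles the fibres; basic \<open>X\<close> settles the horizontal part by
  differentiating \<open>g q (\<eta> q) (Z q) = 0\<close>.\<close>

lemma totally_geodesic_imp_parallel:
  assumes tg: "totally_geodesic_map A B \<pi> nabla nablaP"
  shows vertical_parallel horizontal_parallel
proof -
  have ver: "d\<pi> p (nabla X Z p) = 0"
    if U: "open U" "p \<in> U" and X: "smooth_vf A U X" and Z: "vertical_on A B \<pi> U Z" for U p X Z
  proof -
    have "nablaP X (\<lambda>q. d\<pi> q (Z q)) p = 0"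
      by (rule nablaP_zero[OF U X]) (use vertical_ver[OF Z] ver_iff in blast)
    then show ?thesis
      using tg U X vertical_smooth[OF Z] unfolding totally_geodesic_map_def by force
  qed
  show vertical_parallel
    unfolding vertical_parallel_def using ver vertical_smooth H_zero_iff by blast
  show horizontal_parallel
    unfolding horizontal_parallel_def
  proof (intro allI impI ballI)
    fix U \<xi> \<eta> p
    assume "open U \<and> basic_on A g B \<pi> U \<xi> \<and> basic_on A g B \<pi> U \<eta>" and p: "p \<in> U"
    then have U: "open U" and b: "basic_on A g B \<pi> U \<xi>" "basic_on A g B \<pi> U \<eta>" by auto
    show "V p (nabla \<xi> \<eta> p) = 0"
      unfolding V_zero_iff
    proof
      fix v assume "v \<in> ver p"
      then obtain U' Z where Z: "open U'" "p \<in> U'" "vertical_on A B \<pi> U' Z" "Z p = v"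
        by (rule vertical_extension)
      let ?U = "U \<inter> U'"
      have oU: "open ?U" "p \<in> ?U" using U p Z by auto
      have Z': "vertical_on A B \<pi> ?U Z" by (rule vertical_subset[OF Z(3)]) simp
      have s: "smooth_vf A ?U \<xi>" "smooth_vf A ?U \<eta>"
        by (auto intro: smooth_vf_subset basic_smooth[OF b(1)] basic_smooth[OF b(2)])
      have "dfun A (\<lambda>q. g q (\<eta> q) (Z q)) p = dfun A (\<lambda>q. 0) p"
        by (rule M.g_dfun_cong[OF oU]) (use vertical_ver[OF Z'] basic_hor[OF b(2)] hor_ver(1) in auto)
      then have "g p (nabla \<xi> \<eta> p) v + g p (\<eta> p) (nabla \<xi> Z p) = 0"
        using M.nabla_metric[OF oU s vertical_smooth[OF Z']] Z(4) by (simp add: dfun_const)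
      moreover have "nabla \<xi> Z p \<in> ver p" using ver[OF oU s(1) Z'] ver_iff by blast
      ultimately show "g p (nabla \<xi> \<eta> p) v = 0" using hor_ver(1) basic_hor[OF b(2) p] by force
    qed
  qed
qed

text \<open>\<open>Y\<close> is split into its vertical part and a combination of lifts of a
  coordinate frame of the base. The derivatives of the coefficients occur equally in both
  connections, which leaves a comparison for a single lift; there \<open>X\<close> is split as well,
  its horizontal part treated by \<open>dpi_nabla_hlift\<close>.\<close>

lemma parallel_imp_totally_geodesic:
  assumes vp: vertical_parallel and hp: horizontal_parallel
  shows "totally_geodesic_map A B \<pi> nabla nablaP"
  unfolding totally_geodesic_map_def
proof (intro allI impI ballI)
  fix U X Y p assume "open U \<and> smooth_vf A U X \<and> smooth_vf A U Y" and p: "p \<in> U"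
  then have U: "open U" and X: "smooth_vf A U X" and Y: "smooth_vf A U Y" by auto
  show "nablaP X (\<lambda>q. d\<pi> q (Y q)) p - d\<pi> p (nabla X Y p) = 0"
  proof (rule base_chart[of p])
    fix W d
    assume W: "open W" "\<pi> p \<in> W" "smooth_atlas (insert (W, d) B)" "open (\<pi> -` W)"
        "smooth_fun A (\<pi> -` W) (d \<circ> \<pi>)"
      and ex: "\<And>q v. q \<in> \<pi> -` W \<Longrightarrow> d\<pi> q v = (\<Sum>b\<in>Basis. (dfun A (d \<circ> \<pi>) q v \<bullet> b) *\<^sub>R coord_field B d b (\<pi> q))"
    let ?U = "U \<inter> \<pi> -` W"
    have oU: "open ?U" "p \<in> ?U" using U W p by auto
    let ?E = "coord_field B d"
    let ?f = "\<lambda>b q. dfun A (d \<circ> \<pi>) q (Y q) \<bullet> b"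
    let ?\<eta> = "\<lambda>b q. hlift q (?E b (\<pi> q))"
    have E: "smooth_vf B W (?E w)" for w by (rule smooth_vf_coord_field[OF N.at W(3)])
    have X': "smooth_vf A ?U X" and Y': "smooth_vf A ?U Y"
      by (auto intro: smooth_vf_subset[OF X] smooth_vf_subset[OF Y])
    have f: "smooth_fun A ?U (?f b)" for b
      by (intro smooth_fun_inner[OF M.at oU(1)] smooth_fun_dfun_apply[OF M.at oU(1)]
          smooth_fun_subset[OF W(5)] Y') auto
    have \<eta>b: "basic_on A g B \<pi> ?U (?\<eta> w)" for w
      by (rule basic_subset[OF basic_on_hlift[OF W(1) E]]) auto
    note \<eta> = basic_smooth[OF \<eta>b]
    have sec: "smooth_section_along A B \<pi> ?U (?E b \<circ> \<pi>)" for b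
      by (rule smooth_section_comp[OF W(1) E oU(1)]) auto
    note nP = nablaP_sum[OF oU finite_Basis X', of ?f "\<lambda>b. ?E b \<circ> \<pi>", OF f sec]
    have 1: "nablaP X (\<lambda>q. d\<pi> q (Y q)) p =
        (\<Sum>b\<in>Basis. dfun A (?f b) p (X p) *\<^sub>R ?E b (\<pi> p) + ?f b p *\<^sub>R nablaP X (?E b \<circ> \<pi>) p)"
      using nablaP_local[OF oU X' conjunct1[OF nP], of "\<lambda>q. d\<pi> q (Y q)"] conjunct2[OF nP]
      by (simp add: ex)
    let ?VY = "\<lambda>q. V q (Y q)" and ?HY = "\<lambda>q. \<Sum>b\<in>Basis. ?f b q *\<^sub>R ?\<eta> b q"
    have VY: "vertical_on A B \<pi> ?U ?VY"
      unfolding vertical_on_def using smooth_V[OF oU(1) Y'] V_ver by blast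
    have HY: "smooth_vf A ?U ?HY"
      by (intro smooth_vf_sum[OF M.at oU(1)] smooth_vf_scaleR[OF M.at oU(1)] f \<eta>)
    have "Y q = ?VY q + ?HY q" if "q \<in> ?U" for q
    proof -
      have "H q (Y q) = ?HY q" using that
        by (simp add: H_eq ex[of q "Y q"] linear_sum[OF linear_hlift] linear_scale[OF linear_hlift])
      then show ?thesis using V_plus_H(1)[of q "Y q"] by simp
    qed
    then have "nabla X Y p = nabla X (\<lambda>q. ?VY q + ?HY q) p"
      by (intro M.nabla_local[OF oU X' X' Y' smooth_vf_add[OF M.at oU(1) vertical_smooth[OF VY] HY]]) auto
    also have "\<dots> = nabla X ?VY p + (\<Sum>b\<in>Basis. dfun A (?f b) p (X p) *\<^sub>R ?\<eta> b p + ?f b p *\<^sub>R nabla X (?\<eta> b) p)"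
      using M.nabla_add_right[OF oU X' vertical_smooth[OF VY] HY]
        nabla_sum_right[OF oU finite_Basis f \<eta> X'] by simp
    finally have 2: "d\<pi> p (nabla X Y p) =
        (\<Sum>b\<in>Basis. dfun A (?f b) p (X p) *\<^sub>R ?E b (\<pi> p) + ?f b p *\<^sub>R d\<pi> p (nabla X (?\<eta> b) p))"
      using nabla_vertical_ver[OF vp hp oU X' VY]
      by (simp add: linear_add[OF linear_dpi] linear_sum[OF linear_dpi] linear_scale[OF linear_dpi] dpi_hlift)
    have "d\<pi> p (nabla X (?\<eta> b) p) = nablaP X (?E b \<circ> \<pi>) p" for b
    proof -
      let ?w = "dfun B d (\<pi> p) (d\<pi> p (X p))"
      have Ew: "?E ?w (\<pi> p) = d\<pi> p (X p)" by (rule dfun_coord_field(2)[OF N.at W(3,2)])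
      let ?X1 = "\<lambda>q. V q (X q)" and ?X2 = "\<lambda>q. H q (X q)"
      have X1: "vertical_on A B \<pi> ?U ?X1"
        unfolding vertical_on_def using smooth_V[OF oU(1) X'] V_ver by blast
      have X2: "smooth_vf A ?U ?X2" by (rule smooth_H[OF oU(1) X'])
      have "nabla X (?\<eta> b) p = nabla ?X1 (?\<eta> b) p + nabla ?X2 (?\<eta> b) p"
        using M.nabla_add_left[OF oU vertical_smooth[OF X1] X2 \<eta>] by (simp add: V_plus_H)
      moreover have "nabla ?X2 (?\<eta> b) p = nabla (?\<eta> ?w) (?\<eta> b) p"
        by (rule M.nabla_tensorial[OF oU X2 \<eta> \<eta>]) (simp add: Ew H_eq)
      moreover have "d\<pi> p (nabla ?X1 (?\<eta> b) p) = 0"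
        using dpi_bracket_vertical_basic[OF oU X1 \<eta>b] nabla_vertical_ver[OF vp hp oU \<eta> X1] by simp
      moreover have "d\<pi> p (nabla (?\<eta> ?w) (?\<eta> b) p) = nablaN (?E ?w) (?E b) (\<pi> p)"
        by (rule dpi_nabla_hlift[OF W(1,2) E E])
      moreover have "nablaP X (?E b \<circ> \<pi>) p = nablaN (?E ?w) (?E b) (\<pi> p)"
        by (rule nablaP_comp[OF U X p W(1) E E W(2) Ew])
      ultimately show ?thesis by (simp add: linear_add[OF linear_dpi])
    qed
    then show ?thesis using 1 2 by simp
  qed
qed

end

section \<open>The two tensorial conditions on a Kaehler manifold\<close>

context submersion
begin

lemma app_field_parts:
  "(V \<odot> (\<lambda>p v. V p (J p v)) \<odot> Z) = (\<lambda>q. V q (J q (Z q)))"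
  "(H \<odot> (\<lambda>p v. V p (J p v)) \<odot> Z) = (\<lambda>q. 0)"
  "(V \<odot> (\<lambda>p v. H p (J p v)) \<odot> Z) = (\<lambda>q. 0)"
  "(H \<odot> (\<lambda>p v. H p (J p v)) \<odot> Z) = (\<lambda>q. H q (J q (Z q)))"
  by (simp_all add: app_field_def fun_eq_iff V_of_ver[OF V_ver] V_of_hor[OF H_hor])

lemma nabla_J_parts:
  assumes kae: "kaehler_manifold A g J nabla" and U: "open U" "p \<in> U"
    and X: "smooth_vf A U X" and Z: "smooth_vf A U Z"
  shows "nabla X (\<lambda>q. V q (J q (Z q))) p + nabla X (\<lambda>q. H q (J q (Z q))) p = J p (nabla X Z p)"
    and "smooth_vf A U (\<lambda>q. V q (J q (Z q)))" "smooth_vf A U (\<lambda>q. H q (J q (Z q)))"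
proof -
  have JZ: "smooth_vf A U (\<lambda>q. J q (Z q))" and "nabla X (\<lambda>q. J q (Z q)) p = J p (nabla X Z p)"
    using kae U X Z unfolding kaehler_manifold_def by blast+
  moreover show s: "smooth_vf A U (\<lambda>q. V q (J q (Z q)))" "smooth_vf A U (\<lambda>q. H q (J q (Z q)))"
    using smooth_V[OF U(1) JZ] smooth_H[OF U(1) JZ] by auto
  ultimately show "nabla X (\<lambda>q. V q (J q (Z q))) p + nabla X (\<lambda>q. H q (J q (Z q))) p = J p (nabla X Z p)"
    using M.nabla_add_right[OF U X s] by (simp add: V_plus_H)
qed

text \<open>The four terms are the horizontal and vertical parts of the derivatives of
  \<open>P \<odot> Z\<close> and \<open>F \<odot> Z\<close> along \<open>W\<close>. They add up to
  \<open>J p (nabla W Z p)\<close>, and the common outer operator is the horizontal part of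
  \<open>J\<close>. Reading the second term as \<open>oneill_A_basic\<close> is what supplies the
  missing part \<open>H p (nabla W (F \<odot> Z) p)\<close>.\<close>

lemma vertical_condition:
  assumes kae: "kaehler_manifold A g J nabla" and U: "open U" "p \<in> U"
    and W: "vertical_on A B \<pi> U W" and Z: "vertical_on A B \<pi> U Z"
  defines "P \<equiv> \<lambda>p v. V p (J p v)" and "F \<equiv> \<lambda>p v. H p (J p v)"
  shows "F p (oneill_T nabla V H W (P \<odot> Z) p + oneill_A_basic nabla H (F \<odot> Z) W p) +
    F p ((V \<odot> nabla W (P \<odot> Z)) p + oneill_T nabla V H W (F \<odot> Z) p) = - H p (nabla W Z p)"
proof -
  have lJ: "linear (J p)" and JJ: "J p (J p v) = - v" for v
    using kae unfolding kaehler_manifold_def by auto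
  note Ws = vertical_smooth[OF W] and Zs = vertical_smooth[OF Z]
  note parts = nabla_J_parts[OF kae U Ws Zs]
  have VW: "nabla (\<lambda>q. V q (W q)) Y p = nabla W Y p" if "smooth_vf A U Y" for Y
    by (rule M.nabla_local[OF U _ Ws that that])
      (use V_of_ver(1)[OF vertical_ver[OF W]] smooth_V[OF U(1) Ws] in auto)
  let ?PZ = "\<lambda>q. V q (J q (Z q))" and ?FZ = "\<lambda>q. H q (J q (Z q))"
  note zero = smooth_vf_zero[OF M.at U(1)]
  have "oneill_T nabla V H W (P \<odot> Z) p = H p (nabla W ?PZ p)"
    unfolding oneill_T_def P_def app_field_parts
    by (simp add: app_field_def VW[OF zero] VW[OF parts(2)]
        M.nabla_zero_right[OF U Ws] linear_0[OF linear_V])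
  moreover have "oneill_T nabla V H W (F \<odot> Z) p = V p (nabla W ?FZ p)"
    unfolding oneill_T_def F_def app_field_parts
    by (simp add: app_field_def VW[OF zero] VW[OF parts(3)]
        M.nabla_zero_right[OF U Ws] linear_0[OF linear_H])
  moreover have "oneill_A_basic nabla H (F \<odot> Z) W p = H p (nabla W ?FZ p)"
    by (simp add: oneill_A_basic_def app_field_def F_def)
  moreover have "(V \<odot> nabla W (P \<odot> Z)) p = V p (nabla W ?PZ p)"
    by (simp add: app_field_def P_def)
  ultimately have "F p (oneill_T nabla V H W (P \<odot> Z) p + oneill_A_basic nabla H (F \<odot> Z) W p) +
      F p ((V \<odot> nabla W (P \<odot> Z)) p + oneill_T nabla V H W (F \<odot> Z) p) =
    H p (J p ((H p (nabla W ?PZ p) + H p (nabla W ?FZ p)) + (V p (nabla W ?PZ p) + V p (nabla W ?FZ p))))"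
    by (simp add: F_def linear_add[OF lJ] linear_add[OF linear_H])
  also have "(H p (nabla W ?PZ p) + H p (nabla W ?FZ p)) + (V p (nabla W ?PZ p) + V p (nabla W ?FZ p)) =
      J p (nabla W Z p)"
    unfolding parts(1)[symmetric] linear_add[OF linear_V, symmetric] linear_add[OF linear_H, symmetric]
    by (rule V_plus_H(2))
  finally show ?thesis by (simp add: JJ linear_neg[OF linear_H])
qed

text \<open>The same regrouping with the vertical part of \<open>J\<close> outside. The
  differentiating field is horizontal here, so the tensor \<open>oneill_A\<close> itself supplies
  the parts not written out.\<close>

lemma horizontal_condition:
  assumes kae: "kaehler_manifold A g J nabla" and U: "open U" "p \<in> U"
    and \<xi>: "basic_on A g B \<pi> U \<xi>" and \<eta>: "basic_on A g B \<pi> U \<eta>"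
  defines "P \<equiv> \<lambda>p v. V p (J p v)" and "F \<equiv> \<lambda>p v. H p (J p v)"
  shows "P p (oneill_A nabla V H \<xi> (P \<odot> \<eta>) p + (H \<odot> nabla \<xi> (F \<odot> \<eta>)) p) +
    P p (oneill_A nabla V H \<xi> (F \<odot> \<eta>) p + (V \<odot> nabla \<xi> (P \<odot> \<eta>)) p) = - V p (nabla \<xi> \<eta> p)"
proof -
  have lJ: "linear (J p)" and JJ: "J p (J p v) = - v" for v
    using kae unfolding kaehler_manifold_def by auto
  note Ws = basic_smooth[OF \<xi>] and Zs = basic_smooth[OF \<eta>]
  note parts = nabla_J_parts[OF kae U Ws Zs]
  have HW: "nabla (\<lambda>q. H q (\<xi> q)) Y p = nabla \<xi> Y p" if "smooth_vf A U Y" for Y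
    by (rule M.nabla_local[OF U _ Ws that that])
      (use V_of_hor(2)[OF basic_hor[OF \<xi>]] smooth_H[OF U(1) Ws] in auto)
  let ?PZ = "\<lambda>q. V q (J q (\<eta> q))" and ?FZ = "\<lambda>q. H q (J q (\<eta> q))"
  note zero = smooth_vf_zero[OF M.at U(1)]
  have "oneill_A nabla V H \<xi> (P \<odot> \<eta>) p = H p (nabla \<xi> ?PZ p)"
    unfolding oneill_A_def P_def app_field_parts
    by (simp add: app_field_def HW[OF zero] HW[OF parts(2)]
        M.nabla_zero_right[OF U Ws] linear_0[OF linear_V])
  moreover have "oneill_A nabla V H \<xi> (F \<odot> \<eta>) p = V p (nabla \<xi> ?FZ p)"
    unfolding oneill_A_def F_def app_field_parts
    by (simp add: app_field_def HW[OF zero] HW[OF parts(3)]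
        M.nabla_zero_right[OF U Ws] linear_0[OF linear_H])
  moreover have "(H \<odot> nabla \<xi> (F \<odot> \<eta>)) p = H p (nabla \<xi> ?FZ p)"
    by (simp add: app_field_def F_def)
  moreover have "(V \<odot> nabla \<xi> (P \<odot> \<eta>)) p = V p (nabla \<xi> ?PZ p)"
    by (simp add: app_field_def P_def)
  ultimately have "P p (oneill_A nabla V H \<xi> (P \<odot> \<eta>) p + (H \<odot> nabla \<xi> (F \<odot> \<eta>)) p) +
      P p (oneill_A nabla V H \<xi> (F \<odot> \<eta>) p + (V \<odot> nabla \<xi> (P \<odot> \<eta>)) p) =
    V p (J p ((H p (nabla \<xi> ?PZ p) + H p (nabla \<xi> ?FZ p)) + (V p (nabla \<xi> ?PZ p) + V p (nabla \<xi> ?FZ p))))"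
    by (simp add: P_def linear_add[OF lJ] linear_add[OF linear_V])
  also have "(H p (nabla \<xi> ?PZ p) + H p (nabla \<xi> ?FZ p)) + (V p (nabla \<xi> ?PZ p) + V p (nabla \<xi> ?FZ p)) =
      J p (nabla \<xi> \<eta> p)"
    unfolding parts(1)[symmetric] linear_add[OF linear_V, symmetric] linear_add[OF linear_H, symmetric]
    by (rule V_plus_H(2))
  finally show ?thesis by (simp add: JJ linear_neg[OF linear_V])
qed

end

section \<open>Riemannian products have parallel factors\<close>

lemma subspace_orthogonalI:
  fixes z :: "'a::euclidean_space"
  assumes "subspace K" "\<And>k. (\<And>x. x \<in> K \<Longrightarrow> x \<bullet> k = 0) \<Longrightarrow> z \<bullet> k = 0"
  shows "z \<in> K"
proof -
  obtain y w where yw: "y \<in> span K" "\<And>x. x \<in> span K \<Longrightarrow> orthogonal w x" "z = y + w"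
    using orthogonal_subspace_decomp_exists by metis
  have "x \<bullet> w = 0" if "x \<in> K" for x
    using yw(2) span_base[OF that] by (metis inner_commute orthogonal_def)
  then have "z \<bullet> w = 0" "y \<bullet> w = 0" using assms yw(1) span_eq_iff by blast+
  then have "w = 0" using yw(3) by (simp add: inner_add_left)
  then show ?thesis using yw(1,3) span_eq_iff[THEN iffD2, OF assms(1)] by simp
qed

lemma smooth_map_subset:
  assumes "smooth_map A B U \<rho>" "U' \<subseteq> U"
  shows "smooth_map A B U' \<rho>"
  unfolding smooth_map_def
proof safe
  show "continuous_on U' \<rho>" using assms unfolding smooth_map_def by (blast intro: continuous_on_subset)
  fix V d assume "(V, d) \<in> B"
  then have "smooth_fun A (U \<inter> \<rho> -` V) (d \<circ> \<rho>)" using assms unfolding smooth_map_def by blast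
  then show "smooth_fun A (U' \<inter> \<rho> -` V) (d \<circ> \<rho>)" by (rule smooth_fun_subset) (use assms in blast)
qed

text \<open>In a slice chart the map runs in a translate of \<open>K\<close>. Linear functionals
  that vanish on \<open>K\<close> are therefore constant along it, so the derivative lies in
  \<open>K\<close>.\<close>

lemma dmap_into_integral_manifold:
  assumes at: "smooth_atlas A" and D: "integral_manifold A D S" and \<rho>: "smooth_map A A U \<rho>"
    and U: "open U" "q \<in> U" and S: "\<And>q. q \<in> U \<Longrightarrow> \<rho> q \<in> S"
  shows "dmap A A \<rho> q v \<in> D (\<rho> q)"
proof -
  obtain V c K where ch: "smooth_atlas (insert (V, c) A)" and V: "\<rho> q \<in> V" and K: "subspace K"
    and SV: "S \<inter> V = {y \<in> V. c y - c (\<rho> q) \<in> K}" and DV: "\<And>y. y \<in> S \<inter> V \<Longrightarrow> D y = {v. dfun A c y v \<in> K}"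
    using D S[OF U(2)] unfolding integral_manifold_def by meson
  note oV = compatible_chart(1)[OF ch] and c = smooth_fun_chart[OF at ch]
  note m = smooth_fun_comp_map[OF at at \<rho> U(1) c oV]
  let ?U = "U \<inter> \<rho> -` V"
  have q: "q \<in> ?U" using U V by simp
  have eq: "dfun A (c \<circ> \<rho>) q v = dfun A c (\<rho> q) (dmap A A \<rho> q v)"
    by (rule dmap_chart[OF at at \<rho> U oV V c])
  have "dfun A (c \<circ> \<rho>) q v \<in> K"
  proof (rule subspace_orthogonalI[OF K])
    fix k assume k: "\<And>x. x \<in> K \<Longrightarrow> x \<bullet> k = 0"
    have "(c \<circ> \<rho>) q' \<bullet> k = c (\<rho> q) \<bullet> k" if "q' \<in> ?U" for q'
    proof -
      have "c (\<rho> q') - c (\<rho> q) \<in> K" using SV S that by auto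
      then show ?thesis using k[of "c (\<rho> q') - c (\<rho> q)"] by (simp add: inner_diff_left)
    qed
    then have "dfun A (\<lambda>q'. (c \<circ> \<rho>) q' \<bullet> k) q = dfun A (\<lambda>q'. c (\<rho> q) \<bullet> k) q"
      using dfun_cong[OF at m(1) q, of "\<lambda>q'. c (\<rho> q) \<bullet> k" "\<lambda>q'. (c \<circ> \<rho>) q' \<bullet> k"] by simp
    then show "dfun A (c \<circ> \<rho>) q v \<bullet> k = 0"
      using dfun_inner[OF at m(1) q m(2), of k v] by (simp add: dfun_const)
  qed
  then show ?thesis using DV[of "\<rho> q"] V S[OF U(2)] eq by simp
qed

text \<open>\<open>D\<close> is the tangent distribution of the factor onto which \<open>\<rho>\<close> projects, \<open>D'\<close> that of the other one.\<close>

locale product_projection = levi_civita_manifold A g nabla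
  for A :: "('m::{t2_space, second_countable_topology}, 'e::euclidean_space) chart set" and g nabla +
  fixes U :: "'m set" and \<rho> :: "'m \<Rightarrow> 'm" and D D' :: "'m \<Rightarrow> 'e set"
  assumes U: "open U" and sm: "smooth_map A A U \<rho>" and D_subspace: "subspace (D q)"
    and D_perp: "u \<in> D q \<longleftrightarrow> (\<forall>v\<in>D' q. g q u v = 0)" and D_dim: "dim (D q) = dim (D q')"
    and into: "q \<in> U \<Longrightarrow> dmap A A \<rho> q v \<in> D (\<rho> q)"
    and zero: "q \<in> U \<Longrightarrow> v \<in> D' q \<Longrightarrow> dmap A A \<rho> q v = 0"
    and iso: "q \<in> U \<Longrightarrow> u \<in> D q \<Longrightarrow> v \<in> D q \<Longrightarrow>
      g q u v = g (\<rho> q) (dmap A A \<rho> q u) (dmap A A \<rho> q v)"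
    and ex: "v \<in> D p \<Longrightarrow> \<exists>N Z. open N \<and> p \<in> N \<and> smooth_vf A N Z \<and> (\<forall>q\<in>N. Z q \<in> D q) \<and> Z p = v"
begin

text \<open>\<open>W\<close> is the metric dual of the pullback of \<open>W0\<close>, as for a
  horizontal lift. It is tangent to \<open>D\<close> because the form kills \<open>D'\<close>, and
  \<rho>-related to \<open>W0\<close> because the differential maps \<open>D q\<close> onto
  \<open>D (\<rho> q)\<close>: it is an isometry there and the dimensions agree.\<close>

lemma related_lift:
  assumes p: "p \<in> U" and w: "w \<in> D p"
  obtains N W0 W where "open N" "\<rho> p \<in> N" "smooth_vf A N W0" "smooth_vf A (U \<inter> \<rho> -` N) W"
    "open (U \<inter> \<rho> -` N)" "\<forall>q\<in>U \<inter> \<rho> -` N. W q \<in> D q \<and> dmap A A \<rho> q (W q) = W0 (\<rho> q)" "W p = w"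
proof -
  obtain N W0 where N: "open N" "\<rho> p \<in> N" and W0: "smooth_vf A N W0" "\<forall>q\<in>N. W0 q \<in> D q"
      "W0 (\<rho> p) = dmap A A \<rho> p w"
    using ex[OF into[OF p, of w]] by (elim exE conjE) (rule that)
  let ?U = "U \<inter> \<rho> -` N"
  have oU: "open ?U"
    using continuous_open_preimage[of U \<rho> N] sm U N unfolding smooth_map_def by blast
  have sm': "smooth_map A A ?U \<rho>" by (rule smooth_map_subset[OF sm]) simp
  define W where "W = (\<lambda>q. sharp (g q) (\<lambda>u. g (\<rho> q) (W0 (\<rho> q)) (dmap A A \<rho> q u)))"
  have W: "smooth_vf A ?U W" unfolding W_def
    by (rule smooth_vf_sharp[OF rm oU smooth_form_pullback[OF at rm sm' oU N(1) _ W0(1)]]) auto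
  have lin: "linear (dmap A A \<rho> q)" if "q \<in> U" for q by (rule dmap_linear_on[OF at at sm U that])
  have gW: "g q (W q) u = g (\<rho> q) (W0 (\<rho> q)) (dmap A A \<rho> q u)" if "q \<in> U" for q u
    unfolding W_def
    by (rule sharp[OF g_bilinear g_pos])
      (use linear_compose[OF lin[OF that] bilinear_expand_right(1)[OF g_bilinear]] in \<open>simp_all add: comp_def\<close>)
  have WD: "W q \<in> D q" if "q \<in> U" for q
    using gW[OF that] zero[OF that] g_zero_right by (simp add: D_perp)
  have inj0: "x = 0" if "q \<in> U" "x \<in> D q" "dmap A A \<rho> q x = 0" for q x
    using iso[OF that(1,2,2)] that(3) g_zero_left g_pos by (metis less_irrefl)
  have surj: "\<exists>u\<in>D q. dmap A A \<rho> q u = y" if q: "q \<in> U" and y: "y \<in> D (\<rho> q)" for q y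
  proof -
    have "inj_on (dmap A A \<rho> q) (span (D q))"
    proof (rule inj_onI)
      fix a b assume ab: "a \<in> span (D q)" "b \<in> span (D q)" "dmap A A \<rho> q a = dmap A A \<rho> q b"
      then have "a - b \<in> D q" "dmap A A \<rho> q (a - b) = 0"
        using span_eq_iff[THEN iffD2, OF D_subspace] subspace_diff[OF D_subspace] linear_diff[OF lin[OF q]] by auto
      then show "a = b" using inj0[OF q, of "a - b"] by simp
    qed
    from dim_image_eq[OF lin[OF q] this] have "dim (dmap A A \<rho> q ` D q) = dim (D (\<rho> q))"
      using D_dim by metis
    then have "dmap A A \<rho> q ` D q = D (\<rho> q)"
      using into[OF q] by (intro subspace_dim_equal linear_subspace_image[OF lin[OF q]] D_subspace) auto
    then show ?thesis using y by (metis imageE)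
  qed
  have rel: "dmap A A \<rho> q (W q) = W0 (\<rho> q)" if "q \<in> ?U" for q
  proof -
    have q: "q \<in> U" "\<rho> q \<in> N" using that by auto
    let ?y = "dmap A A \<rho> q (W q) - W0 (\<rho> q)"
    have "?y \<in> D (\<rho> q)" by (rule subspace_diff[OF D_subspace into[OF q(1)] bspec[OF W0(2) q(2)]])
    then obtain u where u: "u \<in> D q" "dmap A A \<rho> q u = ?y" using surj[OF q(1)] by blast
    have "g (\<rho> q) ?y (dmap A A \<rho> q u) = 0"
      using iso[OF q(1) WD[OF q(1)] u(1)] gW[OF q(1), of u] by (simp add: g_diff_left)
    then have "?y = 0" using u(2) g_pos by (metis less_irrefl)
    then show ?thesis by simp
  qed
  have "W p = w"
  proof -
    have "W p - w \<in> D p" by (rule subspace_diff[OF D_subspace WD[OF p] w])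
    moreover have "dmap A A \<rho> p (W p - w) = 0"
      using rel[of p] p N W0(3) linear_diff[OF lin[OF p]] by simp
    ultimately show ?thesis using inj0[OF p, of "W p - w"] by simp
  qed
  then show ?thesis using that[OF N W0(1) W oU] WD rel by blast
qed

end

context levi_civita_manifold
begin

text \<open>The three fields are exchanged for lifts from the factors with the same values at
  \<open>p\<close>. For the lifts all six terms of Koszul's formula vanish.\<close>

lemma product_factor_parallel:
  assumes \<rho>1: "product_projection A g nabla U \<rho>1 D1 D2" and \<rho>2: "product_projection A g nabla U \<rho>2 D2 D1"
    and metric: "\<And>q u v. q \<in> U \<Longrightarrow> g q u v =
      g (\<rho>1 q) (dmap A A \<rho>1 q u) (dmap A A \<rho>1 q v) + g (\<rho>2 q) (dmap A A \<rho>2 q u) (dmap A A \<rho>2 q v)"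
    and U': "open U'" "p \<in> U'" "p \<in> U"
    and X: "smooth_vf A U' X" "\<And>q. q \<in> U' \<Longrightarrow> X q \<in> D1 q"
    and Y: "smooth_vf A U' Y" "\<And>q. q \<in> U' \<Longrightarrow> Y q \<in> D1 q"
    and \<xi>: "smooth_vf A U' \<xi>" "\<And>q. q \<in> U' \<Longrightarrow> \<xi> q \<in> D2 q"
  shows "g p (nabla X Y p) (\<xi> p) = 0"
proof -
  interpret P1: product_projection A g nabla U \<rho>1 D1 D2 by (rule \<rho>1)
  interpret P2: product_projection A g nabla U \<rho>2 D2 D1 by (rule \<rho>2)
  note U = P1.U and sm = P1.sm P2.sm and z1 = P1.zero and z2 = P2.zero
  have perp: "g q u v = 0" if "u \<in> D1 q" "v \<in> D2 q" for q u v using that P1.D_perp by blast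
  obtain Nx X0 X' where x: "open Nx" "\<rho>1 p \<in> Nx" "smooth_vf A Nx X0" "smooth_vf A (U \<inter> \<rho>1 -` Nx) X'"
    "open (U \<inter> \<rho>1 -` Nx)"
    "\<forall>q\<in>U \<inter> \<rho>1 -` Nx. X' q \<in> D1 q \<and> dmap A A \<rho>1 q (X' q) = X0 (\<rho>1 q)" "X' p = X p"
    by (rule P1.related_lift[OF U'(3) X(2)[OF U'(2)]])
  obtain Ny Y0 Y' where y: "open Ny" "\<rho>1 p \<in> Ny" "smooth_vf A Ny Y0" "smooth_vf A (U \<inter> \<rho>1 -` Ny) Y'"
    "open (U \<inter> \<rho>1 -` Ny)"
    "\<forall>q\<in>U \<inter> \<rho>1 -` Ny. Y' q \<in> D1 q \<and> dmap A A \<rho>1 q (Y' q) = Y0 (\<rho>1 q)" "Y' p = Y p"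
    by (rule P1.related_lift[OF U'(3) Y(2)[OF U'(2)]])
  obtain Nz \<xi>0 \<xi>' where z: "open Nz" "\<rho>2 p \<in> Nz" "smooth_vf A Nz \<xi>0" "smooth_vf A (U \<inter> \<rho>2 -` Nz) \<xi>'"
    "open (U \<inter> \<rho>2 -` Nz)"
    "\<forall>q\<in>U \<inter> \<rho>2 -` Nz. \<xi>' q \<in> D2 q \<and> dmap A A \<rho>2 q (\<xi>' q) = \<xi>0 (\<rho>2 q)" "\<xi>' p = \<xi> p"
    by (rule P2.related_lift[OF U'(3) \<xi>(2)[OF U'(2)]])
  define N where "N = Nx \<inter> Ny"
  have N: "open N" "\<rho>1 p \<in> N" using x(1,2) y(1,2) by (auto simp: N_def)
  have N0: "smooth_vf A N X0" "smooth_vf A N Y0"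
    unfolding N_def by (auto intro: smooth_vf_subset[OF x(3)] smooth_vf_subset[OF y(3)])
  define O1 where "O1 = U' \<inter> ((U \<inter> \<rho>1 -` Nx) \<inter> (U \<inter> \<rho>1 -` Ny) \<inter> (U \<inter> \<rho>2 -` Nz))"
  have oO: "open O1" "p \<in> O1" using U' x(2,5) y(2,5) z(2,5) unfolding O1_def by auto
  have OU: "O1 \<subseteq> U" "O1 \<subseteq> U'" "\<rho>1 ` O1 \<subseteq> N" "\<rho>2 ` O1 \<subseteq> Nz" unfolding O1_def N_def by auto
  have smO: "smooth_map A A O1 \<rho>" if "smooth_map A A U \<rho>" for \<rho>
    by (rule smooth_map_subset[OF that OU(1)])
  have XO: "smooth_vf A O1 X'" "smooth_vf A O1 Y'" "smooth_vf A O1 \<xi>'"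
    unfolding O1_def
    by (auto intro: smooth_vf_subset[OF x(4)] smooth_vf_subset[OF y(4)] smooth_vf_subset[OF z(4)])
  have X'': "smooth_vf A O1 X" "smooth_vf A O1 Y" "smooth_vf A O1 \<xi>"
    using OU(2) smooth_vf_subset X(1) Y(1) \<xi>(1) by blast+
  have in1: "X' q \<in> D1 q" "Y' q \<in> D1 q" "\<xi>' q \<in> D2 q" "dmap A A \<rho>1 q (X' q) = X0 (\<rho>1 q)"
    "dmap A A \<rho>1 q (Y' q) = Y0 (\<rho>1 q)" "dmap A A \<rho>2 q (\<xi>' q) = \<xi>0 (\<rho>2 q)" "q \<in> U"
    if "q \<in> O1" for q
    using that x(6) y(6) z(6) unfolding O1_def by auto
  have perpO: "g q (X' q) (\<xi>' q) = 0" "g q (Y' q) (\<xi>' q) = 0" "g q (Y q) (\<xi> q) = 0"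
    "g q (Y' q) (\<xi> q) = 0" if "q \<in> O1" for q
    using perp in1[OF that] Y(2) \<xi>(2) OU(2) that by (auto intro!: perp)
  note lcm = levi_civita_manifold_axioms
  note zero = smooth_vf_zero[OF at]
  have br0: "brk (\<lambda>y. 0) Y y = 0" "brk Y (\<lambda>y. 0) y = 0" if "open N" "y \<in> N" "smooth_vf A N Y" for N Y y
    using nabla_zero_left[OF that] nabla_zero_right[OF that] by (simp_all add: torsion_bracket_def)
  \<comment> \<open>The bracket is related to a bracket with the zero field in either factor, so
    both of its projections vanish, and by the metric it vanishes itself.\<close>
  have mixed: "brk Z \<xi>' p = 0"
    if Z: "smooth_vf A O1 Z" "\<And>q. q \<in> O1 \<Longrightarrow> Z q \<in> D1 q" and Z0: "smooth_vf A N Z0"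
      "\<And>q. q \<in> O1 \<Longrightarrow> dmap A A \<rho>1 q (Z q) = Z0 (\<rho>1 q)" for Z Z0
  proof -
    have "dmap A A \<rho>1 p (brk Z \<xi>' p) = brk Z0 (\<lambda>y. 0) (\<rho>1 p)"
      by (rule bracket_related[OF lcm lcm smO[OF sm(1)] oO N(1) OU(3) Z(1) XO(3) Z0(1) zero[OF N(1)]])
        (use Z0(2) z1 in1 in auto)
    moreover have "dmap A A \<rho>2 p (brk Z \<xi>' p) = brk (\<lambda>y. 0) \<xi>0 (\<rho>2 p)"
      by (rule bracket_related[OF lcm lcm smO[OF sm(2)] oO z(1) OU(4) Z(1) XO(3) zero[OF z(1)] z(3)])
        (use Z(2) z2 in1 in auto)
    ultimately have "g p (brk Z \<xi>' p) (brk Z \<xi>' p) = 0"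
      using metric[OF U'(3), of "brk Z \<xi>' p" "brk Z \<xi>' p"] br0(2)[OF N Z0(1)] br0(1)[OF z(1,2,3)]
      by (simp add: g_zero_left)
    then show ?thesis using g_pos by (metis less_irrefl)
  qed
  have brXY: "g p (brk X' Y' p) (\<xi>' p) = 0"
  proof -
    have "dmap A A \<rho>2 p (brk X' Y' p) = brk (\<lambda>y. 0) (\<lambda>y. 0) (\<rho>2 p)"
      by (rule bracket_related[OF lcm lcm smO[OF sm(2)] oO z(1) OU(4) XO(1,2) zero[OF z(1)] zero[OF z(1)]])
        (use z2 in1 in auto)
    then have "dmap A A \<rho>2 p (brk X' Y' p) = 0" by (simp add: torsion_bracket_def)
    then show ?thesis
      using metric[OF U'(3)] z1[OF U'(3) in1(3)[OF oO(2)]] by (simp add: g_zero_left g_zero_right)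
  qed
  \<comment> \<open>This inner product is a function of the first projection alone, whose
    differential kills \<open>\<xi>' p\<close>.\<close>
  have "dfun A (\<lambda>q. g q (X' q) (Y' q)) p (\<xi>' p) = 0"
  proof -
    let ?k = "\<lambda>y. g y (X0 y) (Y0 y)"
    have "dfun A (\<lambda>q. g q (X' q) (Y' q)) p = dfun A (?k \<circ> \<rho>1) p"
      by (rule g_dfun_cong[OF oO]) (use metric z2 in1 in \<open>simp add: g_zero_left\<close>)
    then have "dfun A (\<lambda>q. g q (X' q) (Y' q)) p (\<xi>' p) = dfun A (?k \<circ> \<rho>1) p (\<xi>' p)" by simp
    also have "\<dots> = dfun A ?k (\<rho>1 p) (dmap A A \<rho>1 p (\<xi>' p))"
      by (rule dmap_chart[OF at at smO[OF sm(1)] oO N g_smooth[OF N(1) N0]])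
    also have "dmap A A \<rho>1 p (\<xi>' p) = 0" by (rule z1[OF U'(3) in1(3)[OF oO(2)]])
    also have "dfun A ?k (\<rho>1 p) 0 = 0"
      by (rule linear_0[OF dfun_linear[OF at N g_smooth[OF N(1) N0]]])
    finally show ?thesis .
  qed
  moreover have "dfun A (\<lambda>q. g q (Y' q) (\<xi>' q)) p = dfun A (\<lambda>q. 0) p"
    "dfun A (\<lambda>q. g q (X' q) (\<xi>' q)) p = dfun A (\<lambda>q. 0) p"
    by (rule g_dfun_cong[OF oO], simp add: perpO)+
  moreover have "brk X' \<xi>' p = 0" "brk Y' \<xi>' p = 0"
    using mixed[OF XO(1) _ N0(1)] mixed[OF XO(2) _ N0(2)] in1 by auto
  ultimately have lifted: "g p (nabla X' Y' p) (\<xi>' p) = 0"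
    using koszul[OF oO XO] brXY by (simp add: dfun_const g_zero_left)
  have "nabla X Y p = nabla X' Y p"
    by (rule nabla_tensorial[OF oO X''(1) XO(1) X''(2)]) (simp add: x(7))
  \<comment> \<open>Differentiating orthogonality shifts the derivative to \<xi>, after which only
    the value at \<open>p\<close> of \<open>Y\<close> or \<open>Y'\<close> matters. This exchanges
    \<open>Y'\<close> for \<open>Y\<close>, although \<open>nabla\<close> is not tensorial in that
    argument.\<close>
  moreover have "g p (nabla X' Y p) (\<xi> p) + g p (Y p) (nabla X' \<xi> p) = 0"
    "g p (nabla X' Y' p) (\<xi> p) + g p (Y' p) (nabla X' \<xi> p) = 0"
  proof -
    have "dfun A (\<lambda>q. g q (Y q) (\<xi> q)) p = dfun A (\<lambda>q. 0) p"
      "dfun A (\<lambda>q. g q (Y' q) (\<xi> q)) p = dfun A (\<lambda>q. 0) p"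
      by (rule g_dfun_cong[OF oO], simp add: perpO)+
    then show "g p (nabla X' Y p) (\<xi> p) + g p (Y p) (nabla X' \<xi> p) = 0"
      "g p (nabla X' Y' p) (\<xi> p) + g p (Y' p) (nabla X' \<xi> p) = 0"
      using nabla_metric[OF oO XO(1) X''(2,3)] nabla_metric[OF oO XO(1,2) X''(3)]
      by (simp_all add: dfun_const)
  qed
  ultimately show ?thesis using lifted y(7) z(7) by simp
qed

end

context submersion
begin

lemma dim_hor: "dim (hor q) = DIM('f)"
proof -
  have "hor q = range (hlift q)"
  proof
    show "hor q \<subseteq> range (hlift q)" using hlift_of_hor[symmetric] by blast
    show "range (hlift q) \<subseteq> hor q" using hlift_hor by blast
  qed
  moreover have "inj (hlift q)" by (metis dpi_hlift injI)
  then have "dim (hlift q ` UNIV) = dim (UNIV :: 'f set)"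
    by (intro dim_image_eq[OF linear_hlift]) (simp add: inj_on_subset)
  ultimately show ?thesis by simp
qed

lemma dim_ver: "dim (ver q) + DIM('f) = DIM('e)"
proof -
  have "u \<in> {x + y |x y. x \<in> ver q \<and> y \<in> hor q}" for u
    using V_ver[of q u] H_hor[of q u] V_plus_H(1)[of q u, symmetric] by blast
  then have "{x + y |x y. x \<in> ver q \<and> y \<in> hor q} = UNIV" by blast
  moreover have "ver q \<inter> hor q = {0}"
    using hor_ver_zero subspace_0[OF subspace_ver] subspace_0[OF subspace_hor] by blast
  ultimately show ?thesis using dim_sums_Int[OF subspace_ver subspace_hor, of q q] by (simp add: dim_hor)
qed

lemma locally_product_imp_parallel:
  assumes lp: "locally_product A g ver hor"
  shows vertical_parallel horizontal_parallel
proof -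
  have *: "\<exists>U \<rho>1 \<rho>2. p \<in> U \<and> product_projection A g nabla U \<rho>1 ver hor \<and> product_projection A g nabla U \<rho>2 hor ver \<and>
      (\<forall>q\<in>U. \<forall>u v. g q u v = g (\<rho>1 q) (dmap A A \<rho>1 q u) (dmap A A \<rho>1 q v) +
        g (\<rho>2 q) (dmap A A \<rho>2 q u) (dmap A A \<rho>2 q v))" for p
  proof -
    obtain U S1 S2 \<rho>1 \<rho>2 where U: "open U" "p \<in> U" and S: "integral_manifold A ver S1" "integral_manifold A hor S2"
      and sm: "smooth_map A A U \<rho>1" "smooth_map A A U \<rho>2"
      and bij: "bij_betw (\<lambda>q. (\<rho>1 q, \<rho>2 q)) U (S1 \<times> S2)"
      and z: "\<And>q v. q \<in> U \<Longrightarrow> v \<in> hor q \<Longrightarrow> dmap A A \<rho>1 q v = 0" "\<And>q v. q \<in> U \<Longrightarrow> v \<in> ver q \<Longrightarrow> dmap A A \<rho>2 q v = 0"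
      and m: "\<And>q u v. q \<in> U \<Longrightarrow> g q u v = g (\<rho>1 q) (dmap A A \<rho>1 q u) (dmap A A \<rho>1 q v) +
        g (\<rho>2 q) (dmap A A \<rho>2 q u) (dmap A A \<rho>2 q v)"
      using lp[unfolded locally_product_def, rule_format, of p] by blast
    have in12: "\<rho>1 q \<in> S1" "\<rho>2 q \<in> S2" if "q \<in> U" for q using bij that unfolding bij_betw_def by auto
    have ext1: "\<exists>N Z. open N \<and> p \<in> N \<and> smooth_vf A N Z \<and> (\<forall>q\<in>N. Z q \<in> ver q) \<and> Z p = v"
      if v: "v \<in> ver p" for p v
    proof (rule vertical_extension[OF v])
      fix U Z assume *: "open U" "p \<in> U" "vertical_on A B \<pi> U Z" "Z p = v"
      show ?thesis by (intro exI[of _ U] exI[of _ Z]) (use * in \<open>auto simp: vertical_on_def\<close>)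
    qed
    have ext2: "\<exists>N Z. open N \<and> p \<in> N \<and> smooth_vf A N Z \<and> (\<forall>q\<in>N. Z q \<in> hor q) \<and> Z p = v"
      if v: "v \<in> hor p" for p v
    proof (rule basic_extension[OF v])
      fix N E assume *: "\<pi> p \<in> N" "open (\<pi> -` N)"
        "basic_on A g B \<pi> (\<pi> -` N) (\<lambda>q. hlift q (E (\<pi> q)))" "hlift p (E (\<pi> p)) = v"
      show ?thesis
        by (intro exI[of _ "\<pi> -` N"] exI[of _ "\<lambda>q. hlift q (E (\<pi> q))"])
          (use * hlift_hor in \<open>auto simp: basic_on_def\<close>)
    qed
    have ver_perp: "u \<in> ver q \<longleftrightarrow> (\<forall>v\<in>hor q. g q u v = 0)" for q u
    proof -
      have "u \<in> ver q" if "\<forall>v\<in>hor q. g q u v = 0" for u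
      proof -
        have "g q (H q u) (H q u) = 0"
          using that H_hor hor_ver(2)[OF H_hor V_ver, of q u u] V_plus_H(1)[of q u]
            M.g_add_left[of q "V q u" "H q u" "H q u"] by auto
        then have "H q u = 0" using M.g_pos by (metis less_irrefl)
        then show ?thesis using V_ver[of q u] V_plus_H(1)[of q u] by simp
      qed
      then show ?thesis using hor_ver by blast
    qed
    note hor_perp = hor_iff
    have dims: "dim (ver q) = dim (ver q')" "dim (hor q) = dim (hor q')" for q q'
      using dim_ver[of q] dim_ver[of q'] dim_hor by auto
    have "product_projection A g nabla U \<rho>1 ver hor"
    proof
      show "dmap A A \<rho>1 q v \<in> ver (\<rho>1 q)" if "q \<in> U" for q v
        by (rule dmap_into_integral_manifold[OF M.at S(1) sm(1) U(1) that in12(1)])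
      show "g q u v = g (\<rho>1 q) (dmap A A \<rho>1 q u) (dmap A A \<rho>1 q v)"
        if "q \<in> U" "u \<in> ver q" "v \<in> ver q" for q u v
        using m[OF that(1)] z(2)[OF that(1)] that by (simp add: M.g_zero_left)
    qed (use U sm subspace_ver ver_perp dims z ext1 in auto)
    moreover have "product_projection A g nabla U \<rho>2 hor ver"
    proof
      show "dmap A A \<rho>2 q v \<in> hor (\<rho>2 q)" if "q \<in> U" for q v
        by (rule dmap_into_integral_manifold[OF M.at S(2) sm(2) U(1) that in12(2)])
      show "g q u v = g (\<rho>2 q) (dmap A A \<rho>2 q u) (dmap A A \<rho>2 q v)"
        if "q \<in> U" "u \<in> hor q" "v \<in> hor q" for q u v
        using m[OF that(1)] z(1)[OF that(1)] that by (simp add: M.g_zero_left)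
    qed (use U sm subspace_hor hor_perp dims z ext2 in auto)
    ultimately show ?thesis using U(2) m by blast
  qed
  show vertical_parallel
    unfolding vertical_parallel_def
  proof (intro allI impI ballI)
    fix U W Z p assume "open U \<and> vertical_on A B \<pi> U W \<and> vertical_on A B \<pi> U Z" and p: "p \<in> U"
    then have U: "open U" and W: "vertical_on A B \<pi> U W" and Z: "vertical_on A B \<pi> U Z" by auto
    obtain U1 \<rho>1 \<rho>2 where U1: "p \<in> U1" and pp: "product_projection A g nabla U1 \<rho>1 ver hor"
      "product_projection A g nabla U1 \<rho>2 hor ver" and m: "\<And>q u v. q \<in> U1 \<Longrightarrow> g q u v =
        g (\<rho>1 q) (dmap A A \<rho>1 q u) (dmap A A \<rho>1 q v) + g (\<rho>2 q) (dmap A A \<rho>2 q u) (dmap A A \<rho>2 q v)"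
      using *[of p] by blast
    let ?u = "H p (nabla W Z p)"
    obtain N E where N: "\<pi> p \<in> N" "open (\<pi> -` N)"
      and \<xi>: "basic_on A g B \<pi> (\<pi> -` N) (\<lambda>q. hlift q (E (\<pi> q)))" "hlift p (E (\<pi> p)) = ?u"
      by (rule basic_extension[OF H_hor])
    let ?\<xi> = "\<lambda>q. hlift q (E (\<pi> q))" and ?U = "U \<inter> \<pi> -` N"
    have oU: "open ?U" "p \<in> ?U" using U N p by auto
    have "g p (nabla W Z p) (?\<xi> p) = 0"
      by (rule M.product_factor_parallel[OF pp m oU U1])
        (auto intro: smooth_vf_subset[OF vertical_smooth[OF W]] smooth_vf_subset[OF vertical_smooth[OF Z]]
          smooth_vf_subset[OF basic_smooth[OF \<xi>(1)]] vertical_ver[OF W] vertical_ver[OF Z] hlift_hor)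
    then have "g p ?u ?u = 0"
      using \<xi>(2) hor_ver(2)[OF H_hor V_ver, of p "nabla W Z p" "nabla W Z p"] V_plus_H(1)[of p "nabla W Z p"]
        M.g_add_left[of p "V p (nabla W Z p)" ?u ?u] by simp
    then show "?u = 0" using M.g_pos by (metis less_irrefl)
  qed
  show horizontal_parallel
    unfolding horizontal_parallel_def
  proof (intro allI impI ballI)
    fix U \<xi> \<eta> p assume "open U \<and> basic_on A g B \<pi> U \<xi> \<and> basic_on A g B \<pi> U \<eta>" and p: "p \<in> U"
    then have U: "open U" and \<xi>: "basic_on A g B \<pi> U \<xi>" and \<eta>: "basic_on A g B \<pi> U \<eta>" by auto
    obtain U1 \<rho>1 \<rho>2 where U1: "p \<in> U1" and pp: "product_projection A g nabla U1 \<rho>1 ver hor"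
      "product_projection A g nabla U1 \<rho>2 hor ver" and m: "\<And>q u v. q \<in> U1 \<Longrightarrow> g q u v =
        g (\<rho>1 q) (dmap A A \<rho>1 q u) (dmap A A \<rho>1 q v) + g (\<rho>2 q) (dmap A A \<rho>2 q u) (dmap A A \<rho>2 q v)"
      using *[of p] by blast
    show "V p (nabla \<xi> \<eta> p) = 0"
      unfolding V_zero_iff
    proof
      fix v assume "v \<in> ver p"
      then obtain U' Z where Z: "open U'" "p \<in> U'" "vertical_on A B \<pi> U' Z" "Z p = v"
        by (rule vertical_extension)
      let ?U = "U \<inter> U'"
      have oU: "open ?U" "p \<in> ?U" using U p Z by auto
      \<comment> \<open>The lemma on factors is used with the two factors exchanged.\<close>
      have "g p (nabla \<xi> \<eta> p) (Z p) = 0"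
        by (rule M.product_factor_parallel[OF pp(2,1) _ oU U1])
          (use m in \<open>auto intro: smooth_vf_subset[OF basic_smooth[OF \<xi>]] smooth_vf_subset[OF basic_smooth[OF \<eta>]]
            smooth_vf_subset[OF vertical_smooth[OF Z(3)]] vertical_ver[OF Z(3)] basic_hor[OF \<xi>] basic_hor[OF \<eta>]\<close>)
      then show "g p (nabla \<xi> \<eta> p) v = 0" using Z(4) by simp
    qed
  qed
qed

end

section \<open>Parallel factors give a local product\<close>

text \<open>\<open>smooth_atlas\<close> names the inverse of a chart as \<open>inv_into\<close>, so
  an inverse found by other means has to be replaced by it.\<close>

lemma homeomorphism_inv_into:
  assumes "homeomorphism S T f f'"
  shows "homeomorphism S T f (inv_into S f)"
proof (rule homeomorphism_cong[OF assms])
  have inj: "inj_on f S" using assms unfolding homeomorphism_def by (metis inj_onI)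
  show "inv_into S f y = f' y" if "y \<in> T" for y
  proof (rule inv_into_f_eq[OF inj])
    show "f' y \<in> S" "f (f' y) = y" using assms that unfolding homeomorphism_def by auto
  qed
qed auto

text \<open>A change of coordinates inside a chart stays compatible with \<open>A\<close>. The
  product coordinates become a chart in this way, while the atlas and its chosen charts are
  unchanged.\<close>

lemma chart_compose:
  fixes A :: "('m::{t2_space, second_countable_topology}, 'e::euclidean_space) chart set"
  assumes at: "smooth_atlas A" and ch: "smooth_atlas (insert (C, c) A)"
    and U: "open U" "U \<subseteq> c ` C" and hom: "homeomorphism U (\<psi> ` U) \<psi> \<psi>i" and B: "open (\<psi> ` U)"
    and sm: "smooth_on U \<psi>" "smooth_on (\<psi> ` U) \<psi>i"
  shows "smooth_atlas (insert (C \<inter> c -` U, \<psi> \<circ> c) A)"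
    and "(\<psi> \<circ> c) ` (C \<inter> c -` U) = \<psi> ` U"
    and "\<And>z. z \<in> \<psi> ` U \<Longrightarrow> inv_into (C \<inter> c -` U) (\<psi> \<circ> c) z = inv_into C c (\<psi>i z)"
proof -
  note c = compatible_chart[OF ch]
  let ?C = "C \<inter> c -` U" and ?c = "\<psi> \<circ> c"
  have cC: "c ` ?C = U" using U by auto
  show img: "?c ` ?C = \<psi> ` U" using cC by (metis image_comp)
  have cont: "continuous_on C c" using c(4) by (rule homeomorphism_cont1)
  have oC: "open ?C" by (rule continuous_open_preimage[OF cont c(1) U(1)])
  have "homeomorphism ?C U c (inv_into C c)"
    by (rule homeomorphism_of_subsets[OF c(4)]) (use U cC in auto)
  from homeomorphism_compose[OF this hom]
  have h: "homeomorphism ?C (\<psi> ` U) ?c (inv_into C c \<circ> \<psi>i)" .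
  have inj: "inj_on ?c ?C" using h unfolding homeomorphism_def by (metis inj_onI)
  show inv: "inv_into ?C ?c z = inv_into C c (\<psi>i z)" if "z \<in> \<psi> ` U" for z
  proof (rule inv_into_f_eq[OF inj])
    show "inv_into C c (\<psi>i z) \<in> ?C" "?c (inv_into C c (\<psi>i z)) = z"
      using h that unfolding homeomorphism_def by auto
  qed
  have oimg: "open (?c ` (?C \<inter> V))" if "open V" for V
  proof -
    have "openin (top_of_set ?C) (?C \<inter> V)" using that by (simp add: openin_open_Int)
    then have "openin (top_of_set (\<psi> ` U)) (?c ` (?C \<inter> V))"
      using homeomorphism_imp_open_map[OF h] by blast
    then show ?thesis using B openin_open_trans by blast
  qed
  have oimg1: "open (c1 ` (V \<inter> ?C))" "open V" "inj_on c1 V" if "(V, c1) \<in> A" for V c1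
    using atlas_open_image[OF at that oC] atlas_chart[OF at that] by (simp_all add: Int_commute)
  have t1: "smooth_on (?c ` (?C \<inter> V)) (c1 \<circ> inv_into ?C ?c)" if V: "(V, c1) \<in> A" for V c1
  proof -
    have 1: "smooth_on (c ` (C \<inter> V)) (c1 \<circ> inv_into C c)"
      using chart_transition_smooth[OF at ch, of V c1] V at by (simp add: insert_absorb)
    have 2: "open (c ` (C \<inter> V))" using c(5)[OF oimg1(2)[OF V]] by (simp add: Int_commute)
    have 3: "smooth_on (?c ` (?C \<inter> V)) \<psi>i" by (rule smooth_on_subset[OF sm(2)]) auto
    have "\<psi>i ` (?c ` (?C \<inter> V)) \<subseteq> c ` (C \<inter> V)"
      by (auto simp: homeomorphism_apply1[OF hom])
    from smooth_on_compose[OF oimg[OF oimg1(2)[OF V]] 2 3 1 this]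
    have "smooth_on (?c ` (?C \<inter> V)) (\<lambda>z. (c1 \<circ> inv_into C c) (\<psi>i z))" .
    then show ?thesis
      by (rule smooth_on_cong[OF oimg[OF oimg1(2)[OF V]]]) (auto simp: inv)
  qed
  have t2: "smooth_on (c1 ` (V \<inter> ?C)) (?c \<circ> inv_into V c1)" if V: "(V, c1) \<in> A" for V c1
  proof -
    have "smooth_on (c1 ` (V \<inter> C)) (c \<circ> inv_into V c1)"
      using chart_transition_smooth[OF at, of V c1 C c] ch V at by (simp add: insert_absorb)
    then have 1: "smooth_on (c1 ` (V \<inter> ?C)) (c \<circ> inv_into V c1)" by (rule smooth_on_subset) auto
    have "(c \<circ> inv_into V c1) ` (c1 ` (V \<inter> ?C)) \<subseteq> U" using oimg1(3)[OF V] by auto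
    from smooth_on_compose[OF oimg1(1)[OF V] U(1) 1 sm(1) this] show ?thesis by (simp add: comp_def)
  qed
  have "smooth_on (\<psi> ` U) (?c \<circ> inv_into ?C ?c)"
  proof (rule smooth_on_cong[OF B smooth_on_linear[OF linear_ident B]])
    fix z assume "z \<in> \<psi> ` U"
    then have "z \<in> ?c ` ?C" by (simp only: img)
    from f_inv_into_f[OF this] show "z = (?c \<circ> inv_into ?C ?c) z" by simp
  qed
  then have t3: "smooth_on (?c ` (?C \<inter> ?C)) (?c \<circ> inv_into ?C ?c)" by (simp only: Int_absorb img)
  have base: "\<forall>(V, d)\<in>A. open V \<and> open (d ` V) \<and> homeomorphism V (d ` V) d (inv_into V d)"
    "\<Union> (fst ` A) = UNIV" "\<forall>(V, d)\<in>A. \<forall>(W, e)\<in>A. smooth_on (d ` (V \<inter> W)) (e \<circ> inv_into V d)"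
    using at unfolding smooth_atlas_def by (auto simp: case_prod_unfold)
  show "smooth_atlas (insert (?C, ?c) A)"
    unfolding smooth_atlas_def
  proof (intro conjI)
    show "\<forall>(V, d)\<in>insert (?C, ?c) A. open V \<and> open (d ` V) \<and> homeomorphism V (d ` V) d (inv_into V d)"
      using base(1) oC B homeomorphism_inv_into[OF h] unfolding img[symmetric] by auto
    show "(\<Union>(V, d)\<in>insert (?C, ?c) A. V) = UNIV" using base(2) by (auto simp: case_prod_unfold)
    show "\<forall>(V, d)\<in>insert (?C, ?c) A. \<forall>(W, e)\<in>insert (?C, ?c) A. smooth_on (d ` (V \<inter> W)) (e \<circ> inv_into V d)"
      using base(3) t1 t2 t3 by auto
  qed
qed

lemma dfun_linear_comp:
  fixes L :: "'k::euclidean_space \<Rightarrow> 'l::euclidean_space"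
  assumes at: "smooth_atlas A" and U: "open U" "q \<in> U" and f: "smooth_fun A U f" and L: "linear L"
  shows "dfun A (\<lambda>q. L (f q)) q v = L (dfun A f q v)"
proof -
  obtain V c where Vc: "chart_at A q = (V, c)" by fastforce
  have "bounded_linear L" using L linear_conv_bounded_linear by blast
  from bounded_linear.has_derivative[OF this dfun_has_derivative[OF at U f Vc]]
  have "dfun A (\<lambda>q. L (f q)) q = (\<lambda>v. L (dfun A f q v))"
    by (intro dfun_eqI[OF Vc]) (simp add: comp_def)
  then show ?thesis by simp
qed

text \<open>The projections of the local product are linear in suitable coordinates, and so are
  their differentials.\<close>

lemma chart_linear_map:
  fixes A :: "('m::{t2_space, second_countable_topology}, 'e::euclidean_space) chart set"
  assumes at: "smooth_atlas A" and ch: "smooth_atlas (insert (C, c) A)"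
    and L: "linear L" "\<And>z. z \<in> c ` C \<Longrightarrow> L z \<in> c ` C"
  defines "\<rho> \<equiv> \<lambda>q. inv_into C c (L (c q))"
  shows "smooth_map A A C \<rho>"
    and "\<And>q. q \<in> C \<Longrightarrow> \<rho> q \<in> C \<and> c (\<rho> q) = L (c q)"
    and "\<And>q v. q \<in> C \<Longrightarrow> dfun A c (\<rho> q) (dmap A A \<rho> q v) = L (dfun A c q v)"
proof -
  note cc = compatible_chart[OF ch]
  show \<rho>: "\<rho> q \<in> C \<and> c (\<rho> q) = L (c q)" if "q \<in> C" for q
    unfolding \<rho>_def using L(2)[of "c q"] that by (simp add: inv_into_into f_inv_into_f)
  have "continuous_on C (inv_into C c \<circ> (L \<circ> c))"
    by (intro continuous_on_compose continuous_on_subset[OF homeomorphism_cont2[OF cc(4)]]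
        homeomorphism_cont1[OF cc(4)] linear_continuous_on)
      (use L linear_conv_bounded_linear in auto)
  then have cont: "continuous_on C \<rho>" by (simp add: \<rho>_def comp_def)
  show sm: "smooth_map A A C \<rho>"
    unfolding smooth_map_def
  proof (intro conjI cont ballI, clarify)
    fix V1 c1 assume V1: "(V1, c1) \<in> A"
    have oV: "open V1" by (rule atlas_chart(1)[OF at V1])
    let ?U = "C \<inter> \<rho> -` V1"
    have oU: "open ?U" by (rule continuous_open_preimage[OF cont cc(1) oV])
    have oc: "open (c ` ?U)" "open (c ` (C \<inter> V1))"
      using cc(5)[OF oU] cc(5)[OF oV] by (simp_all add: Int_commute Int_absorb2 inf.absorb2 Int_left_absorb)
    show "smooth_fun A ?U (c1 \<circ> \<rho>)"
    proof (rule smooth_fun_chartI[OF at ch oU])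
      show "smooth_on (c ` ?U) (\<lambda>z. (c1 \<circ> inv_into C c) (L z))"
      proof (rule smooth_on_compose[OF oc smooth_on_linear[OF L(1) oc(1)]])
        show "smooth_on (c ` (C \<inter> V1)) (c1 \<circ> inv_into C c)"
          using chart_transition_smooth[OF at ch, of V1 c1] V1 at by (simp add: insert_absorb)
        show "L ` (c ` ?U) \<subseteq> c ` (C \<inter> V1)"
        proof
          fix z assume "z \<in> L ` (c ` ?U)"
          then obtain q where q: "q \<in> C" "\<rho> q \<in> V1" "z = L (c q)" by blast
          then have "z = c (\<rho> q)" "\<rho> q \<in> C \<inter> V1" using \<rho>[OF q(1)] by auto
          then show "z \<in> c ` (C \<inter> V1)" by (rule image_eqI)
        qed
      qed
      show "(c1 \<circ> \<rho>) q = (c1 \<circ> inv_into C c) (L (c q))" for q by (simp add: \<rho>_def)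
    qed simp
  qed
  show "dfun A c (\<rho> q) (dmap A A \<rho> q v) = L (dfun A c q v)" if q: "q \<in> C" for q v
  proof -
    have c: "smooth_fun A C c" by (rule smooth_fun_chart[OF at ch])
    have "dfun A c (\<rho> q) (dmap A A \<rho> q v) = dfun A (c \<circ> \<rho>) q v"
      using dmap_chart[OF at at sm cc(1) q cc(1) _ c] \<rho>[OF q] by simp
    also have "\<dots> = dfun A (\<lambda>q. L (c q)) q v"
      using dfun_cong[OF at cc(1) q, of "\<lambda>q. L (c q)" "c \<circ> \<rho>"] \<rho> by simp
    also have "\<dots> = L (dfun A c q v)"
      by (rule dfun_linear_comp[OF at cc(1) q c L(1)])
    finally show ?thesis .
  qed
qed

context submersion
begin

text \<open>A chart in which the fibres and the horizontal leaves are affine.\<close>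

definition adapted_chart :: "'m \<Rightarrow> 'm set \<Rightarrow> ('m \<Rightarrow> 'e) \<Rightarrow> ('e \<Rightarrow> 'e) \<Rightarrow> bool" where
  "adapted_chart p C c P \<longleftrightarrow> smooth_atlas (insert (C, c) A) \<and> p \<in> C \<and> c p = 0 \<and> convex (c ` C) \<and>
     linear P \<and> (\<forall>a. P (P a) = P a) \<and> (\<forall>a\<in>c ` C. \<forall>b\<in>c ` C. P a + (b - P b) \<in> c ` C) \<and>
     (\<exists>W d e. open W \<and> smooth_atlas (insert (W, d) B) \<and> C \<subseteq> \<pi> -` W \<and> linear e \<and> inj e \<and>
        (\<forall>q\<in>C. \<forall>w. dfun A c q (hlift q (coord_field B d w (\<pi> q))) = e w) \<and>
        (\<forall>q\<in>C. \<forall>v. dfun A c q v - P (dfun A c q v) = e (dfun B d (\<pi> q) (d\<pi> q v))) \<and>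
        (\<forall>q\<in>C. c q - P (c q) = e (d (\<pi> q) - d (\<pi> p))))"

text \<open>The bracket projects to the bracket of coordinate fields of the base, which is zero, so
  it is vertical. Its vertical part is a difference of vertical parts of \<open>nabla\<close> on
  basic fields, which are zero by hypothesis.\<close>

lemma brk_hlift_coord:
  assumes hp: horizontal_parallel and W: "open W" "\<pi> q \<in> W" and ch: "smooth_atlas (insert (W, d) B)"
  shows "M.brk (\<lambda>q. hlift q (coord_field B d v (\<pi> q))) (\<lambda>q. hlift q (coord_field B d w (\<pi> q))) q = 0"
proof -
  let ?E = "coord_field B d" and ?\<eta> = "\<lambda>w q. hlift q (coord_field B d w (\<pi> q))"
  have E: "smooth_vf B W (?E w)" for w by (rule smooth_vf_coord_field[OF N.at ch])
  have oU: "open (\<pi> -` W)" "q \<in> \<pi> -` W" using open_vimage_pi[OF W(1)] W(2) by auto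
  have b: "basic_on A g B \<pi> (\<pi> -` W) (?\<eta> w)" for w by (rule basic_on_hlift[OF W(1) E])
  have V0: "V q (nabla (?\<eta> v) (?\<eta> w) q) = 0" for v w
    using hp b oU unfolding horizontal_parallel_def by blast
  have "dfun B d (\<pi> q) (N.brk (?E v) (?E w) (\<pi> q)) = 0"
  proof -
    have "dfun B (\<lambda>y. dfun B d y (?E w y)) (\<pi> q) = dfun B (\<lambda>y. w) (\<pi> q)" for w
      by (rule dfun_cong[OF N.at W]) (simp add: dfun_coord_field[OF N.at ch])
    then show ?thesis using N.dfun_chart_bracket[OF ch W W(2) E E] by (simp add: dfun_const)
  qed
  then have "N.brk (?E v) (?E w) (\<pi> q) = 0"
    using dfun_chart_bij[OF N.at ch W(2)] linear_0 by (metis bij_is_inj injD)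
  moreover have "d\<pi> q (M.brk (?\<eta> v) (?\<eta> w) q) = N.brk (?E v) (?E w) (\<pi> q)"
    by (rule bracket_related[OF M.levi_civita_manifold_axioms N.levi_civita_manifold_axioms
          smooth_pi_on oU W(1) _ basic_smooth[OF b] basic_smooth[OF b] E E]) (auto simp: dpi_hlift)
  ultimately have "M.brk (?\<eta> v) (?\<eta> w) q \<in> ver q" by (simp add: ver_iff)
  moreover have "V q (M.brk (?\<eta> v) (?\<eta> w) q) = 0"
    by (simp add: torsion_bracket_def linear_diff[OF linear_V] V0)
  ultimately show ?thesis using V_of_ver(1) by metis
qed

text \<open>In coordinates \<open>y\<close> is the submersion and \<open>X w\<close> the lift of a
  coordinate field of the base. The coordinate formula for the bracket turns
  \<open>brk_hlift_coord\<close> into the commutation hypothesis of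
  \<open>product_chart\<close>.\<close>

lemma adapted_chart_exists:
  assumes hp: horizontal_parallel
  shows "\<exists>C c P. adapted_chart p C c P"
proof -
  obtain C c where Cc: "(C, c) \<in> A" "p \<in> C" using atlas_chart_at[OF M.at] by metis
  then have "insert (C, c) A = A" by auto
  then have ch: "smooth_atlas (insert (C, c) A)" using M.at by simp
  note cc = compatible_chart[OF ch]
  obtain W d where Wd: "(W, d) \<in> B" "\<pi> p \<in> W" "open W" using atlas_chart_at[OF N.at] by metis
  then have "insert (W, d) B = B" by auto
  then have chd: "smooth_atlas (insert (W, d) B)" using N.at by simp
  have ds: "smooth_fun B W d" by (rule smooth_fun_chart[OF N.at chd])
  have oW: "open (\<pi> -` W)" by (rule open_vimage_pi[OF Wd(3)])
  let ?\<eta> = "\<lambda>w q. hlift q (coord_field B d w (\<pi> q))"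
  have E: "smooth_vf B W (coord_field B d w)" for w by (rule smooth_vf_coord_field[OF N.at chd])
  have \<eta>: "smooth_vf A (\<pi> -` W) (?\<eta> w)" for w by (rule smooth_vf_hlift[OF Wd(3) E])
  define \<Omega> where "\<Omega> = c ` (\<pi> -` W \<inter> C)"
  define y where "y = (d \<circ> \<pi>) \<circ> inv_into C c"
  define X where "X = (\<lambda>w. (\<lambda>q. dfun A c q (?\<eta> w q)) \<circ> inv_into C c)"
  have \<Omega>: "open \<Omega>" "c p \<in> \<Omega>" unfolding \<Omega>_def using cc(5)[OF oW] Cc Wd by auto
  have ys: "smooth_on \<Omega> y"
    unfolding \<Omega>_def y_def by (rule smooth_fun_chart_rep[OF M.at ch oW smooth_fun_pi[OF Wd(3) ds]])
  let ?U0 = "\<pi> -` W \<inter> C"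
  have oU0: "open ?U0" using oW cc(1) by auto
  have \<eta>c: "smooth_fun A ?U0 (\<lambda>q. dfun A c q (?\<eta> w q))" for w
    by (rule smooth_vf_chartD[OF M.at ch oW \<eta>])
  have Xs: "smooth_on \<Omega> (X w)" for w
    using smooth_fun_chart_rep[OF M.at ch oU0 \<eta>c[of w]] unfolding \<Omega>_def X_def by (simp add: Int_assoc)
  have X_at: "X w (c q) = dfun A c q (?\<eta> w q)" if "q \<in> C" for w q
    unfolding X_def using cc(6)[OF that] by simp
  have Xlin: "linear (\<lambda>w. X w x)" if x: "x \<in> \<Omega>" for x
  proof -
    obtain q where q: "q \<in> C" "\<pi> q \<in> W" "x = c q" using x unfolding \<Omega>_def by auto
    show ?thesis unfolding q(3) X_at[OF q(1)]
      using linear_compose[OF linear_compose[OF coord_field_linear[OF N.at chd q(2)] linear_hlift[of q]]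
          dfun_chart_bij(1)[OF M.at ch q(1)]] by (simp add: comp_def)
  qed
  have Dy: "frechet_derivative y (at (c q)) (dfun A c q v) = dfun B d (\<pi> q) (d\<pi> q v)"
    if "q \<in> ?U0" for q v
    using dfun_chart_rep[OF M.at ch oW _ _ smooth_fun_pi[OF Wd(3) ds], of q v]
      dfun_pi[OF Wd(3) _ ds, of q v] that unfolding y_def by simp
  have dy: "frechet_derivative y (at x) (X w x) = w" if x: "x \<in> \<Omega>" for x w
  proof -
    obtain q where q: "q \<in> ?U0" "x = c q" using x unfolding \<Omega>_def by auto
    then show ?thesis using X_at[of q w] Dy[of q "?\<eta> w q"] dfun_coord_field(1)[OF N.at chd, of "\<pi> q" w]
      by (simp add: dpi_hlift)
  qed
  have comm: "frechet_derivative (X v) (at x) (X w x) = frechet_derivative (X w) (at x) (X v x)"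
    if x: "x \<in> \<Omega>" for x v w
  proof -
    obtain q where q: "q \<in> ?U0" "x = c q" using x unfolding \<Omega>_def by auto
    have qC: "q \<in> C" "q \<in> \<pi> -` W" "\<pi> q \<in> W" using q by auto
    have D: "dfun A (\<lambda>q. dfun A c q (?\<eta> w q)) q (?\<eta> v q) = frechet_derivative (X w) (at x) (X v x)" for v w
      using dfun_chart_rep[OF M.at ch oU0 q(1) qC(1) \<eta>c[of w], of "?\<eta> v q"] X_at[OF qC(1), of v]
      unfolding X_def q(2) by simp
    have "dfun A c q (M.brk (?\<eta> v) (?\<eta> w) q) = 0"
      using brk_hlift_coord[OF hp Wd(3) qC(3) chd] linear_0[OF dfun_chart_bij(1)[OF M.at ch qC(1)]] by simp
    then show ?thesis
      using M.dfun_chart_bracket[OF ch oW qC(2,1) \<eta> \<eta>, of v w] D by simp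
  qed
  obtain U \<psi> \<psi>i P where U: "open U" "c p \<in> U" "U \<subseteq> \<Omega>" and \<psi>: "smooth_on U \<psi>" "\<psi> (c p) = 0"
    "open (\<psi> ` U)" "convex (\<psi> ` U)" "homeomorphism U (\<psi> ` U) \<psi> \<psi>i" "smooth_on (\<psi> ` U) \<psi>i"
    and P: "linear P" "\<forall>a. P (P a) = P a" "\<forall>a\<in>\<psi> ` U. \<forall>b\<in>\<psi> ` U. P a + (b - P b) \<in> \<psi> ` U"
    and \<psi>X: "\<forall>x\<in>U. \<forall>v. frechet_derivative \<psi> (at x) (X v x) = X v (c p)"
    and \<psi>P: "\<forall>x\<in>U. \<forall>h. frechet_derivative \<psi> (at x) h - P (frechet_derivative \<psi> (at x) h) =
      X (frechet_derivative y (at x) h) (c p)"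
    and \<psi>y: "\<forall>x\<in>U. \<psi> x - P (\<psi> x) = X (y x - y (c p)) (c p)"
    by (rule product_chart[OF \<Omega> ys Xs Xlin dy comm])
  let ?C = "C \<inter> c -` U" and ?c = "\<psi> \<circ> c" and ?e = "\<lambda>w. X w (c p)"
  have UC: "U \<subseteq> c ` C" using U(3) unfolding \<Omega>_def by blast
  note cn = chart_compose[OF M.at ch U(1) UC \<psi>(5,3,1,6)]
  note cc' = compatible_chart[OF cn(1)]
  have CW: "?C \<subseteq> \<pi> -` W"
  proof
    fix q assume q: "q \<in> ?C"
    then obtain q' where "q' \<in> ?U0" "c q = c q'" using U(3) unfolding \<Omega>_def by blast
    then show "q \<in> \<pi> -` W" using q cc(2) by (metis IntD1 IntD2 inj_onD)
  qed
  have Dc: "dfun A ?c q v = frechet_derivative \<psi> (at (c q)) (dfun A c q v)" if q: "q \<in> ?C" for q v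
  proof -
    have "((?c \<circ> inv_into C c) has_derivative frechet_derivative \<psi> (at (c q))) (at (c q))"
      by (rule has_derivative_transform_within_open[OF smooth_on_SucD(1)[OF \<psi>(1) U(1)] U(1)])
        (use q UC in \<open>auto simp: f_inv_into_f subset_iff\<close>)
    then have "frechet_derivative (?c \<circ> inv_into C c) (at (c q)) = frechet_derivative \<psi> (at (c q))"
      using frechet_derivative_at by metis
    then show ?thesis
      using dfun_chart_rep[OF M.at ch cc'(1) q _ smooth_fun_chart[OF M.at cn(1)], of v] q by simp
  qed
  have inje: "inj ?e" using dy[OF \<Omega>(2)] by (metis injI)
  have "adapted_chart p ?C ?c P"
    unfolding adapted_chart_def
  proof (intro conjI)
    show "\<exists>W d e. open W \<and> smooth_atlas (insert (W, d) B) \<and> ?C \<subseteq> \<pi> -` W \<and> linear e \<and> inj e \<and>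
        (\<forall>q\<in>?C. \<forall>w. dfun A ?c q (hlift q (coord_field B d w (\<pi> q))) = e w) \<and>
        (\<forall>q\<in>?C. \<forall>v. dfun A ?c q v - P (dfun A ?c q v) = e (dfun B d (\<pi> q) (d\<pi> q v))) \<and>
        (\<forall>q\<in>?C. ?c q - P (?c q) = e (d (\<pi> q) - d (\<pi> p)))"
    proof (rule exI[of _ W], rule exI[of _ d], rule exI[of _ ?e], intro conjI ballI allI)
      fix q assume q: "q \<in> ?C"
      then have q': "c q \<in> U" "q \<in> C" "q \<in> ?U0" using CW by auto
      show "dfun A ?c q (?\<eta> w q) = ?e w" for w
        unfolding Dc[OF q] X_at[OF q'(2), symmetric] using \<psi>X q'(1) by blast
      show "dfun A ?c q v - P (dfun A ?c q v) = ?e (dfun B d (\<pi> q) (d\<pi> q v))" for v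
        unfolding Dc[OF q] Dy[OF q'(3), symmetric] using \<psi>P q'(1) by blast
      show "?c q - P (?c q) = ?e (d (\<pi> q) - d (\<pi> p))"
        using bspec[OF \<psi>y q'(1)] cc(6)[OF q'(2)] cc(6)[OF Cc(2)] by (simp add: y_def)
    qed (fact Wd chd CW Xlin[OF \<Omega>(2)] inje)+
  qed (use cn Cc U(2) \<psi>(2,4) P in \<open>auto simp: cn(2)\<close>)
  then show ?thesis by blast
qed

end

section \<open>Splitting of the metric in an adapted chart\<close>

context submersion
begin

text \<open>\<xi> has constant components in the chart and so commutes with the coordinate fields u
  and u' in question. Thus \<open>nabla\<close> of u along \<xi> is \<open>nabla\<close> of \<xi>
  along u, and its product with u' is minus the product of \<xi> with \<open>nabla\<close> of u'
  along u, which is vertical.\<close>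

lemma vertical_metric_invariant:
  assumes vp: vertical_parallel and ch: "smooth_atlas (insert (C, c) A)" and q: "q \<in> C"
    and a: "\<And>q. q \<in> C \<Longrightarrow> coord_field A c a q \<in> ver q" and b: "\<And>q. q \<in> C \<Longrightarrow> coord_field A c b q \<in> ver q"
    and \<xi>: "basic_on A g B \<pi> C \<xi>" "\<And>q. q \<in> C \<Longrightarrow> dfun A c q (\<xi> q) = k"
  shows "dfun A (\<lambda>q. g q (coord_field A c a q) (coord_field A c b q)) q (\<xi> q) = 0"
proof -
  let ?u = "coord_field A c"
  note C = compatible_chart(1)[OF ch]
  have us: "smooth_vf A C (?u z)" for z by (rule smooth_vf_coord_field[OF M.at ch])
  note \<xi>s = basic_smooth[OF \<xi>(1)]
  have half: "g q (nabla \<xi> (?u z) q) (?u z' q) = 0"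
    if z: "\<And>q. q \<in> C \<Longrightarrow> ?u z q \<in> ver q" and z': "\<And>q. q \<in> C \<Longrightarrow> ?u z' q \<in> ver q" for z z'
  proof -
    have "dfun A (\<lambda>q. dfun A c q (?u z q)) q = dfun A (\<lambda>q. z) q"
      "dfun A (\<lambda>q. dfun A c q (\<xi> q)) q = dfun A (\<lambda>q. k) q"
      by (rule dfun_cong[OF M.at C q], simp add: dfun_coord_field[OF M.at ch] \<xi>(2))+
    then have "dfun A c q (M.brk \<xi> (?u z) q) = 0"
      using M.dfun_chart_bracket[OF ch C q q \<xi>s us] by (simp add: dfun_const)
    then have "M.brk \<xi> (?u z) q = 0"
      using dfun_chart_bij[OF M.at ch q] linear_0 by (metis bij_is_inj injD)
    then have eq: "nabla \<xi> (?u z) q = nabla (?u z) \<xi> q" by (simp add: torsion_bracket_def)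
    have ver: "vertical_on A B \<pi> C (?u z)" "vertical_on A B \<pi> C (?u z')"
      using us z z' unfolding vertical_on_def by auto
    have "dfun A (\<lambda>q. g q (\<xi> q) (?u z' q)) q = dfun A (\<lambda>q. 0) q"
      by (rule M.g_dfun_cong[OF C q]) (use z' basic_hor[OF \<xi>(1)] hor_ver(1) in auto)
    then have "g q (nabla (?u z) \<xi> q) (?u z' q) + g q (\<xi> q) (nabla (?u z) (?u z') q) = 0"
      using M.nabla_metric[OF C q us[of z] \<xi>s us[of z']] by (simp add: dfun_const)
    moreover have "H q (nabla (?u z) (?u z') q) = 0"
      using vp ver C q unfolding vertical_parallel_def by blast
    then have "nabla (?u z) (?u z') q \<in> ver q" using H_zero_iff ver_iff by blast
    then have "g q (\<xi> q) (nabla (?u z) (?u z') q) = 0" by (rule hor_ver(1)[OF basic_hor[OF \<xi>(1) q]])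
    ultimately show ?thesis unfolding eq by simp
  qed
  show ?thesis
    unfolding M.nabla_metric[OF C q \<xi>s us us] M.g_sym[of q "?u a q"] using half[OF a b] half[OF b a] by simp
qed

text \<open>In an adapted chart vertical vectors are those fixed by \<open>P\<close> and horizontal
  ones those killed by \<open>P\<close>. The projections of the product are \<open>P\<close> and its
  complement read in the chart, and the metric is compared separately on the vertical and on the
  horizontal parts.\<close>

lemma parallel_imp_locally_product:
  assumes vp: vertical_parallel and hp: horizontal_parallel
  shows "locally_product A g ver hor"
  unfolding locally_product_def
proof
  fix p
  obtain C c P where "adapted_chart p C c P" using adapted_chart_exists[OF hp] by blast
  then obtain W d e where ch: "smooth_atlas (insert (C, c) A)" and pC: "p \<in> C" "c p = 0"
    and conv: "convex (c ` C)" and P: "linear P" "\<And>a. P (P a) = P a"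
    and box: "\<And>a b. a \<in> c ` C \<Longrightarrow> b \<in> c ` C \<Longrightarrow> P a + (b - P b) \<in> c ` C"
    and W: "open W" "smooth_atlas (insert (W, d) B)" "C \<subseteq> \<pi> -` W" and e: "linear e" "inj e"
    and c\<eta>: "\<And>q w. q \<in> C \<Longrightarrow> dfun A c q (hlift q (coord_field B d w (\<pi> q))) = e w"
    and cP: "\<And>q v. q \<in> C \<Longrightarrow> dfun A c q v - P (dfun A c q v) = e (dfun B d (\<pi> q) (d\<pi> q v))"
    and cd: "\<And>q. q \<in> C \<Longrightarrow> c q - P (c q) = e (d (\<pi> q) - d (\<pi> p))"
    unfolding adapted_chart_def by auto
  note cc = compatible_chart[OF ch]
  have P0: "P 0 = 0" by (rule linear_0[OF P(1)])
  have zero: "0 \<in> c ` C" using pC by force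
  have PB: "P z \<in> c ` C" "z - P z \<in> c ` C" if "z \<in> c ` C" for z
    using box[OF that zero] box[OF zero that] P0 by simp_all
  have lQ: "linear (\<lambda>z. z - P z)" by (rule linear_compose_sub[OF linear_ident P(1)])
  have PQ: "P (z - P z) = 0" for z using linear_diff[OF P(1)] P(2) by simp
  have Wq: "\<pi> q \<in> W" if "q \<in> C" for q using that W(3) by auto
  have e0: "e w = 0 \<longleftrightarrow> w = 0" for w using e linear_0[OF e(1)] by (metis injD)
  have d0: "dfun B d (\<pi> q) v = 0 \<longleftrightarrow> v = 0" if "q \<in> C" for q v
    using dfun_chart_bij[OF N.at W(2) Wq[OF that]] linear_0 by (metis bij_is_inj injD)
  have inj_c: "v = v'" if "q \<in> C" "dfun A c q v = dfun A c q v'" for q v v'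
    using dfun_chart_bij(2)[OF M.at ch that(1)] that(2) by (meson bij_is_inj injD)
  have lin_c: "linear (dfun A c q)" if "q \<in> C" for q by (rule dfun_chart_bij(1)[OF M.at ch that])
  have ver_chart: "v \<in> ver q \<longleftrightarrow> P (dfun A c q v) = dfun A c q v" if "q \<in> C" for q v
  proof -
    have "v \<in> ver q \<longleftrightarrow> e (dfun B d (\<pi> q) (d\<pi> q v)) = 0" by (simp add: ver_iff e0 d0[OF that])
    then show ?thesis unfolding cP[OF that, symmetric] by auto
  qed
  have hor_chart: "v \<in> hor q \<longleftrightarrow> P (dfun A c q v) = 0" if q: "q \<in> C" for q v
  proof -
    have *: "dfun A c q (hlift q (d\<pi> q v)) = e (dfun B d (\<pi> q) (d\<pi> q v))"
      using c\<eta>[OF q, of "dfun B d (\<pi> q) (d\<pi> q v)"] dfun_coord_field(2)[OF N.at W(2) Wq[OF q]] by simp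
    show ?thesis
    proof
      assume "v \<in> hor q"
      then have "dfun A c q v - P (dfun A c q v) = dfun A c q v"
        using * hlift_of_hor[of v q] cP[OF q, of v] by simp
      then show "P (dfun A c q v) = 0" by (simp only: diff_eq_eq add_0_right add_cancel_right_right)
    next
      assume "P (dfun A c q v) = 0"
      then have "dfun A c q v = dfun A c q (hlift q (d\<pi> q v))"
        unfolding * cP[OF q, symmetric] by simp
      from inj_c[OF q this] have "v = hlift q (d\<pi> q v)" .
      then show "v \<in> hor q" using hlift_hor[of q "d\<pi> q v"] by simp
    qed
  qed
  let ?r1 = "\<lambda>q. inv_into C c (P (c q))" and ?r2 = "\<lambda>q. inv_into C c (c q - P (c q))"
  have r1: "smooth_map A A C ?r1" "q \<in> C \<Longrightarrow> ?r1 q \<in> C \<and> c (?r1 q) = P (c q)"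
    "q \<in> C \<Longrightarrow> dfun A c (?r1 q) (dmap A A ?r1 q v) = P (dfun A c q v)" for q v
    using chart_linear_map[OF M.at ch P(1)] PB(1) by blast+
  have r2: "smooth_map A A C ?r2" "q \<in> C \<Longrightarrow> ?r2 q \<in> C \<and> c (?r2 q) = c q - P (c q)"
    "q \<in> C \<Longrightarrow> dfun A c (?r2 q) (dmap A A ?r2 q v) = dfun A c q v - P (dfun A c q v)" for q v
    using chart_linear_map[OF M.at ch lQ] PB(2) by blast+
  define S1 where "S1 = {q \<in> C. P (c q) = c q}"
  define S2 where "S2 = {q \<in> C. P (c q) = 0}"
  have S1: "integral_manifold A ver S1"
    unfolding integral_manifold_def
  proof
    fix s assume s: "s \<in> S1"
    show "\<exists>V c K. smooth_atlas (insert (V, c) A) \<and> s \<in> V \<and> subspace K \<and>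
        S1 \<inter> V = {q \<in> V. c q - c s \<in> K} \<and> (\<forall>q\<in>S1 \<inter> V. ver q = {v. dfun A c q v \<in> K})"
      by (rule exI[of _ C], rule exI[of _ c], rule exI[of _ "{z. P z = z}"])
        (use s ch ver_chart in \<open>auto simp: S1_def subspace_def P0 linear_add[OF P(1)] linear_scale[OF P(1)]
          linear_diff[OF P(1)]\<close>)
  qed
  have S2: "integral_manifold A hor S2"
    unfolding integral_manifold_def
  proof
    fix s assume s: "s \<in> S2"
    show "\<exists>V c K. smooth_atlas (insert (V, c) A) \<and> s \<in> V \<and> subspace K \<and>
        S2 \<inter> V = {q \<in> V. c q - c s \<in> K} \<and> (\<forall>q\<in>S2 \<inter> V. hor q = {v. dfun A c q v \<in> K})"
      by (rule exI[of _ C], rule exI[of _ c], rule exI[of _ "{z. P z = 0}"])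
        (use s ch hor_chart in \<open>auto simp: S2_def subspace_def P0 linear_add[OF P(1)] linear_scale[OF P(1)]
          linear_diff[OF P(1)]\<close>)
  qed
  have bij: "bij_betw (\<lambda>q. (?r1 q, ?r2 q)) C (S1 \<times> S2)"
    unfolding bij_betw_def
  proof
    show "inj_on (\<lambda>q. (?r1 q, ?r2 q)) C"
    proof (rule inj_onI)
      fix q q' assume q: "q \<in> C" "q' \<in> C" "(?r1 q, ?r2 q) = (?r1 q', ?r2 q')"
      then have "c (?r1 q) + c (?r2 q) = c (?r1 q') + c (?r2 q')" by simp
      then have "c q = c q'" using r1(2) r2(2) q(1,2) by simp
      then show "q = q'" using cc(2) q(1,2) by (meson inj_onD)
    qed
    show "(\<lambda>q. (?r1 q, ?r2 q)) ` C = S1 \<times> S2"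
    proof
      show "(\<lambda>q. (?r1 q, ?r2 q)) ` C \<subseteq> S1 \<times> S2"
        using r1(2) r2(2) P(2) PQ by (auto simp: S1_def S2_def)
      show "S1 \<times> S2 \<subseteq> (\<lambda>q. (?r1 q, ?r2 q)) ` C"
      proof clarify
        fix s1 s2 assume s: "s1 \<in> S1" "s2 \<in> S2"
        then have s': "s1 \<in> C" "P (c s1) = c s1" "s2 \<in> C" "P (c s2) = 0" by (auto simp: S1_def S2_def)
        let ?q = "inv_into C c (c s1 + c s2)"
        have "c s1 + c s2 \<in> c ` C" using box[of "c s1" "c s2"] s' by simp
        then have q: "?q \<in> C" "c ?q = c s1 + c s2" by (simp_all add: inv_into_into f_inv_into_f)
        have "?r1 ?q = s1" "?r2 ?q = s2"
          using s' cc(6) by (simp_all add: q(2) linear_add[OF P(1)])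
        then show "(s1, s2) \<in> (\<lambda>q. (?r1 q, ?r2 q)) ` C" using q(1) by (metis (no_types, lifting) image_eqI)
      qed
    qed
  qed
  have kill1: "dmap A A ?r1 q v = 0" if q: "q \<in> C" and v: "v \<in> hor q" for q v
  proof (rule inj_c)
    show r: "?r1 q \<in> C" using r1(2)[OF q] by blast
    have "P (dfun A c q v) = 0" using hor_chart[OF q] v by blast
    then show "dfun A c (?r1 q) (dmap A A ?r1 q v) = dfun A c (?r1 q) 0"
      unfolding r1(3)[OF q] linear_0[OF lin_c[OF r]] .
  qed
  have kill2: "dmap A A ?r2 q v = 0" if q: "q \<in> C" and v: "v \<in> ver q" for q v
  proof (rule inj_c)
    show r: "?r2 q \<in> C" using r2(2)[OF q] by blast
    have "P (dfun A c q v) = dfun A c q v" using ver_chart[OF q] v by blast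
    then show "dfun A c (?r2 q) (dmap A A ?r2 q v) = dfun A c (?r2 q) 0"
      unfolding r2(3)[OF q] linear_0[OF lin_c[OF r]] by simp
  qed
  \<comment> \<open>The complementary coordinate of a point determines its image in the base, and
    \<open>?r2\<close> keeps that coordinate.\<close>
  have pi2: "\<pi> (?r2 q) = \<pi> q" if q: "q \<in> C" for q
  proof -
    have r: "?r2 q \<in> C" "c (?r2 q) = c q - P (c q)" using r2(2)[OF q] by auto
    have "e (d (\<pi> (?r2 q)) - d (\<pi> p)) = e (d (\<pi> q) - d (\<pi> p))"
      using cd[OF r(1)] cd[OF q] PQ[of "c q"] r(2) by simp
    then have "d (\<pi> (?r2 q)) = d (\<pi> q)" using e(2) by (metis injD diff_add_cancel)
    then show ?thesis using compatible_chart(2)[OF W(2)] Wq[OF q] Wq[OF r(1)] by (meson inj_onD)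
  qed
  \<comment> \<open>Both sides are the metric of the base at the same point, since
    \<open>?r2\<close> preserves \<pi> and its differential takes horizontal values.\<close>
  have horizontal: "g (?r2 q) (dmap A A ?r2 q u) (dmap A A ?r2 q v) = g q (H q u) (H q v)"
    if q: "q \<in> C" for q u v
  proof -
    have r: "?r2 q \<in> C" using r2(2)[OF q] by auto
    have hd: "dmap A A ?r2 q u \<in> hor (?r2 q)" for u
      unfolding hor_chart[OF r] r2(3)[OF q] by (rule PQ)
    have "d\<pi> (?r2 q) (dmap A A ?r2 q u) = d\<pi> q u" for u
    proof -
      have "e (dfun B d (\<pi> (?r2 q)) (d\<pi> (?r2 q) (dmap A A ?r2 q u))) = e (dfun B d (\<pi> q) (d\<pi> q u))"
        unfolding cP[OF r, symmetric] cP[OF q, symmetric] r2(3)[OF q] PQ by simp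
      from injD[OF e(2) this]
      have "dfun B d (\<pi> q) (d\<pi> (?r2 q) (dmap A A ?r2 q u)) = dfun B d (\<pi> q) (d\<pi> q u)"
        unfolding pi2[OF q] .
      then show ?thesis by (rule injD[OF bij_is_inj[OF dfun_chart_bij(2)[OF N.at W(2) Wq[OF q]]]])
    qed
    with isometry_hor[OF hd hd, of u v]
    have "g (?r2 q) (dmap A A ?r2 q u) (dmap A A ?r2 q v) = h (\<pi> q) (d\<pi> q u) (d\<pi> q v)"
      unfolding pi2[OF q] by simp
    also have "\<dots> = g q (H q u) (H q v)" using isometry_hor[OF H_hor H_hor, of q u v] by (simp add: dpi_H)
    finally show ?thesis .
  qed
  have vertical: "g (?r1 q) (dmap A A ?r1 q u) (dmap A A ?r1 q v) = g q (V q u) (V q v)"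
    if q: "q \<in> C" for q u v
  proof -
    have r: "?r1 q \<in> C" "c (?r1 q) = P (c q)" using r1(2)[OF q] by auto
    let ?u = "coord_field A c"
    have Pa: "P (dfun A c q u) = dfun A c q (V q u)" for u
    proof -
      have "P (dfun A c q u) = P (dfun A c q (V q u)) + P (dfun A c q (H q u))"
        using V_plus_H(1)[of q u] linear_add[OF P(1)] linear_add[OF lin_c[OF q]] by metis
      moreover have "P (dfun A c q (V q u)) = dfun A c q (V q u)" "P (dfun A c q (H q u)) = 0"
        using ver_chart[OF q] hor_chart[OF q] V_ver H_hor by blast+
      ultimately show ?thesis by simp
    qed
    define a b where "a = P (dfun A c q u)" and "b = P (dfun A c q v)"
    have Va: "V q u = ?u a q" "V q v = ?u b q"
      unfolding a_def b_def Pa using dfun_coord_field(2)[OF M.at ch q] by simp_all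
    have ra: "dmap A A ?r1 q u = ?u a (?r1 q)" "dmap A A ?r1 q v = ?u b (?r1 q)"
      unfolding a_def b_def r1(3)[OF q, symmetric] using dfun_coord_field(2)[OF M.at ch r(1)] by simp_all
    have Pab: "P a = a" "P b = b" unfolding a_def b_def by (rule P(2))+
    have vera: "?u a q' \<in> ver q'" "?u b q' \<in> ver q'" if "q' \<in> C" for q'
      using ver_chart[OF that] dfun_coord_field(1)[OF M.at ch that] Pab by simp_all
    let ?\<gamma> = "\<lambda>q. g q (?u a q) (?u b q)"
    have us: "smooth_vf A C (?u z)" for z by (rule smooth_vf_coord_field[OF M.at ch])
    have \<gamma>s: "smooth_fun A C ?\<gamma>" by (rule M.g_smooth[OF cc(1) us us])
    let ?\<Gamma> = "?\<gamma> \<circ> inv_into C c"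
    \<comment> \<open>With this \<open>w\<close> the vector \<open>e w\<close> leads from
      \<open>P (c q)\<close> to \<open>c q\<close>, and it represents the basic field
      \<open>?\<xi>\<close> in the chart. The segment thus runs along a leaf, convexity keeps it in
      the chart, and the vertical inner product is constant on it.\<close>
    define w where "w = d (\<pi> q) - d (\<pi> p)"
    let ?\<xi> = "\<lambda>q. hlift q (coord_field B d w (\<pi> q))"
    have \<xi>: "basic_on A g B \<pi> C ?\<xi>"
      by (rule basic_subset[OF basic_on_hlift[OF W(1) smooth_vf_coord_field[OF N.at W(2)]] W(3)])
    have flat: "(?\<Gamma> has_derivative frechet_derivative ?\<Gamma> (at z)) (at z) \<and> frechet_derivative ?\<Gamma> (at z) (e w) = 0"
      if z: "z \<in> c ` C" for z
    proof -
      obtain q' where q': "q' \<in> C" "z = c q'" using z by blast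
      have "dfun A ?\<gamma> q' (?\<xi> q') = 0"
        by (rule vertical_metric_invariant[OF vp ch q'(1) vera \<xi> c\<eta>])
      then show ?thesis
        using dfun_chart_rep[OF M.at ch cc(1) q'(1) q'(1) \<gamma>s, of "?\<xi> q'"] c\<eta>[OF q'(1)] q'(2)
          has_derivative_chart_rep[OF M.at ch cc(1) q'(1) q'(1) \<gamma>s] by simp
    qed
    define l where "l = (\<lambda>t. P (c q) + t *\<^sub>R e w)"
    have ew: "e w = c q - P (c q)" unfolding w_def by (rule cd[OF q, symmetric])
    then have l01: "l 0 = P (c q)" "l 1 = c q" by (simp_all add: l_def)
    have lB: "l t \<in> c ` C" if "t \<in> {0..1}" for t
    proof -
      have "l t = (1 - t) *\<^sub>R P (c q) + t *\<^sub>R c q"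
        by (simp add: l_def ew algebra_simps)
      then show ?thesis using convexD[OF conv PB(1)[of "c q"], of "c q" "1 - t" t] q that by simp
    qed
    have "((\<lambda>t. ?\<Gamma> (l t)) has_vector_derivative 0) (at t within {0..1})" if t: "t \<in> {0..1}" for t
    proof -
      have "(l has_vector_derivative e w) (at t within {0..1})"
        unfolding l_def by (auto intro!: derivative_eq_intros)
      from vector_derivative_diff_chain_within[OF this has_derivative_at_withinI[OF conjunct1[OF flat[OF lB[OF t]]]]]
      show ?thesis using conjunct2[OF flat[OF lB[OF t]]] by (simp add: comp_def)
    qed
    from has_vector_derivative_zero_constant[OF convex_real_interval(5) this]
    obtain k where k: "\<And>t. t \<in> {0..1} \<Longrightarrow> ?\<Gamma> (l t) = k" by blast
    then have "?\<Gamma> (l 0) = ?\<Gamma> (l 1)" using k[of 0] k[of 1] by simp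
    then have "?\<gamma> (?r1 q) = ?\<gamma> q" unfolding l01 using cc(6)[OF q] by simp
    then show ?thesis by (simp add: Va ra)
  qed
  have metric: "g q u v = g (?r1 q) (dmap A A ?r1 q u) (dmap A A ?r1 q v) +
      g (?r2 q) (dmap A A ?r2 q u) (dmap A A ?r2 q v)" if q: "q \<in> C" for q u v
  proof -
    have "g q u v = g q (V q u + H q u) (V q v + H q v)" by (simp add: V_plus_H)
    also have "\<dots> = g q (V q u) (V q v) + g q (H q u) (H q v)"
      using hor_ver(1)[OF H_hor[of q u] V_ver[of q v]] hor_ver(2)[OF H_hor[of q v] V_ver[of q u]]
      by (simp add: M.g_add_left M.g_add_right)
    finally show ?thesis unfolding vertical[OF q] horizontal[OF q] .
  qed
  show "\<exists>U S1 S2 \<rho>1 \<rho>2.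
      open U \<and> p \<in> U \<and> p \<in> S1 \<and> p \<in> S2 \<and> integral_manifold A ver S1 \<and> integral_manifold A hor S2 \<and>
      smooth_map A A U \<rho>1 \<and> smooth_map A A U \<rho>2 \<and> bij_betw (\<lambda>q. (\<rho>1 q, \<rho>2 q)) U (S1 \<times> S2) \<and>
      (\<forall>q\<in>U. (\<forall>v\<in>hor q. dmap A A \<rho>1 q v = 0) \<and> (\<forall>v\<in>ver q. dmap A A \<rho>2 q v = 0) \<and>
        (\<forall>u v. g q u v = g (\<rho>1 q) (dmap A A \<rho>1 q u) (dmap A A \<rho>1 q v) +
          g (\<rho>2 q) (dmap A A \<rho>2 q u) (dmap A A \<rho>2 q v)))"
    by (rule exI[of _ C], rule exI[of _ S1], rule exI[of _ S2], rule exI[of _ ?r1], rule exI[of _ ?r2])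
      (use cc(1) pC P0 S1 S2 r1(1) r2(1) bij kill1 kill2 metric in \<open>simp add: S1_def S2_def\<close>)
qed

end

section \<open>Equivalence of the three conditions\<close>

theorem corollary3p14:
  fixes A :: "('m::{t2_space, second_countable_topology}, 'e::euclidean_space) chart set"
    and g :: "'m \<Rightarrow> 'e \<Rightarrow> 'e \<Rightarrow> real"
    and J :: "'m \<Rightarrow> 'e \<Rightarrow> 'e"
    and B :: "('n::{t2_space, second_countable_topology}, 'f::euclidean_space) chart set"
    and h :: "'n \<Rightarrow> 'f \<Rightarrow> 'f \<Rightarrow> real"
    and \<pi> :: "'m \<Rightarrow> 'n"
    and nabla nablaN nablaP T \<A> \<A>b V H P F \<phi> \<omega>
    and \<theta>1 \<theta>2 :: real
  assumes "kaehler_manifold A g J nabla"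
    and "riemannian_manifold B h"
    and "levi_civita B h nablaN"
    and "bi_slant_submersion A g J B h \<pi> \<theta>1 \<theta>2"
    and "pullback_connection A B \<pi> nablaN nablaP"
    and "V = vproj A g B \<pi>"
    and "H = hproj A g B \<pi>"
    and "T = oneill_T nabla V H"
    and "\<A> = oneill_A nabla V H"
    and "\<A>b = oneill_A_basic nabla H"
    and "P = (\<lambda>p v. V p (J p v))"
    and "F = (\<lambda>p v. H p (J p v))"
    and "\<phi> = (\<lambda>p v. V p (J p v))"
    and "\<omega> = (\<lambda>p v. H p (J p v))"
  shows
    "(locally_product A g (vert A B \<pi>) (horiz A g B \<pi>)
        \<longleftrightarrow> totally_geodesic_map A B \<pi> nabla nablaP) \<and>
     (totally_geodesic_map A B \<pi> nabla nablaP \<longleftrightarrow>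
        (\<forall>U W Z. open U \<and> vertical_on A B \<pi> U W \<and> vertical_on A B \<pi> U Z \<longrightarrow>
           (\<forall>p \<in> U.
              \<omega> p (T W (P \<odot> Z) p + \<A>b (F \<odot> Z) W p) +
              F p ((V \<odot> nabla W (P \<odot> Z)) p + T W (F \<odot> Z) p) = 0)) \<and>
        (\<forall>U \<xi> \<eta>. open U \<and> basic_on A g B \<pi> U \<xi> \<and> basic_on A g B \<pi> U \<eta> \<longrightarrow>
           (\<forall>p \<in> U.
              \<phi> p (\<A> \<xi> (\<phi> \<odot> \<eta>) p + (H \<odot> nabla \<xi> (\<omega> \<odot> \<eta>)) p) +
              P p (\<A> \<xi> (\<omega> \<odot> \<eta>) p + (V \<odot> nabla \<xi> (\<phi> \<odot> \<eta>)) p) = 0)))"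
proof -
  interpret S: pullback_submersion A g nabla B h nablaN \<pi> nablaP
  proof
    show "riemannian_manifold A g" "levi_civita A g nabla"
      using assms(1) unfolding kaehler_manifold_def by blast+
    show "riemannian_submersion A g B h \<pi>" using assms(4) unfolding bi_slant_submersion_def by blast
  qed (fact assms)+
  have i: "locally_product A g (vert A B \<pi>) (horiz A g B \<pi>) \<longleftrightarrow> S.vertical_parallel \<and> S.horizontal_parallel"
    using S.locally_product_imp_parallel S.parallel_imp_locally_product by blast
  have ii: "totally_geodesic_map A B \<pi> nabla nablaP \<longleftrightarrow> S.vertical_parallel \<and> S.horizontal_parallel"
    using S.totally_geodesic_imp_parallel S.parallel_imp_totally_geodesic by blast
  have iii1: "S.vertical_parallel \<longleftrightarrow>
      (\<forall>U W Z. open U \<and> vertical_on A B \<pi> U W \<and> vertical_on A B \<pi> U Z \<longrightarrow>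
           (\<forall>p \<in> U.
              \<omega> p (T W (P \<odot> Z) p + \<A>b (F \<odot> Z) W p) +
              F p ((V \<odot> nabla W (P \<odot> Z)) p + T W (F \<odot> Z) p) = 0))"
    (is "_ \<longleftrightarrow> (\<forall>U W Z. _ U W Z \<longrightarrow> (\<forall>p \<in> U. ?E W Z p = 0))")
    unfolding S.vertical_parallel_def
  proof (intro iff_allI imp_cong ball_cong refl, elim conjE)
    fix U X Y p assume "open U" "vertical_on A B \<pi> U X" "vertical_on A B \<pi> U Y" "p \<in> U"
    from S.vertical_condition[OF assms(1) this(1,4,2,3)]
    show "(hproj A g B \<pi> p (nabla X Y p) = 0) = (?E X Y p = 0)" unfolding assms(6-) by simp
  qed
  have iii2: "S.horizontal_parallel \<longleftrightarrow>
      (\<forall>U \<xi> \<eta>. open U \<and> basic_on A g B \<pi> U \<xi> \<and> basic_on A g B \<pi> U \<eta> \<longrightarrow>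
           (\<forall>p \<in> U.
              \<phi> p (\<A> \<xi> (\<phi> \<odot> \<eta>) p + (H \<odot> nabla \<xi> (\<omega> \<odot> \<eta>)) p) +
              P p (\<A> \<xi> (\<omega> \<odot> \<eta>) p + (V \<odot> nabla \<xi> (\<phi> \<odot> \<eta>)) p) = 0))"
    (is "_ \<longleftrightarrow> (\<forall>U \<xi> \<eta>. _ U \<xi> \<eta> \<longrightarrow> (\<forall>p \<in> U. ?E \<xi> \<eta> p = 0))")
    unfolding S.horizontal_parallel_def
  proof (intro iff_allI imp_cong ball_cong refl, elim conjE)
    fix U X Y p assume "open U" "basic_on A g B \<pi> U X" "basic_on A g B \<pi> U Y" "p \<in> U"
    from S.horizontal_condition[OF assms(1) this(1,4,2,3)]
    show "(vproj A g B \<pi> p (nabla X Y p) = 0) = (?E X Y p = 0)" unfolding assms(6-) by simp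
  qed
  show ?thesis unfolding i ii iii1[symmetric] iii2[symmetric] by blast
qed

end
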